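(* (A) Let $I\ne\{0\}$ be a principal ideal. Then the following are equivalent: (i) $I$ is am-stable; (ii) for every ideal $J$, ${}_aJ={}_aI$ (or, equivalently, $J^o=I^o$) implies $J=I$; (iii) for every ideal $J$, $J_a=I_a$ (or, equivalently, $J^-=I^-$) implies $J=I$; (iv) for every ideal $J$, $J^{oo}=I^{oo}$ implies $J=I$; (v) for every ideal $J$, $J_-=I_-$ implies $J=I$. (B) Let $I\ne\{0\}$ be a principal ideal. Then the following are equivalent: (i) $I$ is am-$\infty$ stable; (ii) for every ideal $J$, ${}_{a_\infty}J={}_{a_\infty}I$ (or, equivalently, $J^{o\infty}=I^{o\infty}$) implies $J=I$; (iii) for every ideal $J$, $J_{a_\infty}=I_{a_\infty}$ (or, equivalently, $J^{-\infty}=I^{-\infty}$) implies $J=I$; (iv) for every ideal $J$, $J^{oo\infty}=I^{oo\infty}$ implies $J=I$; (v) for every ideal $J$, $J_{-\infty}=I_{-\infty}$ implies $J=I$.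
   Context: $H$ is a separable infinite-dimensional complex Hilbert space. "Ideal" means a two-sided ideal of $B(H)$ contained in the compact operators. $c_o^*$ is the set of nonnegative monotone nonincreasing sequences converging to $0$, and $(\ell^1)^*$ the set of summable sequences in $c_o^*$. $\Sigma(I):=\{s(X)\mid X\in I\}\subset c_o^*$, where $s(X)$ is the sequence of s-numbers (singular values) of $X$; $I\mapsto\Sigma(I)$ is an inclusion-preserving bijection between ideals and the hereditary (solid) subcones of $c_o^*$ invariant under the ampliations $D_m$, $(D_m\xi)_n:=\xi_{\lceil n/m\rceil}$, $m\in\mathbb N$. A principal ideal is one generated by a single operator. $\mathscr L_1$ is the trace class. $\omega=\langle 1/n\rangle$ and $se(\omega)$ is the ideal with $\Sigma(se(\omega))=\{\xi\in c_o^*\mid\xi=o(\omega)\}$. Arithmetic mean ideals. For $\xi\in c_o^*$ put $(\xi_a)_n:=\frac1n\sum_{j=1}^n\xi_j$. ${}_aI$ is the ideal with $\Sigma({}_aI)=\{\xi\in c_o^*\mid\xi_a\in\Sigma(I)\}$; $I_a$ is the ideal with $\Sigma(I_a)=\{\xi\in c_o^*\mid\xi=O(\eta_a)\text{ for some }\eta\in\Sigma(I)\}$; $I^-:={}_a(I_a)$; $I^o:=({}_aI)_a$. $I$ is am-closed if $I=I^-$, am-open if $I=I^o$, am-stable if $I={}_aI$ (equivalently $I=I_a$). $I_-$ is the largest am-closed ideal contained in $I$ and $I^{oo}$ the smallest am-open ideal containing $I$. Arithmetic mean at infinity ideals. For $\xi\in(\ell^1)^*$ put $(\xi_{a_\infty})_n:=\frac1n\sum_{j=n+1}^\infty\xi_j$.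 ${}_{a_\infty}I$ is the ideal with $\Sigma({}_{a_\infty}I)=\{\xi\in(\ell^1)^*\mid\xi_{a_\infty}\in\Sigma(I)\}$; $I_{a_\infty}$ is the ideal with $\Sigma(I_{a_\infty})=\{\xi\in c_o^*\mid\xi=O(\eta_{a_\infty})\text{ for some }\eta\in\Sigma(I\cap\mathscr L_1)\}$; $I^{-\infty}:={}_{a_\infty}(I_{a_\infty})$; $I^{o\infty}:=({}_{a_\infty}I)_{a_\infty}$. $I$ is am-$\infty$ closed if $I=I^{-\infty}$, am-$\infty$ open if $I=I^{o\infty}$, am-$\infty$ stable if $I={}_{a_\infty}I$ (equivalently $I\subset\mathscr L_1$ and $I=I_{a_\infty}$). $I_{-\infty}$ is the largest am-$\infty$ closed ideal contained in $I$ and $I^{oo\infty}$ the smallest am-$\infty$ open ideal containing $I\cap se(\omega)$. *)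

theory Defs
  imports "HOL-Analysis.Analysis" "HOL-Library.Landau_Symbols"
begin

section \<open>Complex Hilbert spaces\<close>

text \<open>The inner product is linear in the first argument. Its real part is the inner product of
  the underlying real Hilbert space, which also provides norm and topology; together with
  conjugate symmetry this yields positive definiteness.\<close>

class chilbert_space = real_inner + banach +
  fixes scaleC :: "complex \<Rightarrow> 'a \<Rightarrow> 'a" (infixr "*\<^sub>C" 75)
    and cinner :: "'a \<Rightarrow> 'a \<Rightarrow> complex"
  assumes scaleC_add_right: "c *\<^sub>C (x + y) = c *\<^sub>C x + c *\<^sub>C y"
    and scaleC_add_left: "(c + d) *\<^sub>C x = c *\<^sub>C x + d *\<^sub>C x"
    and scaleC_scaleC: "c *\<^sub>C d *\<^sub>C x = (c * d) *\<^sub>C x"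
    and scaleC_one: "1 *\<^sub>C x = x"
    and scaleR_scaleC: "r *\<^sub>R x = complex_of_real r *\<^sub>C x"
    and cinner_commute: "cinner x y = cnj (cinner y x)"
    and cinner_add_left: "cinner (x + y) z = cinner x z + cinner y z"
    and cinner_scaleC_left: "cinner (c *\<^sub>C x) y = c * cinner x y"
    and inner_cinner: "inner x y = Re (cinner x y)"

interpretation complex_vector: vector_space "scaleC :: complex \<Rightarrow> 'h \<Rightarrow> 'h::chilbert_space"
  by unfold_locales (simp_all add: scaleC_add_right scaleC_add_left scaleC_scaleC scaleC_one)

section \<open>Operators and ideals\<close>

text \<open>The library type of bounded operators only knows real linearity; \<open>B(H)\<close> consists of the
  complex-linear ones.\<close>

definition bounded_ops :: "('h::chilbert_space \<Rightarrow>\<^sub>L 'h) set" where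
  "bounded_ops = {T. \<forall>c x. blinfun_apply T (c *\<^sub>C x) = c *\<^sub>C blinfun_apply T x}"

definition compact_ops :: "('h::chilbert_space \<Rightarrow>\<^sub>L 'h) set" where
  "compact_ops = {T \<in> bounded_ops. compact (closure (blinfun_apply T ` cball 0 1))}"

text \<open>Scalar multiples are covered by composition with multiples of the identity.\<close>

definition is_ideal :: "('h::chilbert_space \<Rightarrow>\<^sub>L 'h) set \<Rightarrow> bool" where
  "is_ideal I \<longleftrightarrow> I \<subseteq> compact_ops \<and> 0 \<in> I \<and> (\<forall>X\<in>I. \<forall>Y\<in>I. X + Y \<in> I)
     \<and> (\<forall>X\<in>I. \<forall>A\<in>bounded_ops. A o\<^sub>L X \<in> I \<and> X o\<^sub>L A \<in> I)"

definition principal_ideal :: "('h::chilbert_space \<Rightarrow>\<^sub>L 'h) set \<Rightarrow> bool" where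
  "principal_ideal I \<longleftrightarrow> (\<exists>X\<in>compact_ops. I = is_ideal hull {X})"

definition hadjoint :: "('h::chilbert_space \<Rightarrow>\<^sub>L 'h) \<Rightarrow> ('h \<Rightarrow>\<^sub>L 'h)" where
  "hadjoint T = (THE S. \<forall>x y. cinner (blinfun_apply T x) y = cinner x (blinfun_apply S y))"

text \<open>The s-numbers of a compact operator \<open>X\<close> are the square roots of the eigenvalues of
  \<open>X\<^sup>* X\<close>, arranged in nonincreasing order, repeated according to multiplicity, and completed by
  zeros if there are only finitely many positive ones.

  All sequences are indexed from \<open>0\<close>: the value at \<open>n\<close> is the mathematical \<open>(n+1)\<close>-st term.\<close>

definition s_numbers :: "('h::chilbert_space \<Rightarrow>\<^sub>L 'h) \<Rightarrow> nat \<Rightarrow> real" where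
  "s_numbers X = (THE s. antimono s \<and> s \<longlonglongrightarrow> 0 \<and>
     (\<forall>l>0. card {n. s n = l} =
        complex_vector.dim {x. blinfun_apply (hadjoint X o\<^sub>L X) x = complex_of_real (l\<^sup>2) *\<^sub>C x}))"

section \<open>Characteristic sets\<close>

definition c0_star :: "(nat \<Rightarrow> real) set" where
  "c0_star = {\<xi>. (\<forall>n. 0 \<le> \<xi> n) \<and> antimono \<xi> \<and> \<xi> \<longlonglongrightarrow> 0}"

definition l1_star :: "(nat \<Rightarrow> real) set" where
  "l1_star = {\<xi> \<in> c0_star. summable \<xi>}"

definition Sig :: "('h::chilbert_space \<Rightarrow>\<^sub>L 'h) set \<Rightarrow> (nat \<Rightarrow> real) set" where
  "Sig I = s_numbers ` I"

definition ideal_with :: "(nat \<Rightarrow> real) set \<Rightarrow> ('h::chilbert_space \<Rightarrow>\<^sub>L 'h) set" where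
  "ideal_with S = (THE I. is_ideal I \<and> Sig I = S)"

definition trace_class :: "('h::chilbert_space \<Rightarrow>\<^sub>L 'h) set" where
  "trace_class = {X \<in> compact_ops. summable (s_numbers X)}"

definition se_omega :: "('h::chilbert_space \<Rightarrow>\<^sub>L 'h) set" where
  "se_omega = ideal_with {\<xi> \<in> c0_star. \<xi> \<in> o(\<lambda>n. 1 / real (Suc n))}"

text \<open>The bound is required for all \<open>n\<close>, not just eventually: this matters when \<open>\<eta>\<close> has zero
  terms, e.g. only the zero sequence is \<open>O(0)\<close>.\<close>

definition big_oh :: "(nat \<Rightarrow> real) \<Rightarrow> (nat \<Rightarrow> real) \<Rightarrow> bool" where
  "big_oh \<xi> \<eta> \<longleftrightarrow> (\<exists>M. \<forall>n. \<xi> n \<le> M * \<eta> n)"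

section \<open>Arithmetic mean ideals\<close>

definition am_seq :: "(nat \<Rightarrow> real) \<Rightarrow> nat \<Rightarrow> real" where
  "am_seq \<xi> n = (\<Sum>j\<le>n. \<xi> j) / real (Suc n)"

definition pre_am :: "('h::chilbert_space \<Rightarrow>\<^sub>L 'h) set \<Rightarrow> ('h \<Rightarrow>\<^sub>L 'h) set" where
  "pre_am I = ideal_with {\<xi> \<in> c0_star. am_seq \<xi> \<in> Sig I}"

definition am :: "('h::chilbert_space \<Rightarrow>\<^sub>L 'h) set \<Rightarrow> ('h \<Rightarrow>\<^sub>L 'h) set" where
  "am I = ideal_with {\<xi> \<in> c0_star. \<exists>\<eta>\<in>Sig I. big_oh \<xi> (am_seq \<eta>)}"

definition am_closure :: "('h::chilbert_space \<Rightarrow>\<^sub>L 'h) set \<Rightarrow> ('h \<Rightarrow>\<^sub>L 'h) set" where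
  "am_closure I = pre_am (am I)"

definition am_interior :: "('h::chilbert_space \<Rightarrow>\<^sub>L 'h) set \<Rightarrow> ('h \<Rightarrow>\<^sub>L 'h) set" where
  "am_interior I = am (pre_am I)"

definition am_closed :: "('h::chilbert_space \<Rightarrow>\<^sub>L 'h) set \<Rightarrow> bool" where
  "am_closed I \<longleftrightarrow> is_ideal I \<and> I = am_closure I"

definition am_open :: "('h::chilbert_space \<Rightarrow>\<^sub>L 'h) set \<Rightarrow> bool" where
  "am_open I \<longleftrightarrow> is_ideal I \<and> I = am_interior I"

definition am_stable :: "('h::chilbert_space \<Rightarrow>\<^sub>L 'h) set \<Rightarrow> bool" where
  "am_stable I \<longleftrightarrow> is_ideal I \<and> I = pre_am I"

definition largest_am_closed :: "('h::chilbert_space \<Rightarrow>\<^sub>L 'h) set \<Rightarrow> ('h \<Rightarrow>\<^sub>L 'h) set" where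
  "largest_am_closed I = (GREATEST L. am_closed L \<and> L \<subseteq> I)"

definition smallest_am_open :: "('h::chilbert_space \<Rightarrow>\<^sub>L 'h) set \<Rightarrow> ('h \<Rightarrow>\<^sub>L 'h) set" where
  "smallest_am_open I = (LEAST L. am_open L \<and> I \<subseteq> L)"

section \<open>Arithmetic mean at infinity ideals\<close>

definition am_inf_seq :: "(nat \<Rightarrow> real) \<Rightarrow> nat \<Rightarrow> real" where
  "am_inf_seq \<xi> n = (\<Sum>j. \<xi> (j + Suc n)) / real (Suc n)"

text \<open>For \<open>I = {0}\<close> the defining set would be \<open>{(c,0,0,...) | c \<ge> 0}\<close>, which is not invariant under
  ampliations and hence not the characteristic set of an ideal. The pre-mean of the zero ideal is
  therefore taken to be the zero ideal, the largest ideal whose characteristic set is contained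
  in this set.\<close>

definition pre_am_inf :: "('h::chilbert_space \<Rightarrow>\<^sub>L 'h) set \<Rightarrow> ('h \<Rightarrow>\<^sub>L 'h) set" where
  "pre_am_inf I = (if I = {0} then {0}
     else ideal_with {\<xi> \<in> l1_star. am_inf_seq \<xi> \<in> Sig I})"

definition am_inf :: "('h::chilbert_space \<Rightarrow>\<^sub>L 'h) set \<Rightarrow> ('h \<Rightarrow>\<^sub>L 'h) set" where
  "am_inf I = ideal_with
     {\<xi> \<in> c0_star. \<exists>\<eta>\<in>Sig (I \<inter> trace_class). big_oh \<xi> (am_inf_seq \<eta>)}"

definition am_inf_closure :: "('h::chilbert_space \<Rightarrow>\<^sub>L 'h) set \<Rightarrow> ('h \<Rightarrow>\<^sub>L 'h) set" where
  "am_inf_closure I = pre_am_inf (am_inf I)"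

definition am_inf_interior :: "('h::chilbert_space \<Rightarrow>\<^sub>L 'h) set \<Rightarrow> ('h \<Rightarrow>\<^sub>L 'h) set" where
  "am_inf_interior I = am_inf (pre_am_inf I)"

definition am_inf_closed :: "('h::chilbert_space \<Rightarrow>\<^sub>L 'h) set \<Rightarrow> bool" where
  "am_inf_closed I \<longleftrightarrow> is_ideal I \<and> I = am_inf_closure I"

definition am_inf_open :: "('h::chilbert_space \<Rightarrow>\<^sub>L 'h) set \<Rightarrow> bool" where
  "am_inf_open I \<longleftrightarrow> is_ideal I \<and> I = am_inf_interior I"

definition am_inf_stable :: "('h::chilbert_space \<Rightarrow>\<^sub>L 'h) set \<Rightarrow> bool" where
  "am_inf_stable I \<longleftrightarrow> is_ideal I \<and> I = pre_am_inf I"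

definition largest_am_inf_closed :: "('h::chilbert_space \<Rightarrow>\<^sub>L 'h) set \<Rightarrow> ('h \<Rightarrow>\<^sub>L 'h) set" where
  "largest_am_inf_closed I = (GREATEST L. am_inf_closed L \<and> L \<subseteq> I)"

definition smallest_am_inf_open :: "('h::chilbert_space \<Rightarrow>\<^sub>L 'h) set \<Rightarrow> ('h \<Rightarrow>\<^sub>L 'h) set" where
  "smallest_am_inf_open I = (LEAST L. am_inf_open L \<and> I \<inter> se_omega \<subseteq> L)"

end

theory Submission imports Defs begin

text \<open>
  A compact operator has a singular value decomposition: maximise \<open>norm (X e)\<close> over unit vectors
  orthogonal to those already chosen. Hence ideals correspond to characteristic sets of null sequences,
  and the theorem becomes one about such sets. The mean \<open>F\<close> and the pre-mean \<open>G\<close> form a Galois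
  connection, which makes the closures, interiors and their equivalent formulations formal.

  If a principal ideal is stable, the partial sums (at infinity: the tails) of its generator grow
  (decay) geometrically, and this regularity lets one recover the ideal from each of its images.
  Conversely, (iii) and (v) force a principal ideal to be closed; a gliding hump then makes the
  domination by the generator uniform, and testing it on flat blocks yields stability. Finally, (ii) and
  (iv) force the ideal to be open; if it were not stable, then \<open>n \<xi>\<^sub>n\<close> would be nearly constant on
  arbitrarily long blocks, where the generator could be lowered, or raised, to that of a different ideal
  without changing the open envelope, or the pre-mean.
\<close>

subsection \<open>Complex inner products\<close>

text \<open>The converse directions begin with a formal observation: \<open>G F G = G\<close> and
  \<open>F G F = F\<close>, so a set and its interior have the same pre-mean, a set and its closure
  have the same mean, and cancellation makes them equal. (iv) and (v) use in the same way that
  \<open>so\<close> and \<open>lc\<close> are idempotent. Two facts behind \<open>lc\<close> and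
  \<open>so\<close> are not formal. For the largest closed subset \<open>lc\<close> to be additive,
  each element of the closure of a sum must be split along the two summands. For the smallest open
  superset \<open>so\<close>, one needs a least mean above a given sequence. The obvious candidate
  is only monotone after multiplication by n, whereas n times a mean is concave (at infinity:
  convex), so a comparison up to domination has to be proved. The obstacle in all estimates is the
  ampliation hidden in domination: its order depends on the sequence. Once a single order serves a
  whole class of sequences, step functions with one step are enough as tests, and every constant can
  be read off from them.\<close>

lemma cinner_zero_left [simp]: "cinner 0 (y::'h::chilbert_space) = 0"
proof -
  have "cinner (0 + 0) y = cinner 0 y + cinner 0 y" by (rule cinner_add_left)
  then show ?thesis by simp
qed

lemma cinner_zero_right [simp]: "cinner (x::'h::chilbert_space) 0 = 0"
  by (subst cinner_commute) simp

lemma cinner_add_right: "cinner (x::'h::chilbert_space) (y + z) = cinner x y + cinner x z"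
proof -
  have "cinner x (y + z) = cnj (cinner (y + z) x)" by (rule cinner_commute)
  also have "\<dots> = cnj (cinner y x) + cnj (cinner z x)" by (simp add: cinner_add_left)
  also have "\<dots> = cinner x y + cinner x z" by (metis cinner_commute)
  finally show ?thesis .
qed

lemma cinner_scaleC_right: "cinner (x::'h::chilbert_space) (c *\<^sub>C y) = cnj c * cinner x y"
proof -
  have "cinner x (c *\<^sub>C y) = cnj (cinner (c *\<^sub>C y) x)" by (rule cinner_commute)
  also have "\<dots> = cnj c * cnj (cinner y x)" by (simp add: cinner_scaleC_left)
  also have "\<dots> = cnj c * cinner x y" by (metis cinner_commute)
  finally show ?thesis .
qed

lemma cinner_minus_left: "cinner (- x::'h::chilbert_space) y = - cinner x y"
proof -
  have "cinner x y + cinner (- x) y = 0" by (simp add: cinner_add_left[symmetric])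
  then show ?thesis by (simp add: add_eq_0_iff)
qed

lemma cinner_minus_right: "cinner (x::'h::chilbert_space) (- y) = - cinner x y"
proof -
  have "cinner x y + cinner x (- y) = 0" by (simp add: cinner_add_right[symmetric])
  then show ?thesis by (simp add: add_eq_0_iff)
qed

lemma cinner_diff_left: "cinner (x - y::'h::chilbert_space) z = cinner x z - cinner y z"
  using cinner_add_left[of x "- y" z] by (simp add: cinner_minus_left)

lemma cinner_diff_right: "cinner (x::'h::chilbert_space) (y - z) = cinner x y - cinner x z"
  using cinner_add_right[of x y "- z"] by (simp add: cinner_minus_right)

lemma cinner_scaleR_left: "cinner (r *\<^sub>R x::'h::chilbert_space) y = of_real r * cinner x y"
  by (simp add: scaleR_scaleC cinner_scaleC_left)

lemma cinner_scaleR_right: "cinner (x::'h::chilbert_space) (r *\<^sub>R y) = of_real r * cinner x y"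
  by (simp add: scaleR_scaleC cinner_scaleC_right)

lemma cinner_sum_left: "cinner (sum f A) (y::'h::chilbert_space) = (\<Sum>i\<in>A. cinner (f i) y)"
  by (induction A rule: infinite_finite_induct) (auto simp: cinner_add_left)

lemma cinner_sum_right: "cinner (y::'h::chilbert_space) (sum f A) = (\<Sum>i\<in>A. cinner y (f i))"
  by (induction A rule: infinite_finite_induct) (auto simp: cinner_add_right)

lemma cinner_self: "cinner x (x::'h::chilbert_space) = of_real ((norm x)\<^sup>2)"
proof -
  have "Im (cinner x x) = 0"
    using arg_cong[OF cinner_commute[of x x], of Im] by simp
  moreover have "Re (cinner x x) = (norm x)\<^sup>2"
    by (simp add: inner_cinner[symmetric] power2_norm_eq_inner)
  ultimately show ?thesis by (simp add: complex_eq_iff)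
qed

lemma norm_scaleC [simp]: "norm (c *\<^sub>C x::'h::chilbert_space) = norm c * norm x"
proof -
  have "of_real ((norm (c *\<^sub>C x))\<^sup>2) = c * cnj c * of_real ((norm x)\<^sup>2)"
    by (simp only: cinner_self[symmetric] cinner_scaleC_left cinner_scaleC_right mult_ac)
  also have "\<dots> = of_real ((norm c * norm x)\<^sup>2)"
    by (simp only: complex_norm_square[symmetric] of_real_mult[symmetric] power_mult_distrib)
  finally have "(norm (c *\<^sub>C x))\<^sup>2 = (norm c * norm x)\<^sup>2" using of_real_eq_iff by blast
  then show ?thesis by (simp add: power2_eq_iff_nonneg)
qed

lemma norm_cinner_le: "norm (cinner x (y::'h::chilbert_space)) \<le> norm x * norm y"
proof (cases "cinner x y = 0")
  case False
  \<comment> \<open>The unimodular \<open>c\<close> turns the inner product into its modulus, so the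
    complex estimate follows from the real Cauchy-Schwarz inequality.\<close>
  define c where "c = cnj (cinner x y) / norm (cinner x y)"
  have nc: "norm c = 1" using False by (simp add: c_def norm_divide)
  have "cinner (c *\<^sub>C x) y = of_real (norm (cinner x y))"
    using False complex_norm_square[of "cinner x y"]
    by (simp add: cinner_scaleC_left c_def field_simps power2_eq_square)
  then have "norm (cinner x y) = inner (c *\<^sub>C x) y" by (simp add: inner_cinner)
  also have "\<dots> \<le> norm (c *\<^sub>C x) * norm y" by (rule norm_cauchy_schwarz)
  finally show ?thesis by (simp add: nc)
qed simp

lemma bounded_linear_cinner_left: "bounded_linear (\<lambda>x::'h::chilbert_space. cinner x y)"
  by (rule bounded_linear_intro[where K="norm y"])
     (simp_all add: cinner_add_left cinner_scaleR_left scaleR_conv_of_real norm_cinner_le)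

lemma bounded_linear_cinner_right: "bounded_linear (\<lambda>x::'h::chilbert_space. cinner y x)"
  by (rule bounded_linear_intro[where K="norm y"])
     (use norm_cinner_le[of y] in \<open>simp_all add: cinner_add_right cinner_scaleR_right scaleR_conv_of_real mult.commute\<close>)

lemma bounded_linear_scaleC: "bounded_linear (\<lambda>x::'h::chilbert_space. c *\<^sub>C x)"
  by (rule bounded_linear_intro[where K="norm c"])
     (simp_all add: scaleC_add_right scaleR_scaleC scaleC_scaleC mult.commute)

lemma scaleC_zero_left [simp]: "0 *\<^sub>C (x::'h::chilbert_space) = 0"
  using scaleR_scaleC[of 0 x] by simp

lemma scaleC_zero_right [simp]: "c *\<^sub>C (0::'h::chilbert_space) = 0"
  using bounded_linear.linear[OF bounded_linear_scaleC[of c]] linear_0 by blast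

lemma cinner_eqI_right: "(\<And>y. cinner y x = cinner y x') \<Longrightarrow> x = (x'::'h::chilbert_space)"
proof -
  assume "\<And>y. cinner y x = cinner y x'"
  then have "cinner (x - x') (x - x') = 0" by (simp add: cinner_diff_right)
  then show "x = x'" by (simp add: cinner_self)
qed

lemma norm_add_squared_orthogonal:
  "cinner x (y::'h::chilbert_space) = 0 \<Longrightarrow> (norm (x + y))\<^sup>2 = (norm x)\<^sup>2 + (norm y)\<^sup>2"
proof -
  assume "cinner x y = 0"
  then have "inner x y = 0" by (simp add: inner_cinner)
  then show ?thesis by (simp add: power2_norm_eq_inner inner_add_left inner_add_right inner_commute)
qed

subsection \<open>Orthonormal sequences\<close>

definition orthonormal :: "(nat \<Rightarrow> 'h::chilbert_space) \<Rightarrow> bool" where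
  "orthonormal e \<longleftrightarrow> (\<forall>i j. cinner (e i) (e j) = (if i = j then 1 else 0))"

lemma orthonormalD: "orthonormal e \<Longrightarrow> cinner (e i) (e j) = (if i = j then 1 else 0)"
  by (simp add: orthonormal_def)

lemma orthonormal_norm: "orthonormal e \<Longrightarrow> norm (e i) = 1"
proof -
  assume "orthonormal e"
  then have "(of_real ((norm (e i))\<^sup>2) :: complex) = of_real 1"
    using orthonormalD[of e i i] by (simp only: cinner_self) simp
  then have "(norm (e i))\<^sup>2 = 1" by (simp only: of_real_eq_iff)
  then show "norm (e i) = 1" by (simp add: power2_eq_1_iff) (smt (verit) norm_ge_zero)
qed

lemma orthonormal_compose: "orthonormal e \<Longrightarrow> inj g \<Longrightarrow> orthonormal (\<lambda>n. e (g n))"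
  by (auto simp: orthonormal_def inj_eq)

lemma orthonormal_inj: "orthonormal e \<Longrightarrow> inj e"
proof (rule injI)
  fix i j assume "orthonormal e" "e i = e j"
  then show "i = j" using orthonormalD[of e i j] orthonormalD[of e j j] by (auto split: if_splits)
qed

lemma norm_sum_orthonormal:
  assumes "orthonormal e" "finite A"
  shows "(norm (\<Sum>i\<in>A. a i *\<^sub>C e i))\<^sup>2 = (\<Sum>i\<in>A. (norm (a i))\<^sup>2)"
  using assms(2)
proof (induction A rule: finite_induct)
  case (insert j A)
  have "cinner (a j *\<^sub>C e j) (\<Sum>i\<in>A. a i *\<^sub>C e i) = 0"
    using insert.hyps
    by (auto simp: cinner_sum_right cinner_scaleC_left cinner_scaleC_right orthonormalD[OF assms(1)] intro!: sum.neutral)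
  with insert show ?case
    by (simp add: norm_add_squared_orthogonal power_mult_distrib orthonormal_norm[OF assms(1)])
qed simp

lemma Bessel_residual:
  assumes "orthonormal e"
  shows "(norm x)\<^sup>2 = (norm (x - (\<Sum>i<n. cinner x (e i) *\<^sub>C e i)))\<^sup>2 + (\<Sum>i<n. (norm (cinner x (e i)))\<^sup>2)"
proof -
  define y where "y = (\<Sum>i<n. cinner x (e i) *\<^sub>C e i)"
  have "cinner (x - y) (e j) = 0" if "j < n" for j
    using that by (simp add: y_def cinner_diff_left cinner_sum_left cinner_scaleC_left orthonormalD[OF assms]
      if_distrib[of "\<lambda>z. _ * z"] cong: if_cong)
  then have "cinner (x - y) y = 0"
    unfolding y_def by (auto simp: cinner_sum_right cinner_scaleC_right)
  then have "(norm (x - y + y))\<^sup>2 = (norm (x - y))\<^sup>2 + (norm y)\<^sup>2"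
    by (rule norm_add_squared_orthogonal)
  then show ?thesis
    using norm_sum_orthonormal[OF assms, of "{..<n}" "\<lambda>i. cinner x (e i)"] by (simp add: y_def)
qed

lemma Bessel_finite:
  assumes "orthonormal e"
  shows "(\<Sum>i<n. (norm (cinner x (e i)))\<^sup>2) \<le> (norm x)\<^sup>2"
  using Bessel_residual[OF assms, of x n] by simp

lemma residual_orthogonal:
  assumes "orthonormal e" "j < n"
  shows "cinner (x - (\<Sum>i<n. cinner x (e i) *\<^sub>C e i)) (e j) = 0"
  using assms(2) by (simp add: cinner_diff_left cinner_sum_left cinner_scaleC_left orthonormalD[OF assms(1)]
      if_distrib[of "\<lambda>z. _ * z"] cong: if_cong)

lemma summable_Bessel:
  assumes "orthonormal e"
  shows "summable (\<lambda>i. (norm (cinner x (e i)))\<^sup>2)" "(\<Sum>i. (norm (cinner x (e i)))\<^sup>2) \<le> (norm x)\<^sup>2"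
proof -
  show "summable (\<lambda>i. (norm (cinner x (e i)))\<^sup>2)"
    by (rule summableI_nonneg_bounded[where x="(norm x)\<^sup>2"]) (use Bessel_finite[OF assms] in auto)
  then show "(\<Sum>i. (norm (cinner x (e i)))\<^sup>2) \<le> (norm x)\<^sup>2"
    by (rule suminf_le_const) (rule Bessel_finite[OF assms])
qed

text \<open>Riesz-Fischer. By Pythagoras the partial sums are Cauchy because the sums of squared
  coefficients are; completeness gives the vector, and continuity carries coefficients and norm to
  the limit.\<close>

lemma orthonormal_series:
  fixes a :: "nat \<Rightarrow> complex"
  assumes e: "orthonormal e" and a: "summable (\<lambda>i. (norm (a i))\<^sup>2)"
  shows "summable (\<lambda>i. a i *\<^sub>C e i)"
    and "cinner (\<Sum>i. a i *\<^sub>C e i) (e j) = a j"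
    and "(norm (\<Sum>i. a i *\<^sub>C e i))\<^sup>2 = (\<Sum>i. (norm (a i))\<^sup>2)"
proof -
  show s: "summable (\<lambda>i. a i *\<^sub>C e i)"
    unfolding summable_Cauchy
  proof (intro allI impI)
    fix r :: real assume "r > 0"
    then have "r\<^sup>2 > 0" by simp
    then obtain N where N: "\<And>m n. m \<ge> N \<Longrightarrow> norm (\<Sum>i=m..<n. (norm (a i))\<^sup>2) < r\<^sup>2"
      using a unfolding summable_Cauchy by meson
    have "norm (\<Sum>i=m..<n. a i *\<^sub>C e i) < r" if "m \<ge> N" for m n
    proof -
      have "(norm (\<Sum>i=m..<n. a i *\<^sub>C e i))\<^sup>2 < r\<^sup>2"
        using N[OF that, of n] by (subst norm_sum_orthonormal[OF e]) (auto simp: sum_nonneg)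
      then show ?thesis using \<open>r > 0\<close> by (simp add: power_less_imp_less_base)
    qed
    then show "\<exists>N. \<forall>m\<ge>N. \<forall>n. norm (\<Sum>i=m..<n. a i *\<^sub>C e i) < r" by blast
  qed
  have "(\<lambda>i. cinner (a i *\<^sub>C e i) (e j)) sums cinner (\<Sum>i. a i *\<^sub>C e i) (e j)"
    by (rule bounded_linear.sums[OF bounded_linear_cinner_left]) (use s in \<open>simp add: summable_sums\<close>)
  moreover have "(\<lambda>i. cinner (a i *\<^sub>C e i) (e j)) = (\<lambda>i. if i = j then a j else 0)"
    by (auto simp: cinner_scaleC_left orthonormalD[OF e])
  ultimately show "cinner (\<Sum>i. a i *\<^sub>C e i) (e j) = a j"
    using sums_single[of j "\<lambda>_. a j"] sums_unique2 by (metis (no_types, lifting))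
  have "(\<lambda>n. (norm (\<Sum>i<n. a i *\<^sub>C e i))\<^sup>2) \<longlonglongrightarrow> (norm (\<Sum>i. a i *\<^sub>C e i))\<^sup>2"
    by (intro tendsto_intros summable_LIMSEQ s)
  moreover have "(\<lambda>n. \<Sum>i<n. (norm (a i))\<^sup>2) \<longlonglongrightarrow> (\<Sum>i. (norm (a i))\<^sup>2)"
    by (rule summable_LIMSEQ[OF a])
  ultimately show "(norm (\<Sum>i. a i *\<^sub>C e i))\<^sup>2 = (\<Sum>i. (norm (a i))\<^sup>2)"
    by (simp add: norm_sum_orthonormal[OF e] LIMSEQ_unique)
qed

lemma bounded_weights:
  assumes e: "orthonormal e" and s: "\<And>n. \<bar>s n\<bar> \<le> (C::real)"
  shows "summable (\<lambda>n. (norm (of_real (s n) * cinner x (e n)))\<^sup>2)"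
    and "(\<Sum>n. (norm (of_real (s n) * cinner x (e n)))\<^sup>2) \<le> (C * norm x)\<^sup>2"
proof -
  have le: "(norm (of_real (s n) * cinner x (e n)))\<^sup>2 \<le> C\<^sup>2 * (norm (cinner x (e n)))\<^sup>2" for n
  proof -
    have "\<bar>s n\<bar>\<^sup>2 \<le> C\<^sup>2" by (rule power_mono[OF s]) simp
    then show ?thesis by (simp add: norm_mult power_mult_distrib mult_right_mono)
  qed
  have S: "summable (\<lambda>n. C\<^sup>2 * (norm (cinner x (e n)))\<^sup>2)"
    by (rule summable_mult[OF summable_Bessel(1)[OF e]])
  show 1: "summable (\<lambda>n. (norm (of_real (s n) * cinner x (e n)))\<^sup>2)"
    by (rule summable_comparison_test'[OF S, of 0]) (use le in auto)
  have "(\<Sum>n. (norm (of_real (s n) * cinner x (e n)))\<^sup>2) \<le> (\<Sum>n. C\<^sup>2 * (norm (cinner x (e n)))\<^sup>2)"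
    by (rule suminf_le[OF le 1 S])
  also have "\<dots> = C\<^sup>2 * (\<Sum>n. (norm (cinner x (e n)))\<^sup>2)"
    by (rule suminf_mult[OF summable_Bessel(1)[OF e]])
  also have "\<dots> \<le> C\<^sup>2 * (norm x)\<^sup>2"
    by (intro mult_left_mono summable_Bessel(2)[OF e]) simp
  finally show "(\<Sum>n. (norm (of_real (s n) * cinner x (e n)))\<^sup>2) \<le> (C * norm x)\<^sup>2"
    by (simp add: power_mult_distrib)
qed

subsection \<open>Weighted partial isometries\<close>

text \<open>One notation for three kinds of operators: compact ones (null weights), partial
  isometries between orthonormal systems (weights 1) and bounded diagonal multipliers. Bounded
  weights make the series a bounded operator.\<close>

definition wop :: "(nat \<Rightarrow> real) \<Rightarrow> (nat \<Rightarrow> 'h::chilbert_space) \<Rightarrow> (nat \<Rightarrow> 'h) \<Rightarrow> 'h \<Rightarrow>\<^sub>L 'h" where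
  "wop s e f = Blinfun (\<lambda>x. \<Sum>n. (of_real (s n) * cinner x (e n)) *\<^sub>C f n)"

lemma wop:
  assumes e: "orthonormal e" and f: "orthonormal f" and s: "\<And>n. \<bar>s n\<bar> \<le> (C::real)"
  shows "(\<lambda>n. (of_real (s n) * cinner x (e n)) *\<^sub>C f n) sums blinfun_apply (wop s e f) x"
    and "norm (blinfun_apply (wop s e f) x) \<le> C * norm x"
    and "wop s e f \<in> bounded_ops"
    and "cinner (blinfun_apply (wop s e f) x) (f j) = of_real (s j) * cinner x (e j)"
proof -
  define T where "T = (\<lambda>x. \<Sum>n. (of_real (s n) * cinner x (e n)) *\<^sub>C f n)"
  note bw = bounded_weights[OF e s]
  have sm: "summable (\<lambda>n. (of_real (s n) * cinner x (e n)) *\<^sub>C f n)" for x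
    by (rule orthonormal_series(1)[OF f bw(1)])
  have C: "C \<ge> 0" using s[of 0] by simp
  have nT: "norm (T x) \<le> C * norm x" for x
  proof -
    have "(norm (T x))\<^sup>2 \<le> (C * norm x)\<^sup>2"
      unfolding T_def using orthonormal_series(3)[OF f bw(1)[where x=x]] bw(2)[where x=x] by simp
    then show ?thesis using C by (simp add: power2_le_iff_abs_le)
  qed
  have Tadd: "T (x + y) = T x + T y" for x y
    unfolding T_def by (subst suminf_add[OF sm sm]) (simp add: cinner_add_left scaleC_add_left distrib_left)
  have TC: "T (c *\<^sub>C x) = c *\<^sub>C T x" for c x
    unfolding T_def by (subst bounded_linear.suminf[OF bounded_linear_scaleC sm])
       (simp add: cinner_scaleC_left scaleC_scaleC algebra_simps)
  have bl: "bounded_linear T"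
    by (rule bounded_linear_intro[where K=C]) (use Tadd TC nT in \<open>auto simp: scaleR_scaleC mult.commute\<close>)
  have ap: "blinfun_apply (wop s e f) = T"
    unfolding wop_def T_def[symmetric] by (rule bounded_linear_Blinfun_apply[OF bl])
  show "(\<lambda>n. (of_real (s n) * cinner x (e n)) *\<^sub>C f n) sums blinfun_apply (wop s e f) x"
    unfolding ap T_def by (rule summable_sums[OF sm])
  show "norm (blinfun_apply (wop s e f) x) \<le> C * norm x" unfolding ap by (rule nT)
  show "wop s e f \<in> bounded_ops" by (simp add: bounded_ops_def ap TC)
  show "cinner (blinfun_apply (wop s e f) x) (f j) = of_real (s j) * cinner x (e j)"
    unfolding ap T_def by (rule orthonormal_series(2)[OF f bw(1)])
qed

lemma wop_eqI:
  assumes "orthonormal e" "orthonormal f" "\<And>n. \<bar>s n\<bar> \<le> (C::real)"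
    and "\<And>x. (\<lambda>n. (of_real (s n) * cinner x (e n)) *\<^sub>C f n) sums blinfun_apply T x"
  shows "T = wop s e f"
  by (rule blinfun_eqI) (rule sums_unique2[OF assms(4) wop(1)[OF assms(1-3)]])

lemma wop_compose:
  assumes "orthonormal e" "orthonormal f" "orthonormal g"
    "\<And>n. \<bar>s n\<bar> \<le> (C::real)" "\<And>n. \<bar>t n\<bar> \<le> (D::real)"
  shows "wop t f g o\<^sub>L wop s e f = wop (\<lambda>n. t n * s n) e g"
proof (rule wop_eqI[where C="D * C"])
  fix n :: nat show "\<bar>t n * s n\<bar> \<le> D * C"
    unfolding abs_mult by (intro mult_mono assms) (use assms(5)[of 0] in auto)
next
  fix x
  have "(\<lambda>n. (of_real (t n) * cinner (blinfun_apply (wop s e f) x) (f n)) *\<^sub>C g n) sums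
      blinfun_apply (wop t f g) (blinfun_apply (wop s e f) x)"
    by (rule wop(1)[OF assms(2,3,5)])
  then show "(\<lambda>n. (of_real (t n * s n) * cinner x (e n)) *\<^sub>C g n) sums
      blinfun_apply (wop t f g o\<^sub>L wop s e f) x"
    by (simp add: wop(4)[OF assms(1,2,4)] mult.assoc)
qed (rule assms)+

lemma wop_add:
  assumes "orthonormal e" "orthonormal f"
    "\<And>n. \<bar>s n\<bar> \<le> (C::real)" "\<And>n. \<bar>t n\<bar> \<le> (D::real)"
  shows "wop s e f + wop t e f = wop (\<lambda>n. s n + t n) e f"
proof -
  have 1: "\<bar>s n + t n\<bar> \<le> C + D" for n
    by (rule order_trans[OF abs_triangle_ineq add_mono[OF assms(3,4)]])
  have 2: "(\<lambda>n. (of_real (s n + t n) * cinner x (e n)) *\<^sub>C f n) sums blinfun_apply (wop s e f + wop t e f) x" for x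
    unfolding blinfun.add_left of_real_add distrib_right scaleC_add_left
    by (rule sums_add[OF wop(1)[OF assms(1,2,3)] wop(1)[OF assms(1,2,4)]])
  show ?thesis by (rule wop_eqI[OF assms(1,2) 1 2])
qed

lemma bounded_ops_compose: "A \<in> bounded_ops \<Longrightarrow> B \<in> bounded_ops \<Longrightarrow> A o\<^sub>L B \<in> bounded_ops"
  by (simp add: bounded_ops_def)

lemma bounded_ops_add: "A \<in> bounded_ops \<Longrightarrow> B \<in> bounded_ops \<Longrightarrow> A + B \<in> bounded_ops"
  by (simp add: bounded_ops_def plus_blinfun.rep_eq scaleC_add_right)

subsection \<open>Singular value decomposition of compact operators\<close>

lemma compact_ops_convergent_subseq:
  assumes "T \<in> compact_ops" "\<And>n. norm (x n) \<le> 1"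
  obtains l r where "strict_mono (r :: nat \<Rightarrow> nat)" "(\<lambda>n. blinfun_apply T (x (r n))) \<longlonglongrightarrow> l"
proof -
  have c: "compact (closure (blinfun_apply T ` cball 0 1))" using assms(1) by (simp add: compact_ops_def)
  have "\<forall>n. blinfun_apply T (x n) \<in> closure (blinfun_apply T ` cball 0 1)"
    using assms(2) by (auto intro!: closure_subset[THEN subsetD])
  then have "\<exists>l\<in>closure (blinfun_apply T ` cball 0 1). \<exists>r. strict_mono r \<and> ((\<lambda>n. blinfun_apply T (x n)) \<circ> r) \<longlonglongrightarrow> l"
    using c[unfolded compact_def, rule_format, of "\<lambda>n. blinfun_apply T (x n)"] by blast
  then show ?thesis using that by (auto simp: o_def)
qed

text \<open>One step of the singular value decomposition: \<open>V\<close> holds the vectors already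
  chosen, and \<open>y\<close> witnesses that something nonzero is orthogonal to them.\<close>

lemma maximizing_vector:
  fixes X :: "'h::chilbert_space \<Rightarrow>\<^sub>L 'h"
  assumes X: "X \<in> compact_ops" and y: "y \<noteq> 0" "\<And>v. v \<in> V \<Longrightarrow> cinner y v = 0"
  shows "\<exists>e. norm e = 1 \<and> (\<forall>v\<in>V. cinner e v = 0) \<and>
    (\<forall>x. (\<forall>v\<in>V. cinner x v = 0) \<longrightarrow> norm (blinfun_apply X x) \<le> norm (blinfun_apply X e) * norm x)"
proof -
  define U where "U = {x. norm x = 1 \<and> (\<forall>v\<in>V. cinner x v = 0)}"
  define M where "M = (SUP x\<in>U. norm (blinfun_apply X x))"
  have bdd: "bdd_above ((\<lambda>x. norm (blinfun_apply X x)) ` U)"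
  proof (rule bdd_aboveI2)
    fix x assume "x \<in> U"
    then show "norm (blinfun_apply X x) \<le> norm X" using norm_blinfun[of X x] by (simp add: U_def)
  qed
  have y': "(1 / norm y) *\<^sub>R y \<in> U" using y by (simp add: U_def cinner_scaleR_left)
  then have neU: "U \<noteq> {}" by blast
  have le1: "norm (blinfun_apply X x) \<le> M" if "x \<in> U" for x
    unfolding M_def by (rule cSUP_upper[OF that bdd])
  have leM: "norm (blinfun_apply X x) \<le> M * norm x" if "\<forall>v\<in>V. cinner x v = 0" for x
  proof (cases "x = 0")
    case False
    then have "(1 / norm x) *\<^sub>R x \<in> U" using that by (simp add: U_def cinner_scaleR_left)
    from le1[OF this] False show ?thesis by (simp add: blinfun.scaleR_right field_simps)
  qed (simp add: blinfun.zero_right)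
  have M0: "M \<ge> 0" using le1[OF y'] norm_ge_zero order_trans by blast
  show ?thesis
  proof (cases "M = 0")
    \<comment> \<open>If \<open>M = 0\<close>, every admissible unit vector will do; the Cauchy
      estimate of the other case cancels \<open>M\<close>.\<close>
    case True
    show ?thesis
      by (rule exI[of _ "(1 / norm y) *\<^sub>R y"]) (use True leM y' in \<open>auto simp: U_def\<close>)
  next
    case False
    then have Mpos: "M > 0" using M0 by simp
    have "\<exists>x. x \<in> U \<and> M - 1 / real (Suc n) < norm (blinfun_apply X x)" for n
      using less_cSUP_iff[OF neU bdd, of "M - 1 / real (Suc n)"] by (auto simp: M_def)
    then obtain x where x: "\<And>n. x n \<in> U" "\<And>n. M - 1 / real (Suc n) < norm (blinfun_apply X (x n))"
      by metis
    have "\<And>n. norm (x n) \<le> 1" using x(1) by (simp add: U_def)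
    then obtain l r where r: "strict_mono (r :: nat \<Rightarrow> nat)" "(\<lambda>n. blinfun_apply X (x (r n))) \<longlonglongrightarrow> l"
      using compact_ops_convergent_subseq[OF X] by blast
    have "(\<lambda>n. norm (blinfun_apply X (x n))) \<longlonglongrightarrow> M"
    proof (rule tendsto_sandwich[where h="\<lambda>_. M"])
      show "\<forall>\<^sub>F n in sequentially. M - 1 / real (Suc n) \<le> norm (blinfun_apply X (x n))"
        using x(2) by (intro always_eventually) (auto intro: less_imp_le)
      show "\<forall>\<^sub>F n in sequentially. norm (blinfun_apply X (x n)) \<le> M"
        using le1 x(1) by (intro always_eventually) auto
      have "(\<lambda>n. M - 1 / real (Suc n)) \<longlonglongrightarrow> M - 0"
        by (intro tendsto_intros LIMSEQ_Suc[OF lim_1_over_n])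
      then show "(\<lambda>n. M - 1 / real (Suc n)) \<longlonglongrightarrow> M" by simp
    qed simp
    then have "(\<lambda>n. norm (blinfun_apply X (x (r n)))) \<longlonglongrightarrow> M"
      using LIMSEQ_subseq_LIMSEQ[OF _ r(1)] by (fastforce simp: o_def)
    moreover have "(\<lambda>n. norm (blinfun_apply X (x (r n)))) \<longlonglongrightarrow> norm l"
      by (intro tendsto_intros r)
    ultimately have nl: "norm l = M" using LIMSEQ_unique by blast
    text \<open>By the parallelogram law, an almost norm attaining sequence with convergent images is Cauchy.\<close>
    have "Cauchy (\<lambda>n. x (r n))"
      unfolding Cauchy_def dist_norm
    proof (intro allI impI)
      fix \<epsilon> :: real assume \<epsilon>: "\<epsilon> > 0"
      \<comment> \<open>\<open>d \<le> M\<close> keeps \<open>2 * M - 2 * d\<close> nonnegative, so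
        that it may be squared; \<open>16 * d \<le> M * \<epsilon>\<^sup>2\<close> makes the
        resulting bound \<open>M * (8 * d)\<close> smaller than
        \<open>M\<^sup>2 * \<epsilon>\<^sup>2\<close>.\<close>
      define d where "d = min M (M * \<epsilon>\<^sup>2 / 16)"
      have d: "d > 0" "d \<le> M" "16 * d \<le> M * \<epsilon>\<^sup>2" using Mpos \<epsilon> by (auto simp: d_def min_def)
      obtain N where N: "\<And>n. n \<ge> N \<Longrightarrow> norm (blinfun_apply X (x (r n)) - l) < d"
        using LIMSEQ_D[OF r(2) d(1)] by blast
      have "norm (x (r m) - x (r n)) < \<epsilon>" if "m \<ge> N" "n \<ge> N" for m n
      proof -
        let ?a = "x (r m)" and ?b = "x (r n)"
        have "norm (2 *\<^sub>R l) \<le> norm (blinfun_apply X ?a + blinfun_apply X ?b) + norm (blinfun_apply X ?a - l) + norm (blinfun_apply X ?b - l)"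
        proof -
          have "2 *\<^sub>R l = (blinfun_apply X ?a + blinfun_apply X ?b) - (blinfun_apply X ?a - l) - (blinfun_apply X ?b - l)"
            by (simp add: scaleR_2)
          then show ?thesis by (metis (no_types, opaque_lifting) norm_triangle_ineq4 order_trans add_right_mono)
        qed
        then have "2 * M - 2 * d \<le> norm (blinfun_apply X (?a + ?b))"
          using N[OF that(1)] N[OF that(2)] nl by (simp add: blinfun.add_right)
        also have "\<dots> \<le> M * norm (?a + ?b)"
          by (rule leM) (use x(1) in \<open>auto simp: U_def cinner_add_left\<close>)
        finally have "(2 * M - 2 * d)\<^sup>2 \<le> (M * norm (?a + ?b))\<^sup>2"
          using d by (intro power_mono) auto
        then have 1: "(2 * M - 2 * d)\<^sup>2 \<le> M\<^sup>2 * (norm (?a + ?b))\<^sup>2" by (simp add: power_mult_distrib)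
        have par: "(norm (?a - ?b))\<^sup>2 = 4 - (norm (?a + ?b))\<^sup>2"
        proof -
          have "norm ?a = 1" "norm ?b = 1" using x(1) by (auto simp: U_def)
          then have "inner ?a ?a = 1" "inner ?b ?b = 1" by (simp_all add: power2_norm_eq_inner[symmetric])
          then show ?thesis
            by (simp add: power2_norm_eq_inner inner_add_left inner_add_right inner_diff_left inner_diff_right inner_commute)
        qed
        have "M\<^sup>2 * (norm (?a - ?b))\<^sup>2 \<le> M * (8 * d)"
        proof -
          have "M\<^sup>2 * (norm (?a - ?b))\<^sup>2 = 4 * M\<^sup>2 - M\<^sup>2 * (norm (?a + ?b))\<^sup>2"
            by (simp add: par right_diff_distrib)
          moreover have "(2 * M - 2 * d)\<^sup>2 = 4 * M\<^sup>2 - M * (8 * d) + 4 * d\<^sup>2"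
            by (simp add: power2_eq_square algebra_simps)
          ultimately show ?thesis using 1 zero_le_power2[of d] by linarith
        qed
        also have "\<dots> < M * (M * \<epsilon>\<^sup>2)"
          using Mpos d by (intro mult_strict_left_mono) auto
        finally have "M\<^sup>2 * (norm (?a - ?b))\<^sup>2 < M\<^sup>2 * \<epsilon>\<^sup>2" by (simp add: power2_eq_square)
        then have "(norm (?a - ?b))\<^sup>2 < \<epsilon>\<^sup>2" using Mpos by simp
        then show ?thesis using \<epsilon> by (simp add: power_less_imp_less_base)
      qed
      then show "\<exists>N. \<forall>m\<ge>N. \<forall>n\<ge>N. norm (x (r m) - x (r n)) < \<epsilon>" by blast
    qed
    then obtain e where e: "(\<lambda>n. x (r n)) \<longlonglongrightarrow> e" using Cauchy_convergent_iff convergent_def by blast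
    have ne: "norm e = 1"
    proof -
      have "(\<lambda>n. norm (x (r n))) \<longlonglongrightarrow> norm e" by (intro tendsto_intros e)
      moreover have "(\<lambda>n. norm (x (r n))) = (\<lambda>n. 1)" using x(1) by (auto simp: U_def)
      ultimately show ?thesis using LIMSEQ_unique tendsto_const by metis
    qed
    have oe: "cinner e v = 0" if "v \<in> V" for v
    proof -
      have "(\<lambda>n. cinner (x (r n)) v) \<longlonglongrightarrow> cinner e v"
        by (rule bounded_linear.tendsto[OF bounded_linear_cinner_left e])
      moreover have "(\<lambda>n. cinner (x (r n)) v) = (\<lambda>n. 0)" using x(1) that by (auto simp: U_def)
      ultimately show ?thesis using LIMSEQ_unique tendsto_const by metis
    qed
    have "(\<lambda>n. blinfun_apply X (x (r n))) \<longlonglongrightarrow> blinfun_apply X e"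
      by (rule blinfun.tendsto[OF tendsto_const e])
    then have "norm (blinfun_apply X e) = M" using r(2) nl LIMSEQ_unique by blast
    then show ?thesis using ne oe leM by auto
  qed
qed

text \<open>First-order variation. Adding a small multiple of \<open>x\<close> to \<open>e\<close>
  changes the norm of the vector only to second order, but the norm of the image to first order
  unless the two images are orthogonal.\<close>

lemma maximizing_vector_orthogonal:
  fixes X :: "'h::chilbert_space \<Rightarrow>\<^sub>L 'h"
  assumes X: "X \<in> bounded_ops" and e: "norm e = 1" "\<forall>v\<in>V. cinner e v = 0"
    and max: "\<And>x. (\<forall>v\<in>V. cinner x v = 0) \<Longrightarrow> norm (blinfun_apply X x) \<le> norm (blinfun_apply X e) * norm x"
    and x: "\<forall>v\<in>V. cinner x v = 0" "cinner x e = 0"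
  shows "cinner (blinfun_apply X x) (blinfun_apply X e) = 0"
proof (rule ccontr)
  define c where "c = cinner (blinfun_apply X x) (blinfun_apply X e)"
  define M where "M = norm (blinfun_apply X e)"
  assume "cinner (blinfun_apply X x) (blinfun_apply X e) \<noteq> 0"
  then have c: "norm c > 0" by (simp add: c_def)
  \<comment> \<open>With \<open>t\<close> a multiple of \<open>cnj c\<close> the first-order gain is
    \<open>2 * \<epsilon> * (norm c)\<^sup>2\<close>; this \<epsilon> is so small that the
    second-order term cannot pay for it.\<close>
  define \<epsilon> where "\<epsilon> = 1 / (M\<^sup>2 * (norm x)\<^sup>2 + 1)"
  have \<epsilon>: "\<epsilon> > 0" by (simp add: \<epsilon>_def add_nonneg_pos)
  define t where "t = of_real \<epsilon> * cnj c"
  have nt: "norm t = \<epsilon> * norm c" using \<epsilon> by (simp add: t_def norm_mult)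
  have XC: "blinfun_apply X (t *\<^sub>C x) = t *\<^sub>C blinfun_apply X x" using X by (simp add: bounded_ops_def)
  have "norm (blinfun_apply X (e + t *\<^sub>C x)) \<le> M * norm (e + t *\<^sub>C x)"
    unfolding M_def by (rule max) (use e x in \<open>auto simp: cinner_add_left cinner_scaleC_left\<close>)
  then have "(norm (blinfun_apply X (e + t *\<^sub>C x)))\<^sup>2 \<le> (M * norm (e + t *\<^sub>C x))\<^sup>2"
    by (intro power_mono) auto
  also have "\<dots> = M\<^sup>2 * (1 + \<epsilon>\<^sup>2 * (norm c)\<^sup>2 * (norm x)\<^sup>2)"
  proof -
    have "cinner e x = 0" using x(2) cinner_commute[of e x] by simp
    then have "(norm (e + t *\<^sub>C x))\<^sup>2 = (norm e)\<^sup>2 + (norm (t *\<^sub>C x))\<^sup>2"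
      by (intro norm_add_squared_orthogonal) (simp add: cinner_scaleC_right)
    then show ?thesis by (simp add: power_mult_distrib e nt mult.assoc)
  qed
  finally have 1: "(norm (blinfun_apply X (e + t *\<^sub>C x)))\<^sup>2 \<le> M\<^sup>2 * (1 + \<epsilon>\<^sup>2 * (norm c)\<^sup>2 * (norm x)\<^sup>2)" .
  have "inner (t *\<^sub>C blinfun_apply X x) (blinfun_apply X e) = \<epsilon> * (norm c)\<^sup>2"
  proof -
    have "cinner (t *\<^sub>C blinfun_apply X x) (blinfun_apply X e) = of_real \<epsilon> * (c * cnj c)"
      by (simp add: cinner_scaleC_left t_def c_def)
    also have "\<dots> = of_real (\<epsilon> * (norm c)\<^sup>2)" by (simp only: complex_norm_square[symmetric] of_real_mult)
    finally show ?thesis by (simp add: inner_cinner)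
  qed
  moreover have "(norm (blinfun_apply X (e + t *\<^sub>C x)))\<^sup>2 = M\<^sup>2 + 2 * inner (t *\<^sub>C blinfun_apply X x) (blinfun_apply X e)
      + (norm (t *\<^sub>C blinfun_apply X x))\<^sup>2"
  proof -
    have "(norm (a + b))\<^sup>2 = (norm a)\<^sup>2 + 2 * inner b a + (norm b)\<^sup>2" for a b :: 'h
      by (simp add: power2_norm_eq_inner inner_add_left inner_add_right inner_commute)
    then show ?thesis unfolding blinfun.add_right XC M_def .
  qed
  moreover have "(norm (t *\<^sub>C blinfun_apply X x))\<^sup>2 \<ge> 0" by simp
  ultimately have "M\<^sup>2 + 2 * \<epsilon> * (norm c)\<^sup>2 \<le> M\<^sup>2 * (1 + \<epsilon>\<^sup>2 * (norm c)\<^sup>2 * (norm x)\<^sup>2)"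
    using 1 by linarith
  then have "\<epsilon> * (norm c)\<^sup>2 * 2 \<le> \<epsilon> * (norm c)\<^sup>2 * (\<epsilon> * (M\<^sup>2 * (norm x)\<^sup>2))"
    by (simp add: algebra_simps power2_eq_square)
  then have "2 \<le> \<epsilon> * (M\<^sup>2 * (norm x)\<^sup>2)" using \<epsilon> c by simp
  moreover have "\<epsilon> * (M\<^sup>2 * (norm x)\<^sup>2) \<le> 1"
    by (simp add: \<epsilon>_def divide_le_eq add_nonneg_pos)
  ultimately show False by simp
qed

section \<open>Choice of orthonormal sequences in infinite dimension\<close>

definition infinite_dim :: "'h::chilbert_space itself \<Rightarrow> bool" where
  "infinite_dim _ \<longleftrightarrow> (\<nexists>B::'h set. finite B \<and> complex_vector.span B = UNIV)"

lemma orthogonal_vector_exists: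
  fixes n :: nat
  assumes inf: "infinite_dim TYPE('h::chilbert_space)"
    and e: "\<And>i j. i < n \<Longrightarrow> j < n \<Longrightarrow> cinner (e i) (e j :: 'h) = (if i = j then 1 else 0)"
  shows "\<exists>y. norm y = 1 \<and> (\<forall>i<n. cinner y (e i) = 0)"
proof -
  have "\<exists>x. x \<notin> complex_vector.span (e ` {..<n})"
  proof (rule ccontr)
    assume "\<not> ?thesis"
    then have "complex_vector.span (e ` {..<n}) = UNIV" by blast
    moreover have "finite (e ` {..<n})" by simp
    ultimately show False using inf unfolding infinite_dim_def by blast
  qed
  then obtain x where x: "x \<notin> complex_vector.span (e ` {..<n})" by blast
  define z where "z = x - (\<Sum>i<n. cinner x (e i) *\<^sub>C e i)"
  have oz: "cinner z (e j) = 0" if "j < n" for j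
  proof -
    have "cinner (\<Sum>i<n. cinner x (e i) *\<^sub>C e i) (e j) = (\<Sum>i<n. if i = j then cinner x (e j) else 0)"
      unfolding cinner_sum_left by (rule sum.cong) (use that e in \<open>auto simp: cinner_scaleC_left\<close>)
    then show ?thesis using that by (simp add: z_def cinner_diff_left)
  qed
  have "z \<noteq> 0"
  proof
    assume "z = 0"
    then have "x = (\<Sum>i<n. cinner x (e i) *\<^sub>C e i)" by (simp add: z_def)
    also have "\<dots> \<in> complex_vector.span (e ` {..<n})"
      by (intro complex_vector.span_sum complex_vector.span_scale complex_vector.span_base) auto
    finally show False using x by simp
  qed
  then show ?thesis
    by (intro exI[of _ "(1 / norm z) *\<^sub>R z"]) (auto simp: cinner_scaleR_left oz)
qed

lemma orthonormalI_less:
  assumes "\<And>n. norm (e n) = 1" "\<And>n i. i < n \<Longrightarrow> cinner (e n) (e i) = 0"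
  shows "orthonormal e"
  unfolding orthonormal_def
proof (intro allI)
  fix i j show "cinner (e i) (e j) = (if i = j then 1 else 0)"
    using assms(2)[of i j] assms(2)[of j i] cinner_commute[of "e i" "e j"]
    by (cases i j rule: linorder_cases) (auto simp: cinner_self assms(1))
qed

text \<open>Well-founded choice in which the next vector may depend on the earlier ones;
  \<open>adm\<close> says that \<open>Q\<close> inspects only those. It yields both the right
  singular vectors, chosen by maximality, and the left ones, prescribed where the weight is positive
  and free elsewhere.\<close>

lemma orthonormal_wf_choice:
  fixes Q :: "(nat \<Rightarrow> 'h::chilbert_space) \<Rightarrow> nat \<Rightarrow> 'h \<Rightarrow> bool"
  assumes adm: "\<And>e e' n y. (\<And>i. i < n \<Longrightarrow> e i = e' i) \<Longrightarrow> Q e n y = Q e' n y"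
    and ex: "\<And>e n. (\<And>i j. i < n \<Longrightarrow> j < n \<Longrightarrow> cinner (e i) (e j) = (if i = j then 1 else 0)) \<Longrightarrow>
      (\<And>i. i < n \<Longrightarrow> Q e i (e i)) \<Longrightarrow> \<exists>y. norm y = 1 \<and> (\<forall>i<n. cinner y (e i) = 0) \<and> Q e n y"
  obtains e where "orthonormal e" "\<And>n. Q e n (e n)"
proof -
  define P where "P = (\<lambda>e n y. norm y = 1 \<and> (\<forall>i<n. cinner y (e i) = 0) \<and> Q e n y)"
  have "\<exists>e. \<forall>n. P e n (e n)"
  proof (rule dependent_wf_choice[where R="less_than"])
    fix f g :: "nat \<Rightarrow> 'h" and x r assume "\<And>z. (z, x) \<in> less_than \<Longrightarrow> f z = g z"
    then have eq: "\<And>i. i < x \<Longrightarrow> f i = g i" by simp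
    show "P f x r = P g x r" unfolding P_def using adm[OF eq] eq by auto
  next
    fix n and f :: "nat \<Rightarrow> 'h" assume "\<And>y. (y, n) \<in> less_than \<Longrightarrow> P f y (f y)"
    then have H: "\<And>i. i < n \<Longrightarrow> P f i (f i)" by simp
    have "cinner (f i) (f j) = (if i = j then 1 else 0)" if "i < n" "j < n" for i j
      using H[OF that(1)] H[OF that(2)] cinner_commute[of "f i" "f j"] that unfolding P_def
      by (cases i j rule: linorder_cases) (auto simp: cinner_self)
    from ex[OF this] H show "\<exists>r. P f n r" unfolding P_def by blast
  qed auto
  then obtain e where e: "\<And>n. P e n (e n)" by blast
  have "orthonormal e" by (rule orthonormalI_less) (use e in \<open>auto simp: P_def\<close>)
  with e show ?thesis using that unfolding P_def by blast
qed

definition svd :: "('h::chilbert_space \<Rightarrow>\<^sub>L 'h) \<Rightarrow> (nat \<Rightarrow> real) \<Rightarrow> (nat \<Rightarrow> 'h) \<Rightarrow> (nat \<Rightarrow> 'h) \<Rightarrow> bool" where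
  "svd X s e f \<longleftrightarrow> s \<in> c0_star \<and> orthonormal e \<and> orthonormal f \<and> X = wop s e f"

lemma c0_starD:
  assumes "s \<in> c0_star"
  shows "0 \<le> s n" "m \<le> n \<Longrightarrow> s n \<le> s m" "s \<longlonglongrightarrow> 0" "\<bar>s n\<bar> \<le> s 0"
  using assms by (auto simp: c0_star_def antimono_def)

text \<open>Both systems are infinite sequences even if \<open>X\<close> has finite rank: at weight
  \<open>0\<close> the left vectors are filled in arbitrarily, which infinite dimension
  permits.\<close>

lemma svd_exists:
  fixes X :: "'h::chilbert_space \<Rightarrow>\<^sub>L 'h"
  assumes inf: "infinite_dim TYPE('h)" and X: "X \<in> compact_ops"
  shows "\<exists>s e f. svd X s e f"
proof -
  have Xb: "X \<in> bounded_ops" using X by (simp add: compact_ops_def)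
  obtain e where e: "orthonormal e" "\<And>n. \<forall>x. (\<forall>i<n. cinner x (e i) = 0) \<longrightarrow>
      norm (blinfun_apply X x) \<le> norm (blinfun_apply X (e n)) * norm x"
  proof (rule orthonormal_wf_choice[where Q="\<lambda>e n y. \<forall>x. (\<forall>i<n. cinner x (e i) = 0) \<longrightarrow>
      norm (blinfun_apply X x) \<le> norm (blinfun_apply X y) * norm (x::'h)"])
    fix e :: "nat \<Rightarrow> 'h" and n
    assume "\<And>i j. i < n \<Longrightarrow> j < n \<Longrightarrow> cinner (e i) (e j) = (if i = j then 1 else 0)"
    from orthogonal_vector_exists[OF inf this]
    obtain y where "norm y = 1" "\<forall>i<n. cinner y (e i) = 0" by blast
    then have "y \<noteq> 0" "\<And>v. v \<in> e ` {..<n} \<Longrightarrow> cinner y v = 0" by auto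
    note y = this
    have eq: "(\<forall>v\<in>e ` {..<n}. R v) \<longleftrightarrow> (\<forall>i<n. R (e i))" for R by auto
    show "\<exists>y. norm y = 1 \<and> (\<forall>i<n. cinner y (e i) = 0) \<and> (\<forall>x. (\<forall>i<n. cinner x (e i) = 0) \<longrightarrow>
      norm (blinfun_apply X x) \<le> norm (blinfun_apply X y) * norm x)" 
      using maximizing_vector[where V="e ` {..<n}", OF X y(1)] y(2) unfolding eq by blast
  qed auto
  define s where "s = (\<lambda>n. norm (blinfun_apply X (e n)))"
  have max: "norm (blinfun_apply X x) \<le> s n * norm x" if "\<forall>i<n. cinner x (e i) = 0" for x n
    using e(2) that by (auto simp: s_def)
  have orth: "cinner (blinfun_apply X (e j)) (blinfun_apply X (e i)) = 0" if "i < j" for i j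
    by (rule maximizing_vector_orthogonal[OF Xb, where V="e ` {..<i}"])
       (use that max orthonormal_norm[OF e(1)] orthonormalD[OF e(1)] in \<open>auto simp: s_def\<close>)
  have s0: "s n \<ge> 0" for n by (simp add: s_def)
  have anti: "antimono s"
  proof (rule antimonoI)
    fix m n :: nat assume "m \<le> n"
    have "norm (blinfun_apply X (e n)) \<le> s m * norm (e n)"
      by (rule max) (use \<open>m \<le> n\<close> orthonormalD[OF e(1)] in auto)
    then show "s n \<le> s m" by (simp add: s_def orthonormal_norm[OF e(1)])
  qed
  have lim: "s \<longlonglongrightarrow> 0"
  proof (rule LIMSEQ_I)
    fix d :: real assume d: "d > 0"
    \<comment> \<open>Otherwise the images of the \<open>e n\<close> are mutually orthogonal of norm
      at least \<open>d\<close> and have no convergent subsequence, against compactness.\<close>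
    have "\<exists>N. s N < d"
    proof (rule ccontr)
      assume "\<not> ?thesis"
      then have ge: "s n \<ge> d" for n by (meson not_less)
      obtain l r where r: "strict_mono (r :: nat \<Rightarrow> nat)" "(\<lambda>n. blinfun_apply X (e (r n))) \<longlonglongrightarrow> l"
        by (rule compact_ops_convergent_subseq[OF X, of e]) (simp_all add: orthonormal_norm[OF e(1)])
      have "Cauchy (\<lambda>n. blinfun_apply X (e (r n)))" using r(2) by (rule LIMSEQ_imp_Cauchy)
      then obtain N where N: "\<And>m n. m \<ge> N \<Longrightarrow> n \<ge> N \<Longrightarrow>
          norm (blinfun_apply X (e (r m)) - blinfun_apply X (e (r n))) < d"
        using d unfolding Cauchy_def dist_norm by meson
      let ?a = "blinfun_apply X (e (r (Suc N)))" and ?b = "blinfun_apply X (e (r N))"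
      have "cinner ?a ?b = 0" by (rule orth) (simp add: r(1) strict_mono_less)
      then have "(norm (?a + - ?b))\<^sup>2 = (norm ?a)\<^sup>2 + (norm (- ?b))\<^sup>2"
        by (intro norm_add_squared_orthogonal) (simp add: cinner_minus_right)
      moreover have "(norm (?a - ?b))\<^sup>2 < d\<^sup>2" using N[of "Suc N" N] d by (intro power_strict_mono) auto
      moreover have "d\<^sup>2 \<le> (norm ?a)\<^sup>2" using ge[of "r (Suc N)"] d unfolding s_def by (intro power_mono) auto
      ultimately show False by (smt (verit) diff_conv_add_uminus zero_le_power2)
    qed
    then obtain N where "s N < d" by blast
    then have "\<forall>n\<ge>N. norm (s n - 0) < d" using anti s0 by (auto simp: antimono_def intro: le_less_trans)
    then show "\<exists>N. \<forall>n\<ge>N. norm (s n - 0) < d" by blast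
  qed
  have sc: "s \<in> c0_star" using s0 anti lim by (simp add: c0_star_def)
  obtain f where f: "orthonormal f" "\<And>n. s n > 0 \<longrightarrow> f n = (1 / s n) *\<^sub>R blinfun_apply X (e n)"
  proof (rule orthonormal_wf_choice[where Q="\<lambda>f n y. s n > 0 \<longrightarrow> y = (1 / s n) *\<^sub>R blinfun_apply X (e n)"])
    fix f :: "nat \<Rightarrow> 'h" and n
    assume o: "\<And>i j. i < n \<Longrightarrow> j < n \<Longrightarrow> cinner (f i) (f j) = (if i = j then 1 else 0)"
      and q: "\<And>i. i < n \<Longrightarrow> 0 < s i \<longrightarrow> f i = (1 / s i) *\<^sub>R blinfun_apply X (e i)"
    show "\<exists>y. norm y = 1 \<and> (\<forall>i<n. cinner y (f i) = 0) \<and> (0 < s n \<longrightarrow> y = (1 / s n) *\<^sub>R blinfun_apply X (e n))"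
    proof (cases "0 < s n")
      case True
      have "cinner (blinfun_apply X (e n)) (f i) = 0" if "i < n" for i
      proof -
        have "0 < s i" by (rule less_le_trans[OF True antimonoD[OF anti less_imp_le[OF that]]])
        then show ?thesis using q[OF that] orth[OF that] by (simp add: cinner_scaleR_right)
      qed
      then show ?thesis using True by (auto simp: cinner_scaleR_left s_def)
    next
      case False
      then show ?thesis using orthogonal_vector_exists[OF inf o] by auto
    qed
  qed auto
  have Xe: "blinfun_apply X (e n) = s n *\<^sub>R f n" for n
    using f(2)[of n] s0[of n] by (cases "s n = 0") (auto simp: s_def)
  have "X = wop s e f"
  proof (rule wop_eqI[OF e(1) f(1) c0_starD(4)[OF sc]])
    fix x
    \<comment> \<open>\<open>z n\<close> is orthogonal to the first \<open>n\<close> vectors, so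
      maximality bounds the norm of its image by \<open>s n * norm x\<close>. That this bound tends
      to \<open>0\<close> is the convergence of the series to the image of \<open>x\<close>.\<close>
    define z where "z = (\<lambda>n. x - (\<Sum>i<n. cinner x (e i) *\<^sub>C e i))"
    have Xz: "blinfun_apply X (z n) = blinfun_apply X x - (\<Sum>i<n. (of_real (s i) * cinner x (e i)) *\<^sub>C f i)" for n
      using Xb by (simp add: z_def blinfun.diff_right blinfun.sum_right bounded_ops_def Xe scaleR_scaleC scaleC_scaleC mult.commute)
    have "norm (z n) \<le> norm x" for n
    proof -
      have "(norm (z n))\<^sup>2 \<le> (norm x)\<^sup>2"
        using Bessel_residual[OF e(1), of x n] sum_nonneg[of "{..<n}" "\<lambda>i. (norm (cinner x (e i)))\<^sup>2"]
        by (simp add: z_def)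
      then show ?thesis by (simp add: power2_le_iff_abs_le)
    qed
    then have "norm (blinfun_apply X (z n)) \<le> s n * norm x" for n
      using max[of n "z n"] residual_orthogonal[OF e(1), of _ n x] s0[of n]
      by (smt (verit) z_def mult_left_mono)
    moreover have "(\<lambda>n. s n * norm x) \<longlonglongrightarrow> 0" using tendsto_mult_left_zero[OF lim] by simp
    ultimately have "(\<lambda>n. blinfun_apply X (z n)) \<longlonglongrightarrow> 0"
      by (rule Lim_null_comparison[OF always_eventually, rule_format])
    then have "(\<lambda>n. blinfun_apply X x - blinfun_apply X (z n)) \<longlonglongrightarrow> blinfun_apply X x - 0"
      by (intro tendsto_intros)
    then show "(\<lambda>n. (of_real (s n) * cinner x (e n)) *\<^sub>C f n) sums blinfun_apply X x"
      unfolding sums_def by (simp add: Xz)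
  qed
  then show ?thesis using sc e(1) f(1) by (auto simp: svd_def)
qed

subsection \<open>Singular numbers\<close>

lemma wop_basis:
  assumes "orthonormal e" "orthonormal f" "\<And>n. \<bar>s n\<bar> \<le> (C::real)"
  shows "blinfun_apply (wop s e f) (e k) = of_real (s k) *\<^sub>C f k"
proof -
  have "(\<lambda>n. (of_real (s n) * cinner (e k) (e n)) *\<^sub>C f n) sums blinfun_apply (wop s e f) (e k)"
    by (rule wop(1)[OF assms])
  moreover have "(\<lambda>n. (of_real (s n) * cinner (e k) (e n)) *\<^sub>C f n) = (\<lambda>n. if n = k then of_real (s k) *\<^sub>C f k else 0)"
    by (auto simp: orthonormalD[OF assms(1)])
  ultimately show ?thesis
    using sums_unique2[OF _ sums_single[of k "\<lambda>_. of_real (s k) *\<^sub>C f k"]] by simp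
qed

lemma hadjoint_wop:
  assumes "orthonormal e" "orthonormal f" "\<And>n. \<bar>s n\<bar> \<le> (C::real)"
  shows "hadjoint (wop s e f) = wop s f e"
  unfolding hadjoint_def
proof (rule the_equality)
  show 1: "\<forall>x y. cinner (blinfun_apply (wop s e f) x) y = cinner x (blinfun_apply (wop s f e) y)"
  proof (intro allI)
    fix x y
    have "(\<lambda>n. cinner ((of_real (s n) * cinner x (e n)) *\<^sub>C f n) y) sums cinner (blinfun_apply (wop s e f) x) y"
      by (rule bounded_linear.sums[OF bounded_linear_cinner_left wop(1)[OF assms]])
    moreover have "(\<lambda>n. cinner x ((of_real (s n) * cinner y (f n)) *\<^sub>C e n)) sums cinner x (blinfun_apply (wop s f e) y)"
      by (rule bounded_linear.sums[OF bounded_linear_cinner_right wop(1)[OF assms(2,1,3)]])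
    moreover have "cinner ((of_real (s n) * cinner x (e n)) *\<^sub>C f n) y = cinner x ((of_real (s n) * cinner y (f n)) *\<^sub>C e n)" for n
      using cinner_commute[of "f n" y] by (simp add: cinner_scaleC_left cinner_scaleC_right)
    ultimately show "cinner (blinfun_apply (wop s e f) x) y = cinner x (blinfun_apply (wop s f e) y)"
      using sums_unique2 by simp
  qed
  fix S assume S: "\<forall>x y. cinner (blinfun_apply (wop s e f) x) y = cinner x (blinfun_apply S y)"
  show "S = wop s f e"
  proof (rule blinfun_eqI, rule cinner_eqI_right)
    fix x y show "cinner y (blinfun_apply S x) = cinner y (blinfun_apply (wop s f e) x)" using S 1 by metis
  qed
qed

lemma c0_star_finite_level:
  assumes "s \<longlonglongrightarrow> 0" "(l::real) > 0"
  shows "finite {n. s n = l}"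
proof -
  obtain N where N: "\<And>n. n \<ge> N \<Longrightarrow> norm (s n - 0) < l" using LIMSEQ_D[OF assms] by blast
  have "{n. s n = l} \<subseteq> {..<N}"
  proof
    fix n assume "n \<in> {n. s n = l}"
    then have "\<not> n \<ge> N" using N[of n] assms(2) by auto
    then show "n \<in> {..<N}" by simp
  qed
  then show ?thesis by (rule finite_subset) simp
qed

text \<open>Comparing coefficients, an eigenvector for \<open>l\<^sup>2\<close> has components only
  along those \<open>e n\<close> with \<open>s n = l\<close>. As \<open>l > 0\<close> and
  \<open>s\<close> is null, these are finitely many, so the algebraic span is the whole
  eigenspace.\<close>

lemma eigenspace_wop:
  assumes e: "orthonormal e" and s: "s \<in> c0_star" and l: "l > 0"
  shows "{x. blinfun_apply (wop (\<lambda>n. s n * s n) e e) x = complex_of_real (l\<^sup>2) *\<^sub>C x} = complex_vector.span (e ` {n. s n = l})"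
    (is "?E = _")
proof (rule antisym)
  have bd: "\<bar>s n * s n\<bar> \<le> s 0 * s 0" for n
    unfolding abs_mult by (intro mult_mono c0_starD(4)[OF s]) (use c0_starD(1)[OF s] in auto)
  have fin: "finite {n. s n = l}" by (rule c0_star_finite_level[OF c0_starD(3)[OF s] l])
  have TC: "blinfun_apply (wop (\<lambda>n. s n * s n) e e) (c *\<^sub>C x) = c *\<^sub>C blinfun_apply (wop (\<lambda>n. s n * s n) e e) x" for c x
    using wop(3)[OF e e bd] by (simp add: bounded_ops_def)
  show "complex_vector.span (e ` {n. s n = l}) \<subseteq> ?E"
  proof (rule complex_vector.span_minimal)
    show "e ` {n. s n = l} \<subseteq> ?E" by (auto simp: wop_basis[OF e e bd] power2_eq_square)
    show "complex_vector.subspace ?E"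
      unfolding complex_vector.subspace_def
      by (auto simp: blinfun.zero_right blinfun.add_right scaleC_add_right TC scaleC_scaleC mult.commute)
  qed
  show "?E \<subseteq> complex_vector.span (e ` {n. s n = l})"
  proof
    fix x assume "x \<in> ?E"
    then have x: "blinfun_apply (wop (\<lambda>n. s n * s n) e e) x = complex_of_real (l\<^sup>2) *\<^sub>C x" by simp
    have z: "cinner x (e n) = 0" if "s n \<noteq> l" for n
    proof -
      have "of_real (s n * s n) * cinner x (e n) = of_real (l\<^sup>2) * cinner x (e n)"
        by (rule trans[OF wop(4)[symmetric, OF e e bd]]) (simp only: x cinner_scaleC_left)
      moreover have "s n * s n \<noteq> l\<^sup>2"
        using that c0_starD(1)[OF s, of n] l by (metis power2_eq_iff_nonneg power2_eq_square less_imp_le)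
      ultimately show ?thesis by (metis mult_cancel_right of_real_eq_iff)
    qed
    have "(\<lambda>n. (of_real (s n * s n) * cinner x (e n)) *\<^sub>C e n) sums
        (\<Sum>n | s n = l. (of_real (s n * s n) * cinner x (e n)) *\<^sub>C e n)"
      by (rule sums_finite[OF fin]) (simp add: z)
    then have "complex_of_real (l\<^sup>2) *\<^sub>C x = (\<Sum>n | s n = l. (of_real (s n * s n) * cinner x (e n)) *\<^sub>C e n)"
      using sums_unique2[OF wop(1)[where s="\<lambda>n. s n * s n" and x=x, OF e e bd]] unfolding x by blast
    also have "\<dots> \<in> complex_vector.span (e ` {n. s n = l})"
      by (intro complex_vector.span_sum complex_vector.span_scale complex_vector.span_base) auto
    finally have "complex_of_real (1 / l\<^sup>2) *\<^sub>C complex_of_real (l\<^sup>2) *\<^sub>C x \<in> complex_vector.span (e ` {n. s n = l})"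
      by (rule complex_vector.span_scale)
    moreover have "complex_of_real (1 / l\<^sup>2) * complex_of_real (l\<^sup>2) = 1" using l by (simp add: of_real_mult[symmetric] del: of_real_mult of_real_power of_real_divide)
    ultimately show "x \<in> complex_vector.span (e ` {n. s n = l})"
      by (simp only: scaleC_scaleC scaleC_one)
  qed
qed

lemma dim_span_orthonormal:
  assumes e: "orthonormal e" and A: "finite A"
  shows "complex_vector.dim (complex_vector.span (e ` A)) = card A"
proof -
  have "\<not> complex_vector.dependent (e ` A)"
  proof
    assume "complex_vector.dependent (e ` A)"
    then obtain u where u: "\<exists>v\<in>e ` A. u v \<noteq> 0" "(\<Sum>v\<in>e ` A. u v *\<^sub>C v) = 0"
      using complex_vector.dependent_finite[of "e ` A"] A by auto
    have "cinner (\<Sum>v\<in>e ` A. u v *\<^sub>C v) (e k) = (\<Sum>i\<in>A. if i = k then u (e k) else 0)" for k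
      by (subst sum.reindex) (auto simp: cinner_sum_left cinner_scaleC_left orthonormalD[OF e]
        intro!: sum.cong intro: inj_on_subset[OF orthonormal_inj[OF e]])
    then have "(\<Sum>i\<in>A. if i = k then u (e k) else 0) = 0" for k using u(2) by (metis cinner_zero_left)
    note zero = this
    have "u (e k) = 0" if "k \<in> A" for k using zero[of k] that A by simp
    then show False using u(1) by auto
  qed
  then show ?thesis
    using complex_vector.dim_span_eq_card_independent card_image[OF inj_on_subset[OF orthonormal_inj[OF e] subset_UNIV]] by metis
qed

text \<open>At the first disagreement, with \<open>s n < t n\<close>, monotonicity confines the
  indices where \<open>s\<close> takes the value \<open>t n\<close> to those below \<open>n\<close>,
  where both sequences agree. So \<open>s\<close> misses the occurrence at \<open>n\<close> and
  takes this value less often.\<close>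

lemma antimono_multiplicities_aux:
  fixes s t :: "nat \<Rightarrow> real"
  assumes s: "antimono s" and t: "t \<longlonglongrightarrow> 0" "0 < t n"
    and c: "card {k. s k = t n} = card {k. t k = t n}"
    and eq: "\<And>k. k < n \<Longrightarrow> s k = t k" and less: "s n < t n"
  shows False
proof -
  have fin: "finite {k. t k = t n}" by (rule c0_star_finite_level[OF t])
  have "{k. s k = t n} \<subset> {k. t k = t n}"
  proof
    show "{k. s k = t n} \<subseteq> {k. t k = t n}"
    proof
      fix k assume "k \<in> {k. s k = t n}"
      then have k: "s k = t n" by simp
      then have "\<not> n \<le> k" using antimonoD[OF s, of n k] less by auto
      then show "k \<in> {k. t k = t n}" using eq[of k] k by simp
    qed
    show "{k. s k = t n} \<noteq> {k. t k = t n}"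
    proof -
      have "n \<in> {k. t k = t n}" "n \<notin> {k. s k = t n}" using less by auto
      then show ?thesis by blast
    qed
  qed
  then have "card {k. s k = t n} < card {k. t k = t n}" by (rule psubset_card_mono[OF fin])
  then show False using c by simp
qed

text \<open>Makes the definite description in \<open>s_numbers\<close> unique, which prescribes
  multiplicities of positive values only.\<close>

lemma antimono_multiplicities_unique:
  fixes s t :: "nat \<Rightarrow> real"
  assumes s: "antimono s" "s \<longlonglongrightarrow> 0" and t: "antimono t" "t \<longlonglongrightarrow> 0"
    and c: "\<And>l. l > 0 \<Longrightarrow> card {n. s n = l} = card {n. t n = l}"
  shows "s = t"
proof
  have s0: "0 \<le> s n" for n using s by (intro decseq_ge) (simp_all add: decseq_def antimono_def)
  have t0: "0 \<le> t n" for n using t by (intro decseq_ge) (simp_all add: decseq_def antimono_def)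
  fix n show "s n = t n"
  proof (induction n rule: less_induct)
    case (less n)
    note IH = less.IH
    show ?case
    proof (cases "s n" "t n" rule: linorder_cases)
      case less
      then have "0 < t n" using s0[of n] by linarith
      then show ?thesis using antimono_multiplicities_aux[OF s(1) t(2) _ c IH less] by blast
    next
      case greater
      then have "0 < s n" using t0[of n] by linarith
      then show ?thesis
        using antimono_multiplicities_aux[OF t(1) s(2) _ c[symmetric] IH[symmetric] greater] by blast
    qed
  qed
qed

lemma s_numbers_wop:
  assumes s: "s \<in> c0_star" and e: "orthonormal e" and f: "orthonormal f"
  shows "s_numbers (wop s e f) = s"
  unfolding s_numbers_def
proof (rule the_equality)
  note bd = c0_starD(4)[OF s]
  have comp: "hadjoint (wop s e f) o\<^sub>L wop s e f = wop (\<lambda>n. s n * s n) e e"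
    unfolding hadjoint_wop[OF e f bd] by (rule wop_compose[OF e f e bd bd])
  have mult: "card {n. s n = l} = complex_vector.dim {x. blinfun_apply (hadjoint (wop s e f) o\<^sub>L wop s e f) x = complex_of_real (l\<^sup>2) *\<^sub>C x}"
    if "l > 0" for l
    unfolding comp eigenspace_wop[OF e s that]
    using dim_span_orthonormal[OF e c0_star_finite_level[OF c0_starD(3)[OF s] that]] by simp
  show "antimono s \<and> s \<longlonglongrightarrow> 0 \<and> (\<forall>l>0. card {n. s n = l} =
     complex_vector.dim {x. blinfun_apply (hadjoint (wop s e f) o\<^sub>L wop s e f) x = complex_of_real (l\<^sup>2) *\<^sub>C x})"
    using s mult by (simp add: c0_star_def)
  fix t assume t: "antimono t \<and> t \<longlonglongrightarrow> 0 \<and> (\<forall>l>0. card {n. t n = l} =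
     complex_vector.dim {x. blinfun_apply (hadjoint (wop s e f) o\<^sub>L wop s e f) x = complex_of_real (l\<^sup>2) *\<^sub>C x})"
  show "t = s"
    by (rule antimono_multiplicities_unique) (use t s mult in \<open>auto simp: c0_star_def\<close>)
qed

lemma svd_s_numbers:
  assumes "svd X s e f" shows "s_numbers X = s"
  using assms s_numbers_wop by (auto simp: svd_def)

lemma svd_s_numbers_exists:
  assumes "infinite_dim TYPE('h::chilbert_space)" "(X::'h \<Rightarrow>\<^sub>L 'h) \<in> compact_ops"
  obtains e f where "svd X (s_numbers X) e f"
  using svd_exists[OF assms] svd_s_numbers by metis

lemma s_numbers_c0_star:
  assumes "infinite_dim TYPE('h::chilbert_space)" "(X::'h \<Rightarrow>\<^sub>L 'h) \<in> compact_ops"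
  shows "s_numbers X \<in> c0_star"
  using svd_s_numbers_exists[OF assms] unfolding svd_def by metis

subsection \<open>Singular numbers by approximation\<close>

text \<open>Stands in for a dimension count; the induction on the number of equations eliminates an
  unknown \<open>p\<close> with nonzero pivot in the last equation.\<close>

lemma underdetermined_system:
  fixes A :: "nat \<Rightarrow> nat \<Rightarrow> complex"
  assumes "finite J" "n < card J"
  shows "\<exists>x. (\<exists>j\<in>J. x j \<noteq> 0) \<and> (\<forall>i<n. (\<Sum>j\<in>J. A i j * x j) = 0)"
  using assms
proof (induction n arbitrary: A J)
  case 0
  then have "J \<noteq> {}" by auto
  then show ?case by (intro exI[of _ "\<lambda>_. 1"]) auto
next
  case (Suc n)
  show ?case
  proof (cases "\<forall>j\<in>J. A n j = 0")
    case True
    obtain x where x: "\<exists>j\<in>J. x j \<noteq> 0" "\<forall>i<n. (\<Sum>j\<in>J. A i j * x j) = 0"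
      using Suc.IH[of J A] Suc.prems by auto
    then show ?thesis using True by (auto simp: less_Suc_eq)
  next
    case False
    then obtain p where p: "p \<in> J" "A n p \<noteq> 0" by blast
    define K where "K = J - {p}"
    define B where "B = (\<lambda>i j. A i j - A i p * A n j / A n p)"
    have K: "finite K" "n < card K" "J = insert p K" "p \<notin> K" using Suc.prems p by (auto simp: K_def card_Diff_singleton)
    obtain x where x: "\<exists>j\<in>K. x j \<noteq> 0" "\<forall>i<n. (\<Sum>j\<in>K. B i j * x j) = 0"
      using Suc.IH[OF K(1,2), of B] by auto
    define y where "y = x(p := - (\<Sum>j\<in>K. A n j * x j) / A n p)"
    have sy: "(\<Sum>j\<in>J. A i j * y j) = (\<Sum>j\<in>K. A i j * x j) - A i p * (\<Sum>j\<in>K. A n j * x j) / A n p" for i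
    proof -
      have "(\<Sum>j\<in>K. A i j * y j) = (\<Sum>j\<in>K. A i j * x j)"
        by (rule sum.cong) (use K(4) in \<open>auto simp: y_def\<close>)
      then show ?thesis using K(1,4) by (simp add: K(3)) (simp add: y_def)
    qed
    have "(\<Sum>j\<in>J. A i j * y j) = 0" if "i < Suc n" for i
    proof (cases "i = n")
      case True
      then show ?thesis using p(2) by (simp add: sy)
    next
      case False
      then have "(\<Sum>j\<in>K. B i j * x j) = 0" using x(2) that by simp
      moreover have "(\<Sum>j\<in>K. B i j * x j) = (\<Sum>j\<in>K. A i j * x j) - A i p * (\<Sum>j\<in>K. A n j * x j) / A n p"
        by (simp add: B_def left_diff_distrib sum_subtractf sum_distrib_left sum_divide_distrib mult.assoc)
      ultimately show ?thesis by (simp add: sy)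
    qed
    moreover have "\<exists>j\<in>J. y j \<noteq> 0"
    proof -
      obtain j where "j \<in> K" "x j \<noteq> 0" using x(1) by blast
      then show ?thesis using K by (intro bexI[of _ j]) (auto simp: y_def)
    qed
    ultimately show ?thesis by blast
  qed
qed

lemma svd_norm_le:
  assumes X: "svd X s e f" and x: "\<And>i. i < n \<Longrightarrow> cinner x (e i) = 0"
  shows "norm (blinfun_apply X x) \<le> s n * norm x"
proof -
  have s: "s \<in> c0_star" and e: "orthonormal e" and f: "orthonormal f" and Xw: "X = wop s e f"
    using X by (auto simp: svd_def)
  define r where "r = (\<lambda>i. if i < n then 0 else s i)"
  have r: "\<bar>r i\<bar> \<le> s n" for i using c0_starD(1,2)[OF s] by (simp add: r_def)
  have "(\<lambda>i. (of_real (s i) * cinner x (e i)) *\<^sub>C f i) = (\<lambda>i. (of_real (r i) * cinner x (e i)) *\<^sub>C f i)"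
    using x by (auto simp: r_def)
  then have "(\<lambda>i. (of_real (r i) * cinner x (e i)) *\<^sub>C f i) sums blinfun_apply X x"
    using wop(1)[where s=s and x=x, OF e f c0_starD(4)[OF s]] Xw by simp
  then have "blinfun_apply X x = blinfun_apply (wop r e f) x"
    by (rule sums_unique2[OF _ wop(1)[OF e f r]])
  then show ?thesis using wop(2)[OF e f r, where x=x] by simp
qed

text \<open>Half of the minimax principle. The \<open>n\<close> functionals have a nonzero common
  zero in the span of the first \<open>n + 1\<close> right singular vectors, where \<open>X\<close>
  stretches by at least \<open>s n\<close>. Together with \<open>svd_norm_le\<close>, bounds for
  sums and products follow by listing suitable functionals.\<close>

lemma svd_le:
  fixes \<phi> :: "nat \<Rightarrow> 'h::chilbert_space \<Rightarrow> complex"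
  assumes X: "svd X s e f"
    and add: "\<And>i x y. \<phi> i (x + y) = \<phi> i x + \<phi> i y" and scale: "\<And>i c x. \<phi> i (c *\<^sub>C x) = c * \<phi> i x"
    and le: "\<And>x. (\<And>i. i < n \<Longrightarrow> \<phi> i x = 0) \<Longrightarrow> norm (blinfun_apply X x) \<le> c * norm x"
  shows "s n \<le> c"
proof -
  have s: "s \<in> c0_star" and e: "orthonormal e" and f: "orthonormal f" and Xw: "X = wop s e f"
    using X by (auto simp: svd_def)
  note bd = c0_starD(4)[OF s]
  obtain a where a: "\<exists>j\<in>{..n}. a j \<noteq> 0" "\<forall>i<n. (\<Sum>j\<in>{..n}. \<phi> i (e j) * a j) = 0"
    using underdetermined_system[of "{..n}" n "\<lambda>i j. \<phi> i (e j)"] by auto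
  define x where "x = (\<Sum>j\<le>n. a j *\<^sub>C e j)"
  have \<phi>0: "\<phi> i 0 = 0" for i using scale[of i 0 0] by simp
  have \<phi>sum: "\<phi> i (sum g A) = (\<Sum>j\<in>A. \<phi> i (g j))" for i A and g :: "nat \<Rightarrow> 'h"
    by (induction A rule: infinite_finite_induct) (simp_all add: \<phi>0 add)
  have "\<phi> i x = 0" if "i < n" for i
    using a(2) that by (simp add: x_def \<phi>sum scale mult.commute)
  then have 1: "norm (blinfun_apply X x) \<le> c * norm x" by (rule le)
  have Xx: "blinfun_apply X x = (\<Sum>j\<le>n. (of_real (s j) * a j) *\<^sub>C f j)"
    using wop(3)[OF e f bd] unfolding Xw x_def blinfun.sum_right
    by (simp add: bounded_ops_def wop_basis[OF e f bd] scaleC_scaleC mult.commute)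
  have nx: "(norm x)\<^sup>2 = (\<Sum>j\<le>n. (norm (a j))\<^sup>2)" unfolding x_def by (rule norm_sum_orthonormal[OF e]) simp
  obtain j where j: "j \<le> n" "a j \<noteq> 0" using a(1) by auto
  have "(\<Sum>j\<le>n. (norm (a j))\<^sup>2) > 0" by (rule sum_pos2[of _ j]) (use j in auto)
  then have xpos: "norm x > 0" using nx by auto
  have "(s n * norm x)\<^sup>2 = (\<Sum>j\<le>n. (s n)\<^sup>2 * (norm (a j))\<^sup>2)"
    by (simp add: power_mult_distrib nx sum_distrib_left)
  also have "\<dots> \<le> (\<Sum>j\<le>n. (s j)\<^sup>2 * (norm (a j))\<^sup>2)"
    by (intro sum_mono mult_right_mono power_mono) (use c0_starD(1,2)[OF s] in auto)
  also have "\<dots> = (\<Sum>j\<le>n. (norm (of_real (s j) * a j))\<^sup>2)"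
    by (simp add: norm_mult power_mult_distrib)
  also have "\<dots> = (norm (blinfun_apply X x))\<^sup>2"
    unfolding Xx by (rule norm_sum_orthonormal[OF f, symmetric]) simp
  finally have "s n * norm x \<le> norm (blinfun_apply X x)" by (rule power2_le_imp_le) simp
  then have "s n * norm x \<le> c * norm x" using 1 by linarith
  then show ?thesis using xpos by simp
qed

subsection \<open>Compactness\<close>

lemma compact_opsI:
  assumes "T \<in> bounded_ops" "compact K" "blinfun_apply T ` cball 0 1 \<subseteq> K"
  shows "T \<in> compact_ops"
proof -
  have "closure (blinfun_apply T ` cball 0 1) \<subseteq> K"
    by (rule closure_minimal[OF assms(3) compact_imp_closed[OF assms(2)]])
  then have "closure (blinfun_apply T ` cball 0 1) = K \<inter> closure (blinfun_apply T ` cball 0 1)" by blast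
  moreover have "compact (K \<inter> closure (blinfun_apply T ` cball 0 1))"
    by (rule compact_Int_closed[OF assms(2) closed_closure])
  ultimately show ?thesis using assms(1) by (simp add: compact_ops_def)
qed

lemma compact_opsD:
  assumes "T \<in> compact_ops"
  shows "T \<in> bounded_ops" "compact (closure (blinfun_apply T ` cball 0 1))"
    "norm x \<le> 1 \<Longrightarrow> blinfun_apply T x \<in> closure (blinfun_apply T ` cball 0 1)"
  using assms closure_subset[of "blinfun_apply T ` cball 0 1"] by (auto simp: compact_ops_def)

lemma compact_ops_add:
  assumes X: "X \<in> compact_ops" and Y: "Y \<in> compact_ops"
  shows "X + Y \<in> compact_ops"
proof (rule compact_opsI[OF bounded_ops_add[OF compact_opsD(1)[OF X] compact_opsD(1)[OF Y]]])
  show "compact {x + y | x y. x \<in> closure (blinfun_apply X ` cball 0 1) \<and> y \<in> closure (blinfun_apply Y ` cball 0 1)}"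
    by (rule compact_sums[OF compact_opsD(2)[OF X] compact_opsD(2)[OF Y]])
  show "blinfun_apply (X + Y) ` cball 0 1 \<subseteq> {x + y | x y. x \<in> closure (blinfun_apply X ` cball 0 1) \<and> y \<in> closure (blinfun_apply Y ` cball 0 1)}"
  proof (rule image_subsetI)
    fix x :: 'a assume "x \<in> cball 0 1"
    then have "norm x \<le> 1" by simp
    then show "blinfun_apply (X + Y) x \<in> {x + y | x y. x \<in> closure (blinfun_apply X ` cball 0 1) \<and> y \<in> closure (blinfun_apply Y ` cball 0 1)}"
      using compact_opsD(3)[OF X] compact_opsD(3)[OF Y] by (auto simp: blinfun.add_left)
  qed
qed

lemma compact_ops_compose_left:
  assumes A: "A \<in> bounded_ops" and X: "X \<in> compact_ops"
  shows "A o\<^sub>L X \<in> compact_ops"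
proof (rule compact_opsI[OF bounded_ops_compose[OF A compact_opsD(1)[OF X]]])
  show "compact (blinfun_apply A ` closure (blinfun_apply X ` cball 0 1))"
    by (intro compact_continuous_image compact_opsD(2)[OF X] linear_continuous_on blinfun.bounded_linear_right)
  show "blinfun_apply (A o\<^sub>L X) ` cball 0 1 \<subseteq> blinfun_apply A ` closure (blinfun_apply X ` cball 0 1)"
    using compact_opsD(3)[OF X] by auto
qed

lemma compact_ops_compose_right:
  assumes A: "A \<in> bounded_ops" and X: "X \<in> compact_ops"
  shows "X o\<^sub>L A \<in> compact_ops"
proof (rule compact_opsI[OF bounded_ops_compose[OF compact_opsD(1)[OF X] A]])
  define M where "M = norm A + 1"
  have M: "M > 0" by (simp add: M_def add_nonneg_pos)
  show "compact ((\<lambda>x. M *\<^sub>R x) ` closure (blinfun_apply X ` cball 0 1))"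
    by (rule compact_scaling[OF compact_opsD(2)[OF X]])
  show "blinfun_apply (X o\<^sub>L A) ` cball 0 1 \<subseteq> (\<lambda>x. M *\<^sub>R x) ` closure (blinfun_apply X ` cball 0 1)"
  proof (rule image_subsetI)
    fix x :: 'a assume "x \<in> cball 0 1"
    then have nx: "norm x \<le> 1" by simp
    have "norm (blinfun_apply A x) \<le> norm A * norm x" by (rule norm_blinfun)
    also have "\<dots> \<le> norm A * 1" by (rule mult_left_mono[OF nx]) simp
    finally have "norm ((1 / M) *\<^sub>R blinfun_apply A x) \<le> 1" using M by (simp add: M_def field_simps)
    then have "blinfun_apply X ((1 / M) *\<^sub>R blinfun_apply A x) \<in> closure (blinfun_apply X ` cball 0 1)"
      by (rule compact_opsD(3)[OF X])
    moreover have "blinfun_apply (X o\<^sub>L A) x = M *\<^sub>R blinfun_apply X ((1 / M) *\<^sub>R blinfun_apply A x)"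
      using M by (simp add: blinfun.scaleR_right)
    ultimately show "blinfun_apply (X o\<^sub>L A) x \<in> (\<lambda>x. M *\<^sub>R x) ` closure (blinfun_apply X ` cball 0 1)" by blast
  qed
qed

lemma compact_ops_zero: "0 \<in> compact_ops"
proof (rule compact_opsI[of _ "{0}"])
  show "0 \<in> bounded_ops" by (simp add: bounded_ops_def)
qed auto

lemma compact_ops_limit:
  fixes T :: "'h::chilbert_space \<Rightarrow>\<^sub>L 'h"
  assumes T: "T \<in> bounded_ops"
    and lim: "\<And>\<epsilon>. \<epsilon> > 0 \<Longrightarrow> \<exists>F\<in>compact_ops. \<forall>x. norm (blinfun_apply T x - blinfun_apply F x) \<le> \<epsilon> * norm x"
  shows "T \<in> compact_ops"
proof -
  let ?K = "closure (blinfun_apply T ` cball 0 1)"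
  have "\<exists>k. finite k \<and> ?K \<subseteq> (\<Union>x\<in>k. ball x \<epsilon>)" if \<epsilon>: "\<epsilon> > 0" for \<epsilon>
  proof -
    \<comment> \<open>A finite net of radius \<epsilon>/4 for the image under the approximant
      becomes a net of closed balls of radius \<epsilon>/2 for \<open>T\<close>; closed balls
      survive the closure and lie in open balls of radius \<epsilon>.\<close>
    have "\<epsilon> / 4 > 0" using \<epsilon> by simp
    then obtain F where F: "F \<in> compact_ops" "\<And>x. norm (blinfun_apply T x - blinfun_apply F x) \<le> \<epsilon> / 4 * norm x"
      using lim by blast
    obtain k where k: "finite k" "closure (blinfun_apply F ` cball 0 1) \<subseteq> (\<Union>x\<in>k. ball x (\<epsilon> / 4))"
      using compact_opsD(2)[OF F(1)] \<open>\<epsilon> / 4 > 0\<close> unfolding compact_eq_totally_bounded by blast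
    have "blinfun_apply T ` cball 0 1 \<subseteq> (\<Union>x\<in>k. cball x (\<epsilon> / 2))"
    proof (rule image_subsetI)
      fix x :: 'h assume "x \<in> cball 0 1"
      then have nx: "norm x \<le> 1" by simp
      then obtain y where y: "y \<in> k" "dist y (blinfun_apply F x) < \<epsilon> / 4"
        using compact_opsD(3)[OF F(1) nx] k(2) by auto
      have "norm (blinfun_apply T x - blinfun_apply F x) \<le> \<epsilon> / 4 * 1"
        using F(2)[of x] mult_left_mono[OF nx, of "\<epsilon> / 4"] \<epsilon> by linarith
      then have "dist (blinfun_apply F x) (blinfun_apply T x) \<le> \<epsilon> / 4" by (simp add: dist_norm norm_minus_commute)
      then have "dist y (blinfun_apply T x) \<le> \<epsilon> / 2"
        using y(2) dist_triangle[of y "blinfun_apply T x" "blinfun_apply F x"] by linarith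
      then show "blinfun_apply T x \<in> (\<Union>x\<in>k. cball x (\<epsilon> / 2))" using y(1) by auto
    qed
    then have "?K \<subseteq> (\<Union>x\<in>k. cball x (\<epsilon> / 2))"
      by (rule closure_minimal) (use k(1) in auto)
    also have "\<dots> \<subseteq> (\<Union>x\<in>k. ball x \<epsilon>)" using \<epsilon> by fastforce
    finally show ?thesis using k(1) by blast
  qed
  moreover have "complete ?K" by (simp add: complete_eq_closed)
  ultimately show ?thesis using T by (simp add: compact_ops_def compact_eq_totally_bounded)
qed

lemma compact_ops_rank_one:
  assumes "T \<in> bounded_ops" "\<And>x. blinfun_apply T x = (c * cinner x a) *\<^sub>C b"
  shows "T \<in> compact_ops"
proof (rule compact_opsI[OF assms(1)])
  have "bounded_linear (\<lambda>z::complex. z *\<^sub>C b)"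
    by (rule bounded_linear_intro[where K="norm b"]) (simp_all add: scaleC_add_left scaleR_scaleC scaleC_scaleC scaleR_conv_of_real)
  then show "compact ((\<lambda>z. z *\<^sub>C b) ` cball 0 (norm c * norm a))"
    by (intro compact_continuous_image linear_continuous_on compact_cball)
  show "blinfun_apply T ` cball 0 1 \<subseteq> (\<lambda>z. z *\<^sub>C b) ` cball 0 (norm c * norm a)"
  proof (rule image_subsetI)
    fix x :: 'a assume "x \<in> cball 0 1"
    then have nx: "norm x \<le> 1" by simp
    have "norm (cinner x a) \<le> norm x * norm a" by (rule norm_cinner_le)
    also have "\<dots> \<le> 1 * norm a" by (rule mult_right_mono[OF nx]) simp
    finally have "norm (c * cinner x a) \<le> norm c * norm a" by (simp add: norm_mult mult_left_mono)
    then show "blinfun_apply T x \<in> (\<lambda>z. z *\<^sub>C b) ` cball 0 (norm c * norm a)"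
      unfolding assms(2) by (intro imageI) simp
  qed
qed

lemma wop_finite_support_compact:
  assumes e: "orthonormal e" and f: "orthonormal f"
  shows "wop (\<lambda>i. if i < n then s i else 0) e f \<in> compact_ops"
proof (induction n)
  case 0
  have "wop (\<lambda>i. 0) e f = 0"
    by (rule wop_eqI[OF e f, where C=0, symmetric]) simp_all
  then show ?case using compact_ops_zero by simp
next
  case (Suc n)
  have b1: "\<bar>if i < n then s i else 0\<bar> \<le> (\<Sum>j\<le>n. \<bar>s j\<bar>)" for i
    by (cases "i < n") (auto intro!: sum_nonneg member_le_sum[of i "{..n}" "\<lambda>j. \<bar>s j\<bar>"])
  have b2: "\<bar>if i = n then s n else 0\<bar> \<le> \<bar>s n\<bar>" for i by simp
  have "wop (\<lambda>i. if i < n then s i else 0) e f + wop (\<lambda>i. if i = n then s n else 0) e f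
      = wop (\<lambda>i. (if i < n then s i else 0) + (if i = n then s n else 0)) e f"
    by (rule wop_add[OF e f b1 b2])
  also have "(\<lambda>i. (if i < n then s i else 0) + (if i = n then s n else 0)) = (\<lambda>i. if i < Suc n then s i else 0)"
    by auto
  finally have eq: "wop (\<lambda>i. if i < Suc n then s i else 0) e f =
      wop (\<lambda>i. if i < n then s i else 0) e f + wop (\<lambda>i. if i = n then s n else 0) e f" by simp
  have "wop (\<lambda>i. if i = n then s n else 0) e f \<in> compact_ops"
  proof (rule compact_ops_rank_one[OF wop(3)[OF e f b2]])
    fix x
    have "(\<lambda>i. (of_real (if i = n then s n else 0) * cinner x (e i)) *\<^sub>C f i) =
        (\<lambda>i. if i = n then (of_real (s n) * cinner x (e n)) *\<^sub>C f n else 0)" by auto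
    then show "blinfun_apply (wop (\<lambda>i. if i = n then s n else 0) e f) x = (of_real (s n) * cinner x (e n)) *\<^sub>C f n"
      using sums_unique2[OF wop(1)[OF e f b2, where x=x] ] sums_single[of n "\<lambda>_. (of_real (s n) * cinner x (e n)) *\<^sub>C f n"] by simp
  qed
  then show ?case unfolding eq by (rule compact_ops_add[OF Suc.IH])
qed

lemma wop_compact:
  assumes s: "s \<in> c0_star" and e: "orthonormal e" and f: "orthonormal f"
  shows "wop s e f \<in> compact_ops"
proof (rule compact_ops_limit[OF wop(3)[OF e f c0_starD(4)[OF s]]])
  fix \<epsilon> :: real assume "\<epsilon> > 0"
  then obtain N where N: "\<And>n. n \<ge> N \<Longrightarrow> norm (s n - 0) < \<epsilon>" using LIMSEQ_D[OF c0_starD(3)[OF s]] by blast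
  define r where "r = (\<lambda>i. if i < N then 0 else s i)"
  define t where "t = (\<lambda>i. if i < N then s i else 0)"
  have r: "\<bar>r i\<bar> \<le> \<epsilon>" for i using N[of i] \<open>\<epsilon> > 0\<close> by (auto simp: r_def)
  have t: "\<bar>t i\<bar> \<le> s 0" for i using c0_starD(4)[OF s, of i] c0_starD(1)[OF s, of 0] by (auto simp: t_def)
  have "wop r e f + wop t e f = wop (\<lambda>i. r i + t i) e f" by (rule wop_add[OF e f r t])
  moreover have "(\<lambda>i. r i + t i) = s" by (auto simp: r_def t_def)
  ultimately have eq: "wop s e f = wop r e f + wop t e f" by simp
  show "\<exists>F\<in>compact_ops. \<forall>x. norm (blinfun_apply (wop s e f) x - blinfun_apply F x) \<le> \<epsilon> * norm x"
  proof (intro bexI allI)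
    show "wop t e f \<in> compact_ops" unfolding t_def by (rule wop_finite_support_compact[OF e f])
    fix x show "norm (blinfun_apply (wop s e f) x - blinfun_apply (wop t e f) x) \<le> \<epsilon> * norm x"
      using wop(2)[OF e f r, where x=x] by (simp add: eq blinfun.add_left)
  qed
qed

section \<open>The Calkin correspondence\<close>

text \<open>Indices start at \<open>0\<close>, so the ampliation \<open>D\<^sub>m \<xi>\<close> is \<open>\<lambda>n. \<xi> (n div m)\<close>.\<close>

definition dominated :: "(nat \<Rightarrow> real) \<Rightarrow> (nat \<Rightarrow> real) \<Rightarrow> bool" where
  "dominated \<eta> \<xi> \<longleftrightarrow> (\<exists>m>0. \<exists>M. \<forall>n. \<eta> n \<le> M * \<xi> (n div m))"

text \<open>The hereditary cones invariant under ampliations: closure under \<open>dominated\<close>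
  packs solidity, multiples and ampliations into one condition.\<close>

definition char_set :: "(nat \<Rightarrow> real) set \<Rightarrow> bool" where
  "char_set S \<longleftrightarrow> S \<subseteq> c0_star \<and> (\<lambda>_. 0) \<in> S \<and> (\<forall>\<xi>\<in>S. \<forall>\<eta>\<in>S. (\<lambda>n. \<xi> n + \<eta> n) \<in> S)
     \<and> (\<forall>\<xi>\<in>S. \<forall>\<eta>\<in>c0_star. dominated \<eta> \<xi> \<longrightarrow> \<eta> \<in> S)"

lemma char_setD:
  assumes "char_set S"
  shows "\<xi> \<in> S \<Longrightarrow> \<xi> \<in> c0_star" "(\<lambda>_. 0) \<in> S" "\<xi> \<in> S \<Longrightarrow> \<eta> \<in> S \<Longrightarrow> (\<lambda>n. \<xi> n + \<eta> n) \<in> S"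
    "\<xi> \<in> S \<Longrightarrow> \<eta> \<in> c0_star \<Longrightarrow> dominated \<eta> \<xi> \<Longrightarrow> \<eta> \<in> S"
  using assms by (auto simp: char_set_def)

lemma dominatedI: "m > 0 \<Longrightarrow> (\<And>n. \<eta> n \<le> M * \<xi> (n div m)) \<Longrightarrow> dominated \<eta> \<xi>"
  by (auto simp: dominated_def)

lemma c0_starI:
  assumes "\<And>n. 0 \<le> s n" "\<And>m n. m \<le> n \<Longrightarrow> s n \<le> s m" "s \<longlonglongrightarrow> 0"
  shows "s \<in> c0_star"
  using assms by (auto simp: c0_star_def antimono_def)

lemma c0_star_zero: "(\<lambda>_. 0) \<in> c0_star"
  by (rule c0_starI) auto

lemma c0_star_add:
  assumes "\<xi> \<in> c0_star" "\<eta> \<in> c0_star"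
  shows "(\<lambda>n. \<xi> n + \<eta> n) \<in> c0_star"
proof (rule c0_starI)
  show "(\<lambda>n. \<xi> n + \<eta> n) \<longlonglongrightarrow> 0"
    using tendsto_add[OF c0_starD(3)[OF assms(1)] c0_starD(3)[OF assms(2)]] by simp
qed (use c0_starD(1,2)[OF assms(1)] c0_starD(1,2)[OF assms(2)] in \<open>auto intro: add_nonneg_nonneg add_mono\<close>)

lemma filterlim_nat_div:
  assumes m: "(m::nat) > 0" shows "filterlim (\<lambda>n. n div m) sequentially sequentially"
  unfolding filterlim_at_top
proof
  fix Z
  have "Z \<le> n div m" if "n \<ge> Z * m" for n
    using div_le_mono[OF that, of m] m by simp
  then show "\<forall>\<^sub>F n in sequentially. Z \<le> n div m" using eventually_sequentially by blast
qed

lemma c0_star_ampliation: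
  assumes s: "s \<in> c0_star" and m: "m > 0"
  shows "(\<lambda>n. s (n div m)) \<in> c0_star"
proof (rule c0_starI)
  show "(\<lambda>n. s (n div m)) \<longlonglongrightarrow> 0" by (rule filterlim_compose[OF c0_starD(3)[OF s] filterlim_nat_div[OF m]])
qed (use c0_starD(1,2)[OF s] div_le_mono in auto)

section \<open>Operator ideals and their characteristic sets\<close>

locale infinite_dimensional_hilbert =
  fixes hilbert_type :: "'h::chilbert_space itself"
  assumes inf: "infinite_dim TYPE('h)"
begin

lemma orthonormal_exists: "\<exists>e :: nat \<Rightarrow> 'h. orthonormal e"
proof -
  obtain e :: "nat \<Rightarrow> 'h" where "orthonormal e"
    by (rule orthonormal_wf_choice[where Q="\<lambda>_ _ _. True"]) (use orthogonal_vector_exists[OF inf] in auto)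
  then show ?thesis by blast
qed

lemma idealD:
  assumes "is_ideal (I :: ('h \<Rightarrow>\<^sub>L 'h) set)"
  shows "X \<in> I \<Longrightarrow> X \<in> compact_ops" "0 \<in> I" "X \<in> I \<Longrightarrow> Y \<in> I \<Longrightarrow> X + Y \<in> I"
    "X \<in> I \<Longrightarrow> A \<in> bounded_ops \<Longrightarrow> A o\<^sub>L X \<in> I" "X \<in> I \<Longrightarrow> A \<in> bounded_ops \<Longrightarrow> X o\<^sub>L A \<in> I"
  using assms by (auto simp: is_ideal_def)

text \<open>\<open>Y\<close> factors through \<open>X\<close>: a partial isometry carries the right
  singular system of \<open>Y\<close> to that of \<open>X\<close>, and a bounded diagonal operator,
  with the quotients of the s-numbers as weights, carries the left system of \<open>X\<close> to
  that of \<open>Y\<close>.\<close>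

lemma ideal_mem_le:
  fixes I :: "('h \<Rightarrow>\<^sub>L 'h) set"
  assumes I: "is_ideal I" and X: "X \<in> I" and Y: "Y \<in> compact_ops"
    and le: "\<And>n. s_numbers Y n \<le> M * s_numbers X n"
  shows "Y \<in> I"
proof -
  define s where "s = s_numbers X"
  define t where "t = s_numbers Y"
  obtain e f where X': "svd X s e f" using svd_s_numbers_exists[OF inf idealD(1)[OF I X]] s_def by metis
  obtain e' f' where Y': "svd Y t e' f'" using svd_s_numbers_exists[OF inf Y] t_def by metis
  have s: "s \<in> c0_star" and e: "orthonormal e" and f: "orthonormal f" and Xw: "X = wop s e f"
    using X' by (auto simp: svd_def)
  have t: "t \<in> c0_star" and e': "orthonormal e'" and f': "orthonormal f'" and Yw: "Y = wop t e' f'"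
    using Y' by (auto simp: svd_def)
  \<comment> \<open>Where \<open>s n\<close> vanishes the hypothesis forces \<open>t n = 0\<close>,
    so the default \<open>0\<close> preserves \<open>r n * s n = t n\<close>.\<close>
  define r where "r = (\<lambda>n. if s n = 0 then 0 else t n / s n)"
  have r: "\<bar>r n\<bar> \<le> \<bar>M\<bar>" for n
  proof (cases "s n = 0")
    case False
    then have "s n > 0" using c0_starD(1)[OF s, of n] by simp
    then have "t n / s n \<le> M" using le[of n] by (simp add: s_def t_def divide_le_eq)
    moreover have "0 \<le> t n / s n" using c0_starD(1)[OF t] c0_starD(1)[OF s] by simp
    ultimately show ?thesis using False by (simp add: r_def)
  qed (simp add: r_def)
  have rs: "r n * s n = t n" for n
    using le[of n] c0_starD(1)[OF t, of n] by (auto simp: r_def s_def[symmetric] t_def[symmetric])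
  have one: "\<bar>1::real\<bar> \<le> 1" for n :: nat by simp
  have s': "\<bar>s n * 1\<bar> \<le> s 0" for n using c0_starD(4)[OF s, of n] by simp
  have "wop r f f' o\<^sub>L (X o\<^sub>L wop (\<lambda>_. 1) e' e) = wop r f f' o\<^sub>L wop (\<lambda>n. s n * 1) e' f"
    unfolding Xw by (subst wop_compose[OF e' e f one c0_starD(4)[OF s]]) (rule refl)
  also have "\<dots> = wop (\<lambda>n. r n * (s n * 1)) e' f'"
    by (rule wop_compose[OF e' f f' s' r])
  finally have "wop r f f' o\<^sub>L (X o\<^sub>L wop (\<lambda>_. 1) e' e) = Y" by (simp add: rs Yw)
  moreover have "wop r f f' o\<^sub>L (X o\<^sub>L wop (\<lambda>_. 1) e' e) \<in> I"
    by (intro idealD(4,5)[OF I] X wop(3)[OF f f' r] wop(3)[OF e' e one])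
  ultimately show ?thesis by simp
qed

lemma ideal_mem_iff:
  fixes I :: "('h \<Rightarrow>\<^sub>L 'h) set"
  assumes I: "is_ideal I"
  shows "X \<in> I \<longleftrightarrow> X \<in> compact_ops \<and> s_numbers X \<in> Sig I"
proof
  assume "X \<in> compact_ops \<and> s_numbers X \<in> Sig I"
  then obtain Y where "Y \<in> I" "s_numbers X = s_numbers Y" "X \<in> compact_ops" by (auto simp: Sig_def)
  then show "X \<in> I" using ideal_mem_le[OF I, of Y X 1] by simp
qed (use idealD(1)[OF I] in \<open>auto simp: Sig_def\<close>)

lemma ideal_wop_iff:
  fixes I :: "('h \<Rightarrow>\<^sub>L 'h) set"
  assumes I: "is_ideal I" and s: "s \<in> c0_star" and e: "orthonormal e" and f: "orthonormal f"
  shows "wop s e f \<in> I \<longleftrightarrow> s \<in> Sig I"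
  using ideal_mem_iff[OF I, of "wop s e f"] wop_compact[OF s e f] s_numbers_wop[OF s e f] by simp

lemma ideal_sum: "is_ideal (I :: ('h \<Rightarrow>\<^sub>L 'h) set) \<Longrightarrow> (\<And>i. i \<in> A \<Longrightarrow> g i \<in> I) \<Longrightarrow> sum g A \<in> I"
  by (induction A rule: infinite_finite_induct) (auto simp: idealD)

text \<open>Sorting the indices by their residue modulo \<open>m\<close> exhibits the ampliated
  operator as a sum of \<open>m\<close> operators with the original weights. This is why ideals are
  invariant under ampliation.\<close>

lemma wop_ampliation:
  fixes e f :: "nat \<Rightarrow> 'h"
  assumes s: "s \<in> c0_star" and m: "m > 0" and e: "orthonormal e" and f: "orthonormal f"
  shows "wop (\<lambda>n. s (n div m)) e f = (\<Sum>r<m. wop s (\<lambda>q. e (q * m + r)) (\<lambda>q. f (q * m + r)))"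
proof (rule blinfun_eqI)
  fix x
  define a where "a = (\<lambda>n. (of_real (s (n div m)) * cinner x (e n)) *\<^sub>C f n)"
  have inj: "inj (\<lambda>q. q * m + r)" for r using m by (auto intro!: injI)
  have "a sums blinfun_apply (wop (\<lambda>n. s (n div m)) e f) x"
    unfolding a_def by (rule wop(1)[OF e f c0_starD(4)[OF c0_star_ampliation[OF s m]]])
  then have 1: "(\<lambda>q. sum a {q * m..<q * m + m}) sums blinfun_apply (wop (\<lambda>n. s (n div m)) e f) x"
    by (rule sums_group[OF _ m])
  have "(\<lambda>q. a (q * m + r)) sums blinfun_apply (wop s (\<lambda>q. e (q * m + r)) (\<lambda>q. f (q * m + r))) x" if "r < m" for r
  proof -
    have "(\<lambda>q. a (q * m + r)) = (\<lambda>q. (of_real (s q) * cinner x (e (q * m + r))) *\<^sub>C f (q * m + r))"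
      using that by (auto simp: a_def)
    then show ?thesis
      by (simp only: wop(1)[OF orthonormal_compose[OF e inj[of r]] orthonormal_compose[OF f inj[of r]] c0_starD(4)[OF s]])
  qed
  then have "(\<lambda>q. \<Sum>r<m. a (q * m + r)) sums (\<Sum>r<m. blinfun_apply (wop s (\<lambda>q. e (q * m + r)) (\<lambda>q. f (q * m + r))) x)"
    by (intro sums_sum) auto
  moreover have "(\<Sum>r<m. a (q * m + r)) = sum a {q * m..<q * m + m}" for q
    by (rule sum.reindex_bij_witness[where i="\<lambda>n. n - q * m" and j="\<lambda>r. q * m + r"]) auto
  ultimately show "blinfun_apply (wop (\<lambda>n. s (n div m)) e f) x =
      blinfun_apply (\<Sum>r<m. wop s (\<lambda>q. e (q * m + r)) (\<lambda>q. f (q * m + r))) x"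
    using 1 sums_unique2 by (simp add: blinfun.sum_left)
qed

lemma char_set_Sig:
  fixes I :: "('h \<Rightarrow>\<^sub>L 'h) set"
  assumes I: "is_ideal I"
  shows "char_set (Sig I)"
proof -
  obtain e :: "nat \<Rightarrow> 'h" where e: "orthonormal e" using orthonormal_exists by blast
  have sub: "Sig I \<subseteq> c0_star" using s_numbers_c0_star[OF inf idealD(1)[OF I]] by (auto simp: Sig_def)
  have "wop (\<lambda>i. 0) e e = 0"
    by (rule wop_eqI[OF e e, where C=0, symmetric]) simp_all
  then have z: "(\<lambda>_. 0) \<in> Sig I"
    using ideal_wop_iff[OF I c0_star_zero e e] idealD(2)[OF I] by simp
  have add: "(\<lambda>n. \<xi> n + \<eta> n) \<in> Sig I" if "\<xi> \<in> Sig I" "\<eta> \<in> Sig I" for \<xi> \<eta>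
  proof -
    have c: "\<xi> \<in> c0_star" "\<eta> \<in> c0_star" using sub that by auto
    have "wop \<xi> e e + wop \<eta> e e = wop (\<lambda>n. \<xi> n + \<eta> n) e e"
      by (rule wop_add[OF e e c0_starD(4)[OF c(1)] c0_starD(4)[OF c(2)]])
    moreover have "wop \<xi> e e + wop \<eta> e e \<in> I"
      using ideal_wop_iff[OF I c(1) e e] ideal_wop_iff[OF I c(2) e e] that by (simp add: idealD(3)[OF I])
    ultimately show ?thesis using ideal_wop_iff[OF I c0_star_add[OF c] e e] by simp
  qed
  have dom: "\<eta> \<in> Sig I" if "\<xi> \<in> Sig I" "\<eta> \<in> c0_star" and d: "dominated \<eta> \<xi>" for \<xi> \<eta>
  proof -
    have \<xi>: "\<xi> \<in> c0_star" using sub that by auto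
    obtain m M where m: "m > 0" and M: "\<And>n. \<eta> n \<le> M * \<xi> (n div m)"
      using d by (auto simp: dominated_def)
    note am = c0_star_ampliation[OF \<xi> m]
    have inj: "inj (\<lambda>q. q * m + r)" for r using m by (auto intro!: injI)
    have "wop (\<lambda>n. \<xi> (n div m)) e e \<in> I"
      unfolding wop_ampliation[OF \<xi> m e e]
      by (rule ideal_sum[OF I])
         (use ideal_wop_iff[OF I \<xi> orthonormal_compose[OF e inj] orthonormal_compose[OF e inj]] that(1) in blast)
    then have "wop \<eta> e e \<in> I"
      by (rule ideal_mem_le[OF I _ wop_compact[OF that(2) e e]])
         (use M in \<open>simp add: s_numbers_wop[OF that(2) e e] s_numbers_wop[OF am e e]\<close>)
    then show ?thesis using ideal_wop_iff[OF I that(2) e e] by simp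
  qed
  show ?thesis unfolding char_set_def using sub z add dom by blast
qed

text \<open>The first \<open>n\<close> right singular vectors of \<open>X\<close> and those of
  \<open>Y\<close> give \<open>2 * n\<close> functionals; on their common kernel both operators
  satisfy their norm bounds.\<close>

lemma s_numbers_add:
  fixes X Y :: "'h \<Rightarrow>\<^sub>L 'h"
  assumes X: "X \<in> compact_ops" and Y: "Y \<in> compact_ops"
  shows "s_numbers (X + Y) (2 * n) \<le> s_numbers X n + s_numbers Y n"
proof -
  obtain e f where X': "svd X (s_numbers X) e f" by (rule svd_s_numbers_exists[OF inf X])
  obtain e' f' where Y': "svd Y (s_numbers Y) e' f'" by (rule svd_s_numbers_exists[OF inf Y])
  obtain e'' f'' where Z: "svd (X + Y) (s_numbers (X + Y)) e'' f''"
    by (rule svd_s_numbers_exists[OF inf compact_ops_add[OF X Y]])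
  show ?thesis
  proof (rule svd_le[OF Z, where \<phi>="\<lambda>i x. cinner x (if i < n then e i else e' (i - n))"])
    fix x assume "\<And>i. i < 2 * n \<Longrightarrow> cinner x (if i < n then e i else e' (i - n)) = 0"
    note z = this
    have "cinner x (e i) = 0" if "i < n" for i using z[of i] that by simp
    then have 1: "norm (blinfun_apply X x) \<le> s_numbers X n * norm x" by (rule svd_norm_le[OF X'])
    have "cinner x (e' i) = 0" if "i < n" for i using z[of "n + i"] that by simp
    then have 2: "norm (blinfun_apply Y x) \<le> s_numbers Y n * norm x" by (rule svd_norm_le[OF Y'])
    show "norm (blinfun_apply (X + Y) x) \<le> (s_numbers X n + s_numbers Y n) * norm x"
      using 1 2 norm_triangle_ineq[of "blinfun_apply X x" "blinfun_apply Y x"]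
      by (simp add: blinfun.add_left distrib_right)
  qed (simp_all add: cinner_add_left cinner_scaleC_left)
qed

lemma s_numbers_compose_left:
  fixes X A :: "'h \<Rightarrow>\<^sub>L 'h"
  assumes X: "X \<in> compact_ops" and A: "A \<in> bounded_ops"
  shows "s_numbers (A o\<^sub>L X) n \<le> norm A * s_numbers X n"
proof -
  obtain e f where X': "svd X (s_numbers X) e f" by (rule svd_s_numbers_exists[OF inf X])
  obtain e'' f'' where Z: "svd (A o\<^sub>L X) (s_numbers (A o\<^sub>L X)) e'' f''"
    by (rule svd_s_numbers_exists[OF inf compact_ops_compose_left[OF A X]])
  show ?thesis
  proof (rule svd_le[OF Z, where \<phi>="\<lambda>i x. cinner x (e i)"])
    fix x assume "\<And>i. i < n \<Longrightarrow> cinner x (e i) = 0"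
    then have "norm (blinfun_apply X x) \<le> s_numbers X n * norm x" by (rule svd_norm_le[OF X'])
    then have "norm A * norm (blinfun_apply X x) \<le> norm A * (s_numbers X n * norm x)" by (simp add: mult_left_mono)
    then show "norm (blinfun_apply (A o\<^sub>L X) x) \<le> norm A * s_numbers X n * norm x"
      using norm_blinfun[of A "blinfun_apply X x"] by (simp add: mult.assoc)
  qed (simp_all add: cinner_add_left cinner_scaleC_left)
qed

lemma s_numbers_compose_right:
  fixes X A :: "'h \<Rightarrow>\<^sub>L 'h"
  assumes X: "X \<in> compact_ops" and A: "A \<in> bounded_ops"
  shows "s_numbers (X o\<^sub>L A) n \<le> norm A * s_numbers X n"
proof -
  obtain e f where X': "svd X (s_numbers X) e f" by (rule svd_s_numbers_exists[OF inf X])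
  obtain e'' f'' where Z: "svd (X o\<^sub>L A) (s_numbers (X o\<^sub>L A)) e'' f''"
    by (rule svd_s_numbers_exists[OF inf compact_ops_compose_right[OF A X]])
  have s: "0 \<le> s_numbers X n" by (rule c0_starD(1)[OF s_numbers_c0_star[OF inf X]])
  have AC: "blinfun_apply A (c *\<^sub>C x) = c *\<^sub>C blinfun_apply A x" for c x using A by (simp add: bounded_ops_def)
  show ?thesis
  proof (rule svd_le[OF Z, where \<phi>="\<lambda>i x. cinner (blinfun_apply A x) (e i)"])
    fix x assume "\<And>i. i < n \<Longrightarrow> cinner (blinfun_apply A x) (e i) = 0"
    then have "norm (blinfun_apply X (blinfun_apply A x)) \<le> s_numbers X n * norm (blinfun_apply A x)"
      by (rule svd_norm_le[OF X'])
    also have "\<dots> \<le> s_numbers X n * (norm A * norm x)" by (rule mult_left_mono[OF norm_blinfun s])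
    finally show "norm (blinfun_apply (X o\<^sub>L A) x) \<le> norm A * s_numbers X n * norm x"
      by (simp add: mult_ac)
  qed (simp_all add: cinner_add_left cinner_scaleC_left blinfun.add_right AC)
qed

lemma ideal_of_char_set:
  assumes S: "char_set S"
  defines "I \<equiv> {X :: 'h \<Rightarrow>\<^sub>L 'h. X \<in> compact_ops \<and> s_numbers X \<in> S}"
  shows "is_ideal I" "Sig I = S"
proof -
  obtain e :: "nat \<Rightarrow> 'h" where e: "orthonormal e" using orthonormal_exists by blast
  have z: "wop (\<lambda>i. 0) e e = 0"
    by (rule wop_eqI[OF e e, where C=0, symmetric]) simp_all
  show "is_ideal I"
    unfolding is_ideal_def
  proof (intro conjI ballI)
    show "I \<subseteq> compact_ops" by (auto simp: I_def)
    show "0 \<in> I"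
      using s_numbers_wop[OF c0_star_zero e e] char_setD(2)[OF S] compact_ops_zero by (simp add: I_def z)
  next
    fix X Y assume "X \<in> I" "Y \<in> I"
    then have X: "X \<in> compact_ops" "s_numbers X \<in> S" and Y: "Y \<in> compact_ops" "s_numbers Y \<in> S"
      by (auto simp: I_def)
    note XY = compact_ops_add[OF X(1) Y(1)]
    note c = s_numbers_c0_star[OF inf XY]
    \<comment> \<open>The doubled index in \<open>s_numbers_add\<close> is an ampliation with
      \<open>m = 2\<close>, which \<open>S\<close> absorbs.\<close>
    have "dominated (s_numbers (X + Y)) (\<lambda>n. s_numbers X n + s_numbers Y n)"
    proof (rule dominatedI[where m=2 and M=1])
      fix n
      have "s_numbers (X + Y) n \<le> s_numbers (X + Y) (2 * (n div 2))" by (rule c0_starD(2)[OF c]) simp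
      also have "\<dots> \<le> s_numbers X (n div 2) + s_numbers Y (n div 2)" by (rule s_numbers_add[OF X(1) Y(1)])
      finally show "s_numbers (X + Y) n \<le> 1 * (s_numbers X (n div 2) + s_numbers Y (n div 2))" by simp
    qed simp
    then have "s_numbers (X + Y) \<in> S"
      by (rule char_setD(4)[OF S char_setD(3)[OF S X(2) Y(2)] c])
    then show "X + Y \<in> I" using XY by (simp add: I_def)
  next
    fix X A :: "'h \<Rightarrow>\<^sub>L 'h" assume "X \<in> I" and A: "A \<in> bounded_ops"
    then have X: "X \<in> compact_ops" "s_numbers X \<in> S" by (auto simp: I_def)
    note AX = compact_ops_compose_left[OF A X(1)] and XA = compact_ops_compose_right[OF A X(1)]
    have "s_numbers (A o\<^sub>L X) \<in> S"
      by (rule char_setD(4)[OF S X(2) s_numbers_c0_star[OF inf AX]], rule dominatedI[where m=1])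
         (use s_numbers_compose_left[OF X(1) A] in simp_all)
    then show "A o\<^sub>L X \<in> I" using AX by (simp add: I_def)
    have "s_numbers (X o\<^sub>L A) \<in> S"
      by (rule char_setD(4)[OF S X(2) s_numbers_c0_star[OF inf XA]], rule dominatedI[where m=1])
         (use s_numbers_compose_right[OF X(1) A] in simp_all)
    then show "X o\<^sub>L A \<in> I" using XA by (simp add: I_def)
  qed
  show "Sig I = S"
  proof
    show "Sig I \<subseteq> S" by (auto simp: Sig_def I_def)
    show "S \<subseteq> Sig I"
    proof
      fix s assume s: "s \<in> S"
      note c = char_setD(1)[OF S s]
      have "wop s e e \<in> I" using s by (simp add: I_def wop_compact[OF c e e] s_numbers_wop[OF c e e])
      then show "s \<in> Sig I" unfolding Sig_def using s_numbers_wop[OF c e e] by (metis imageI)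
    qed
  qed
qed

lemma Sig_subset_iff:
  fixes I J :: "('h \<Rightarrow>\<^sub>L 'h) set"
  assumes I: "is_ideal I" and J: "is_ideal J"
  shows "Sig I \<subseteq> Sig J \<longleftrightarrow> I \<subseteq> J"
proof
  assume "Sig I \<subseteq> Sig J"
  then show "I \<subseteq> J" using ideal_mem_iff[OF I] ideal_mem_iff[OF J] by blast
next
  assume "I \<subseteq> J" then show "Sig I \<subseteq> Sig J" by (auto simp: Sig_def)
qed

lemma Sig_eq_iff:
  fixes I J :: "('h \<Rightarrow>\<^sub>L 'h) set"
  assumes I: "is_ideal I" and J: "is_ideal J"
  shows "Sig I = Sig J \<longleftrightarrow> I = J"
  using Sig_subset_iff[OF I J] Sig_subset_iff[OF J I] by auto

lemma ideal_with:
  assumes S: "char_set S"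
  shows "is_ideal (ideal_with S :: ('h \<Rightarrow>\<^sub>L 'h) set)" "Sig (ideal_with S :: ('h \<Rightarrow>\<^sub>L 'h) set) = S"
proof -
  have "\<exists>!I :: ('h \<Rightarrow>\<^sub>L 'h) set. is_ideal I \<and> Sig I = S"
    using ideal_of_char_set[OF S] Sig_eq_iff by metis
  then have "is_ideal (ideal_with S :: ('h \<Rightarrow>\<^sub>L 'h) set) \<and> Sig (ideal_with S :: ('h \<Rightarrow>\<^sub>L 'h) set) = S"
    unfolding ideal_with_def by (rule theI')
  then show "is_ideal (ideal_with S :: ('h \<Rightarrow>\<^sub>L 'h) set)" "Sig (ideal_with S :: ('h \<Rightarrow>\<^sub>L 'h) set) = S" by auto
qed

lemma ideal_with_Sig: "is_ideal (I :: ('h \<Rightarrow>\<^sub>L 'h) set) \<Longrightarrow> ideal_with (Sig I) = I"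
  using ideal_with[OF char_set_Sig] Sig_eq_iff by blast

lemma zero_ideal: "is_ideal ({0} :: ('h \<Rightarrow>\<^sub>L 'h) set)" "Sig ({0} :: ('h \<Rightarrow>\<^sub>L 'h) set) = {\<lambda>_. 0}"
proof -
  show 1: "is_ideal ({0} :: ('h \<Rightarrow>\<^sub>L 'h) set)"
    unfolding is_ideal_def using compact_ops_zero by (auto simp: blinfun_eqI blinfun.zero_right)
  show "Sig ({0} :: ('h \<Rightarrow>\<^sub>L 'h) set) = {\<lambda>_. 0}"
    using char_setD(2)[OF char_set_Sig[OF 1]] by (auto simp: Sig_def)
qed

lemma ideal_Int:
  fixes I J :: "('h \<Rightarrow>\<^sub>L 'h) set"
  assumes "is_ideal I" "is_ideal J" shows "is_ideal (I \<inter> J)"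
  using assms unfolding is_ideal_def by blast

lemma Sig_Int:
  fixes I J :: "('h \<Rightarrow>\<^sub>L 'h) set"
  assumes I: "is_ideal I" and J: "is_ideal J" shows "Sig (I \<inter> J) = Sig I \<inter> Sig J"
proof
  show "Sig (I \<inter> J) \<subseteq> Sig I \<inter> Sig J" by (auto simp: Sig_def)
  show "Sig I \<inter> Sig J \<subseteq> Sig (I \<inter> J)"
  proof
    fix s assume s: "s \<in> Sig I \<inter> Sig J"
    then obtain X where X: "X \<in> I" "s = s_numbers X" by (auto simp: Sig_def)
    then have "X \<in> J" using ideal_mem_iff[OF J, of X] idealD(1)[OF I] s by simp
    then show "s \<in> Sig (I \<inter> J)" using X by (auto simp: Sig_def)
  qed
qed

lemma Sig_trace_class:
  fixes I :: "('h \<Rightarrow>\<^sub>L 'h) set"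
  assumes I: "is_ideal I"
  shows "Sig (I \<inter> trace_class) = Sig I \<inter> l1_star"
  using idealD(1)[OF I] s_numbers_c0_star[OF inf] by (auto simp: Sig_def trace_class_def l1_star_def)

end

section \<open>Characteristic sets\<close>

lemma dominatedE:
  assumes "dominated \<eta> \<xi>" "\<xi> \<in> c0_star"
  obtains m M where "m > 0" "M > (0::real)" "\<And>n. \<eta> n \<le> M * \<xi> (n div m)"
proof -
  obtain m M where m: "m > 0" "\<And>n. \<eta> n \<le> M * \<xi> (n div m)" using assms(1) by (auto simp: dominated_def)
  have "\<eta> n \<le> (\<bar>M\<bar> + 1) * \<xi> (n div m)" for n
  proof -
    have "M * \<xi> (n div m) \<le> (\<bar>M\<bar> + 1) * \<xi> (n div m)"
      by (rule mult_right_mono) (use c0_starD(1)[OF assms(2)] in auto)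
    then show ?thesis using m(2)[of n] by linarith
  qed
  moreover have "\<bar>M\<bar> + 1 > 0" by linarith
  ultimately show ?thesis using m(1) that by blast
qed

lemma dominated_le: "(\<And>n. \<eta> n \<le> M * \<xi> n) \<Longrightarrow> dominated \<eta> \<xi>"
  by (rule dominatedI[where m=1 and M=M]) auto

lemma dominated_refl: "dominated \<xi> \<xi>"
  by (rule dominated_le[where M=1]) simp

lemma dominated_ampliation: "m > 0 \<Longrightarrow> dominated (\<lambda>n. \<xi> (n div m)) \<xi>"
  by (rule dominatedI[where m=m and M=1]) auto

lemma dominated_trans:
  assumes "dominated \<zeta> \<eta>" "dominated \<eta> \<xi>" and \<eta>: "\<eta> \<in> c0_star" and \<xi>: "\<xi> \<in> c0_star"
  shows "dominated \<zeta> \<xi>"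
proof -
  obtain m M where m: "m > 0" "M > 0" "\<And>n. \<zeta> n \<le> M * \<eta> (n div m)" by (rule dominatedE[OF assms(1) \<eta>]) blast
  obtain k K where k: "k > 0" "K > 0" "\<And>n. \<eta> n \<le> K * \<xi> (n div k)" by (rule dominatedE[OF assms(2) \<xi>]) blast
  show ?thesis
  proof (rule dominatedI[where m="m * k" and M="M * K"])
    fix n
    have "\<zeta> n \<le> M * \<eta> (n div m)" by (rule m(3))
    also have "\<dots> \<le> M * (K * \<xi> (n div m div k))" by (rule mult_left_mono[OF k(3)]) (use m in simp)
    finally show "\<zeta> n \<le> M * K * \<xi> (n div (m * k))" by (simp add: div_mult2_eq mult.assoc)
  qed (use m k in simp)
qed

lemma c0_star_div_le:
  assumes "\<xi> \<in> c0_star" "0 < k" "k \<le> m" shows "\<xi> (n div k) \<le> \<xi> (n div m)"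
  by (rule c0_starD(2)[OF assms(1)]) (rule div_le_mono2[OF assms(2,3)])

lemma dominated_add:
  assumes "dominated \<zeta> \<xi>" "dominated \<eta> \<xi>" and \<xi>: "\<xi> \<in> c0_star"
  shows "dominated (\<lambda>n. \<zeta> n + \<eta> n) \<xi>"
proof -
  obtain m M where m: "m > 0" "M > 0" "\<And>n. \<zeta> n \<le> M * \<xi> (n div m)" by (rule dominatedE[OF assms(1) \<xi>]) blast
  obtain k K where k: "k > 0" "K > 0" "\<And>n. \<eta> n \<le> K * \<xi> (n div k)" by (rule dominatedE[OF assms(2) \<xi>]) blast
  show ?thesis
  proof (rule dominatedI[where m="max m k" and M="M + K"])
    fix n
    have "M * \<xi> (n div m) \<le> M * \<xi> (n div max m k)"
      by (rule mult_left_mono[OF c0_star_div_le[OF \<xi> m(1)]]) (use m in auto)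
    moreover have "K * \<xi> (n div k) \<le> K * \<xi> (n div max m k)"
      by (rule mult_left_mono[OF c0_star_div_le[OF \<xi> k(1)]]) (use k in auto)
    ultimately show "\<zeta> n + \<eta> n \<le> (M + K) * \<xi> (n div max m k)"
      using m(3)[of n] k(3)[of n] by (simp add: distrib_right)
  qed (use m in simp)
qed

text \<open>Finitely many exceptional indices are absorbed by a larger ampliation: below
  \<open>Suc N\<close> it gives the constant value \<sigma> 0, which is positive, so a multiple of
  it exceeds \<open>B\<close>.\<close>

lemma dominated_eventually:
  assumes \<sigma>: "\<sigma> \<in> c0_star" "\<sigma> 0 > 0" and m: "m > 0" and B: "\<And>n. \<eta> n \<le> B"
    and le: "\<And>n. n \<ge> N \<Longrightarrow> \<eta> n \<le> M * \<sigma> (n div m)"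
  shows "dominated \<eta> \<sigma>"
proof (rule dominatedI[where m="m * Suc N" and M="\<bar>M\<bar> + \<bar>B\<bar> / \<sigma> 0"])
  fix n
  show "\<eta> n \<le> (\<bar>M\<bar> + \<bar>B\<bar> / \<sigma> 0) * \<sigma> (n div (m * Suc N))"
  proof (cases "n < Suc N")
    case True
    have "Suc N \<le> m * Suc N" using mult_le_mono1[of 1 m "Suc N"] m by simp
    then have "n < m * Suc N" using True by linarith
    then have z: "n div (m * Suc N) = 0" by simp
    have "\<eta> n \<le> \<bar>B\<bar>" using B[of n] by linarith
    also have "\<dots> \<le> (\<bar>M\<bar> + \<bar>B\<bar> / \<sigma> 0) * \<sigma> 0" using \<sigma>(2) by (simp add: distrib_right)
    finally show ?thesis by (simp only: z)
  next
    case False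
    have "\<eta> n \<le> M * \<sigma> (n div m)" by (rule le) (use False in simp)
    also have "\<dots> \<le> (\<bar>M\<bar> + \<bar>B\<bar> / \<sigma> 0) * \<sigma> (n div m)"
      by (rule mult_right_mono) (use \<sigma> c0_starD(1)[OF \<sigma>(1)] in \<open>auto intro: order_trans[OF abs_ge_self]\<close>)
    also have "\<dots> \<le> (\<bar>M\<bar> + \<bar>B\<bar> / \<sigma> 0) * \<sigma> (n div (m * Suc N))"
      by (rule mult_left_mono[OF c0_star_div_le[OF \<sigma>(1) m]]) (use \<sigma> in auto)
    finally show ?thesis .
  qed
qed (use m in simp)

lemma c0_star_scale: "\<xi> \<in> c0_star \<Longrightarrow> M \<ge> 0 \<Longrightarrow> (\<lambda>n. M * \<xi> n) \<in> c0_star"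
  by (rule c0_starI) (auto intro: mult_left_mono tendsto_mult_right_zero simp: c0_starD)

lemma c0_star_pos_0:
  assumes "\<xi> \<in> c0_star" "\<xi> \<noteq> (\<lambda>_. 0)" shows "\<xi> 0 > 0"
proof (rule ccontr)
  assume "\<not> \<xi> 0 > 0"
  then have "\<xi> n = 0" for n using c0_starD(1)[OF assms(1), of n] c0_starD(2)[OF assms(1), of 0 n] by simp
  then show False using assms(2) by blast
qed

lemma char_set_le:
  assumes "char_set S" "\<xi> \<in> S" "\<eta> \<in> c0_star" "\<And>n. \<eta> n \<le> M * \<xi> n"
  shows "\<eta> \<in> S"
  by (rule char_setD(4)[OF assms(1-3)]) (rule dominated_le[OF assms(4)])

lemma char_set_scale:
  assumes "char_set S" "\<xi> \<in> S" "M \<ge> 0" shows "(\<lambda>n. M * \<xi> n) \<in> S"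
  by (rule char_set_le[OF assms(1,2) c0_star_scale[OF char_setD(1)[OF assms(1,2)] assms(3)], where M=M]) simp

lemma char_set_ampliation:
  assumes "char_set S" "\<xi> \<in> S" "m > 0" shows "(\<lambda>n. \<xi> (n div m)) \<in> S"
  by (rule char_setD(4)[OF assms(1,2) c0_star_ampliation[OF char_setD(1)[OF assms(1,2)] assms(3)] dominated_ampliation[OF assms(3)]])

lemma char_set_zero: "char_set {\<lambda>_. 0}"
  unfolding char_set_def
proof (intro conjI ballI impI)
  fix \<xi> \<eta> :: "nat \<Rightarrow> real" assume "\<xi> \<in> {\<lambda>_. 0}" and \<eta>: "\<eta> \<in> c0_star" and "dominated \<eta> \<xi>"
  then have "\<eta> n \<le> 0" for n by (auto simp: dominated_def)
  then have "\<eta> n = 0" for n using c0_starD(1)[OF \<eta>, of n] by (simp add: antisym)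
  then show "\<eta> \<in> {\<lambda>_. 0}" by auto
qed (auto simp: c0_star_zero)

lemma char_set_c0_star: "char_set c0_star"
  unfolding char_set_def using c0_star_zero c0_star_add by blast

lemma char_set_nonzero:
  assumes "char_set S" "S \<noteq> {\<lambda>_. 0}"
  obtains \<sigma> where "\<sigma> \<in> S" "\<sigma> \<in> c0_star" "\<sigma> 0 > 0"
proof -
  obtain \<sigma> where "\<sigma> \<in> S" "\<sigma> \<noteq> (\<lambda>_. 0)" using assms char_setD(2)[OF assms(1)] by blast
  then show ?thesis using that c0_star_pos_0 char_setD(1)[OF assms(1)] by blast
qed

text \<open>The characteristic set of the ideal generated by an operator with s-numbers
  \<xi>.\<close>

definition princ :: "(nat \<Rightarrow> real) \<Rightarrow> (nat \<Rightarrow> real) set" where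
  "princ \<xi> = {\<eta> \<in> c0_star. dominated \<eta> \<xi>}"

lemma princ_self: "\<xi> \<in> c0_star \<Longrightarrow> \<xi> \<in> princ \<xi>"
  by (simp add: princ_def dominated_refl)

lemma char_set_princ: "\<xi> \<in> c0_star \<Longrightarrow> char_set (princ \<xi>)"
  unfolding char_set_def princ_def
  by (auto simp: c0_star_zero c0_star_add dominated_add intro: dominated_trans dominatedI[of 1 _ 0])

lemma princ_subset: "char_set S \<Longrightarrow> \<xi> \<in> S \<Longrightarrow> princ \<xi> \<subseteq> S"
  by (auto simp: princ_def char_setD(4))

lemma princ_nonzero: "\<xi> \<in> c0_star \<Longrightarrow> \<xi> 0 > 0 \<Longrightarrow> princ \<xi> \<noteq> {\<lambda>_. 0}"
  using princ_self[of \<xi>] by auto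

lemma princ_zero: "princ (\<lambda>_. 0) = {\<lambda>_. 0}"
  using princ_subset[OF char_set_zero] princ_self[OF c0_star_zero] by blast

subsection \<open>Mean operations\<close>

text \<open>Both theories are instances of one scheme: \<open>a\<close> is a mean operation on the characteristic set
  \<open>U\<close> (all of \<open>c\<^sub>0\<^sup>*\<close>, respectively the summable sequences) with values in \<open>V\<close>. The maps \<open>F\<close> and \<open>G\<close>
  form a Galois connection. The summand \<open>\<sigma>\<close> below is needed for the mean at infinity only, which
  annihilates sequences supported in one point.\<close>

locale mean_op =
  fixes a :: "(nat \<Rightarrow> real) \<Rightarrow> nat \<Rightarrow> real" and U V :: "(nat \<Rightarrow> real) set"
  assumes char_U: "char_set U" and char_V: "char_set V" and U_V: "U \<subseteq> V"
    and a_V: "\<xi> \<in> U \<Longrightarrow> a \<xi> \<in> V"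
    and a_add: "\<xi> \<in> U \<Longrightarrow> \<eta> \<in> U \<Longrightarrow> a (\<lambda>n. \<xi> n + \<eta> n) = (\<lambda>n. a \<xi> n + a \<eta> n)"
    and a_scale: "\<xi> \<in> U \<Longrightarrow> M \<ge> 0 \<Longrightarrow> a (\<lambda>n. M * \<xi> n) = (\<lambda>n. M * a \<xi> n)"
    and a_mono: "\<xi> \<in> U \<Longrightarrow> \<eta> \<in> U \<Longrightarrow> (\<And>n. \<xi> n \<le> \<eta> n) \<Longrightarrow> a \<xi> n \<le> a \<eta> n"
    and a_amp: "\<xi> \<in> U \<Longrightarrow> m > 0 \<Longrightarrow> a \<xi> (n div m) \<le> a (\<lambda>k. \<xi> (k div m)) n"
    and a_amp_dominated: "\<xi> \<in> U \<Longrightarrow> m > 0 \<Longrightarrow> \<sigma> \<in> c0_star \<Longrightarrow> \<sigma> 0 > 0 \<Longrightarrow>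
      dominated (a (\<lambda>k. \<xi> (k div m))) (\<lambda>n. a \<xi> n + \<sigma> n)"
    and a_dominates: "\<xi> \<in> U \<Longrightarrow> \<sigma> \<in> c0_star \<Longrightarrow> \<sigma> 0 > 0 \<Longrightarrow> dominated \<xi> (\<lambda>n. a \<xi> n + \<sigma> n)"
    and a_pos: "\<xi> \<in> U \<Longrightarrow> \<xi> 0 > 0 \<Longrightarrow> a (\<lambda>k. \<xi> (k div 2)) 0 > 0"
begin

definition F :: "(nat \<Rightarrow> real) set \<Rightarrow> (nat \<Rightarrow> real) set" where
  "F S = {\<xi> \<in> c0_star. \<exists>\<eta>\<in>S \<inter> U. big_oh \<xi> (a \<eta>)}"

text \<open>The branch for the zero set follows \<open>pre_am_inf\<close>: a sequence supported in
  its first term has mean zero at infinity, but its proper ampliations do not.\<close>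

definition G :: "(nat \<Rightarrow> real) set \<Rightarrow> (nat \<Rightarrow> real) set" where
  "G S = (if S = {\<lambda>_. 0} then {\<lambda>_. 0} else {\<xi> \<in> U. a \<xi> \<in> S})"

lemma U_c0: "\<xi> \<in> U \<Longrightarrow> \<xi> \<in> c0_star" by (rule char_setD(1)[OF char_U])
lemma V_c0: "\<xi> \<in> V \<Longrightarrow> \<xi> \<in> c0_star" by (rule char_setD(1)[OF char_V])
lemma a_c0: "\<xi> \<in> U \<Longrightarrow> a \<xi> \<in> c0_star" by (rule V_c0[OF a_V])
lemma zero_U: "(\<lambda>_. 0) \<in> U" by (rule char_setD(2)[OF char_U])

lemma a_zero: "a (\<lambda>_. 0) = (\<lambda>_. 0)"
  using a_scale[OF zero_U, of 0] by simp

lemma FI: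
  assumes "\<xi> \<in> c0_star" "\<eta> \<in> S" "\<eta> \<in> U" "\<And>n. \<xi> n \<le> M * a \<eta> n" shows "\<xi> \<in> F S"
  using assms by (auto simp: F_def big_oh_def)

lemma FE:
  assumes "\<xi> \<in> F S"
  obtains \<eta> M where "\<xi> \<in> c0_star" "\<eta> \<in> S" "\<eta> \<in> U" "M > 0" "\<And>n. \<xi> n \<le> M * a \<eta> n"
proof -
  obtain \<eta> M where \<eta>: "\<xi> \<in> c0_star" "\<eta> \<in> S" "\<eta> \<in> U" "\<And>n. \<xi> n \<le> M * a \<eta> n"
    using assms by (auto simp: F_def big_oh_def)
  have "M * a \<eta> n \<le> (\<bar>M\<bar> + 1) * a \<eta> n" for n
    by (rule mult_right_mono) (use c0_starD(1)[OF a_c0[OF \<eta>(3)]] in auto)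
  then have "\<And>n. \<xi> n \<le> (\<bar>M\<bar> + 1) * a \<eta> n" using \<eta>(4) order_trans by blast
  moreover have "\<bar>M\<bar> + 1 > 0" by linarith
  ultimately show ?thesis using \<eta>(1-3) that by blast
qed

lemma a_in_F: "\<eta> \<in> S \<Longrightarrow> \<eta> \<in> U \<Longrightarrow> a \<eta> \<in> F S"
  by (rule FI[OF a_c0, where M=1]) auto

lemma G_U: "G S \<subseteq> U" using zero_U by (auto simp: G_def)

lemma a_G: "char_set S \<Longrightarrow> \<zeta> \<in> G S \<Longrightarrow> a \<zeta> \<in> S"
  using char_setD(2) by (auto simp: G_def a_zero split: if_splits)

lemma GI: "S \<noteq> {\<lambda>_. 0} \<Longrightarrow> \<zeta> \<in> U \<Longrightarrow> a \<zeta> \<in> S \<Longrightarrow> \<zeta> \<in> G S"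
  by (simp add: G_def)

lemma char_F:
  assumes S: "char_set S" shows "char_set (F S)"
  unfolding char_set_def
proof (intro conjI ballI impI)
  show "F S \<subseteq> c0_star" by (auto simp: F_def)
  show "(\<lambda>_. 0) \<in> F S"
    by (rule FI[OF c0_star_zero char_setD(2)[OF S] zero_U, where M=0]) simp
next
  fix \<xi> \<xi>' assume "\<xi> \<in> F S" "\<xi>' \<in> F S"
  obtain \<eta> M where 1: "\<xi> \<in> c0_star" "\<eta> \<in> S" "\<eta> \<in> U" "M > 0" "\<And>n. \<xi> n \<le> M * a \<eta> n" by (rule FE[OF \<open>\<xi> \<in> F S\<close>]) blast
  obtain \<eta>' M' where 2: "\<xi>' \<in> c0_star" "\<eta>' \<in> S" "\<eta>' \<in> U" "M' > 0" "\<And>n. \<xi>' n \<le> M' * a \<eta>' n" by (rule FE[OF \<open>\<xi>' \<in> F S\<close>]) blast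
  show "(\<lambda>n. \<xi> n + \<xi>' n) \<in> F S"
  proof (rule FI[OF c0_star_add[OF 1(1) 2(1)] char_setD(3)[OF S 1(2) 2(2)] char_setD(3)[OF char_U 1(3) 2(3)], where M="M + M'"])
    fix n
    have "M * a \<eta> n \<le> (M + M') * a \<eta> n" "M' * a \<eta>' n \<le> (M + M') * a \<eta>' n"
      using 1(4) 2(4) c0_starD(1)[OF a_c0[OF 1(3)]] c0_starD(1)[OF a_c0[OF 2(3)]] by (auto intro!: mult_right_mono)
    then show "\<xi> n + \<xi>' n \<le> (M + M') * a (\<lambda>n. \<eta> n + \<eta>' n) n"
      unfolding a_add[OF 1(3) 2(3)] distrib_left using 1(5)[of n] 2(5)[of n] by linarith
  qed
next
  fix \<xi> \<zeta> assume "\<xi> \<in> F S" and \<zeta>: "\<zeta> \<in> c0_star" "dominated \<zeta> \<xi>"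
  obtain \<eta> M where 1: "\<xi> \<in> c0_star" "\<eta> \<in> S" "\<eta> \<in> U" "M > 0" "\<And>n. \<xi> n \<le> M * a \<eta> n" by (rule FE[OF \<open>\<xi> \<in> F S\<close>]) blast
  obtain m K where m: "m > 0" "K > 0" "\<And>n. \<zeta> n \<le> K * \<xi> (n div m)" by (rule dominatedE[OF \<zeta>(2) 1(1)]) blast
  show "\<zeta> \<in> F S"
  proof (rule FI[OF \<zeta>(1) char_set_ampliation[OF S 1(2) m(1)] char_set_ampliation[OF char_U 1(3) m(1)], where M="K * M"])
    fix n
    have "\<zeta> n \<le> K * \<xi> (n div m)" by (rule m(3))
    also have "\<dots> \<le> K * (M * a \<eta> (n div m))" using m(2) 1(5) by simp
    also have "\<dots> \<le> K * (M * a (\<lambda>n. \<eta> (n div m)) n)"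
      using m(2) 1(4) a_amp[OF 1(3) m(1)] by simp
    finally show "\<zeta> n \<le> K * M * a (\<lambda>n. \<eta> (n div m)) n" by (simp add: mult.assoc)
  qed
qed

lemma char_G:
  assumes S: "char_set S" shows "char_set (G S)"
proof (cases "S = {\<lambda>_. 0}")
  case True
  then show ?thesis using char_set_zero by (simp add: G_def)
next
  case False
  \<comment> \<open>A nonzero element of \<open>S\<close> serves as the summand \<sigma> in
    \<open>a_amp_dominated\<close>.\<close>
  then obtain \<sigma> where \<sigma>: "\<sigma> \<in> S" "\<sigma> \<in> c0_star" "\<sigma> 0 > 0" using char_set_nonzero[OF S] by blast
  have G: "G S = {\<xi> \<in> U. a \<xi> \<in> S}" using False by (simp add: G_def)
  show ?thesis
    unfolding char_set_def G
  proof (intro conjI ballI impI)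
    show "{\<xi> \<in> U. a \<xi> \<in> S} \<subseteq> c0_star" using U_c0 by blast
    show "(\<lambda>_. 0) \<in> {\<xi> \<in> U. a \<xi> \<in> S}" using zero_U a_zero char_setD(2)[OF S] by simp
  next
    fix \<xi> \<eta> assume "\<xi> \<in> {\<xi> \<in> U. a \<xi> \<in> S}" "\<eta> \<in> {\<xi> \<in> U. a \<xi> \<in> S}"
    then show "(\<lambda>n. \<xi> n + \<eta> n) \<in> {\<xi> \<in> U. a \<xi> \<in> S}"
      using char_setD(3)[OF char_U] char_setD(3)[OF S] a_add by auto
  next
    fix \<xi> \<zeta> assume "\<xi> \<in> {\<xi> \<in> U. a \<xi> \<in> S}" and \<zeta>: "\<zeta> \<in> c0_star" "dominated \<zeta> \<xi>"
    then have \<xi>: "\<xi> \<in> U" "a \<xi> \<in> S" by auto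
    have \<zeta>U: "\<zeta> \<in> U" by (rule char_setD(4)[OF char_U \<xi>(1) \<zeta>])
    obtain m K where m: "m > 0" "K > 0" "\<And>n. \<zeta> n \<le> K * \<xi> (n div m)" by (rule dominatedE[OF \<zeta>(2) U_c0[OF \<xi>(1)]]) blast
    note am = char_set_ampliation[OF char_U \<xi>(1) m(1)]
    have "a (\<lambda>k. \<xi> (k div m)) \<in> S"
      by (rule char_setD(4)[OF S char_setD(3)[OF S \<xi>(2) \<sigma>(1)] a_c0[OF am] a_amp_dominated[OF \<xi>(1) m(1) \<sigma>(2,3)]])
    then have "a \<zeta> \<in> S"
    proof (rule char_set_le[OF S _ a_c0[OF \<zeta>U], where M=K])
      fix n
      have "a \<zeta> n \<le> a (\<lambda>k. K * \<xi> (k div m)) n"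
        by (rule a_mono[OF \<zeta>U char_set_scale[OF char_U am]]) (use m in auto)
      then show "a \<zeta> n \<le> K * a (\<lambda>k. \<xi> (k div m)) n" using a_scale[OF am, of K] m(2) by simp
    qed
    then show "\<zeta> \<in> {\<xi> \<in> U. a \<xi> \<in> S}" using \<zeta>U by simp
  qed
qed

lemma F_mono: "S \<subseteq> T \<Longrightarrow> F S \<subseteq> F T" by (auto simp: F_def)

lemma F_Int_U: "F (S \<inter> U) = F S" by (auto simp: F_def)

lemma F_V: "F S \<subseteq> V"
proof
  fix \<xi> assume "\<xi> \<in> F S"
  then obtain \<eta> M where 1: "\<xi> \<in> c0_star" "\<eta> \<in> S" "\<eta> \<in> U" "M > 0" "\<And>n. \<xi> n \<le> M * a \<eta> n" by (rule FE) blast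
  show "\<xi> \<in> V" by (rule char_set_le[OF char_V a_V[OF 1(3)] 1(1,5)])
qed

text \<open>The mean is applied to the doubled sequence, which has a positive mean even if the mean
  of \<eta> itself vanishes.\<close>

lemma F_zero_imp:
  assumes S: "char_set S" and F: "F S = {\<lambda>_. 0}" and \<eta>: "\<eta> \<in> S" "\<eta> \<in> U" shows "\<eta> = (\<lambda>_. 0)"
proof (rule ccontr)
  assume "\<eta> \<noteq> (\<lambda>_. 0)"
  then have "\<eta> 0 > 0" using c0_star_pos_0 U_c0[OF \<eta>(2)] by blast
  then have "a (\<lambda>k. \<eta> (k div 2)) 0 > 0" by (rule a_pos[OF \<eta>(2)])
  moreover have "a (\<lambda>k. \<eta> (k div 2)) \<in> F S"
    by (rule a_in_F) (use char_set_ampliation[OF S \<eta>(1)] char_set_ampliation[OF char_U \<eta>(2)] in auto)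
  ultimately show False using F by auto
qed

text \<open>\<open>F\<close> is left adjoint to \<open>G\<close> on the sets inside
  \<open>U\<close>; the formal rules for closures and interiors are consequences. The zero branch of
  \<open>G\<close> fits in because \<open>F S\<close> vanishes only if \<open>S \<inter> U\<close>
  does.\<close>

lemma galois:
  assumes S: "char_set S" and T: "char_set T"
  shows "F S \<subseteq> T \<longleftrightarrow> S \<inter> U \<subseteq> G T"
proof
  assume FT: "F S \<subseteq> T"
  show "S \<inter> U \<subseteq> G T"
  proof
    fix \<zeta> assume \<zeta>: "\<zeta> \<in> S \<inter> U"
    show "\<zeta> \<in> G T"
    proof (cases "T = {\<lambda>_. 0}")
      case True
      then have "F S = {\<lambda>_. 0}" using FT char_setD(2)[OF char_F[OF S]] by blast
      then show ?thesis using F_zero_imp[OF S] \<zeta> True by (auto simp: G_def)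
    next
      case False
      show ?thesis by (rule GI[OF False]) (use \<zeta> FT a_in_F in auto)
    qed
  qed
next
  assume H: "S \<inter> U \<subseteq> G T"
  show "F S \<subseteq> T"
  proof
    fix \<xi> assume "\<xi> \<in> F S"
    then obtain \<eta> M where 1: "\<xi> \<in> c0_star" "\<eta> \<in> S" "\<eta> \<in> U" "M > 0" "\<And>n. \<xi> n \<le> M * a \<eta> n" by (rule FE) blast
    have "a \<eta> \<in> T" by (rule a_G[OF T]) (use H 1 in blast)
    then show "\<xi> \<in> T" by (rule char_set_le[OF T _ 1(1,5)])
  qed
qed

lemma G_mono:
  assumes "char_set S" "char_set T" "S \<subseteq> T" shows "G S \<subseteq> G T"
proof -
  have "F (G S) \<subseteq> S" using galois[OF char_G[OF assms(1)] assms(1)] by blast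
  then show ?thesis using galois[OF char_G[OF assms(1)] assms(2)] assms(3) G_U by blast
qed

lemma FG_subset: "char_set S \<Longrightarrow> F (G S) \<subseteq> S"
  using galois[OF char_G] by blast

lemma subset_GF: "char_set S \<Longrightarrow> S \<inter> U \<subseteq> G (F S)"
  using galois[OF _ char_F] by blast

lemma GFG: assumes "char_set S" shows "G (F (G S)) = G S"
proof
  show "G (F (G S)) \<subseteq> G S" by (intro G_mono char_F char_G FG_subset assms)
  show "G S \<subseteq> G (F (G S))" using subset_GF[OF char_G[OF assms]] G_U by blast
qed

lemma FGF: assumes "char_set S" shows "F (G (F S)) = F S"
proof
  show "F (G (F S)) \<subseteq> F S" by (intro FG_subset char_F assms)
  show "F S \<subseteq> F (G (F S))" using F_mono[OF subset_GF[OF assms]] by (simp add: F_Int_U)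
qed

lemma G_subset: assumes S: "char_set S" shows "G S \<subseteq> S"
proof
  fix \<zeta> assume \<zeta>: "\<zeta> \<in> G S"
  show "\<zeta> \<in> S"
  proof (cases "S = {\<lambda>_. 0}")
    case True then show ?thesis using \<zeta> by (simp add: G_def)
  next
    case False
    then obtain \<sigma> where \<sigma>: "\<sigma> \<in> S" "\<sigma> \<in> c0_star" "\<sigma> 0 > 0" using char_set_nonzero[OF S] by blast
    have U: "\<zeta> \<in> U" using \<zeta> G_U by blast
    show ?thesis
      by (rule char_setD(4)[OF S char_setD(3)[OF S a_G[OF S \<zeta>] \<sigma>(1)] U_c0[OF U] a_dominates[OF U \<sigma>(2,3)]])
  qed
qed

lemma subset_F: assumes "char_set S" shows "S \<inter> U \<subseteq> F S"
  using subset_GF[OF assms] G_subset[OF char_F[OF assms]] by blast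

lemma G_eq_iff: "char_set S \<Longrightarrow> char_set T \<Longrightarrow> G S = G T \<longleftrightarrow> F (G S) = F (G T)"
  by (metis GFG)

lemma F_eq_iff: "char_set S \<Longrightarrow> char_set T \<Longrightarrow> F S = F T \<longleftrightarrow> G (F S) = G (F T)"
  by (metis FGF)

lemma stable_imp_open_closed:
  assumes S: "char_set S" and st: "S = G S"
  shows "F S = S" "G (F S) = S" "F (G S) = S" "S \<subseteq> U"
proof -
  show U: "S \<subseteq> U" using st G_U by blast
  have "F S \<subseteq> S" using FG_subset[OF S] st by simp
  moreover have "S \<subseteq> F S" using subset_F[OF S] U by blast
  ultimately show FS: "F S = S" by blast
  show "G (F S) = S" "F (G S) = S" using FS st by auto
qed

text \<open>Membership in the closure uses a single \<eta>, so the closure is the union of the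
  closures of principal subsets. Thus it is enough to define \<open>lc\<close> through principal
  sets.\<close>

lemma GF_princ:
  assumes T: "char_set T" and \<zeta>: "\<zeta> \<in> G (F T)"
  shows "\<exists>\<eta>\<in>T \<inter> U. \<zeta> \<in> G (F (princ \<eta>))"
proof (cases "F T = {\<lambda>_. 0}")
  case True
  then have "\<zeta> = (\<lambda>_. 0)" using \<zeta> by (simp add: G_def)
  then show ?thesis
    using char_setD(2)[OF T] zero_U char_setD(2)[OF char_G[OF char_F[OF char_set_princ[OF c0_star_zero]]]] by blast
next
  case False
  have U: "\<zeta> \<in> U" using \<zeta> G_U by blast
  obtain \<eta> M where 1: "a \<zeta> \<in> c0_star" "\<eta> \<in> T" "\<eta> \<in> U" "M > 0" "\<And>n. a \<zeta> n \<le> M * a \<eta> n"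
    by (rule FE[OF a_G[OF char_F[OF T] \<zeta>]]) blast
  \<comment> \<open>Adding the nonzero \<tau> to \<eta> keeps the mean of the principal set nonzero,
    so that membership in \<open>G\<close> is decided by its regular branch.\<close>
  obtain \<tau> where \<tau>: "\<tau> \<in> T" "\<tau> \<in> U" "\<tau> \<noteq> (\<lambda>_. 0)"
  proof -
    obtain \<sigma> where \<sigma>: "\<sigma> \<in> F T" "\<sigma> 0 > 0" using char_set_nonzero[OF char_F[OF T] False] by blast
    obtain \<tau> M where 2: "\<tau> \<in> T" "\<tau> \<in> U" "\<And>n. \<sigma> n \<le> M * a \<tau> n" by (rule FE[OF \<sigma>(1)]) blast
    have "\<tau> \<noteq> (\<lambda>_. 0)" using 2(3)[of 0] \<sigma>(2) a_zero by auto
    then show ?thesis using 2 that by blast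
  qed
  define \<theta> where "\<theta> = (\<lambda>n. \<eta> n + \<tau> n)"
  have \<theta>: "\<theta> \<in> T" "\<theta> \<in> U"
    unfolding \<theta>_def using char_setD(3)[OF T 1(2) \<tau>(1)] char_setD(3)[OF char_U 1(3) \<tau>(2)] by auto
  note c = U_c0[OF \<theta>(2)]
  have "\<theta> 0 > 0" using c0_star_pos_0[OF U_c0[OF \<tau>(2)] \<tau>(3)] c0_starD(1)[OF U_c0[OF 1(3)], of 0] by (simp add: \<theta>_def)
  then have "F (princ \<theta>) \<noteq> {\<lambda>_. 0}"
    using F_zero_imp[OF char_set_princ[OF c] _ princ_self[OF c] \<theta>(2)] by auto
  moreover have "a \<zeta> \<in> F (princ \<theta>)"
  proof (rule FI[OF 1(1) princ_self[OF c] \<theta>(2), where M=M])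
    fix n
    have "a \<eta> n \<le> a \<theta> n" unfolding \<theta>_def a_add[OF 1(3) \<tau>(2)] using c0_starD(1)[OF a_c0[OF \<tau>(2)]] by simp
    then have "M * a \<eta> n \<le> M * a \<theta> n" using 1(4) by simp
    then show "a \<zeta> n \<le> M * a \<theta> n" using 1(5)[of n] by linarith
  qed
  ultimately have "\<zeta> \<in> G (F (princ \<theta>))" using GI U by blast
  then show ?thesis using \<theta> by blast
qed

end

text \<open>\<open>GF_add\<close> splits an element of the closure of a sum along the summands,
  which makes \<open>lc\<close> additive. \<open>mu \<eta>\<close> plays the least mean above
  \<eta>: it lies below every multiple of a mean that lies above \<eta>, and is equivalent to a mean
  under domination.\<close>

locale mean_theory = mean_op +
  fixes mu :: "(nat \<Rightarrow> real) \<Rightarrow> nat \<Rightarrow> real"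
  assumes GF_add: "\<zeta>1 \<in> U \<Longrightarrow> \<zeta>2 \<in> U \<Longrightarrow> \<zeta> \<in> G (F (princ (\<lambda>n. \<zeta>1 n + \<zeta>2 n))) \<Longrightarrow>
      \<exists>e1\<in>G (F (princ \<zeta>1)). \<exists>e2\<in>G (F (princ \<zeta>2)). dominated \<zeta> (\<lambda>n. e1 n + e2 n)"
    and mu_c0: "\<eta> \<in> V \<Longrightarrow> mu \<eta> \<in> c0_star"
    and mu_ge: "\<eta> \<in> V \<Longrightarrow> \<eta> n \<le> mu \<eta> n"
    and mu_mono: "\<eta> \<in> V \<Longrightarrow> \<eta>' \<in> V \<Longrightarrow> (\<And>n. \<eta> n \<le> \<eta>' n) \<Longrightarrow> mu \<eta> n \<le> mu \<eta>' n"
    and mu_mean: "\<eta> \<in> V \<Longrightarrow> \<exists>\<rho>\<in>U. dominated (a \<rho>) (mu \<eta>) \<and> dominated (mu \<eta>) (a \<rho>)"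
    and mu_least: "\<eta> \<in> V \<Longrightarrow> \<zeta> \<in> U \<Longrightarrow> M > 0 \<Longrightarrow> (\<And>n. \<eta> n \<le> M * a \<zeta> n) \<Longrightarrow> mu \<eta> n \<le> M * a \<zeta> n"
begin

text \<open>The union of all closed sets that are generated by one element of \<open>U\<close> and
  contained in \<open>S\<close>, which turns out to be the largest closed subset.\<close>

definition lc :: "(nat \<Rightarrow> real) set \<Rightarrow> (nat \<Rightarrow> real) set" where
  "lc S = {\<zeta> \<in> U. G (F (princ \<zeta>)) \<subseteq> S}"

text \<open>The least means above elements of \<open>S \<inter> V\<close>, with all that they
  dominate, as candidate for the smallest open set containing \<open>S \<inter> V\<close>.\<close>

definition so :: "(nat \<Rightarrow> real) set \<Rightarrow> (nat \<Rightarrow> real) set" where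
  "so S = {\<zeta> \<in> c0_star. \<exists>\<eta>\<in>S \<inter> V. dominated \<zeta> (mu \<eta>)}"

section \<open>Largest closed subset and smallest open superset\<close>

lemma GF_princ_mono:
  assumes "S \<subseteq> T" "char_set S" "char_set T"
  shows "G (F S) \<subseteq> G (F T)"
  using G_mono[OF char_F[OF assms(2)] char_F[OF assms(3)] F_mono[OF assms(1)]] .

lemma GF_princ_zero: "G (F (princ (\<lambda>_. 0))) = {\<lambda>_. 0}"
proof -
  have "F {\<lambda>_. 0} \<subseteq> {\<lambda>_. 0}" using galois[OF char_set_zero char_set_zero] zero_U by (auto simp: G_def)
  then have "F {\<lambda>_. 0} = {\<lambda>_. 0}" using char_setD(2)[OF char_F[OF char_set_zero]] by blast
  then show ?thesis by (simp add: princ_zero G_def)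
qed

lemma char_lc:
  assumes S: "char_set S" shows "char_set (lc S)"
  unfolding char_set_def
proof (intro conjI ballI impI)
  show "lc S \<subseteq> c0_star" using U_c0 by (auto simp: lc_def)
  show "(\<lambda>_. 0) \<in> lc S" using zero_U char_setD(2)[OF S] by (simp add: lc_def GF_princ_zero)
next
  fix \<xi> \<eta> assume "\<xi> \<in> lc S" "\<eta> \<in> lc S"
  then have \<xi>: "\<xi> \<in> U" "G (F (princ \<xi>)) \<subseteq> S" and \<eta>: "\<eta> \<in> U" "G (F (princ \<eta>)) \<subseteq> S" by (auto simp: lc_def)
  have "\<zeta> \<in> S" if \<zeta>: "\<zeta> \<in> G (F (princ (\<lambda>n. \<xi> n + \<eta> n)))" for \<zeta>
  proof -
    obtain e1 e2 where e: "e1 \<in> G (F (princ \<xi>))" "e2 \<in> G (F (princ \<eta>))" "dominated \<zeta> (\<lambda>n. e1 n + e2 n)"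
      using GF_add[OF \<xi>(1) \<eta>(1) \<zeta>] by blast
    have "\<zeta> \<in> c0_star" using \<zeta> G_U U_c0 by blast
    then show ?thesis using char_setD(4)[OF S char_setD(3)[OF S] _ e(3)] e(1,2) \<xi>(2) \<eta>(2) by blast
  qed
  then show "(\<lambda>n. \<xi> n + \<eta> n) \<in> lc S" using char_setD(3)[OF char_U \<xi>(1) \<eta>(1)] by (auto simp: lc_def)
next
  fix \<xi> \<eta> assume "\<xi> \<in> lc S" and \<eta>: "\<eta> \<in> c0_star" "dominated \<eta> \<xi>"
  then have \<xi>: "\<xi> \<in> U" "G (F (princ \<xi>)) \<subseteq> S" by (auto simp: lc_def)
  note c = char_set_princ[OF U_c0[OF \<xi>(1)]]
  have "princ \<eta> \<subseteq> princ \<xi>" by (rule princ_subset[OF c]) (use \<eta> in \<open>simp add: princ_def\<close>)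
  then have "G (F (princ \<eta>)) \<subseteq> S" using GF_princ_mono[OF _ char_set_princ[OF \<eta>(1)] c] \<xi>(2) by blast
  then show "\<eta> \<in> lc S" using char_setD(4)[OF char_U \<xi>(1) \<eta>] by (simp add: lc_def)
qed

lemma lc_subset: assumes S: "char_set S" shows "lc S \<subseteq> S"
proof
  fix \<zeta> assume "\<zeta> \<in> lc S"
  then have \<zeta>: "\<zeta> \<in> U" "G (F (princ \<zeta>)) \<subseteq> S" by (auto simp: lc_def)
  note c = U_c0[OF \<zeta>(1)]
  have "\<zeta> \<in> princ \<zeta> \<inter> U" using princ_self[OF c] \<zeta>(1) by simp
  then show "\<zeta> \<in> S" using subset_GF[OF char_set_princ[OF c]] \<zeta>(2) by blast
qed

lemma lc_closed: assumes S: "char_set S" shows "G (F (lc S)) = lc S"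
proof
  have U: "lc S \<subseteq> U" by (auto simp: lc_def)
  then show "lc S \<subseteq> G (F (lc S))" using subset_GF[OF char_lc[OF S]] by blast
  show "G (F (lc S)) \<subseteq> lc S"
  proof
    fix \<zeta> assume \<zeta>: "\<zeta> \<in> G (F (lc S))"
    then obtain \<eta> where \<eta>: "\<eta> \<in> lc S" "\<eta> \<in> U" "\<zeta> \<in> G (F (princ \<eta>))" using GF_princ[OF char_lc[OF S]] by blast
    have \<zeta>U: "\<zeta> \<in> U" using \<zeta> G_U by blast
    note c = char_set_princ[OF U_c0[OF \<eta>(2)]] and d = char_set_princ[OF U_c0[OF \<zeta>U]]
    have "princ \<zeta> \<subseteq> G (F (princ \<eta>))" by (rule princ_subset[OF char_G[OF char_F[OF c]] \<eta>(3)])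
    then have "G (F (princ \<zeta>)) \<subseteq> G (F (G (F (princ \<eta>))))" by (rule GF_princ_mono[OF _ d char_G[OF char_F[OF c]]])
    also have "\<dots> = G (F (princ \<eta>))" by (rule GFG[OF char_F[OF c]])
    also have "\<dots> \<subseteq> S" using \<eta>(1) by (simp add: lc_def)
    finally show "\<zeta> \<in> lc S" using \<zeta>U by (simp add: lc_def)
  qed
qed

lemma lc_greatest:
  assumes S: "char_set S" and K: "char_set K" "K = G (F K)" "K \<subseteq> S"
  shows "K \<subseteq> lc S"
proof
  fix \<zeta> assume \<zeta>: "\<zeta> \<in> K"
  have U: "\<zeta> \<in> U" using \<zeta> K(2) G_U by blast
  have "G (F (princ \<zeta>)) \<subseteq> G (F K)" by (rule GF_princ_mono[OF princ_subset[OF K(1) \<zeta>] char_set_princ[OF U_c0[OF U]] K(1)])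
  then show "\<zeta> \<in> lc S" using U K by (auto simp: lc_def)
qed

lemma lc_of_closed:
  assumes "char_set K" "K = G (F K)" shows "lc K = K"
  using lc_subset[OF assms(1)] lc_greatest[OF assms(1) assms] by blast

lemma char_so:
  assumes S: "char_set S" shows "char_set (so S)"
  unfolding char_set_def
proof (intro conjI ballI impI)
  show "so S \<subseteq> c0_star" by (auto simp: so_def)
  have z: "(\<lambda>_. 0) \<in> S \<inter> V" using char_setD(2)[OF S] char_setD(2)[OF char_V] by simp
  then show "(\<lambda>_. 0) \<in> so S"
    using c0_star_zero dominated_le[of "\<lambda>_. 0" 0] by (auto simp: so_def)
next
  fix \<xi> \<xi>' assume "\<xi> \<in> so S" "\<xi>' \<in> so S"
  then obtain \<eta> \<eta>' where \<eta>: "\<xi> \<in> c0_star" "\<eta> \<in> S" "\<eta> \<in> V" "dominated \<xi> (mu \<eta>)"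
    and \<eta>': "\<xi>' \<in> c0_star" "\<eta>' \<in> S" "\<eta>' \<in> V" "dominated \<xi>' (mu \<eta>')" by (auto simp: so_def)
  define \<theta> where "\<theta> = (\<lambda>n. \<eta> n + \<eta>' n)"
  have \<theta>: "\<theta> \<in> S" "\<theta> \<in> V"
    unfolding \<theta>_def using char_setD(3)[OF S \<eta>(2) \<eta>'(2)] char_setD(3)[OF char_V \<eta>(3) \<eta>'(3)] by auto
  have le: "\<eta> n \<le> \<theta> n" "\<eta>' n \<le> \<theta> n" for n
    using c0_starD(1)[OF V_c0[OF \<eta>(3)]] c0_starD(1)[OF V_c0[OF \<eta>'(3)]] by (auto simp: \<theta>_def)
  have "dominated (mu \<eta>) (mu \<theta>)"
    by (rule dominated_le[where M=1]) (simp add: mu_mono[OF \<eta>(3) \<theta>(2) le(1)])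
  then have 1: "dominated \<xi> (mu \<theta>)" by (rule dominated_trans[OF \<eta>(4) _ mu_c0[OF \<eta>(3)] mu_c0[OF \<theta>(2)]])
  have "dominated (mu \<eta>') (mu \<theta>)"
    by (rule dominated_le[where M=1]) (simp add: mu_mono[OF \<eta>'(3) \<theta>(2) le(2)])
  then have 2: "dominated \<xi>' (mu \<theta>)" by (rule dominated_trans[OF \<eta>'(4) _ mu_c0[OF \<eta>'(3)] mu_c0[OF \<theta>(2)]])
  show "(\<lambda>n. \<xi> n + \<xi>' n) \<in> so S"
    using dominated_add[OF 1 2 mu_c0[OF \<theta>(2)]] c0_star_add[OF \<eta>(1) \<eta>'(1)] \<theta> by (auto simp: so_def)
next
  fix \<xi> \<zeta> assume "\<xi> \<in> so S" and \<zeta>: "\<zeta> \<in> c0_star" "dominated \<zeta> \<xi>"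
  then obtain \<eta> where \<eta>: "\<xi> \<in> c0_star" "\<eta> \<in> S" "\<eta> \<in> V" "dominated \<xi> (mu \<eta>)" by (auto simp: so_def)
  show "\<zeta> \<in> so S"
    using dominated_trans[OF \<zeta>(2) \<eta>(4) \<eta>(1) mu_c0[OF \<eta>(3)]] \<zeta>(1) \<eta> by (auto simp: so_def)
qed

lemma subset_so: "S \<inter> V \<subseteq> so S"
proof
  fix \<eta> assume \<eta>: "\<eta> \<in> S \<inter> V"
  then have "dominated \<eta> (mu \<eta>)" by (intro dominated_le[where M=1]) (simp add: mu_ge)
  then show "\<eta> \<in> so S" using \<eta> V_c0 by (auto simp: so_def)
qed

lemma so_least:
  assumes T: "char_set T" "F (G T) = T" and ST: "S \<inter> V \<subseteq> T"
  shows "so S \<subseteq> T"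
proof
  fix \<zeta> assume "\<zeta> \<in> so S"
  then obtain \<eta> where \<eta>: "\<zeta> \<in> c0_star" "\<eta> \<in> S" "\<eta> \<in> V" "dominated \<zeta> (mu \<eta>)" by (auto simp: so_def)
  have "\<eta> \<in> F (G T)" using \<eta> ST T(2) by blast
  then obtain \<rho> M where \<rho>: "\<rho> \<in> G T" "\<rho> \<in> U" "M > 0" "\<And>n. \<eta> n \<le> M * a \<rho> n" by (rule FE) blast
  \<comment> \<open>Openness of \<open>T\<close> puts \<eta> below a multiple of the mean of \<rho>,
    and this mean lies in \<open>T\<close>; by minimality \<open>mu \<eta>\<close> is below the same
    multiple.\<close>
  have "mu \<eta> \<in> T"
    by (rule char_set_le[OF T(1) a_G[OF T(1) \<rho>(1)] mu_c0[OF \<eta>(3)] mu_least[OF \<eta>(3) \<rho>(2-4)]])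
  then show "\<zeta> \<in> T" by (rule char_setD(4)[OF T(1) _ \<eta>(1,4)])
qed

lemma so_open: assumes S: "char_set S" shows "F (G (so S)) = so S"
proof
  show "F (G (so S)) \<subseteq> so S" by (rule FG_subset[OF char_so[OF S]])
  show "so S \<subseteq> F (G (so S))"
  proof
    fix \<zeta> assume \<zeta>: "\<zeta> \<in> so S"
    then obtain \<eta> where \<eta>: "\<zeta> \<in> c0_star" "\<eta> \<in> S" "\<eta> \<in> V" "dominated \<zeta> (mu \<eta>)" by (auto simp: so_def)
    obtain \<rho> where \<rho>: "\<rho> \<in> U" "dominated (a \<rho>) (mu \<eta>)" "dominated (mu \<eta>) (a \<rho>)" using mu_mean[OF \<eta>(3)] by blast
    have a: "a \<rho> \<in> so S" using \<rho>(2) \<eta>(2,3) a_c0[OF \<rho>(1)] by (auto simp: so_def)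
    show "\<zeta> \<in> F (G (so S))"
    proof (cases "so S = {\<lambda>_. 0}")
      case True
      then show ?thesis using \<zeta> char_setD(2)[OF char_F[OF char_G[OF char_so[OF S]]]] by auto
    next
      case False
      have "\<rho> \<in> G (so S)" by (rule GI[OF False \<rho>(1) a])
      then have "a \<rho> \<in> F (G (so S))" by (rule a_in_F[OF _ \<rho>(1)])
      then show ?thesis
        by (rule char_setD(4)[OF char_F[OF char_G[OF char_so[OF S]]] _ \<eta>(1)
          dominated_trans[OF \<eta>(4) \<rho>(3) mu_c0[OF \<eta>(3)] a_c0[OF \<rho>(1)]]])
    qed
  qed
qed

lemma so_mono: "S \<inter> V \<subseteq> T \<Longrightarrow> so S \<subseteq> so T"
  unfolding so_def by blast

lemma so_of_open:
  assumes T: "char_set T" "F (G T) = T" shows "so T = T"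
proof -
  have "T \<subseteq> V" using F_V[of "G T"] T(2) by simp
  then show ?thesis using subset_so[of T] so_least[OF T, of T] by blast
qed

end

text \<open>The analytic facts on principal sets. Two of them serve twice:
  \<open>stable_pre_cancel\<close> for pre-means and for largest closed subsets,
  \<open>closed_imp_stable\<close> for means and for largest closed subsets.\<close>

locale mean_cancellation = mean_theory +
  assumes stable_pre_cancel: "\<xi> \<in> c0_star \<Longrightarrow> \<xi> 0 > 0 \<Longrightarrow> princ \<xi> = G (princ \<xi>) \<Longrightarrow> char_set J \<Longrightarrow>
      princ \<xi> \<subseteq> J \<Longrightarrow> G J \<subseteq> princ \<xi> \<Longrightarrow> J \<subseteq> princ \<xi>"
    and stable_mean_cancel: "\<xi> \<in> c0_star \<Longrightarrow> \<xi> 0 > 0 \<Longrightarrow> princ \<xi> = G (princ \<xi>) \<Longrightarrow> char_set J \<Longrightarrow>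
      F J = princ \<xi> \<Longrightarrow> J = princ \<xi>"
    and stable_open_cancel: "\<xi> \<in> c0_star \<Longrightarrow> \<xi> 0 > 0 \<Longrightarrow> princ \<xi> = G (princ \<xi>) \<Longrightarrow> char_set J \<Longrightarrow>
      so J = princ \<xi> \<Longrightarrow> J = princ \<xi>"
    and closed_imp_stable: "\<xi> \<in> c0_star \<Longrightarrow> \<xi> 0 > 0 \<Longrightarrow> princ \<xi> = G (F (princ \<xi>)) \<Longrightarrow> princ \<xi> = G (princ \<xi>)"
    and open_unstable_pre: "\<xi> \<in> c0_star \<Longrightarrow> \<xi> 0 > 0 \<Longrightarrow> princ \<xi> = F (G (princ \<xi>)) \<Longrightarrow> princ \<xi> \<noteq> G (princ \<xi>) \<Longrightarrow>
      \<exists>J. char_set J \<and> G J = G (princ \<xi>) \<and> J \<noteq> princ \<xi>"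
    and open_unstable_open: "\<xi> \<in> c0_star \<Longrightarrow> \<xi> 0 > 0 \<Longrightarrow> princ \<xi> = F (G (princ \<xi>)) \<Longrightarrow> princ \<xi> \<noteq> G (princ \<xi>) \<Longrightarrow>
      \<exists>J. char_set J \<and> so J = so (princ \<xi>) \<and> J \<noteq> princ \<xi>"
begin

section \<open>Stability and the four cancellation properties\<close>

lemma stable_iff_pre_cancel:
  assumes \<xi>: "\<xi> \<in> c0_star" "\<xi> 0 > 0"
  shows "princ \<xi> = G (princ \<xi>) \<longleftrightarrow> (\<forall>J. char_set J \<longrightarrow> G J = G (princ \<xi>) \<longrightarrow> J = princ \<xi>)"
proof (intro iffI allI impI)
  fix J assume st: "princ \<xi> = G (princ \<xi>)" and J: "char_set J" "G J = G (princ \<xi>)"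
  have "princ \<xi> \<subseteq> J" using G_subset[OF J(1)] J(2) st by simp
  then show "J = princ \<xi>" using stable_pre_cancel[OF \<xi> st J(1)] J(2) st by auto
next
  assume H: "\<forall>J. char_set J \<longrightarrow> G J = G (princ \<xi>) \<longrightarrow> J = princ \<xi>"
  note P = char_set_princ[OF \<xi>(1)]
  have "F (G (princ \<xi>)) = princ \<xi>" using H char_F[OF char_G[OF P]] GFG[OF P] by blast
  then show "princ \<xi> = G (princ \<xi>)" using open_unstable_pre[OF \<xi>] H by metis
qed

lemma stable_iff_mean_cancel:
  assumes \<xi>: "\<xi> \<in> c0_star" "\<xi> 0 > 0"
  shows "princ \<xi> = G (princ \<xi>) \<longleftrightarrow> (\<forall>J. char_set J \<longrightarrow> F J = F (princ \<xi>) \<longrightarrow> J = princ \<xi>)"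
proof (intro iffI allI impI)
  note P = char_set_princ[OF \<xi>(1)]
  fix J assume st: "princ \<xi> = G (princ \<xi>)" and J: "char_set J" "F J = F (princ \<xi>)"
  then show "J = princ \<xi>" using stable_mean_cancel[OF \<xi> st J(1)] stable_imp_open_closed(1)[OF P st] by simp
next
  assume H: "\<forall>J. char_set J \<longrightarrow> F J = F (princ \<xi>) \<longrightarrow> J = princ \<xi>"
  note P = char_set_princ[OF \<xi>(1)]
  have "G (F (princ \<xi>)) = princ \<xi>" using H char_G[OF char_F[OF P]] FGF[OF P] by blast
  then show "princ \<xi> = G (princ \<xi>)" using closed_imp_stable[OF \<xi>] by simp
qed

lemma stable_iff_open_cancel:
  assumes \<xi>: "\<xi> \<in> c0_star" "\<xi> 0 > 0"
  shows "princ \<xi> = G (princ \<xi>) \<longleftrightarrow> (\<forall>J. char_set J \<longrightarrow> so J = so (princ \<xi>) \<longrightarrow> J = princ \<xi>)"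
proof (intro iffI allI impI)
  note P = char_set_princ[OF \<xi>(1)]
  fix J assume st: "princ \<xi> = G (princ \<xi>)" and J: "char_set J" "so J = so (princ \<xi>)"
  then show "J = princ \<xi>"
    using stable_open_cancel[OF \<xi> st J(1)] so_of_open[OF P stable_imp_open_closed(3)[OF P st]] by simp
next
  assume H: "\<forall>J. char_set J \<longrightarrow> so J = so (princ \<xi>) \<longrightarrow> J = princ \<xi>"
  note P = char_set_princ[OF \<xi>(1)]
  have "so (so (princ \<xi>)) = so (princ \<xi>)" by (rule so_of_open[OF char_so[OF P] so_open[OF P]])
  then have "so (princ \<xi>) = princ \<xi>" using H char_so[OF P] by blast
  then have "F (G (princ \<xi>)) = princ \<xi>" using so_open[OF P] by simp
  then show "princ \<xi> = G (princ \<xi>)" using open_unstable_open[OF \<xi>] H by metis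
qed

lemma stable_iff_closed_cancel:
  assumes \<xi>: "\<xi> \<in> c0_star" "\<xi> 0 > 0"
  shows "princ \<xi> = G (princ \<xi>) \<longleftrightarrow> (\<forall>J. char_set J \<longrightarrow> lc J = lc (princ \<xi>) \<longrightarrow> J = princ \<xi>)"
proof (intro iffI allI impI)
  note P = char_set_princ[OF \<xi>(1)]
  fix J assume st: "princ \<xi> = G (princ \<xi>)" and J: "char_set J" "lc J = lc (princ \<xi>)"
  have lcJ: "lc J = princ \<xi>" using lc_of_closed[OF P] stable_imp_open_closed(2)[OF P st] J(2) by simp
  then have "princ \<xi> \<subseteq> J" using lc_subset[OF J(1)] by simp
  \<comment> \<open>\<open>G J\<close> is closed and lies in \<open>J\<close>, hence in
    \<open>lc J\<close>; this reduces the case to the cancellation of pre-means.\<close>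
  moreover have "G J \<subseteq> princ \<xi>"
    using lc_greatest[OF J(1) char_G[OF J(1)] GFG[OF J(1), symmetric] G_subset[OF J(1)]] lcJ by simp
  ultimately show "J = princ \<xi>" using stable_pre_cancel[OF \<xi> st J(1)] by blast
next
  assume H: "\<forall>J. char_set J \<longrightarrow> lc J = lc (princ \<xi>) \<longrightarrow> J = princ \<xi>"
  note P = char_set_princ[OF \<xi>(1)]
  have "lc (lc (princ \<xi>)) = lc (princ \<xi>)" by (rule lc_of_closed[OF char_lc[OF P] lc_closed[OF P, symmetric]])
  then have "lc (princ \<xi>) = princ \<xi>" using H char_lc[OF P] by blast
  then show "princ \<xi> = G (princ \<xi>)" using closed_imp_stable[OF \<xi>] lc_closed[OF P] by simp
qed

end

subsection \<open>Transfer to operator ideals\<close>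

text \<open>\<open>W\<close> is the operator side of \<open>V\<close>. It enters only through
  intersections with ideals, because for the arithmetic mean it is the set of all operators, which
  is not an ideal.\<close>

locale ideal_mean_cancellation = mean_cancellation + infinite_dimensional_hilbert hilbert_type
  for hilbert_type :: "'h::chilbert_space itself" +
  fixes pre up :: "('h \<Rightarrow>\<^sub>L 'h) set \<Rightarrow> ('h \<Rightarrow>\<^sub>L 'h) set" and W :: "('h \<Rightarrow>\<^sub>L 'h) set"
  assumes pre: "is_ideal I \<Longrightarrow> pre I = ideal_with (G (Sig I))"
    and up: "is_ideal I \<Longrightarrow> up I = ideal_with (F (Sig I))"
    and W: "is_ideal I \<Longrightarrow> is_ideal (I \<inter> W)" "is_ideal I \<Longrightarrow> Sig (I \<inter> W) = Sig I \<inter> V"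
begin

lemma pre_ideal: "is_ideal I \<Longrightarrow> is_ideal (pre I)" "is_ideal I \<Longrightarrow> Sig (pre I) = G (Sig I)"
  using pre ideal_with[OF char_G[OF char_set_Sig]] by auto

lemma up_ideal: "is_ideal I \<Longrightarrow> is_ideal (up I)" "is_ideal I \<Longrightarrow> Sig (up I) = F (Sig I)"
  using up ideal_with[OF char_F[OF char_set_Sig]] by auto

lemma largest_closed:
  assumes J: "is_ideal J"
  shows "(GREATEST L. (is_ideal L \<and> L = pre (up L)) \<and> L \<subseteq> J) = ideal_with (lc (Sig J))"
proof (rule Greatest_equality)
  note c = char_set_Sig[OF J]
  let ?L = "ideal_with (lc (Sig J)) :: ('h \<Rightarrow>\<^sub>L 'h) set"
  note i = ideal_with[OF char_lc[OF c]]
  have "?L = pre (up (?L))"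
    by (subst Sig_eq_iff[symmetric]) (simp_all add: pre_ideal up_ideal i lc_closed[OF c])
  moreover have "?L \<subseteq> J"
    by (subst Sig_subset_iff[symmetric]) (simp_all add: i J lc_subset[OF c])
  ultimately show "(is_ideal (?L) \<and> ?L = pre (up (?L))) \<and>
      ?L \<subseteq> J"
    by (intro conjI i(1))
  fix L assume L: "(is_ideal L \<and> L = pre (up L)) \<and> L \<subseteq> J"
  then have "Sig L = G (F (Sig L))" using pre_ideal(2)[OF up_ideal(1), of L] up_ideal(2)[of L] by metis
  moreover have "Sig L \<subseteq> Sig J" using Sig_subset_iff[of L J] L J by simp
  ultimately have "Sig L \<subseteq> lc (Sig J)" using lc_greatest[OF c char_set_Sig, of L] L by blast
  then show "L \<le> ?L"
    using Sig_subset_iff[of L ?L] i L by simp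
qed

lemma smallest_open:
  assumes J: "is_ideal J"
  shows "(LEAST L. (is_ideal L \<and> L = up (pre L)) \<and> J \<inter> W \<subseteq> L) = ideal_with (so (Sig J))"
proof (rule Least_equality)
  note c = char_set_Sig[OF J]
  let ?L = "ideal_with (so (Sig J)) :: ('h \<Rightarrow>\<^sub>L 'h) set"
  note i = ideal_with[OF char_so[OF c]]
  have "?L = up (pre (?L))"
    by (subst Sig_eq_iff[symmetric]) (simp_all add: pre_ideal up_ideal i so_open[OF c])
  moreover have "J \<inter> W \<subseteq> ?L"
    by (subst Sig_subset_iff[symmetric]) (simp_all add: i J W subset_so)
  ultimately show "(is_ideal (?L) \<and> ?L = up (pre (?L))) \<and>
      J \<inter> W \<subseteq> ?L"
    by (intro conjI i(1))
  fix L assume L: "(is_ideal L \<and> L = up (pre L)) \<and> J \<inter> W \<subseteq> L"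
  then have "F (G (Sig L)) = Sig L" using up_ideal(2)[OF pre_ideal(1), of L] pre_ideal(2)[of L] by metis
  moreover have "Sig J \<inter> V \<subseteq> Sig L" using Sig_subset_iff[of "J \<inter> W" L] L J W by simp
  ultimately have "so (Sig J) \<subseteq> Sig L" using so_least[OF char_set_Sig, of L] L by blast
  then show "?L \<le> L"
    using Sig_subset_iff[of ?L L] i L by simp
qed

lemma principal_Sig:
  assumes "principal_ideal (I :: ('h \<Rightarrow>\<^sub>L 'h) set)"
  obtains \<xi> where "is_ideal I" "\<xi> \<in> c0_star" "Sig I = princ \<xi>"
proof -
  obtain X where X: "X \<in> compact_ops" "I = is_ideal hull {X}" using assms by (auto simp: principal_ideal_def)
  define \<xi> where "\<xi> = s_numbers X"
  have \<xi>: "\<xi> \<in> c0_star" unfolding \<xi>_def by (rule s_numbers_c0_star[OF inf X(1)])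
  note i = ideal_with[OF char_set_princ[OF \<xi>]]
  have "is_ideal hull {X} = ideal_with (princ \<xi>)"
  proof (rule hull_unique)
    show "{X} \<subseteq> ideal_with (princ \<xi>)"
      using ideal_mem_iff[OF i(1), of X] X(1) princ_self[OF \<xi>] i(2) by (simp add: \<xi>_def)
    show "is_ideal (ideal_with (princ \<xi>) :: ('h \<Rightarrow>\<^sub>L 'h) set)" by (rule i(1))
    fix K :: "('h \<Rightarrow>\<^sub>L 'h) set" assume K: "{X} \<subseteq> K" "is_ideal K"
    then have "\<xi> \<in> Sig K" by (auto simp: Sig_def \<xi>_def)
    then have "princ \<xi> \<subseteq> Sig K" by (rule princ_subset[OF char_set_Sig[OF K(2)]])
    then show "ideal_with (princ \<xi>) \<subseteq> K" using Sig_subset_iff[OF i(1) K(2)] i(2) by simp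
  qed
  then show ?thesis using that \<xi> i X(2) by metis
qed

text \<open>Carries a cancellation property across the bijection between ideals and characteristic
  sets.\<close>

lemma ideal_cancel_iff:
  fixes I :: "('h \<Rightarrow>\<^sub>L 'h) set"
  assumes I: "is_ideal I" and P: "\<And>J :: ('h \<Rightarrow>\<^sub>L 'h) set. is_ideal J \<Longrightarrow> Q J \<longleftrightarrow> R (Sig J)"
  shows "(\<forall>J. is_ideal J \<longrightarrow> Q J \<longrightarrow> J = I) \<longleftrightarrow> (\<forall>S. char_set S \<longrightarrow> R S \<longrightarrow> S = Sig I)"
proof (intro iffI allI impI)
  fix S assume H: "\<forall>J. is_ideal J \<longrightarrow> Q J \<longrightarrow> J = I" and S: "char_set S" "R S"
  then have "ideal_with S = I" using P[OF ideal_with(1)[OF S(1)]] ideal_with[OF S(1)] by simp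
  then show "S = Sig I" using ideal_with(2)[OF S(1)] by metis
next
  fix J assume "\<forall>S. char_set S \<longrightarrow> R S \<longrightarrow> S = Sig I" and J: "is_ideal J" "Q J"
  then have "Sig J = Sig I" using char_set_Sig[OF J(1)] P[OF J(1)] by blast
  then show "J = I" using Sig_eq_iff[OF J(1) I] by simp
qed

lemma ideal_with_eq_iff:
  assumes "char_set S" "char_set T"
  shows "(ideal_with S :: ('h \<Rightarrow>\<^sub>L 'h) set) = ideal_with T \<longleftrightarrow> S = T"
  using ideal_with[OF assms(1)] ideal_with[OF assms(2)] by metis

theorem ideal_cancellation:
  assumes princ_I: "principal_ideal I" and nonzero: "I \<noteq> {0}"
  shows "(\<forall>J. is_ideal J \<longrightarrow> (pre J = pre I \<longleftrightarrow> up (pre J) = up (pre I))) \<and>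
    (\<forall>J. is_ideal J \<longrightarrow> (up J = up I \<longleftrightarrow> pre (up J) = pre (up I))) \<and>
    ((is_ideal I \<and> I = pre I) \<longleftrightarrow> (\<forall>J. is_ideal J \<longrightarrow> pre J = pre I \<longrightarrow> J = I)) \<and>
    ((is_ideal I \<and> I = pre I) \<longleftrightarrow> (\<forall>J. is_ideal J \<longrightarrow> up J = up I \<longrightarrow> J = I)) \<and>
    ((is_ideal I \<and> I = pre I) \<longleftrightarrow> (\<forall>J. is_ideal J \<longrightarrow>
      (LEAST L. (is_ideal L \<and> L = up (pre L)) \<and> J \<inter> W \<subseteq> L) =
      (LEAST L. (is_ideal L \<and> L = up (pre L)) \<and> I \<inter> W \<subseteq> L) \<longrightarrow> J = I)) \<and>
    ((is_ideal I \<and> I = pre I) \<longleftrightarrow> (\<forall>J. is_ideal J \<longrightarrow>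
      (GREATEST L. (is_ideal L \<and> L = pre (up L)) \<and> L \<subseteq> J) =
      (GREATEST L. (is_ideal L \<and> L = pre (up L)) \<and> L \<subseteq> I) \<longrightarrow> J = I))"
proof -
  obtain \<xi> where I: "is_ideal I" and \<xi>: "\<xi> \<in> c0_star" and Sig_I: "Sig I = princ \<xi>" by (rule principal_Sig[OF princ_I])
  have "princ \<xi> \<noteq> {\<lambda>_. 0}" using Sig_eq_iff[OF I zero_ideal(1)] zero_ideal(2) nonzero Sig_I by simp
  then have "\<xi> \<noteq> (\<lambda>_. 0)" using princ_zero by auto
  then have \<xi>0: "\<xi> 0 > 0" by (rule c0_star_pos_0[OF \<xi>])
  have pre_eq: "pre J = pre I \<longleftrightarrow> G (Sig J) = G (princ \<xi>)" if "is_ideal J" for J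
    using Sig_eq_iff[OF pre_ideal(1)[OF that] pre_ideal(1)[OF I]] pre_ideal(2)[OF that] pre_ideal(2)[OF I] Sig_I by simp
  have up_eq: "up J = up I \<longleftrightarrow> F (Sig J) = F (princ \<xi>)" if "is_ideal J" for J
    using Sig_eq_iff[OF up_ideal(1)[OF that] up_ideal(1)[OF I]] up_ideal(2)[OF that] up_ideal(2)[OF I] Sig_I by simp
  have uppre_eq: "up (pre J) = up (pre I) \<longleftrightarrow> F (G (Sig J)) = F (G (princ \<xi>))" if "is_ideal J" for J
    using Sig_eq_iff[OF up_ideal(1)[OF pre_ideal(1)[OF that]] up_ideal(1)[OF pre_ideal(1)[OF I]]]
    by (simp add: up_ideal(2)[OF pre_ideal(1)] pre_ideal(2) that I Sig_I)
  have preup_eq: "pre (up J) = pre (up I) \<longleftrightarrow> G (F (Sig J)) = G (F (princ \<xi>))" if "is_ideal J" for J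
    using Sig_eq_iff[OF pre_ideal(1)[OF up_ideal(1)[OF that]] pre_ideal(1)[OF up_ideal(1)[OF I]]]
    by (simp add: pre_ideal(2)[OF up_ideal(1)] up_ideal(2) that I Sig_I)
  have st: "(is_ideal I \<and> I = pre I) \<longleftrightarrow> princ \<xi> = G (princ \<xi>)"
    using Sig_eq_iff[OF I pre_ideal(1)[OF I]] pre_ideal(2)[OF I] Sig_I I by simp
  note cI = char_set_Sig[OF I, unfolded Sig_I]
  show ?thesis
  proof (intro conjI allI impI)
    fix J :: "('h \<Rightarrow>\<^sub>L 'h) set" assume J: "is_ideal J"
    show "pre J = pre I \<longleftrightarrow> up (pre J) = up (pre I)"
      unfolding pre_eq[OF J] uppre_eq[OF J] by (rule G_eq_iff[OF char_set_Sig[OF J] cI])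
    show "up J = up I \<longleftrightarrow> pre (up J) = pre (up I)"
      unfolding up_eq[OF J] preup_eq[OF J] by (rule F_eq_iff[OF char_set_Sig[OF J] cI])
  next
    show "(is_ideal I \<and> I = pre I) \<longleftrightarrow> (\<forall>J. is_ideal J \<longrightarrow> pre J = pre I \<longrightarrow> J = I)"
      unfolding st stable_iff_pre_cancel[OF \<xi> \<xi>0]
      using ideal_cancel_iff[where R="\<lambda>S. G S = G (princ \<xi>)", OF I pre_eq] Sig_I by simp
    show "(is_ideal I \<and> I = pre I) \<longleftrightarrow> (\<forall>J. is_ideal J \<longrightarrow> up J = up I \<longrightarrow> J = I)"
      unfolding st stable_iff_mean_cancel[OF \<xi> \<xi>0]
      using ideal_cancel_iff[where R="\<lambda>S. F S = F (princ \<xi>)", OF I up_eq] Sig_I by simp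
    have so_eq: "(LEAST L. (is_ideal L \<and> L = up (pre L)) \<and> J \<inter> W \<subseteq> L) =
      (LEAST L. (is_ideal L \<and> L = up (pre L)) \<and> I \<inter> W \<subseteq> L) \<longleftrightarrow> so (Sig J) = so (princ \<xi>)" if J: "is_ideal J" for J :: "('h \<Rightarrow>\<^sub>L 'h) set"
      unfolding smallest_open[OF J] smallest_open[OF I] Sig_I
      by (rule ideal_with_eq_iff[OF char_so[OF char_set_Sig[OF J]] char_so[OF cI]])
    show "(is_ideal I \<and> I = pre I) \<longleftrightarrow> (\<forall>J. is_ideal J \<longrightarrow>
      (LEAST L. (is_ideal L \<and> L = up (pre L)) \<and> J \<inter> W \<subseteq> L) =
      (LEAST L. (is_ideal L \<and> L = up (pre L)) \<and> I \<inter> W \<subseteq> L) \<longrightarrow> J = I)"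
      unfolding st stable_iff_open_cancel[OF \<xi> \<xi>0]
      using ideal_cancel_iff[where R="\<lambda>S. so S = so (princ \<xi>)", OF I so_eq] Sig_I by simp
    have lc_eq: "(GREATEST L. (is_ideal L \<and> L = pre (up L)) \<and> L \<subseteq> J) =
      (GREATEST L. (is_ideal L \<and> L = pre (up L)) \<and> L \<subseteq> I) \<longleftrightarrow> lc (Sig J) = lc (princ \<xi>)" if J: "is_ideal J" for J :: "('h \<Rightarrow>\<^sub>L 'h) set"
      unfolding largest_closed[OF J] largest_closed[OF I] Sig_I
      by (rule ideal_with_eq_iff[OF char_lc[OF char_set_Sig[OF J]] char_lc[OF cI]])
    show "(is_ideal I \<and> I = pre I) \<longleftrightarrow> (\<forall>J. is_ideal J \<longrightarrow>
      (GREATEST L. (is_ideal L \<and> L = pre (up L)) \<and> L \<subseteq> J) =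
      (GREATEST L. (is_ideal L \<and> L = pre (up L)) \<and> L \<subseteq> I) \<longrightarrow> J = I)"
      unfolding st stable_iff_closed_cancel[OF \<xi> \<xi>0]
      using ideal_cancel_iff[where R="\<lambda>S. lc S = lc (princ \<xi>)", OF I lc_eq] Sig_I by simp
  qed
qed

end

subsection \<open>Automatic uniformity\<close>

text \<open>A gliding hump: if uniformity failed, a weighted sum of witnesses would violate domination.\<close>

lemma uniform_domination:
  fixes C :: "(nat set \<times> real) set" and Q :: "(nat \<Rightarrow> real) set"
  defines "Q \<equiv> {\<rho>. (\<forall>n. 0 \<le> \<rho> n) \<and> antimono \<rho> \<and> (\<forall>A b. (A, b) \<in> C \<longrightarrow> sum \<rho> A \<le> b)}"
  assumes fin: "\<And>A b. (A, b) \<in> C \<Longrightarrow> finite A" and cover: "\<And>n. \<exists>A b. (A, b) \<in> C \<and> n \<in> A"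
    and \<xi>: "\<xi> \<in> c0_star" and dom: "\<And>\<rho>. \<rho> \<in> Q \<Longrightarrow> dominated \<rho> \<xi>"
  shows "\<exists>m>0. \<forall>\<rho>\<in>Q. \<forall>n. \<rho> n \<le> real m * \<xi> (n div m)"
proof (rule ccontr)
  assume not: "\<not> ?thesis"
  define w where "w = (\<lambda>k. (1 / 2 :: real) ^ Suc k)"
  \<comment> \<open>As \<open>w k * c k = Suc k\<close>, the \<open>k\<close>-th witness still
    violates domination by an unbounded factor after being weighted with \<open>w k\<close>.\<close>
  define c where "c = (\<lambda>k. Suc k * 2 ^ Suc k :: nat)"
  have "\<exists>\<rho> n. \<rho> \<in> Q \<and> real (c k) * \<xi> (n div c k) < \<rho> n" for k
  proof -
    have "c k > 0" by (simp add: c_def)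
    then show ?thesis using not by (meson not_le)
  qed
  then obtain r N where r: "\<And>k. r k \<in> Q" and N: "\<And>k. real (c k) * \<xi> (N k div c k) < r k (N k)" by metis
  have r0: "0 \<le> r k n" and ranti: "antimono (r k)" and rC: "(A, b) \<in> C \<Longrightarrow> sum (r k) A \<le> b" for k n A b
    using r[of k] by (auto simp: Q_def)
  have w0: "w k > 0" for k by (simp add: w_def)
  have ws: "w sums 1" using power_half_series by (simp add: w_def)
  \<comment> \<open>A constraint covering the index \<open>n\<close> bounds all witnesses there at
    once, so the weighted series converges.\<close>
  have sm: "summable (\<lambda>k. w k * r k n)" for n
  proof -
    obtain A b where A: "(A, b) \<in> C" "n \<in> A" using cover by blast
    have "r k n \<le> b" for k
      using member_le_sum[of n A "r k"] A fin[OF A(1)] r0 rC[OF A(1), of k] by fastforce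
    then have "norm (w k * r k n) \<le> w k * b" for k using w0[of k] r0[of k n] by simp
    moreover have "summable (\<lambda>k. w k * b)" using ws by (intro summable_mult2) (simp add: sums_iff)
    ultimately show ?thesis by (rule summable_comparison_test'[where N=0, rotated])
  qed
  define \<sigma> where "\<sigma> = (\<lambda>n. \<Sum>k. w k * r k n)"
  \<comment> \<open>The weights add up to \<open>1\<close> and each constraint is a finite sum, so
    \<open>Q\<close> is closed under this infinite convex combination.\<close>
  have "\<sigma> \<in> Q"
    unfolding Q_def mem_Collect_eq
  proof (intro conjI allI impI)
    show "0 \<le> \<sigma> n" for n unfolding \<sigma>_def by (rule suminf_nonneg[OF sm]) (use w0 r0 in \<open>simp add: less_imp_le\<close>)
    show "antimono \<sigma>"
    proof (rule antimonoI)
      fix m n :: nat assume "m \<le> n"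
      then show "\<sigma> n \<le> \<sigma> m"
        unfolding \<sigma>_def by (intro suminf_le sm mult_left_mono antimonoD[OF ranti] less_imp_le[OF w0])
    qed
    fix A b assume A: "(A, b) \<in> C"
    have "sum \<sigma> A = (\<Sum>k. \<Sum>n\<in>A. w k * r k n)" unfolding \<sigma>_def by (rule suminf_sum[symmetric]) (rule sm)
    also have "\<dots> \<le> (\<Sum>k. w k * b)"
    proof (rule suminf_le)
      show "(\<Sum>n\<in>A. w k * r k n) \<le> w k * b" for k
        unfolding sum_distrib_left[symmetric] by (rule mult_left_mono[OF rC[OF A]]) (use w0[of k] in simp)
      show "summable (\<lambda>k. \<Sum>n\<in>A. w k * r k n)" by (rule summable_sum) (rule sm)
      show "summable (\<lambda>k. w k * b)" using ws by (intro summable_mult2) (simp add: sums_iff)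
    qed
    also have "\<dots> = b" using ws suminf_mult2[of w b] by (simp add: sums_iff)
    finally show "sum \<sigma> A \<le> b" .
  qed
  then obtain m M where m: "m > 0" "M > 0" "\<And>n. \<sigma> n \<le> M * \<xi> (n div m)" by (rule dominatedE[OF dom \<xi>]) blast
  obtain k :: nat where k: "m \<le> k" "M \<le> real k" using real_arch_simple[of "max M (real m)"] by auto
  have kc: "k \<le> c k"
  proof -
    have "k * 1 \<le> Suc k * 2 ^ Suc k" by (intro mult_mono) auto
    then show ?thesis by (simp add: c_def)
  qed
  have "\<sigma> (N k) \<le> M * \<xi> (N k div m)" by (rule m(3))
  also have "\<dots> \<le> real (Suc k) * \<xi> (N k div c k)"
  proof (rule mult_mono)
    show "\<xi> (N k div m) \<le> \<xi> (N k div c k)" by (rule c0_star_div_le[OF \<xi> m(1)]) (use k kc in simp)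
  qed (use k c0_starD(1)[OF \<xi>] in auto)
  also have "\<dots> = w k * (real (c k) * \<xi> (N k div c k))"
    by (simp add: w_def c_def power_one_over field_simps)
  also have "\<dots> < w k * r k (N k)" by (rule mult_strict_left_mono[OF N w0])
  also have "\<dots> = (\<Sum>j\<in>{k}. w j * r j (N k))" by simp
  also have "\<dots> \<le> \<sigma> (N k)"
    unfolding \<sigma>_def by (rule sum_le_suminf[OF sm]) (use w0 r0 in \<open>auto simp: less_imp_le\<close>)
  finally show False by simp
qed

subsection \<open>Flat blocks\<close>

text \<open>\<open>p\<close> and \<open>q\<close> round an index to the left and right end of its
  block and fix all indices that are in no block. The ratio of right to left end grows with
  \<open>k\<close>, so no fixed ampliation crosses all blocks, while \<open>R\<close> changes by at
  most the factor 2 on each.\<close>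

lemma flat_blocks:
  fixes R :: "nat \<Rightarrow> real"
  assumes R0: "\<And>n. 0 \<le> R n"
    and flat: "\<And>K N. \<exists>s\<ge>N. \<forall>i\<in>{s..K * Suc s + 1}. \<forall>j\<in>{s..K * Suc s + 1}. R i \<le> 2 * R j"
  obtains p q :: "nat \<Rightarrow> nat" where "mono p" "mono q" "\<And>l. p l \<le> l" "\<And>l. l \<le> q l"
    "\<And>l. p (p l) = p l" "\<And>l. p (q l) = q l" "\<And>l. q (p l) = p l" "\<And>l. q (q l) = q l"
    "\<And>l. R (p l) \<le> 2 * R l" "\<And>l. R l \<le> 2 * R (p l)" "\<And>l. R (q l) \<le> 2 * R l" "\<And>l. R l \<le> 2 * R (q l)"
    "\<And>k. \<exists>s. (\<forall>i. s \<le> i \<longrightarrow> i \<le> Suc k * Suc s \<longrightarrow> p i = s) \<and>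
       (\<forall>i. s < i \<longrightarrow> i \<le> Suc k * Suc s + 1 \<longrightarrow> q i = Suc k * Suc s + 1) \<and>
       (\<forall>i\<in>{s..Suc k * Suc s + 1}. \<forall>j\<in>{s..Suc k * Suc s + 1}. R i \<le> 2 * R j)"
proof -
  define P where "P = (\<lambda>K N s. N \<le> s \<and> (\<forall>i\<in>{s..K * Suc s + 1}. \<forall>j\<in>{s..K * Suc s + 1}. R i \<le> 2 * R j))"
  have "\<exists>s. P K N s" for K N using flat[of N K] unfolding P_def by blast
  then obtain S where P: "\<And>K N. P K N (S K N)" by metis
  have S: "\<And>K N. S K N \<ge> N"
    "\<And>K N i j. i \<in> {S K N..K * Suc (S K N) + 1} \<Longrightarrow> j \<in> {S K N..K * Suc (S K N) + 1} \<Longrightarrow> R i \<le> 2 * R j"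
    using P unfolding P_def by blast+
  \<comment> \<open>The left ends: each block starts beyond the right end of the previous one and
    has a larger ratio.\<close>
  define f where "f = rec_nat (S 1 0) (\<lambda>k x. S (Suc (Suc k)) (Suc k * Suc x + 2))"
  define e where "e = (\<lambda>k. Suc k * Suc (f k) + 1)"
  have f0: "f 0 = S 1 0" and fS: "f (Suc k) = S (Suc (Suc k)) (e k + 1)" for k
    by (simp_all add: f_def e_def)
  have Rf: "R i \<le> 2 * R j" if "i \<in> {f k..e k}" "j \<in> {f k..e k}" for k i j
  proof (cases k)
    case 0
    show ?thesis by (rule S(2)[of _ 1 0]) (use that in \<open>simp_all add: 0 f0 e_def\<close>)
  next
    case (Suc k')
    show ?thesis
      by (rule S(2)[of _ "Suc (Suc k')" "e k' + 1"]) (use that in \<open>simp_all only: Suc fS e_def\<close>)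
  qed
  have fe: "f k < e k" for k by (simp add: e_def)
  have ef: "e k < f (Suc k)" for k using S(1)[of "e k + 1" "Suc (Suc k)"] by (simp add: fS)
  have efl: "e j < f k" if "j < k" for j k
    using that
  proof (induction k)
    case (Suc k)
    show ?case
    proof (cases "j = k")
      case True then show ?thesis using ef by simp
    next
      case False
      then have "e j < f k" using Suc by simp
      also have "\<dots> < f (Suc k)" using fe[of k] ef[of k] by simp
      finally show ?thesis .
    qed
  qed simp
  \<comment> \<open>\<open>B\<close> consists of the indices that are not interior to a block.
    Rounding down or up to \<open>B\<close> makes monotonicity and the projection identities
    immediate.\<close>
  define B where "B = {x. \<forall>k. \<not> (f k < x \<and> x < e k)}"
  have B0: "0 \<in> B" by (simp add: B_def)
  have Bf: "f k \<in> B" for k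
  proof -
    have "\<not> (f j < f k \<and> f k < e j)" for j
      by (cases j k rule: linorder_cases) (use efl[of j k] efl[of k j] fe[of k] in auto)
    then show ?thesis by (simp add: B_def)
  qed
  have Be: "e k \<in> B" for k
  proof -
    have "\<not> (f j < e k \<and> e k < e j)" for j
      by (cases j k rule: linorder_cases) (use efl[of j k] efl[of k j] fe[of k] in auto)
    then show ?thesis by (simp add: B_def)
  qed
  have e_ge: "k \<le> e k" for k by (simp add: e_def)
  define p where "p = (\<lambda>l. GREATEST x. x \<le> l \<and> x \<in> B)"
  define q where "q = (\<lambda>l. LEAST x. l \<le> x \<and> x \<in> B)"
  have p: "p l \<le> l \<and> p l \<in> B" for l
    unfolding p_def by (rule GreatestI_nat[of "\<lambda>x. x \<le> l \<and> x \<in> B" 0 l]) (use B0 in auto)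
  have p_ge: "x \<le> p l" if "x \<le> l" "x \<in> B" for x l
    unfolding p_def by (rule Greatest_le_nat[of "\<lambda>x. x \<le> l \<and> x \<in> B" x l]) (use that in auto)
  have q: "l \<le> q l \<and> q l \<in> B" for l
    unfolding q_def by (rule LeastI[of "\<lambda>x. l \<le> x \<and> x \<in> B" "e l"]) (use Be e_ge in auto)
  have q_le: "q l \<le> x" if "l \<le> x" "x \<in> B" for x l
    unfolding q_def by (rule Least_le) (use that in auto)
  have pB: "p x = x" and qB: "q x = x" if "x \<in> B" for x
    using p[of x] p_ge[OF _ that, of x] q[of x] q_le[OF _ that, of x] by auto
  have p_block: "p i = f k" if "f k \<le> i" "i < e k" for i k
  proof (rule antisym)
    show "f k \<le> p i" by (rule p_ge[OF that(1) Bf])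
    have "\<not> (f k < p i \<and> p i < e k)" using p[of i] by (simp add: B_def)
    then show "p i \<le> f k" using p[of i] that by linarith
  qed
  have q_block: "q i = e k" if "f k < i" "i \<le> e k" for i k
  proof (rule antisym)
    show "q i \<le> e k" by (rule q_le[OF that(2) Be])
    have "\<not> (f k < q i \<and> q i < e k)" using q[of i] by (simp add: B_def)
    then show "e k \<le> q i" using q[of i] that by linarith
  qed
  have Rpq: "R (p l) \<le> 2 * R l \<and> R l \<le> 2 * R (p l) \<and> R (q l) \<le> 2 * R l \<and> R l \<le> 2 * R (q l)" for l
  proof (cases "l \<in> B")
    case True
    then show ?thesis using R0[of l] by (simp add: pB qB)
  next
    case False
    then obtain k where k: "f k < l" "l < e k" by (auto simp: B_def)
    then have "p l = f k" "q l = e k" using p_block[of k l] q_block[of k l] by auto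
    then show ?thesis using k Rf[of _ k] fe[of k] by simp
  qed
  show ?thesis
  proof (rule that[of p q])
    show "mono p" by (rule monoI) (use p p_ge order_trans in blast)
    show "mono q" by (rule monoI) (use q q_le order_trans in blast)
    fix k
    show "\<exists>s. (\<forall>i. s \<le> i \<longrightarrow> i \<le> Suc k * Suc s \<longrightarrow> p i = s) \<and>
       (\<forall>i. s < i \<longrightarrow> i \<le> Suc k * Suc s + 1 \<longrightarrow> q i = Suc k * Suc s + 1) \<and>
       (\<forall>i\<in>{s..Suc k * Suc s + 1}. \<forall>j\<in>{s..Suc k * Suc s + 1}. R i \<le> 2 * R j)"
      using p_block[of k] q_block[of k] Rf[of _ k] by (intro exI[of _ "f k"]) (simp add: e_def del: mult_Suc)
  qed (use p q pB qB Rpq in auto)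
qed

text \<open>On a block \<eta> keeps the value of \<xi> at the left end. Since n times \<xi> is
  nearly constant there, \<xi> drops by about the ratio of the block, which no ampliation undoes.
  Among the points where both sequences meet, those to the right serve the pre-mean, those to the
  left the pre-mean at infinity.\<close>

lemma flat_upper:
  assumes \<xi>: "\<xi> \<in> c0_star" and pos: "\<And>n. \<xi> n > 0"
    and flat: "\<And>K N. \<exists>s\<ge>N. \<forall>i\<in>{s..K * Suc s + 1}. \<forall>j\<in>{s..K * Suc s + 1}. real (Suc i) * \<xi> i \<le> 2 * (real (Suc j) * \<xi> j)"
  obtains \<eta> where "\<eta> \<in> c0_star" "\<And>n. \<xi> n \<le> \<eta> n" "\<not> dominated \<eta> \<xi>"
    "\<And>l. \<exists>s\<le>l. \<eta> s = \<xi> s \<and> real (Suc s) * \<xi> s \<le> 2 * (real (Suc l) * \<xi> l)"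
    "\<And>l. \<exists>e\<ge>l. \<eta> e = \<xi> e \<and> real (Suc e) * \<xi> e \<le> 2 * (real (Suc l) * \<xi> l)"
proof -
  define R where "R = (\<lambda>n. real (Suc n) * \<xi> n)"
  have R0: "0 \<le> R n" for n using pos[of n] by (simp add: R_def)
  have fl: "\<exists>s\<ge>N. \<forall>i\<in>{s..K * Suc s + 1}. \<forall>j\<in>{s..K * Suc s + 1}. R i \<le> 2 * R j" for K N
    unfolding R_def by (rule flat)
  obtain p q where pq: "mono p" "\<And>l. p l \<le> l" "\<And>l. l \<le> q l" "\<And>l. p (p l) = p l" "\<And>l. p (q l) = q l"
    and Rp: "\<And>l. R (p l) \<le> 2 * R l" and Rq: "\<And>l. R (q l) \<le> 2 * R l"
    and bl: "\<And>k. \<exists>s. (\<forall>i. s \<le> i \<longrightarrow> i \<le> Suc k * Suc s \<longrightarrow> p i = s) \<and>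
       (\<forall>i. s < i \<longrightarrow> i \<le> Suc k * Suc s + 1 \<longrightarrow> q i = Suc k * Suc s + 1) \<and>
       (\<forall>i\<in>{s..Suc k * Suc s + 1}. \<forall>j\<in>{s..Suc k * Suc s + 1}. R i \<le> 2 * R j)"
    by (rule flat_blocks[of R, OF R0 fl]) blast
  define \<eta> where "\<eta> = (\<lambda>n. \<xi> (p n))"
  have "filterlim p sequentially sequentially"
    unfolding filterlim_at_top
  proof
    fix Z
    have "Z \<le> p n" if "n \<ge> q Z" for n using monoD[OF pq(1) that] pq(3)[of Z] pq(5)[of Z] by simp
    then show "\<forall>\<^sub>F n in sequentially. Z \<le> p n" using eventually_sequentially by blast
  qed
  then have "\<eta> \<longlonglongrightarrow> 0" unfolding \<eta>_def by (rule filterlim_compose[OF c0_starD(3)[OF \<xi>]])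
  then have \<eta>: "\<eta> \<in> c0_star"
    by (intro c0_starI) (use c0_starD(1,2)[OF \<xi>] monoD[OF pq(1)] in \<open>auto simp: \<eta>_def\<close>)
  have "\<not> dominated \<eta> \<xi>"
  proof
    assume "dominated \<eta> \<xi>"
    then obtain m M where m: "m > 0" "M > 0" "\<And>n. \<eta> n \<le> M * \<xi> (n div m)" by (rule dominatedE[OF _ \<xi>]) blast
    obtain k :: nat where k: "real m \<le> real k" "2 * real m * M < real k"
      using reals_Archimedean2[of "max (real m) (2 * real m * M)"] by (auto intro: less_imp_le)
    obtain s where s: "\<And>i. s \<le> i \<Longrightarrow> i \<le> Suc k * Suc s \<Longrightarrow> p i = s"
      "\<And>i j. i \<in> {s..Suc k * Suc s + 1} \<Longrightarrow> j \<in> {s..Suc k * Suc s + 1} \<Longrightarrow> R i \<le> 2 * R j"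
      using bl[of k] by blast
    \<comment> \<open>The last index that \<open>p\<close> sends to \<open>s\<close>; since
      \<open>m \<le> k\<close>, its quotient by \<open>m\<close> still lies in the block.\<close>
    define i where "i = Suc k * Suc s"
    define l where "l = i div m"
    have "p i = s" by (rule s(1)) (simp_all add: i_def)
    then have 1: "\<xi> s \<le> M * \<xi> l" using m(3)[of i] by (simp add: \<eta>_def l_def)
    have "m * Suc s \<le> i" unfolding i_def by (rule mult_right_mono) (use k in simp_all)
    then have "Suc s \<le> l" using div_le_mono[of "m * Suc s" i m] m(1) by (simp add: l_def)
    moreover have "l \<le> i" by (simp add: l_def)
    ultimately have Rl: "R l \<le> 2 * R s" by (intro s(2)) (auto simp: i_def)
    have "real k * real (Suc s) \<le> real m * real (Suc l)"
    proof -
      have "i < m * Suc l" unfolding l_def using m(1) by (metis dividend_less_div_times mult.commute mult_Suc_right add.commute)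
      moreover have "k * Suc s \<le> i" by (simp add: i_def)
      ultimately have "k * Suc s \<le> m * Suc l" by linarith
      then show ?thesis by (metis of_nat_mono of_nat_mult)
    qed
    then have "real k * real (Suc s) * \<xi> l \<le> real m * real (Suc l) * \<xi> l"
      by (rule mult_right_mono) (use pos[of l] in simp)
    also have "\<dots> = real m * R l" by (simp only: R_def mult.assoc)
    also have "\<dots> \<le> real m * (2 * R s)" by (rule mult_left_mono[OF Rl]) simp
    finally have "real k * real (Suc s) * \<xi> l \<le> real m * (2 * (real (Suc s) * \<xi> s))" by (simp only: R_def)
    then have "real (Suc s) * (real k * \<xi> l) \<le> real (Suc s) * (2 * real m * \<xi> s)" by (simp only: mult_ac)
    then have "real k * \<xi> l \<le> 2 * real m * \<xi> s" by (simp only: mult_le_cancel_left_pos of_nat_0_less_iff zero_less_Suc)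
    also have "\<dots> \<le> 2 * real m * (M * \<xi> l)" using 1 m by simp
    finally have "real k * \<xi> l \<le> (2 * real m * M) * \<xi> l" by (simp only: mult_ac)
    then show False using k(2) pos[of l] by simp
  qed
  show ?thesis
  proof (rule that[OF \<eta> _ \<open>\<not> dominated \<eta> \<xi>\<close>])
    show "\<xi> n \<le> \<eta> n" for n using c0_starD(2)[OF \<xi> pq(2)] by (simp add: \<eta>_def)
    show "\<exists>s\<le>l. \<eta> s = \<xi> s \<and> real (Suc s) * \<xi> s \<le> 2 * (real (Suc l) * \<xi> l)" for l
      using pq(2)[of l] pq(4)[of l] Rp[of l] by (intro exI[of _ "p l"]) (simp add: \<eta>_def R_def)
    show "\<exists>e\<ge>l. \<eta> e = \<xi> e \<and> real (Suc e) * \<xi> e \<le> 2 * (real (Suc l) * \<xi> l)" for l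
      using pq(3)[of l] pq(5)[of l] Rq[of l] by (intro exI[of _ "q l"]) (simp add: \<eta>_def R_def)
  qed
qed

text \<open>Now \<eta> takes the value at the right end of the block. Left meeting points serve the
  running maximum behind \<open>am_mu\<close>, right ones the supremum behind
  \<open>am_inf_mu\<close>.\<close>

lemma flat_lower:
  assumes \<xi>: "\<xi> \<in> c0_star" and pos: "\<And>n. \<xi> n > 0"
    and flat: "\<And>K N. \<exists>s\<ge>N. \<forall>i\<in>{s..K * Suc s + 1}. \<forall>j\<in>{s..K * Suc s + 1}. real (Suc i) * \<xi> i \<le> 2 * (real (Suc j) * \<xi> j)"
  obtains \<eta> where "\<eta> \<in> c0_star" "\<And>n. \<eta> n \<le> \<xi> n" "\<not> dominated \<xi> \<eta>"
    "\<And>l. \<exists>s\<le>l. \<eta> s = \<xi> s \<and> real (Suc l) * \<xi> l \<le> 2 * (real (Suc s) * \<xi> s)"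
    "\<And>l. \<exists>e\<ge>l. \<eta> e = \<xi> e \<and> real (Suc l) * \<xi> l \<le> 2 * (real (Suc e) * \<xi> e)"
proof -
  define R where "R = (\<lambda>n. real (Suc n) * \<xi> n)"
  have R0: "0 \<le> R n" for n using pos[of n] by (simp add: R_def)
  have fl: "\<exists>s\<ge>N. \<forall>i\<in>{s..K * Suc s + 1}. \<forall>j\<in>{s..K * Suc s + 1}. R i \<le> 2 * R j" for K N
    unfolding R_def by (rule flat)
  obtain p q where pq: "mono q" "\<And>l. p l \<le> l" "\<And>l. l \<le> q l" "\<And>l. q (p l) = p l" "\<And>l. q (q l) = q l"
    and Rp: "\<And>l. R l \<le> 2 * R (p l)" and Rq: "\<And>l. R l \<le> 2 * R (q l)"
    and bl: "\<And>k. \<exists>s. (\<forall>i. s \<le> i \<longrightarrow> i \<le> Suc k * Suc s \<longrightarrow> p i = s) \<and>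
       (\<forall>i. s < i \<longrightarrow> i \<le> Suc k * Suc s + 1 \<longrightarrow> q i = Suc k * Suc s + 1) \<and>
       (\<forall>i\<in>{s..Suc k * Suc s + 1}. \<forall>j\<in>{s..Suc k * Suc s + 1}. R i \<le> 2 * R j)"
    by (rule flat_blocks[of R, OF R0 fl]) blast
  define \<eta> where "\<eta> = (\<lambda>n. \<xi> (q n))"
  have le: "\<eta> n \<le> \<xi> n" for n using c0_starD(2)[OF \<xi> pq(3)] by (simp add: \<eta>_def)
  have "\<eta> \<longlonglongrightarrow> 0"
    by (rule tendsto_sandwich[OF _ _ tendsto_const c0_starD(3)[OF \<xi>]])
       (use le pos in \<open>auto simp: \<eta>_def less_imp_le\<close>)
  then have \<eta>: "\<eta> \<in> c0_star"
    by (intro c0_starI) (use c0_starD(1,2)[OF \<xi>] monoD[OF pq(1)] in \<open>auto simp: \<eta>_def\<close>)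
  have "\<not> dominated \<xi> \<eta>"
  proof
    assume "dominated \<xi> \<eta>"
    then obtain m M where m: "m > 0" "M > 0" "\<And>n. \<xi> n \<le> M * \<eta> (n div m)" by (rule dominatedE[OF _ \<eta>]) blast
    obtain k :: nat where k: "real m \<le> real k" "4 * M * real m < real k"
      using reals_Archimedean2[of "max (real m) (4 * M * real m)"] by (auto intro: less_imp_le)
    obtain s where s: "\<And>i. s < i \<Longrightarrow> i \<le> Suc k * Suc s + 1 \<Longrightarrow> q i = Suc k * Suc s + 1"
      "\<And>i j. i \<in> {s..Suc k * Suc s + 1} \<Longrightarrow> j \<in> {s..Suc k * Suc s + 1} \<Longrightarrow> R i \<le> 2 * R j"
      using bl[of k] by blast
    define E where "E = Suc k * Suc s + 1"
    \<comment> \<open>Its quotient by \<open>m\<close> is the first index after the left end, where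
      \<open>q\<close> already jumps to the right end \<open>E\<close>.\<close>
    define n where "n = m * Suc s"
    have sn: "Suc s \<le> n" using mult_le_mono1[of 1 m "Suc s"] m(1) by (simp add: n_def)
    have "n \<le> Suc k * Suc s" unfolding n_def by (rule mult_right_mono) (use k in simp_all)
    then have nE: "n \<le> E" by (simp add: E_def)
    have "n div m = Suc s" using m(1) by (simp add: n_def)
    moreover have "q (Suc s) = E" unfolding E_def by (rule s(1)) simp_all
    ultimately have 1: "\<xi> n \<le> M * \<xi> E" using m(3)[of n] by (simp add: \<eta>_def)
    have "E \<in> {s..E}" "n \<in> {s..E}" using sn nE by auto
    then have "R E \<le> 2 * R n" by (rule s(2)[folded E_def])
    also have "\<dots> \<le> 2 * (real (Suc n) * (M * \<xi> E))"
      unfolding R_def using 1 by (intro mult_left_mono) auto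
    finally have "real (Suc E) * \<xi> E \<le> (2 * real (Suc n) * M) * \<xi> E" by (simp only: R_def mult_ac)
    then have 2: "real (Suc E) \<le> 2 * real (Suc n) * M" using pos[of E] by simp
    have "Suc n \<le> 2 * n" using sn by simp
    then have "real (Suc n) \<le> 2 * real n" by linarith
    then have "2 * real (Suc n) * M \<le> 2 * (2 * real n) * M" using m(2) by simp
    also have "\<dots> = (4 * M * real m) * real (Suc s)" by (simp only: n_def of_nat_mult) (simp only: mult_ac)
    also have "\<dots> < real k * real (Suc s)" by (rule mult_strict_right_mono[OF k(2)]) simp
    also have "\<dots> = real (k * Suc s)" by (simp only: of_nat_mult)
    also have "\<dots> \<le> real (Suc E)" by (simp only: of_nat_le_iff E_def) simp
    finally show False using 2 by linarith
  qed
  show ?thesis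
  proof (rule that[OF \<eta> le \<open>\<not> dominated \<xi> \<eta>\<close>])
    show "\<exists>s\<le>l. \<eta> s = \<xi> s \<and> real (Suc l) * \<xi> l \<le> 2 * (real (Suc s) * \<xi> s)" for l
      using pq(2)[of l] pq(4)[of l] Rp[of l] by (intro exI[of _ "p l"]) (simp add: \<eta>_def R_def)
    show "\<exists>e\<ge>l. \<eta> e = \<xi> e \<and> real (Suc l) * \<xi> l \<le> 2 * (real (Suc e) * \<xi> e)" for l
      using pq(3)[of l] pq(5)[of l] Rq[of l] by (intro exI[of _ "q l"]) (simp add: \<eta>_def R_def)
  qed
qed

subsection \<open>Sums of ampliations\<close>

lemma sum_ampliation:
  fixes f :: "nat \<Rightarrow> real"
  assumes "m > 0" shows "(\<Sum>i<q * m. f (i div m)) = real m * (\<Sum>i<q. f i)"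
proof (induction q)
  case (Suc q)
  have split: "{..<Suc q * m} = {..<q * m} \<union> {q * m..<q * m + m}" by (auto simp: add.commute)
  have "(\<Sum>i<Suc q * m. f (i div m)) = (\<Sum>i<q * m. f (i div m)) + (\<Sum>i\<in>{q * m..<q * m + m}. f (i div m))"
    unfolding split by (rule sum.union_disjoint) auto
  moreover have "(\<Sum>i\<in>{q * m..<q * m + m}. f (i div m)) = (\<Sum>i\<in>{q * m..<q * m + m}. f q)"
  proof (rule sum.cong)
    fix i assume "i \<in> {q * m..<q * m + m}"
    then have "i div m = q" by (intro div_nat_eqI) (auto simp: mult.commute)
    then show "f (i div m) = f q" by simp
  qed simp
  ultimately show ?case using Suc.IH by (simp add: distrib_left)
qed simp

section \<open>Arithmetic means\<close>

lemma null_sandwich: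
  fixes \<rho> :: "nat \<Rightarrow> real"
  assumes "\<And>n. 0 \<le> \<rho> n" "\<And>n. \<rho> n \<le> g n" "g \<longlonglongrightarrow> 0" shows "\<rho> \<longlonglongrightarrow> 0"
  by (rule tendsto_sandwich[OF _ _ tendsto_const assms(3)]) (use assms in auto)

lemma am_seq_eq: "am_seq \<xi> n = (\<Sum>j<Suc n. \<xi> j) / real (Suc n)"
  by (simp add: am_seq_def lessThan_Suc_atMost)

lemma am_seq_mult: "real (Suc n) * am_seq \<xi> n = (\<Sum>j<Suc n. \<xi> j)"
  unfolding am_seq_eq by simp

lemma psum_mono:
  fixes \<xi> :: "nat \<Rightarrow> real"
  assumes "\<And>n. 0 \<le> \<xi> n" "m \<le> n" shows "(\<Sum>j<m. \<xi> j) \<le> (\<Sum>j<n. \<xi> j)"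
  by (rule sum_mono2) (use assms in auto)

lemma am_seq_ge:
  assumes "\<xi> \<in> c0_star" shows "\<xi> n \<le> am_seq \<xi> n"
proof -
  have "(\<Sum>j<Suc n. \<xi> n) \<le> (\<Sum>j<Suc n. \<xi> j)" by (rule sum_mono) (use c0_starD(2)[OF assms] in auto)
  then have "real (Suc n) * \<xi> n \<le> real (Suc n) * am_seq \<xi> n" unfolding am_seq_mult by simp
  then show ?thesis by (simp only: mult_le_cancel_left_pos of_nat_0_less_iff zero_less_Suc)
qed

lemma am_seq_c0:
  assumes \<xi>: "\<xi> \<in> c0_star" shows "am_seq \<xi> \<in> c0_star"
proof -
  have nonneg: "0 \<le> am_seq \<xi> n" for n unfolding am_seq_def by (intro divide_nonneg_nonneg sum_nonneg c0_starD(1)[OF \<xi>]) simp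
  have dec: "am_seq \<xi> (Suc n) \<le> am_seq \<xi> n" for n
  proof -
    have "\<xi> (Suc n) \<le> am_seq \<xi> n" using am_seq_ge[OF \<xi>, of n] c0_starD(2)[OF \<xi>, of n "Suc n"] by simp
    have "real (Suc (Suc n)) * am_seq \<xi> (Suc n) = real (Suc n) * am_seq \<xi> n + \<xi> (Suc n)"
      unfolding am_seq_mult by simp
    also have "\<dots> \<le> real (Suc n) * am_seq \<xi> n + am_seq \<xi> n" using \<open>\<xi> (Suc n) \<le> am_seq \<xi> n\<close> by simp
    also have "\<dots> = real (Suc (Suc n)) * am_seq \<xi> n" by (simp add: distrib_right)
    finally show ?thesis by (simp only: mult_le_cancel_left_pos of_nat_0_less_iff zero_less_Suc)
  qed
  have "am_seq \<xi> \<longlonglongrightarrow> 0"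
  proof (rule LIMSEQ_I)
    fix r :: real assume r: "r > 0"
    then obtain N where N: "\<And>n. n \<ge> N \<Longrightarrow> norm (\<xi> n - 0) < r / 2" using LIMSEQ_D[OF c0_starD(3)[OF \<xi>], of "r / 2"] by auto
    obtain K :: nat where K: "real N * \<xi> 0 / (r / 2) < real K" using reals_Archimedean2 by blast
    have "am_seq \<xi> n < r" if "n \<ge> K" for n
    proof -
      have "(\<Sum>j<Suc n. \<xi> j) \<le> (\<Sum>j<Suc n. (if j < N then \<xi> 0 else 0) + r / 2)"
      proof (rule sum_mono)
        fix j show "\<xi> j \<le> (if j < N then \<xi> 0 else 0) + r / 2"
          using N[of j] c0_starD(2)[OF \<xi>, of 0 j] r by auto
      qed
      also have "\<dots> = (\<Sum>j<Suc n. if j < N then \<xi> 0 else 0) + real (Suc n) * (r / 2)" by (simp add: sum.distrib)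
      also have "(\<Sum>j<Suc n. if j < N then \<xi> 0 else 0) \<le> (\<Sum>j<N. \<xi> 0)"
      proof -
        have "(\<Sum>j<Suc n. if j < N then \<xi> 0 else 0) = (\<Sum>j\<in>{..<Suc n} \<inter> {j. j < N}. \<xi> 0)"
          using sum.inter_restrict[of "{..<Suc n}" "\<lambda>_. \<xi> 0" "{j. j < N}"] by (simp only: finite_lessThan mem_Collect_eq simp_thms)
        also have "\<dots> \<le> (\<Sum>j<N. \<xi> 0)" by (rule sum_mono2) (use c0_starD(1)[OF \<xi>] in auto)
        finally show ?thesis .
      qed
      also have "(\<Sum>j<N. \<xi> 0) < real (Suc n) * (r / 2)"
      proof -
        have "real N * \<xi> 0 < real K * (r / 2)" using K r by (simp add: divide_less_eq)
        also have "\<dots> \<le> real (Suc n) * (r / 2)" using that r by (intro mult_right_mono) auto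
        finally show ?thesis by simp
      qed
      finally have "real (Suc n) * am_seq \<xi> n < real (Suc n) * r" unfolding am_seq_mult by (simp add: field_simps)
      then show ?thesis by (simp only: mult_less_cancel_left_pos of_nat_0_less_iff zero_less_Suc)
    qed
    then show "\<exists>no. \<forall>n\<ge>no. norm (am_seq \<xi> n - 0) < r" using nonneg by (intro exI[of _ K]) auto
  qed
  moreover have "antimono (am_seq \<xi>)" unfolding antimono_iff_le_Suc using dec by blast
  ultimately show ?thesis using nonneg by (simp add: c0_star_def)
qed

lemma am_seq_ampliation_ge:
  assumes \<xi>: "\<xi> \<in> c0_star" and m: "m > 0"
  shows "am_seq \<xi> (n div m) \<le> am_seq (\<lambda>k. \<xi> (k div m)) n"
proof -
  define q where "q = n div m"
  \<comment> \<open>\<open>k\<close> is the last index with the same quotient as \<open>n\<close>.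
    There the groups of equal terms are complete and the two means agree; the rest is
    monotonicity.\<close>
  obtain k where k: "Suc q * m = Suc k" using m by (cases "Suc q * m") auto
  have "n < Suc q * m" unfolding q_def using m by (simp add: dividend_less_div_times)
  then have "n \<le> k" using k by simp
  have "real (Suc k) * am_seq (\<lambda>k. \<xi> (k div m)) k = (\<Sum>j<Suc k. \<xi> (j div m))" by (rule am_seq_mult)
  also have "\<dots> = real m * (\<Sum>i<Suc q. \<xi> i)" unfolding k[symmetric] by (rule sum_ampliation[OF m])
  also have "\<dots> = real (Suc k) * am_seq \<xi> q"
    unfolding am_seq_mult[symmetric] k[symmetric] of_nat_mult by (simp only: mult_ac)
  finally have "am_seq (\<lambda>k. \<xi> (k div m)) k = am_seq \<xi> q" by simp
  then show ?thesis
    using c0_starD(2)[OF am_seq_c0[OF c0_star_ampliation[OF \<xi> m]] \<open>n \<le> k\<close>] by (simp add: q_def)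
qed

lemma am_seq_ampliation_le:
  assumes \<xi>: "\<xi> \<in> c0_star" and m: "m > 0"
  shows "am_seq (\<lambda>k. \<xi> (k div m)) n \<le> real m * am_seq \<xi> n"
proof -
  have "real (Suc n) * am_seq (\<lambda>k. \<xi> (k div m)) n \<le> (\<Sum>j<Suc n * m. \<xi> (j div m))"
    unfolding am_seq_mult by (rule psum_mono) (use c0_starD(1)[OF \<xi>] mult_le_mono2[of 1 m "Suc n"] m in auto)
  also have "\<dots> = real (Suc n) * (real m * am_seq \<xi> n)"
    unfolding sum_ampliation[OF m] am_seq_mult[symmetric] by (simp only: mult_ac)
  finally show ?thesis by (simp only: mult_le_cancel_left_pos of_nat_0_less_iff zero_less_Suc)
qed

lemma am_seq_mono: "(\<And>n. \<xi> n \<le> \<eta> n) \<Longrightarrow> am_seq \<xi> n \<le> am_seq \<eta> n"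
  unfolding am_seq_def by (intro divide_right_mono sum_mono) auto

interpretation am: mean_op am_seq c0_star c0_star
proof (rule mean_op.intro, goal_cases)
  case (4 \<xi>) then show ?case by (rule am_seq_c0)
next
  case 5 show ?case by (simp add: fun_eq_iff am_seq_def sum.distrib add_divide_distrib)
next
  case 6 show ?case by (simp add: fun_eq_iff am_seq_def sum_distrib_left)
next
  case (7 \<xi> \<eta> n) then show ?case by (intro am_seq_mono)
next
  case (8 \<xi> m n) then show ?case by (intro am_seq_ampliation_ge)
next
  case (9 \<xi> m \<sigma>)
  show ?case
  proof (rule dominated_le[where M="real m"])
    fix n
    have "real m * am_seq \<xi> n \<le> real m * (am_seq \<xi> n + \<sigma> n)" 
      by (rule mult_left_mono) (simp_all add: c0_starD(1)[OF 9(3)])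
    then show "am_seq (\<lambda>k. \<xi> (k div m)) n \<le> real m * (am_seq \<xi> n + \<sigma> n)"
      using am_seq_ampliation_le[OF 9(1,2), of n] by linarith
  qed
next
  case (10 \<xi> \<sigma>)
  show ?case
  proof (rule dominated_le[where M=1])
    fix n show "\<xi> n \<le> 1 * (am_seq \<xi> n + \<sigma> n)" using am_seq_ge[OF 10(1), of n] c0_starD(1)[OF 10(2), of n] by simp
  qed
qed (simp_all add: char_set_c0_star am_seq_def)

text \<open>Going through principal sets and the Galois connection covers the zero branch of
  \<open>G\<close> without a case distinction.\<close>

lemma am_GF_memI:
  assumes e: "e \<in> c0_star" and T: "char_set T" "\<eta> \<in> T" and le: "\<And>n. am_seq e n \<le> C * am_seq \<eta> n"
  shows "e \<in> am.G (am.F T)"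
proof -
  have \<eta>: "\<eta> \<in> c0_star" by (rule char_setD(1)[OF T])
  have "am.F (princ e) \<subseteq> am.F T"
  proof
    fix \<kappa> assume "\<kappa> \<in> am.F (princ e)"
    then obtain \<theta> M where \<theta>: "\<kappa> \<in> c0_star" "\<theta> \<in> princ e" "\<theta> \<in> c0_star" "M > 0" "\<And>n. \<kappa> n \<le> M * am_seq \<theta> n"
      by (rule am.FE) blast
    obtain m K where m: "m > 0" "K > 0" "\<And>n. \<theta> n \<le> K * e (n div m)"
      using dominatedE[of \<theta> e] \<theta>(2) e by (auto simp: princ_def)
    show "\<kappa> \<in> am.F T"
    proof (rule am.FI[OF \<theta>(1) T(2) \<eta>, where M="M * (K * (real m * C))"])
      fix n
      have "am_seq \<theta> n \<le> am_seq (\<lambda>n. K * e (n div m)) n" by (rule am_seq_mono) (rule m(3))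
      also have "\<dots> = K * am_seq (\<lambda>n. e (n div m)) n"
        using am.a_scale[OF c0_star_ampliation[OF e m(1)], of K] m(2) by simp
      also have "\<dots> \<le> K * (real m * am_seq e n)" using m(2) am_seq_ampliation_le[OF e m(1)] by simp
      also have "\<dots> \<le> K * (real m * (C * am_seq \<eta> n))" using m(2) le by (intro mult_left_mono) auto
      finally have "M * am_seq \<theta> n \<le> M * (K * (real m * (C * am_seq \<eta> n)))" using \<theta>(4) by simp
      then show "\<kappa> n \<le> M * (K * (real m * C)) * am_seq \<eta> n" using \<theta>(5)[of n] by (simp add: mult.assoc)
    qed
  qed
  then have "princ e \<inter> c0_star \<subseteq> am.G (am.F T)"
    using am.galois[OF char_set_princ[OF e] am.char_F[OF T(1)]] by blast
  then show ?thesis using princ_self[OF e] e by blast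
qed

subsection \<open>Sums of am-closed ideals\<close>

text \<open>The part of \<open>\<zeta>\<close> supported on \<open>E\<close> is replaced by its least monotone majorant.\<close>

definition env :: "nat set \<Rightarrow> (nat \<Rightarrow> real) \<Rightarrow> nat \<Rightarrow> real" where
  "env E \<zeta> j = (SUP i\<in>{j..}. if i \<in> E then \<zeta> i else 0)"

lemma env_bdd: "\<zeta> \<in> c0_star \<Longrightarrow> bdd_above ((\<lambda>i. if i \<in> E then \<zeta> i else 0) ` {j..})"
  by (rule bdd_aboveI2[where M="\<zeta> 0"]) (use c0_starD(1,2)[of \<zeta>] in auto)

lemma env_ge:
  assumes "\<zeta> \<in> c0_star" "j \<in> E" shows "\<zeta> j \<le> env E \<zeta> j"
  using cSUP_upper[OF _ env_bdd[OF assms(1), of E j], of j] assms(2) by (simp add: env_def)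

lemma env_nonneg:
  assumes "\<zeta> \<in> c0_star" shows "0 \<le> env E \<zeta> j"
proof -
  have "0 \<le> (if j \<in> E then \<zeta> j else 0)" using c0_starD(1)[OF assms] by simp
  also have "\<dots> \<le> env E \<zeta> j" unfolding env_def by (rule cSUP_upper[OF _ env_bdd[OF assms]]) simp
  finally show ?thesis .
qed

lemma env_leI: "(\<And>i. i \<ge> j \<Longrightarrow> i \<in> E \<Longrightarrow> \<zeta> i \<le> b) \<Longrightarrow> 0 \<le> b \<Longrightarrow> env E \<zeta> j \<le> b"
  unfolding env_def by (rule cSUP_least) auto

lemma env_le: "\<zeta> \<in> c0_star \<Longrightarrow> env E \<zeta> j \<le> \<zeta> j"
  by (rule env_leI) (use c0_starD(1,2) in auto)

lemma env_c0:
  assumes \<zeta>: "\<zeta> \<in> c0_star" shows "env E \<zeta> \<in> c0_star"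
proof (rule c0_starI)
  show "env E \<zeta> n \<le> env E \<zeta> m" if "m \<le> n" for m n
    unfolding env_def by (rule cSUP_subset_mono[OF _ env_bdd[OF \<zeta>]]) (use that in auto)
  show "env E \<zeta> \<longlonglongrightarrow> 0"
    by (rule tendsto_sandwich[OF _ _ tendsto_const c0_starD(3)[OF \<zeta>]])
       (use env_le[OF \<zeta>] env_nonneg[OF \<zeta>] in auto)
qed (rule env_nonneg[OF \<zeta>])

text \<open>Let \<open>p\<close> be the last index of \<open>E\<close> up to \<open>n\<close>. Until
  \<open>p\<close> the envelope is below \<zeta>, whose partial sum is controlled at
  \<open>p\<close>. From there to \<open>n\<close> it is bounded by values of \<zeta> at indices of
  \<open>E\<close> beyond \<open>n\<close>, where the means have decreased. Each part contributes
  2.\<close>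

lemma am_seq_env:
  assumes \<zeta>: "\<zeta> \<in> c0_star" and \<eta>: "\<eta> \<in> c0_star"
    and E: "\<And>j. j \<in> E \<Longrightarrow> am_seq \<zeta> j \<le> 2 * am_seq \<eta> j"
  shows "am_seq (env E \<zeta>) n \<le> 4 * am_seq \<eta> n"
proof -
  have a0: "0 \<le> am_seq \<eta> n" for n by (rule c0_starD(1)[OF am_seq_c0[OF \<eta>]])
  have late: "env E \<zeta> j \<le> 2 * am_seq \<eta> n" if none: "\<And>i. i \<in> E \<Longrightarrow> j \<le> i \<Longrightarrow> n < i" for j
  proof (rule env_leI)
    fix i assume i: "j \<le> i" "i \<in> E"
    have "\<zeta> i \<le> am_seq \<zeta> i" by (rule am_seq_ge[OF \<zeta>])
    also have "\<dots> \<le> 2 * am_seq \<eta> i" by (rule E[OF i(2)])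
    also have "\<dots> \<le> 2 * am_seq \<eta> n" using c0_starD(2)[OF am_seq_c0[OF \<eta>], of n i] none[OF i(2,1)] by simp
    finally show "\<zeta> i \<le> 2 * am_seq \<eta> n" .
  qed (use a0 in simp)
  have "\<exists>k\<le>Suc n. (\<Sum>j<k. \<zeta> j) \<le> 2 * (\<Sum>j<Suc n. \<eta> j) \<and> (\<forall>i\<in>E. k \<le> i \<longrightarrow> n < i)"
  proof (cases "\<exists>p\<le>n. p \<in> E")
    case True
    define p where "p = (GREATEST p. p \<le> n \<and> p \<in> E)"
    have p: "p \<le> n" "p \<in> E" using GreatestI_ex_nat[of "\<lambda>p. p \<le> n \<and> p \<in> E" n] True by (auto simp: p_def)
    have "i \<le> p" if "i \<le> n" "i \<in> E" for i
      unfolding p_def by (rule Greatest_le_nat[of "\<lambda>p. p \<le> n \<and> p \<in> E" i n]) (use that in auto)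
    then have "\<forall>i\<in>E. Suc p \<le> i \<longrightarrow> n < i" by (meson Suc_n_not_le_n not_le order_trans)
    moreover have "(\<Sum>j<Suc p. \<zeta> j) \<le> 2 * (\<Sum>j<Suc p. \<eta> j)"
      unfolding am_seq_mult[symmetric] using E[OF p(2)] mult_left_mono[of "am_seq \<zeta> p" "2 * am_seq \<eta> p" "real (Suc p)"] by simp
    moreover have "(\<Sum>j<Suc p. \<eta> j) \<le> (\<Sum>j<Suc n. \<eta> j)" by (rule psum_mono) (use p c0_starD(1)[OF \<eta>] in auto)
    ultimately show ?thesis using p(1) by (intro exI[of _ "Suc p"]) auto
  next
    case False
    then have "\<forall>i\<in>E. 0 \<le> i \<longrightarrow> n < i" by (meson not_le)
    moreover have "0 \<le> (\<Sum>j<Suc n. \<eta> j)" by (rule sum_nonneg) (rule c0_starD(1)[OF \<eta>])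
    ultimately show ?thesis by (intro exI[of _ 0]) auto
  qed
  then obtain k where k: "k \<le> Suc n" "(\<Sum>j<k. \<zeta> j) \<le> 2 * (\<Sum>j<Suc n. \<eta> j)" "\<And>i. i \<in> E \<Longrightarrow> k \<le> i \<Longrightarrow> n < i" by blast
  have "(\<Sum>j<Suc n. env E \<zeta> j) = (\<Sum>j<k. env E \<zeta> j) + (\<Sum>j=k..<Suc n. env E \<zeta> j)"
    using sum.atLeastLessThan_concat[of 0 k "Suc n" "env E \<zeta>"] k(1) by (simp add: atLeast0LessThan)
  also have "\<dots> \<le> (\<Sum>j<k. \<zeta> j) + (\<Sum>j=k..<Suc n. 2 * am_seq \<eta> n)"
    by (intro add_mono sum_mono env_le[OF \<zeta>] late) (use k(3) in auto)
  also have "(\<Sum>j=k..<Suc n. 2 * am_seq \<eta> n) \<le> real (Suc n) * (2 * am_seq \<eta> n)"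
    unfolding sum_constant card_atLeastLessThan by (intro mult_right_mono) (use a0 in auto)
  also have "\<dots> = 2 * (\<Sum>j<Suc n. \<eta> j)" unfolding am_seq_mult[symmetric] by simp
  also have "(\<Sum>j<k. \<zeta> j) \<le> 2 * (\<Sum>j<Suc n. \<eta> j)" by (rule k(2))
  finally have "real (Suc n) * am_seq (env E \<zeta>) n \<le> real (Suc n) * (4 * am_seq \<eta> n)"
    unfolding am_seq_mult using am_seq_mult[of n \<eta>] by simp
  then show ?thesis by (simp only: mult_le_cancel_left_pos of_nat_0_less_iff zero_less_Suc)
qed

lemma am_GF_add:
  assumes z1: "\<zeta>1 \<in> c0_star" and z2: "\<zeta>2 \<in> c0_star" and \<zeta>: "\<zeta> \<in> am.G (am.F (princ (\<lambda>n. \<zeta>1 n + \<zeta>2 n)))"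
  shows "\<exists>e1\<in>am.G (am.F (princ \<zeta>1)). \<exists>e2\<in>am.G (am.F (princ \<zeta>2)). dominated \<zeta> (\<lambda>n. e1 n + e2 n)"
proof -
  note z = c0_star_add[OF z1 z2]
  have \<zeta>c: "\<zeta> \<in> c0_star" using \<zeta> am.G_U by blast
  obtain \<kappa> M where \<kappa>: "\<kappa> \<in> princ (\<lambda>n. \<zeta>1 n + \<zeta>2 n)" "\<kappa> \<in> c0_star" "M > 0" "\<And>n. am_seq \<zeta> n \<le> M * am_seq \<kappa> n"
    by (rule am.FE[OF am.a_G[OF am.char_F[OF char_set_princ[OF z]] \<zeta>]]) blast
  obtain m K where m: "m > 0" "K > 0" "\<And>n. \<kappa> n \<le> K * (\<zeta>1 (n div m) + \<zeta>2 (n div m))"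
    using dominatedE[of \<kappa> "\<lambda>n. \<zeta>1 n + \<zeta>2 n"] \<kappa>(1) z by (auto simp: princ_def)
  define \<eta>1 where "\<eta>1 = (\<lambda>n. M * K * \<zeta>1 (n div m))"
  define \<eta>2 where "\<eta>2 = (\<lambda>n. M * K * \<zeta>2 (n div m))"
  have MK: "M * K \<ge> 0" using \<kappa>(3) m(2) by simp
  have \<eta>1: "\<eta>1 \<in> princ \<zeta>1" unfolding \<eta>1_def
    by (rule char_set_scale[OF char_set_princ[OF z1] char_set_ampliation[OF char_set_princ[OF z1] princ_self[OF z1] m(1)] MK])
  have \<eta>2: "\<eta>2 \<in> princ \<zeta>2" unfolding \<eta>2_def
    by (rule char_set_scale[OF char_set_princ[OF z2] char_set_ampliation[OF char_set_princ[OF z2] princ_self[OF z2] m(1)] MK])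
  have c1: "\<eta>1 \<in> c0_star" and c2: "\<eta>2 \<in> c0_star" using \<eta>1 \<eta>2 by (auto simp: princ_def)
  have le: "am_seq \<zeta> n \<le> am_seq \<eta>1 n + am_seq \<eta>2 n" for n
  proof -
    have "M * am_seq \<kappa> n = am_seq (\<lambda>n. M * \<kappa> n) n" using am.a_scale[OF \<kappa>(2), of M] \<kappa>(3) by simp
    also have "\<dots> \<le> am_seq (\<lambda>n. \<eta>1 n + \<eta>2 n) n"
    proof (rule am_seq_mono)
      fix n show "M * \<kappa> n \<le> \<eta>1 n + \<eta>2 n"
        using mult_left_mono[OF m(3)[of n], of M] \<kappa>(3) by (simp add: \<eta>1_def \<eta>2_def algebra_simps)
    qed
    also have "\<dots> = am_seq \<eta>1 n + am_seq \<eta>2 n" by (simp add: am.a_add[OF c1 c2])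
    finally show ?thesis using \<kappa>(4)[of n] by linarith
  qed
  \<comment> \<open>At every index one of the two means carries at least half of the mean of
    \<zeta>; \<open>E\<close> and its complement record which.\<close>
  define E where "E = {j. am_seq \<zeta> j \<le> 2 * am_seq \<eta>1 j}"
  have E1: "am_seq \<zeta> j \<le> 2 * am_seq \<eta>1 j" if "j \<in> E" for j using that by (simp add: E_def)
  have E2: "am_seq \<zeta> j \<le> 2 * am_seq \<eta>2 j" if "j \<in> - E" for j using that le[of j] by (simp add: E_def)
  have "env E \<zeta> \<in> am.G (am.F (princ \<zeta>1))"
    by (rule am_GF_memI[OF env_c0[OF \<zeta>c] char_set_princ[OF z1] \<eta>1 am_seq_env[OF \<zeta>c c1 E1]])
  moreover have "env (- E) \<zeta> \<in> am.G (am.F (princ \<zeta>2))"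
    by (rule am_GF_memI[OF env_c0[OF \<zeta>c] char_set_princ[OF z2] \<eta>2 am_seq_env[OF \<zeta>c c2 E2]])
  moreover have "dominated \<zeta> (\<lambda>n. env E \<zeta> n + env (- E) \<zeta> n)"
  proof (rule dominated_le[where M=1])
    fix n show "\<zeta> n \<le> 1 * (env E \<zeta> n + env (- E) \<zeta> n)"
      using env_ge[OF \<zeta>c, of n E] env_ge[OF \<zeta>c, of n "- E"] env_nonneg[OF \<zeta>c, of E n] env_nonneg[OF \<zeta>c, of "- E" n]
      by (cases "n \<in> E") auto
  qed
  ultimately show ?thesis by blast
qed

subsection \<open>The least mean above a sequence\<close>

definition am_maxq :: "(nat \<Rightarrow> real) \<Rightarrow> nat \<Rightarrow> real" where
  "am_maxq \<eta> n = Max ((\<lambda>i. real (Suc i) * \<eta> i) ` {..n})"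

text \<open>\<open>n + 1\<close> times a mean is a partial sum, hence increasing; so a mean above
  \<eta> also has to dominate the running maximum of \<open>(i + 1) * \<eta> i\<close>.\<close>

definition am_mu :: "(nat \<Rightarrow> real) \<Rightarrow> nat \<Rightarrow> real" where
  "am_mu \<eta> n = am_maxq \<eta> n / real (Suc n)"

lemma am_maxq_ge: "i \<le> n \<Longrightarrow> real (Suc i) * \<eta> i \<le> am_maxq \<eta> n"
  unfolding am_maxq_def by (rule Max_ge) auto

lemma am_maxq_leI: "(\<And>i. i \<le> n \<Longrightarrow> real (Suc i) * \<eta> i \<le> b) \<Longrightarrow> am_maxq \<eta> n \<le> b"
  unfolding am_maxq_def by (rule Max.boundedI) auto

lemma am_maxq_attained: "\<exists>i\<le>n. am_maxq \<eta> n = real (Suc i) * \<eta> i"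
proof -
  have "am_maxq \<eta> n \<in> (\<lambda>i. real (Suc i) * \<eta> i) ` {..n}" unfolding am_maxq_def by (rule Max_in) auto
  then show ?thesis by auto
qed

lemma am_maxq_mono: "m \<le> n \<Longrightarrow> am_maxq \<eta> m \<le> am_maxq \<eta> n"
  by (rule am_maxq_leI) (rule am_maxq_ge, simp)

lemma am_mu_mult: "real (Suc n) * am_mu \<eta> n = am_maxq \<eta> n"
  by (simp add: am_mu_def)

lemma am_mu_ge: "\<eta> n \<le> am_mu \<eta> n"
  using am_maxq_ge[of n n \<eta>] by (simp add: am_mu_def pos_le_divide_eq mult.commute)

lemma am_mu_least:
  assumes \<zeta>: "\<zeta> \<in> c0_star" and M: "M > 0" and le: "\<And>n. \<eta> n \<le> M * am_seq \<zeta> n"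
  shows "am_mu \<eta> n \<le> M * am_seq \<zeta> n"
proof -
  have "am_maxq \<eta> n \<le> M * (\<Sum>j<Suc n. \<zeta> j)"
  proof (rule am_maxq_leI)
    fix i assume "i \<le> n"
    have "real (Suc i) * \<eta> i \<le> real (Suc i) * (M * am_seq \<zeta> i)" by (rule mult_left_mono[OF le]) simp
    also have "\<dots> = M * (\<Sum>j<Suc i. \<zeta> j)" unfolding am_seq_mult[symmetric] by simp
    also have "\<dots> \<le> M * (\<Sum>j<Suc n. \<zeta> j)"
      by (intro mult_left_mono psum_mono) (use M \<open>i \<le> n\<close> c0_starD(1)[OF \<zeta>] in auto)
    finally show "real (Suc i) * \<eta> i \<le> M * (\<Sum>j<Suc n. \<zeta> j)" .
  qed
  then have "real (Suc n) * am_mu \<eta> n \<le> real (Suc n) * (M * am_seq \<zeta> n)"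
    unfolding am_mu_mult am_seq_mult[symmetric] by (simp only: mult_ac)
  then show ?thesis by (simp only: mult_le_cancel_left_pos of_nat_0_less_iff zero_less_Suc)
qed

lemma am_mu_le: "\<eta> \<in> c0_star \<Longrightarrow> am_mu \<eta> n \<le> am_seq \<eta> n"
  using am_mu_least[of \<eta> 1 \<eta> n] am_seq_ge[of \<eta>] by simp

lemma am_mu_c0:
  assumes \<eta>: "\<eta> \<in> c0_star" shows "am_mu \<eta> \<in> c0_star"
proof -
  have nn: "0 \<le> am_mu \<eta> n" for n using am_mu_ge[of \<eta> n] c0_starD(1)[OF \<eta>, of n] by linarith
  have "am_mu \<eta> (Suc n) \<le> am_mu \<eta> n" for n
  proof -
    have "am_maxq \<eta> (Suc n) \<le> real (Suc (Suc n)) * am_mu \<eta> n"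
    proof (rule am_maxq_leI)
      fix i assume i: "i \<le> Suc n"
      show "real (Suc i) * \<eta> i \<le> real (Suc (Suc n)) * am_mu \<eta> n"
      proof (cases "i = Suc n")
        case True
        have "\<eta> (Suc n) \<le> am_mu \<eta> n" using am_mu_ge[of \<eta> n] c0_starD(2)[OF \<eta>, of n "Suc n"] by simp
        then show ?thesis unfolding True by (intro mult_left_mono) auto
      next
        case False
        then have "real (Suc i) * \<eta> i \<le> am_maxq \<eta> n" using i by (intro am_maxq_ge) simp
        also have "\<dots> = real (Suc n) * am_mu \<eta> n" by (rule am_mu_mult[symmetric])
        also have "\<dots> \<le> real (Suc (Suc n)) * am_mu \<eta> n" by (intro mult_right_mono nn) simp
        finally show ?thesis .
      qed
    qed
    then have "real (Suc (Suc n)) * am_mu \<eta> (Suc n) \<le> real (Suc (Suc n)) * am_mu \<eta> n" unfolding am_mu_mult .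
    then show ?thesis by (simp only: mult_le_cancel_left_pos of_nat_0_less_iff zero_less_Suc)
  qed
  then have "antimono (am_mu \<eta>)" unfolding antimono_iff_le_Suc by blast
  moreover have "am_mu \<eta> \<longlonglongrightarrow> 0"
    by (rule tendsto_sandwich[OF _ _ tendsto_const c0_starD(3)[OF am_seq_c0[OF \<eta>]]])
       (use nn am_mu_le[OF \<eta>] in auto)
  ultimately show ?thesis using nn by (simp add: c0_star_def)
qed

text \<open>Up to a factor \<open>2\<close>, the quasiconcave function \<open>n \<mapsto> n \<mu>\<^sub>n\<close> is the infimum of the affine functions
  \<open>x \<mapsto> (1 + x/i) i \<mu>\<^sub>i\<close>, which is concave and hence the sequence of partial sums of a monotone sequence.\<close>

lemma am_mu_mean:
  assumes \<eta>: "\<eta> \<in> c0_star"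
  shows "\<exists>\<rho>\<in>c0_star. dominated (am_seq \<rho>) (am_mu \<eta>) \<and> dominated (am_mu \<eta>) (am_seq \<rho>)"
proof -
  define Q where "Q = am_maxq \<eta>"
  define h where "h = (\<lambda>x i. (1 + real x / real (Suc i)) * Q i)"
  define P where "P = (\<lambda>x. INF i. h x i)"
  have mc: "am_mu \<eta> \<in> c0_star" by (rule am_mu_c0[OF \<eta>])
  have Qm: "Q n = real (Suc n) * am_mu \<eta> n" for n by (simp only: Q_def am_mu_mult)
  have Q0: "0 \<le> Q n" for n unfolding Qm using c0_starD(1)[OF mc] by simp
  have h0: "0 \<le> h x i" for x i using Q0[of i] by (simp add: h_def)
  have bdd: "bdd_below (range (h x))" for x by (rule bdd_belowI2[where m=0]) (rule h0)
  have P_le: "P x \<le> h x i" for x i unfolding P_def by (rule cINF_lower[OF bdd]) simp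
  have P_ge: "b \<le> P x" if "\<And>i. b \<le> h x i" for b x unfolding P_def by (rule cINF_greatest) (use that in auto)
  have P0: "0 \<le> P x" for x by (rule P_ge) (rule h0)
  have P_mono: "P x \<le> P (Suc x)" for x
  proof (rule P_ge)
    fix i
    have "h x i \<le> h (Suc x) i" unfolding h_def by (intro mult_right_mono Q0) (simp add: divide_right_mono)
    then show "P x \<le> h (Suc x) i" using P_le[of x i] by linarith
  qed
  have P_conc: "P (Suc (Suc x)) - P (Suc x) \<le> P (Suc x) - P x" for x
  proof -
    have "(P x + P (Suc (Suc x))) / 2 \<le> P (Suc x)"
    proof (rule P_ge)
      fix i
      obtain t where t: "\<And>y. h y i = Q i + real y * t"
        by (rule that[of "Q i / real (Suc i)"]) (simp add: h_def distrib_right)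
      have "h x i + h (Suc (Suc x)) i = 2 * h (Suc x) i" by (simp add: t algebra_simps)
      moreover have "P x + P (Suc (Suc x)) \<le> h x i + h (Suc (Suc x)) i" by (intro add_mono P_le)
      ultimately show "(P x + P (Suc (Suc x))) / 2 \<le> h (Suc x) i" by simp
    qed
    then show ?thesis by (simp add: field_simps)
  qed
  \<comment> \<open>For \<open>i \<ge> n\<close> the constant part of the affine function suffices
    because \<open>Q\<close> increases; for \<open>i < n\<close> the linear part does because
    \<open>am_mu \<eta>\<close> decreases.\<close>
  have P_Q: "Q n \<le> P (Suc n)" for n
  proof (rule P_ge)
    fix i
    show "Q n \<le> h (Suc n) i"
    proof (cases "n \<le> i")
      case True
      then have "Q n \<le> 1 * Q i" by (simp add: Q_def am_maxq_mono)
      also have "\<dots> \<le> h (Suc n) i" unfolding h_def by (intro mult_right_mono Q0) simp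
      finally show ?thesis .
    next
      case False
      have "Q n \<le> real (Suc n) * am_mu \<eta> i" unfolding Qm by (intro mult_left_mono c0_starD(2)[OF mc]) (use False in auto)
      also have "\<dots> = real (Suc n) / real (Suc i) * Q i" by (simp add: Qm)
      also have "\<dots> \<le> h (Suc n) i" unfolding h_def by (intro mult_right_mono Q0) simp
      finally show ?thesis .
    qed
  qed
  have P_2Q: "P (Suc n) \<le> 2 * Q n" for n using P_le[of "Suc n" n] by (simp add: h_def)
  \<comment> \<open>The increments of \<open>P\<close>, with \<open>P 0\<close> added to the first
    so that the partial sums are \<open>P (Suc n)\<close> itself. As \<open>P 0 \<ge> 0\<close>,
    monotonicity is preserved.\<close>
  define \<rho> where "\<rho> = (\<lambda>n. P (Suc n) - P n + (if n = 0 then P 0 else 0))"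
  have sum\<rho>: "(\<Sum>j<Suc n. \<rho> j) = P (Suc n)" for n
    by (induction n) (simp_all add: \<rho>_def)
  have \<rho>0: "0 \<le> \<rho> n" for n using P_mono[of n] P0[of 0] by (simp add: \<rho>_def)
  have "\<rho> (Suc n) \<le> \<rho> n" for n using P_conc[of n] P0[of 0] by (cases n) (simp_all add: \<rho>_def)
  then have anti: "antimono \<rho>" unfolding antimono_iff_le_Suc by blast
  have am: "am_seq \<rho> n = P (Suc n) / real (Suc n)" for n unfolding am_seq_eq sum\<rho> ..
  have am1: "am_seq \<rho> n \<le> 2 * am_mu \<eta> n" for n
    unfolding am am_mu_def times_divide_eq_right Q_def[symmetric] by (rule divide_right_mono[OF P_2Q]) simp
  have am2: "am_mu \<eta> n \<le> 1 * am_seq \<rho> n" for n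
    unfolding am am_mu_def using P_Q[of n] by (simp add: Q_def divide_right_mono)
  have "\<rho> n \<le> am_seq \<rho> n" for n
  proof -
    have "(\<Sum>j<Suc n. \<rho> n) \<le> (\<Sum>j<Suc n. \<rho> j)" by (rule sum_mono) (use antimonoD[OF anti] in auto)
    then have "real (Suc n) * \<rho> n \<le> real (Suc n) * am_seq \<rho> n" unfolding am_seq_mult by simp
    then show ?thesis by (simp only: mult_le_cancel_left_pos of_nat_0_less_iff zero_less_Suc)
  qed
  then have "\<rho> n \<le> 2 * am_mu \<eta> n" for n using am1 order_trans by blast
  then have "\<rho> \<longlonglongrightarrow> 0"
    by (rule null_sandwich[OF \<rho>0 _ tendsto_mult_right_zero[OF c0_starD(3)[OF mc]]])
  then have "\<rho> \<in> c0_star" using \<rho>0 anti by (simp add: c0_star_def)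
  moreover have "dominated (am_seq \<rho>) (am_mu \<eta>)" by (rule dominated_le[OF am1])
  moreover have "dominated (am_mu \<eta>) (am_seq \<rho>)" by (rule dominated_le[OF am2])
  ultimately show ?thesis by blast
qed

interpretation am: mean_theory am_seq c0_star c0_star am_mu
proof (rule mean_theory.intro[OF am.mean_op_axioms], rule mean_theory_axioms.intro, goal_cases)
  case 1 then show ?case by (rule am_GF_add)
next
  case 2 then show ?case by (rule am_mu_c0)
next
  case 3 show ?case by (rule am_mu_ge)
next
  case (4 \<eta> \<eta>' n) then show ?case
    unfolding am_mu_def
    by (intro divide_right_mono am_maxq_leI order_trans[OF mult_left_mono am_maxq_ge]) auto
next
  case 5 then show ?case by (rule am_mu_mean)
next
  case 6 then show ?case by (intro am_mu_least)
qed

subsection \<open>Principal am-stable ideals\<close>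

lemma am_stable_iff:
  assumes \<xi>: "\<xi> \<in> c0_star" "\<xi> 0 > 0"
  shows "princ \<xi> = am.G (princ \<xi>) \<longleftrightarrow> dominated (am_seq \<xi>) \<xi>"
proof
  note P = char_set_princ[OF \<xi>(1)]
  assume "princ \<xi> = am.G (princ \<xi>)"
  then have "am_seq \<xi> \<in> princ \<xi>" using am.a_G[OF P] princ_self[OF \<xi>(1)] by blast
  then show "dominated (am_seq \<xi>) \<xi>" by (simp add: princ_def)
next
  note P = char_set_princ[OF \<xi>(1)]
  assume "dominated (am_seq \<xi>) \<xi>"
  then have "am_seq \<xi> \<in> princ \<xi>" using am_seq_c0[OF \<xi>(1)] by (simp add: princ_def)
  then have "\<xi> \<in> am.G (princ \<xi>)" by (rule am.GI[OF princ_nonzero[OF \<xi>] \<xi>(1)])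
  then show "princ \<xi> = am.G (princ \<xi>)" using princ_subset[OF am.char_G[OF P]] am.G_subset[OF P] by blast
qed

text \<open>Removes the ampliation from the stability estimate: partial sums increase, so the mean
  at \<open>j\<close> is at most \<open>m\<close> times the mean at \<open>j * m\<close>, where the
  estimate leads back to the index \<open>j\<close>.\<close>

lemma am_regular:
  assumes \<xi>: "\<xi> \<in> c0_star" and dom: "dominated (am_seq \<xi>) \<xi>"
  shows "\<exists>\<epsilon>>0. \<forall>n. \<epsilon> * am_seq \<xi> n \<le> \<xi> n"
proof -
  obtain m M where m: "m > 0" "M > 0" "\<And>n. am_seq \<xi> n \<le> M * \<xi> (n div m)" by (rule dominatedE[OF dom \<xi>]) blast
  have "1 / (real m * M) * am_seq \<xi> j \<le> \<xi> j" for j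
  proof -
    have "real (Suc j) * am_seq \<xi> j \<le> real (Suc (j * m)) * am_seq \<xi> (j * m)"
      unfolding am_seq_mult by (rule psum_mono) (use c0_starD(1)[OF \<xi>] m(1) in auto)
    also have "\<dots> \<le> real (Suc j * m) * am_seq \<xi> (j * m)"
      by (rule mult_right_mono) (use m(1) c0_starD(1)[OF am_seq_c0[OF \<xi>]] in \<open>simp_all only: of_nat_le_iff, simp_all\<close>)
    also have "\<dots> \<le> real (Suc j * m) * (M * \<xi> j)"
      using m(3)[of "j * m"] m(1) by (intro mult_left_mono) auto
    finally have "real (Suc j) * am_seq \<xi> j \<le> real (Suc j) * (real m * M * \<xi> j)" by (simp only: of_nat_mult mult_ac)
    then have "am_seq \<xi> j \<le> real m * M * \<xi> j" by (simp only: mult_le_cancel_left_pos of_nat_0_less_iff zero_less_Suc)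
    then show ?thesis using m(1,2) by (simp add: field_simps)
  qed
  then show ?thesis using m(1,2) by (intro exI[of _ "1 / (real m * M)"]) simp
qed

text \<open>Regularity bounds the last term from below, so the second half of \<open>2 * N\<close>
  terms carries at least the share \<epsilon>/2 of their sum. Doubling \<open>N\<close> thus
  multiplies the sum by at least \<open>1 + \<epsilon> / 2\<close>, and iteration beats any
  \<open>C\<close>.\<close>

lemma am_growth:
  assumes \<xi>: "\<xi> \<in> c0_star" and \<epsilon>: "\<epsilon> > 0" "\<And>n. \<epsilon> * am_seq \<xi> n \<le> \<xi> n"
  shows "\<exists>c\<ge>1. \<forall>N. C * (\<Sum>j<N. \<xi> j) \<le> (\<Sum>j<c * N. \<xi> j)"
proof -
  have s0: "0 \<le> (\<Sum>j<N. \<xi> j)" for N by (rule sum_nonneg) (rule c0_starD(1)[OF \<xi>])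
  have dbl: "(1 + \<epsilon> / 2) * (\<Sum>j<N. \<xi> j) \<le> (\<Sum>j<2 * N. \<xi> j)" for N
  proof (cases N)
    case (Suc k)
    define n where "n = 2 * N - 1"
    have n: "Suc n = 2 * N" by (simp add: n_def Suc)
    have "(\<Sum>j<2 * N. \<xi> j) = (\<Sum>j<N. \<xi> j) + (\<Sum>j=N..<2 * N. \<xi> j)"
      using sum.atLeastLessThan_concat[of 0 N "2 * N" \<xi>] by (simp add: atLeast0LessThan)
    moreover have "(\<Sum>j=N..<2 * N. \<xi> n) \<le> (\<Sum>j=N..<2 * N. \<xi> j)"
      by (rule sum_mono) (use c0_starD(2)[OF \<xi>] n in auto)
    moreover have "\<epsilon> / 2 * (\<Sum>j<2 * N. \<xi> j) \<le> (\<Sum>j=N..<2 * N. \<xi> n)"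
    proof -
      have "\<epsilon> * (\<Sum>j<2 * N. \<xi> j) = real (Suc n) * (\<epsilon> * am_seq \<xi> n)"
        using am_seq_mult[of n \<xi>] unfolding n by (simp only: mult_ac)
      also have "\<dots> \<le> real (Suc n) * \<xi> n" by (rule mult_left_mono[OF \<epsilon>(2)]) simp
      also have "real (Suc n) = 2 * real N" unfolding n by simp
      finally show ?thesis by simp
    qed
    moreover have "\<epsilon> / 2 * (\<Sum>j<N. \<xi> j) \<le> \<epsilon> / 2 * (\<Sum>j<2 * N. \<xi> j)"
      by (intro mult_left_mono psum_mono c0_starD(1)[OF \<xi>]) (use \<epsilon> in auto)
    ultimately show ?thesis by (simp add: distrib_right)
  qed simp
  have pw: "(1 + \<epsilon> / 2) ^ k * (\<Sum>j<N. \<xi> j) \<le> (\<Sum>j<2 ^ k * N. \<xi> j)" for k N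
  proof (induction k)
    case (Suc k)
    have "(1 + \<epsilon> / 2) * ((1 + \<epsilon> / 2) ^ k * (\<Sum>j<N. \<xi> j)) \<le> (1 + \<epsilon> / 2) * (\<Sum>j<2 ^ k * N. \<xi> j)"
      by (rule mult_left_mono[OF Suc.IH]) (use \<epsilon> in simp)
    also have "\<dots> \<le> (\<Sum>j<2 * (2 ^ k * N). \<xi> j)" by (rule dbl)
    finally show ?case by (simp add: mult.assoc)
  qed simp
  obtain k where k: "C < (1 + \<epsilon> / 2) ^ k" using real_arch_pow[of "1 + \<epsilon> / 2" C] \<epsilon> by auto
  have "C * (\<Sum>j<N. \<xi> j) \<le> (\<Sum>j<2 ^ k * N. \<xi> j)" for N
    using mult_right_mono[OF less_imp_le[OF k] s0[of N]] pw[of k N] by linarith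
  then show ?thesis by (intro exI[of _ "2 ^ k"]) simp
qed

lemma antimono_le_am_seq:
  assumes "antimono \<rho>" shows "\<rho> n \<le> am_seq \<rho> n"
proof -
  have "(\<Sum>j<Suc n. \<rho> n) \<le> (\<Sum>j<Suc n. \<rho> j)" by (rule sum_mono) (use antimonoD[OF assms] in auto)
  then have "real (Suc n) * \<rho> n \<le> real (Suc n) * am_seq \<rho> n" unfolding am_seq_mult by simp
  then show ?thesis by (simp only: mult_le_cancel_left_pos of_nat_0_less_iff zero_less_Suc)
qed

text \<open>A bound on means is a family of constraints on initial sums. Convergence to
  \<open>0\<close> is not such a constraint but follows, since a decreasing sequence lies below its
  mean and so below \<open>g\<close>.\<close>

lemma am_uniform:
  assumes g: "g \<in> c0_star" and \<xi>: "\<xi> \<in> c0_star"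
    and dom: "\<And>\<rho>. \<rho> \<in> c0_star \<Longrightarrow> (\<And>n. am_seq \<rho> n \<le> g n) \<Longrightarrow> dominated \<rho> \<xi>"
  obtains m where "m > 0"
    "\<And>\<rho> n. (\<And>n. 0 \<le> \<rho> n) \<Longrightarrow> antimono \<rho> \<Longrightarrow> (\<And>n. am_seq \<rho> n \<le> g n) \<Longrightarrow> \<rho> n \<le> real m * \<xi> (n div m)"
proof -
  define C where "C = range (\<lambda>n. ({..<Suc n}, real (Suc n) * g n))"
  have iff: "(\<forall>A b. (A, b) \<in> C \<longrightarrow> sum \<rho> A \<le> b) \<longleftrightarrow> (\<forall>n. am_seq \<rho> n \<le> g n)" for \<rho>
  proof -
    have "(\<forall>A b. (A, b) \<in> C \<longrightarrow> sum \<rho> A \<le> b) \<longleftrightarrow> (\<forall>n. sum \<rho> {..<Suc n} \<le> real (Suc n) * g n)"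
      by (auto simp: C_def simp del: sum.lessThan_Suc)
    also have "\<dots> \<longleftrightarrow> (\<forall>n. am_seq \<rho> n \<le> g n)"
      unfolding am_seq_mult[symmetric] by (simp only: mult_le_cancel_left_pos of_nat_0_less_iff zero_less_Suc)
    finally show ?thesis .
  qed
  have "\<exists>m>0. \<forall>\<rho>\<in>{\<rho>. (\<forall>n. 0 \<le> \<rho> n) \<and> antimono \<rho> \<and> (\<forall>A b. (A, b) \<in> C \<longrightarrow> sum \<rho> A \<le> b)}.
      \<forall>n. \<rho> n \<le> real m * \<xi> (n div m)"
  proof (rule uniform_domination[OF _ _ \<xi>])
    show "finite A" if "(A, b) \<in> C" for A b using that by (auto simp: C_def)
    show "\<exists>A b. (A, b) \<in> C \<and> n \<in> A" for n unfolding C_def by (intro exI[of _ "{..<Suc n}"]) auto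
    fix \<rho> assume "\<rho> \<in> {\<rho>. (\<forall>n. 0 \<le> \<rho> n) \<and> antimono \<rho> \<and> (\<forall>A b. (A, b) \<in> C \<longrightarrow> sum \<rho> A \<le> b)}"
    then have \<rho>: "\<And>n. 0 \<le> \<rho> n" "antimono \<rho>" "\<And>n. am_seq \<rho> n \<le> g n" unfolding iff by auto
    have "\<rho> n \<le> g n" for n using antimono_le_am_seq[OF \<rho>(2)] \<rho>(3) order_trans by blast
    then have "\<rho> \<longlonglongrightarrow> 0"
      by (rule null_sandwich[OF \<rho>(1) _ c0_starD(3)[OF g]])
    then show "dominated \<rho> \<xi>" by (intro dom) (use \<rho> in \<open>auto simp: c0_star_def\<close>)
  qed
  then obtain m where "m > 0" "\<And>\<rho> n. (\<forall>n. 0 \<le> \<rho> n) \<and> antimono \<rho> \<and> (\<forall>n. am_seq \<rho> n \<le> g n) \<Longrightarrow> \<rho> n \<le> real m * \<xi> (n div m)"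
    unfolding iff by blast
  then show ?thesis using that by blast
qed

text \<open>The smallest nonnegative decreasing sequence with value \<open>b\<close> at index
  \<open>N - 1\<close>, hence the cheapest test of a uniform bound at that index.\<close>

definition block :: "real \<Rightarrow> nat \<Rightarrow> nat \<Rightarrow> real" where
  "block b N = (\<lambda>i. if i < N then b else 0)"

lemma block_antimono: "0 \<le> b \<Longrightarrow> antimono (block b N)"
  by (auto simp: block_def antimono_def)

lemma sum_block: "(\<Sum>j<n. block b N j) = real (min n N) * b"
  by (induction n) (auto simp: block_def min_def algebra_simps)

text \<open>All sequences whose mean is below an element \<eta> of \<open>J\<close> are dominated by
  \<xi> uniformly, so the height of a block of length \<open>N\<close> with mean below \<eta> is
  bounded by a value of \<xi>. Growth of the partial sums of \<xi> excludes that the constraints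
  beyond \<open>c * N\<close>, rather than the value of \<eta> at \<open>c * N\<close>, limit this
  height.\<close>

lemma am_stable_pre_cancel:
  assumes \<xi>: "\<xi> \<in> c0_star" "\<xi> 0 > 0" and st: "princ \<xi> = am.G (princ \<xi>)" and J: "char_set J"
    and sub: "princ \<xi> \<subseteq> J" and GJ: "am.G J \<subseteq> princ \<xi>"
  shows "J \<subseteq> princ \<xi>"
proof
  fix \<theta> assume \<theta>: "\<theta> \<in> J"
  \<comment> \<open>Adding \<xi> stays inside \<open>J\<close> and provides the regularity bound:
    \<eta> is at least \<epsilon> times the mean of \<xi>.\<close>
  define \<eta> where "\<eta> = (\<lambda>n. \<theta> n + \<xi> n)"
  have \<eta>J: "\<eta> \<in> J" unfolding \<eta>_def using char_setD(3)[OF J \<theta>] sub princ_self[OF \<xi>(1)] by blast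
  have \<theta>c: "\<theta> \<in> c0_star" and \<eta>: "\<eta> \<in> c0_star" using char_setD(1)[OF J] \<theta> \<eta>J by auto
  have \<xi>\<eta>: "\<xi> n \<le> \<eta> n" and \<theta>\<eta>: "\<theta> n \<le> 1 * \<eta> n" for n
    using c0_starD(1)[OF \<theta>c, of n] c0_starD(1)[OF \<xi>(1), of n] by (auto simp: \<eta>_def)
  obtain \<epsilon> where \<epsilon>: "\<epsilon> > 0" "\<And>n. \<epsilon> * am_seq \<xi> n \<le> \<xi> n" using am_regular[OF \<xi>(1)] am_stable_iff[OF \<xi>] st by blast
  have Jnz: "J \<noteq> {\<lambda>_. 0}" using sub princ_self[OF \<xi>(1)] \<xi>(2) by auto
  obtain k where k: "k > 0" "\<And>\<rho> n. (\<And>n. 0 \<le> \<rho> n) \<Longrightarrow> antimono \<rho> \<Longrightarrow> (\<And>n. am_seq \<rho> n \<le> \<eta> n) \<Longrightarrow> \<rho> n \<le> real k * \<xi> (n div k)"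
  proof (rule am_uniform[OF \<eta> \<xi>(1)])
    fix \<rho> assume \<rho>: "\<rho> \<in> c0_star" "\<And>n. am_seq \<rho> n \<le> \<eta> n"
    have "am_seq \<rho> \<in> J" by (rule char_set_le[OF J \<eta>J am_seq_c0[OF \<rho>(1)], where M=1]) (use \<rho>(2) in simp)
    then have "\<rho> \<in> princ \<xi>" using am.GI[OF Jnz \<rho>(1)] GJ by blast
    then show "dominated \<rho> \<xi>" by (simp add: princ_def)
  qed blast
  \<comment> \<open>This factor makes \<epsilon> times the sum up to \<open>c * N\<close> exceed
    \<open>k\<^sup>2\<close> times the sum up to \<open>N\<close>; the summand \<open>1\<close>
    makes the excess strict.\<close>
  obtain c where c: "c \<ge> 1" "\<And>N. ((real k)\<^sup>2 / \<epsilon> + 1) * (\<Sum>j<N. \<xi> j) \<le> (\<Sum>j<c * N. \<xi> j)"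
    using am_growth[OF \<xi>(1) \<epsilon>] by blast
  have key: "\<eta> (c * N) \<le> real k * \<xi> ((N - 1) div k)" if N: "N \<ge> 1" for N
  proof (rule ccontr)
    assume not: "\<not> ?thesis"
    define S where "S = (\<Sum>j<c * N. \<xi> j)"
    \<comment> \<open>Before \<open>c * N\<close> the height stays below \<eta>; from there on the
      mass \<open>N * b \<le> \<epsilon> * S\<close> is at most \<epsilon> times the partial sums of
      \<xi>, which keeps the mean below \<eta>.\<close>
    define b where "b = min (\<eta> (c * N)) (\<epsilon> * S / real N)"
    have S0: "0 \<le> S" unfolding S_def by (rule sum_nonneg) (rule c0_starD(1)[OF \<xi>(1)])
    have b0: "0 \<le> b" unfolding b_def using c0_starD(1)[OF \<eta>] \<epsilon>(1) S0 by simp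
    have bN: "real N * b \<le> \<epsilon> * S"
    proof -
      have "real N * b \<le> real N * (\<epsilon> * S / real N)" by (intro mult_left_mono) (auto simp: b_def)
      then show ?thesis using N by simp
    qed
    have "block b N (N - 1) \<le> real k * \<xi> ((N - 1) div k)"
    proof (rule k(2)[of "block b N" "N - 1"])
      show "0 \<le> block b N n" for n using b0 by (simp add: block_def)
      show "antimono (block b N)" by (rule block_antimono[OF b0])
      fix n
      have "real (Suc n) * am_seq (block b N) n \<le> real (Suc n) * \<eta> n"
        unfolding am_seq_mult sum_block
      proof (cases "n < c * N")
        case True
        have "b \<le> \<eta> n" using c0_starD(2)[OF \<eta>, of n "c * N"] True by (simp add: b_def)
        then show "real (min (Suc n) N) * b \<le> real (Suc n) * \<eta> n" using b0 by (intro mult_mono) auto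
      next
        case False
        have "real (min (Suc n) N) * b \<le> real N * b" by (intro mult_right_mono b0) simp
        also have "\<dots> \<le> \<epsilon> * S" by (rule bN)
        also have "\<dots> \<le> \<epsilon> * (\<Sum>j<Suc n. \<xi> j)"
          unfolding S_def by (intro mult_left_mono psum_mono c0_starD(1)[OF \<xi>(1)]) (use False \<epsilon> in auto)
        also have "\<dots> = real (Suc n) * (\<epsilon> * am_seq \<xi> n)" unfolding am_seq_mult[symmetric] by simp
        also have "\<dots> \<le> real (Suc n) * \<eta> n" using \<epsilon>(2)[of n] \<xi>\<eta>[of n] by (intro mult_left_mono) auto
        finally show "real (min (Suc n) N) * b \<le> real (Suc n) * \<eta> n" .
      qed
      then show "am_seq (block b N) n \<le> \<eta> n" by (simp only: mult_le_cancel_left_pos of_nat_0_less_iff zero_less_Suc)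
    qed
    then have b: "b \<le> real k * \<xi> ((N - 1) div k)" using N by (simp add: block_def)
    then have "b = \<epsilon> * S / real N" using not by (simp add: b_def min_def split: if_splits)
    then have 1: "\<epsilon> * S \<le> real N * (real k * \<xi> ((N - 1) div k))"
      using b N by (simp add: divide_le_eq mult.commute)
    define q where "q = (N - 1) div k"
    have "N - 1 < Suc q * k" unfolding q_def using k(1) by (simp add: dividend_less_div_times)
    then have "N \<le> Suc q * k" by linarith
    then have "real N \<le> real (Suc q) * real k" by (metis of_nat_mono of_nat_mult)
    then have "real N * (real k * \<xi> q) \<le> (real (Suc q) * real k) * (real k * \<xi> q)"
      by (rule mult_right_mono) (use c0_starD(1)[OF \<xi>(1)] in simp)
    also have "\<dots> = (real k)\<^sup>2 * (real (Suc q) * \<xi> q)" by (simp only: power2_eq_square mult_ac)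
    also have "\<dots> \<le> (real k)\<^sup>2 * (\<Sum>j<Suc q. \<xi> j)"
      unfolding am_seq_mult[symmetric] by (intro mult_left_mono am_seq_ge[OF \<xi>(1)]) auto
    also have "\<dots> \<le> (real k)\<^sup>2 * (\<Sum>j<N. \<xi> j)"
    proof (intro mult_left_mono psum_mono c0_starD(1)[OF \<xi>(1)])
      have "q \<le> N - 1" unfolding q_def by (rule div_le_dividend)
      then show "Suc q \<le> N" using N by linarith
    qed simp
    finally have 2: "\<epsilon> * S \<le> (real k)\<^sup>2 * (\<Sum>j<N. \<xi> j)" using 1 by (simp add: q_def)
    have "\<epsilon> * (((real k)\<^sup>2 / \<epsilon> + 1) * (\<Sum>j<N. \<xi> j)) \<le> \<epsilon> * S"
      unfolding S_def by (rule mult_left_mono[OF c(2)]) (use \<epsilon> in simp)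
    moreover have "\<epsilon> * (((real k)\<^sup>2 / \<epsilon> + 1) * (\<Sum>j<N. \<xi> j)) = (real k)\<^sup>2 * (\<Sum>j<N. \<xi> j) + \<epsilon> * (\<Sum>j<N. \<xi> j)"
      using \<epsilon>(1) by (simp add: field_simps)
    moreover have "(\<Sum>j<1. \<xi> j) \<le> (\<Sum>j<N. \<xi> j)" by (rule psum_mono) (use c0_starD(1)[OF \<xi>(1)] N in auto)
    then have "\<epsilon> * (\<Sum>j<N. \<xi> j) > 0" using \<xi>(2) \<epsilon>(1) by simp
    ultimately show False using 2 by linarith
  qed
  have "dominated \<eta> \<xi>"
  proof (rule dominated_eventually[OF \<xi>, where m="c * (2 * k)" and N=c and M="real k" and B="\<eta> 0"])
    show "c * (2 * k) > 0" using c(1) k(1) by simp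
    show "\<eta> n \<le> \<eta> 0" for n by (rule c0_starD(2)[OF \<eta>]) simp
    fix n assume n: "n \<ge> c"
    define x where "x = n div c"
    have x: "x \<ge> 1" using div_le_mono[OF n, of c] c(1) by (simp add: x_def)
    have "\<eta> n \<le> \<eta> (c * x)" by (rule c0_starD(2)[OF \<eta>]) (simp add: x_def)
    also have "\<dots> \<le> real k * \<xi> ((x - 1) div k)" by (rule key[OF x])
    also have "\<dots> \<le> real k * \<xi> (n div (c * (2 * k)))"
    proof (intro mult_left_mono c0_starD(2)[OF \<xi>(1)])
      have "n div (c * (2 * k)) = x div 2 div k" by (simp add: x_def div_mult2_eq)
      also have "\<dots> \<le> (x - 1) div k" by (rule div_le_mono) (use x in linarith)
      finally show "n div (c * (2 * k)) \<le> (x - 1) div k" .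
    qed simp
    finally show "\<eta> n \<le> real k * \<xi> (n div (c * (2 * k)))" .
  qed
  then have "dominated \<theta> \<xi>" by (rule dominated_trans[OF dominated_le[OF \<theta>\<eta>] _ \<eta> \<xi>(1)])
  then show "\<theta> \<in> princ \<xi>" using \<theta>c by (simp add: princ_def)
qed

text \<open>Take \<eta> in \<open>J\<close> whose mean dominates \<xi>. The partial sums of \<xi>
  and \<eta> are then comparable both ways, so \<eta> inherits growth: its sum of
  \<open>c * n\<close> terms is at least twice that of \<open>n\<close> terms. Hence the latter is
  at most \<open>c * n * \<eta> n\<close>, and \<eta> dominates \<xi> itself.\<close>

lemma am_stable_mean_cancel:
  assumes \<xi>: "\<xi> \<in> c0_star" "\<xi> 0 > 0" and st: "princ \<xi> = am.G (princ \<xi>)" and J: "char_set J"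
    and FJ: "am.F J = princ \<xi>"
  shows "J = princ \<xi>"
proof
  show sub: "J \<subseteq> princ \<xi>" using am.subset_F[OF J] FJ char_setD(1)[OF J] by blast
  obtain \<epsilon> where \<epsilon>: "\<epsilon> > 0" "\<And>n. \<epsilon> * am_seq \<xi> n \<le> \<xi> n" using am_regular[OF \<xi>(1)] am_stable_iff[OF \<xi>] st by blast
  have "\<xi> \<in> am.F J" using FJ princ_self[OF \<xi>(1)] by simp
  then obtain \<eta> M where \<eta>: "\<eta> \<in> J" "\<eta> \<in> c0_star" "M > 0" "\<And>n. \<xi> n \<le> M * am_seq \<eta> n" by (rule am.FE) blast
  obtain m K where m: "m > 0" "K > 0" "\<And>n. \<eta> n \<le> K * \<xi> (n div m)"
    using dominatedE[of \<eta> \<xi>] sub \<eta>(1) \<xi>(1) by (auto simp: princ_def)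
  define D where "D = K * real m"
  have D: "D > 0" using m by (simp add: D_def)
  have up: "(\<Sum>j<N. \<eta> j) \<le> D * (\<Sum>j<N. \<xi> j)" for N
  proof (cases N)
    case (Suc n)
    have "am_seq \<eta> n \<le> am_seq (\<lambda>n. K * \<xi> (n div m)) n" by (rule am_seq_mono) (rule m(3))
    also have "\<dots> = K * am_seq (\<lambda>n. \<xi> (n div m)) n"
      using am.a_scale[OF c0_star_ampliation[OF \<xi>(1) m(1)], of K] m(2) by simp
    also have "\<dots> \<le> K * (real m * am_seq \<xi> n)" using m(2) am_seq_ampliation_le[OF \<xi>(1) m(1)] by simp
    finally have "real (Suc n) * am_seq \<eta> n \<le> real (Suc n) * (D * am_seq \<xi> n)"
      by (intro mult_left_mono) (simp_all add: D_def mult.assoc)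
    also have "\<dots> = D * (real (Suc n) * am_seq \<xi> n)" by (simp only: mult_ac)
    finally show ?thesis unfolding am_seq_mult Suc .
  qed simp
  have low: "\<epsilon> * (\<Sum>j<N. \<xi> j) \<le> M * (\<Sum>j<N. \<eta> j)" for N
  proof (cases N)
    case (Suc n)
    have "\<epsilon> * am_seq \<xi> n \<le> M * am_seq \<eta> n" using \<epsilon>(2)[of n] \<eta>(4)[of n] by linarith
    then have "real (Suc n) * (\<epsilon> * am_seq \<xi> n) \<le> real (Suc n) * (M * am_seq \<eta> n)" by (rule mult_left_mono) simp
    then have "\<epsilon> * (real (Suc n) * am_seq \<xi> n) \<le> M * (real (Suc n) * am_seq \<eta> n)" by (simp only: mult_ac)
    then show ?thesis unfolding am_seq_mult Suc .
  qed simp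
  obtain c where c: "c \<ge> 1" "\<And>N. (2 * M * D / \<epsilon>) * (\<Sum>j<N. \<xi> j) \<le> (\<Sum>j<c * N. \<xi> j)"
    using am_growth[OF \<xi>(1) \<epsilon>] by blast
  have "\<xi> n \<le> (M * real c) * \<eta> n" for n
  proof (cases n)
    case 0
    have "\<xi> 0 \<le> M * \<eta> 0" using \<eta>(4)[of 0] by (simp add: am_seq_def)
    also have "\<dots> \<le> (M * real c) * \<eta> 0" using c(1) \<eta>(3) c0_starD(1)[OF \<eta>(2), of 0] by (intro mult_right_mono) auto
    finally show ?thesis using 0 by simp
  next
    case (Suc k)
    have "\<epsilon> * ((2 * M * D / \<epsilon>) * (\<Sum>j<n. \<xi> j)) \<le> \<epsilon> * (\<Sum>j<c * n. \<xi> j)"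
      by (rule mult_left_mono[OF c(2)]) (use \<epsilon> in simp)
    also have "\<dots> \<le> M * (\<Sum>j<c * n. \<eta> j)" by (rule low)
    finally have "M * (2 * (D * (\<Sum>j<n. \<xi> j))) \<le> M * (\<Sum>j<c * n. \<eta> j)" using \<epsilon>(1) by (simp add: mult_ac)
    then have "2 * (D * (\<Sum>j<n. \<xi> j)) \<le> (\<Sum>j<c * n. \<eta> j)" using \<eta>(3) by simp
    then have 1: "2 * (\<Sum>j<n. \<eta> j) \<le> (\<Sum>j<c * n. \<eta> j)" using up[of n] by linarith
    have nc: "n \<le> c * n" using c(1) by simp
    have "(\<Sum>j<c * n. \<eta> j) = (\<Sum>j<n. \<eta> j) + (\<Sum>j=n..<c * n. \<eta> j)"
      using sum.atLeastLessThan_concat[of 0 n "c * n" \<eta>] nc by (simp add: atLeast0LessThan)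
    also have "(\<Sum>j=n..<c * n. \<eta> j) \<le> (\<Sum>j=n..<c * n. \<eta> n)" by (rule sum_mono) (use c0_starD(2)[OF \<eta>(2)] in auto)
    also have "\<dots> \<le> real (c * n) * \<eta> n"
      unfolding sum_constant card_atLeastLessThan by (intro mult_right_mono c0_starD(1)[OF \<eta>(2)]) (simp only: of_nat_le_iff diff_le_self)
    finally have 2: "(\<Sum>j<n. \<eta> j) \<le> real (c * n) * \<eta> n" using 1 by linarith
    \<comment> \<open>A sum of \<open>n\<close> terms is a mean at the index
      \<open>k = n - 1\<close>; because of this shift \<open>n = 0\<close> is treated apart.\<close>
    have "real n * \<xi> n \<le> real (Suc k) * \<xi> k" using c0_starD(2)[OF \<xi>(1), of k n] Suc by (intro mult_mono) (auto simp: c0_starD(1)[OF \<xi>(1)])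
    also have "\<dots> \<le> real (Suc k) * (M * am_seq \<eta> k)" by (rule mult_left_mono[OF \<eta>(4)]) simp
    also have "\<dots> = M * (\<Sum>j<n. \<eta> j)" using am_seq_mult[of k \<eta>] by (simp only: Suc mult_ac)
    also have "\<dots> \<le> M * (real (c * n) * \<eta> n)" using 2 \<eta>(3) by simp
    finally have "real n * \<xi> n \<le> real n * ((M * real c) * \<eta> n)" by (simp only: of_nat_mult mult_ac)
    then show ?thesis using Suc by (simp del: of_nat_Suc)
  qed
  then have "\<xi> \<in> J" by (rule char_set_le[OF J \<eta>(1) \<xi>(1)])
  then show "princ \<xi> \<subseteq> J" by (rule princ_subset[OF J])
qed

text \<open>Let the running maximum behind \<open>am_mu \<eta>\<close> be attained at
  \<open>i\<close>. It is bounded by a multiple of the partial sum of \<xi> up to \<open>i\<close>,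
  and by growth this is too small to control \<xi> at \<open>n\<close> if \<open>i\<close> is much
  smaller than \<open>n\<close>. So \<open>i\<close> is at least \<open>n div c\<close>, and \<eta>
  alone dominates \<xi>.\<close>

lemma am_stable_open_cancel:
  assumes \<xi>: "\<xi> \<in> c0_star" "\<xi> 0 > 0" and st: "princ \<xi> = am.G (princ \<xi>)" and J: "char_set J"
    and so: "am.so J = princ \<xi>"
  shows "J = princ \<xi>"
proof
  show sub: "J \<subseteq> princ \<xi>" using am.subset_so[of J] so char_setD(1)[OF J] by blast
  obtain \<epsilon> where \<epsilon>: "\<epsilon> > 0" "\<And>n. \<epsilon> * am_seq \<xi> n \<le> \<xi> n" using am_regular[OF \<xi>(1)] am_stable_iff[OF \<xi>] st by blast
  have "\<xi> \<in> am.so J" using so princ_self[OF \<xi>(1)] by simp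
  then obtain \<eta> where \<eta>: "\<eta> \<in> J" "\<eta> \<in> c0_star" "dominated \<xi> (am_mu \<eta>)" by (auto simp: am.so_def)
  obtain m M where m: "m > 0" "M > 0" "\<And>n. \<xi> n \<le> M * am_mu \<eta> (n div m)"
    by (rule dominatedE[OF \<eta>(3) am_mu_c0[OF \<eta>(2)]]) blast
  obtain k K where k: "k > 0" "K > 0" "\<And>n. \<eta> n \<le> K * \<xi> (n div k)"
    using dominatedE[of \<eta> \<xi>] sub \<eta>(1) \<xi>(1) by (auto simp: princ_def)
  define D where "D = real m * M * (K * real k)"
  obtain c where c: "c \<ge> 1" "\<And>N. (D / \<epsilon> + 1) * (\<Sum>j<N. \<xi> j) \<le> (\<Sum>j<c * N. \<xi> j)"
    using am_growth[OF \<xi>(1) \<epsilon>] by blast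
  have "\<xi> n \<le> (real m * M) * \<eta> (n div c)" for n
  proof -
    define l where "l = n div m"
    obtain i where i: "i \<le> l" "am_maxq \<eta> l = real (Suc i) * \<eta> i" using am_maxq_attained by blast
    have "n < Suc l * m" unfolding l_def using m(1) by (simp add: dividend_less_div_times)
    then have nl: "real (Suc n) \<le> real m * real (Suc l)" by (metis Suc_leI mult.commute of_nat_mono of_nat_mult)
    have "real (Suc n) * \<xi> n \<le> real (Suc n) * (M * am_mu \<eta> l)" unfolding l_def by (rule mult_left_mono[OF m(3)]) simp
    also have "\<dots> \<le> (real m * real (Suc l)) * (M * am_mu \<eta> l)"
      by (rule mult_right_mono[OF nl]) (use m(2) c0_starD(1)[OF am_mu_c0[OF \<eta>(2)]] in simp)
    also have "\<dots> = real m * M * (real (Suc l) * am_mu \<eta> l)" by (simp only: mult_ac)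
    also have "\<dots> = real m * M * (real (Suc i) * \<eta> i)" unfolding am_mu_mult i(2) ..
    finally have 1: "real (Suc n) * \<xi> n \<le> real m * M * (real (Suc i) * \<eta> i)" .
    have "\<eta> i \<le> K * am_seq (\<lambda>n. \<xi> (n div k)) i"
      by (rule order_trans[OF k(3) mult_left_mono[OF am_seq_ge[OF c0_star_ampliation[OF \<xi>(1) k(1)]] less_imp_le[OF k(2)]]])
    also have "\<dots> \<le> K * (real k * am_seq \<xi> i)" using k(2) am_seq_ampliation_le[OF \<xi>(1) k(1)] by simp
    finally have "real (Suc i) * \<eta> i \<le> real (Suc i) * (K * (real k * am_seq \<xi> i))" by (rule mult_left_mono) simp
    also have "\<dots> = K * real k * (\<Sum>j<Suc i. \<xi> j)" unfolding am_seq_mult[symmetric] by (simp only: mult_ac)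
    finally have "real m * M * (real (Suc i) * \<eta> i) \<le> real m * M * (K * real k * (\<Sum>j<Suc i. \<xi> j))"
      by (rule mult_left_mono) (use m in simp)
    also have "\<dots> = D * (\<Sum>j<Suc i. \<xi> j)" by (simp only: D_def mult_ac)
    finally have 2: "real (Suc n) * \<xi> n \<le> D * (\<Sum>j<Suc i. \<xi> j)" using 1 by linarith
    have "\<epsilon> * (\<Sum>j<Suc n. \<xi> j) = real (Suc n) * (\<epsilon> * am_seq \<xi> n)" unfolding am_seq_mult[symmetric] by simp
    also have "\<dots> \<le> real (Suc n) * \<xi> n" by (rule mult_left_mono[OF \<epsilon>(2)]) simp
    finally have 3: "\<epsilon> * (\<Sum>j<Suc n. \<xi> j) \<le> D * (\<Sum>j<Suc i. \<xi> j)" using 2 by linarith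
    have "Suc n < c * Suc i"
    proof (rule ccontr)
      assume "\<not> Suc n < c * Suc i"
      then have "(\<Sum>j<c * Suc i. \<xi> j) \<le> (\<Sum>j<Suc n. \<xi> j)" by (intro psum_mono c0_starD(1)[OF \<xi>(1)]) simp
      then have "(D / \<epsilon> + 1) * (\<Sum>j<Suc i. \<xi> j) \<le> (\<Sum>j<Suc n. \<xi> j)" using c(2)[of "Suc i"] by linarith
      then have "\<epsilon> * ((D / \<epsilon> + 1) * (\<Sum>j<Suc i. \<xi> j)) \<le> \<epsilon> * (\<Sum>j<Suc n. \<xi> j)"
        by (rule mult_left_mono) (use \<epsilon> in simp)
      then have "\<epsilon> * ((D / \<epsilon> + 1) * (\<Sum>j<Suc i. \<xi> j)) \<le> D * (\<Sum>j<Suc i. \<xi> j)" using 3 by linarith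
      moreover have "\<epsilon> * ((D / \<epsilon> + 1) * (\<Sum>j<Suc i. \<xi> j)) = D * (\<Sum>j<Suc i. \<xi> j) + \<epsilon> * (\<Sum>j<Suc i. \<xi> j)"
        using \<epsilon>(1) by (simp add: field_simps del: sum.lessThan_Suc)
      moreover have "\<xi> 0 \<le> (\<Sum>j<Suc i. \<xi> j)" by (rule member_le_sum) (use c0_starD(1)[OF \<xi>(1)] in auto)
      then have "\<epsilon> * (\<Sum>j<Suc i. \<xi> j) > 0" using \<xi>(2) \<epsilon>(1) by (simp del: sum.lessThan_Suc)
      ultimately show False by linarith
    qed
    then have "n < Suc i * c" by (simp only: mult.commute)
    then have "n div c < Suc i" by (rule less_mult_imp_div_less)
    then have nc: "n div c \<le> i" by simp
    have "i \<le> n" using i(1) unfolding l_def by (rule order_trans) simp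
    have "real m * M * (real (Suc i) * \<eta> i) \<le> real m * M * (real (Suc n) * \<eta> i)"
      by (intro mult_left_mono mult_right_mono c0_starD(1)[OF \<eta>(2)]) (use m \<open>i \<le> n\<close> in auto)
    then have "real (Suc n) * \<xi> n \<le> real (Suc n) * (real m * M * \<eta> i)" using 1 by (simp only: mult_ac)
    then have "\<xi> n \<le> real m * M * \<eta> i" by (simp only: mult_le_cancel_left_pos of_nat_0_less_iff zero_less_Suc)
    also have "\<dots> \<le> real m * M * \<eta> (n div c)"
      by (intro mult_left_mono c0_starD(2)[OF \<eta>(2) nc]) (use m in simp)
    finally show ?thesis .
  qed
  then have "dominated \<xi> \<eta>" by (intro dominatedI[where m=c]) (use c in auto)
  then have "\<xi> \<in> J" by (rule char_setD(4)[OF J \<eta>(1) \<xi>(1)])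
  then show "princ \<xi> \<subseteq> J" by (rule princ_subset[OF J])
qed

text \<open>Closedness dominates all sequences whose mean is below that of \<xi>. The test is the
  block of height \<open>am_seq \<xi> N\<close> and length \<open>N + 1\<close>, whose mass is the
  partial sum of \<xi>.\<close>

lemma am_closed_imp_stable:
  assumes \<xi>: "\<xi> \<in> c0_star" "\<xi> 0 > 0" and cl: "princ \<xi> = am.G (am.F (princ \<xi>))"
  shows "princ \<xi> = am.G (princ \<xi>)"
proof -
  obtain k where k: "k > 0" "\<And>\<rho> n. (\<And>n. 0 \<le> \<rho> n) \<Longrightarrow> antimono \<rho> \<Longrightarrow> (\<And>n. am_seq \<rho> n \<le> am_seq \<xi> n) \<Longrightarrow> \<rho> n \<le> real k * \<xi> (n div k)"
  proof (rule am_uniform[OF am_seq_c0[OF \<xi>(1)] \<xi>(1)])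
    fix \<rho> assume \<rho>: "\<rho> \<in> c0_star" "\<And>n. am_seq \<rho> n \<le> am_seq \<xi> n"
    have "\<rho> \<in> am.G (am.F (princ \<xi>))"
      by (rule am_GF_memI[OF \<rho>(1) char_set_princ[OF \<xi>(1)] princ_self[OF \<xi>(1)], where C=1]) (use \<rho>(2) in simp)
    then show "dominated \<rho> \<xi>" using cl by (simp add: princ_def)
  qed blast
  have "dominated (am_seq \<xi>) \<xi>"
  proof (rule dominatedI[OF k(1)])
    fix N
    define b where "b = am_seq \<xi> N"
    have b0: "0 \<le> b" unfolding b_def by (rule c0_starD(1)[OF am_seq_c0[OF \<xi>(1)]])
    have "block b (Suc N) N \<le> real k * \<xi> (N div k)"
    proof (rule k(2)[of "block b (Suc N)" N])
      show "0 \<le> block b (Suc N) n" for n using b0 by (simp add: block_def)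
      show "antimono (block b (Suc N))" by (rule block_antimono[OF b0])
      fix n
      have "real (Suc n) * am_seq (block b (Suc N)) n \<le> real (Suc n) * am_seq \<xi> n"
      proof (cases "n \<le> N")
        case True
        have "real (min (Suc n) (Suc N)) * b \<le> real (Suc n) * am_seq \<xi> n"
          using c0_starD(2)[OF am_seq_c0[OF \<xi>(1)] True] b0 by (intro mult_mono) (auto simp: b_def)
        then show ?thesis by (simp only: am_seq_mult[of n "block b (Suc N)"] sum_block)
      next
        case False
        have "(\<Sum>j<Suc n. block b (Suc N) j) = real (Suc N) * am_seq \<xi> N" using False by (simp add: sum_block b_def del: sum.lessThan_Suc)
        also have "\<dots> \<le> (\<Sum>j<Suc n. \<xi> j)" unfolding am_seq_mult by (rule psum_mono) (use c0_starD(1)[OF \<xi>(1)] False in auto)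
        finally show ?thesis by (simp only: am_seq_mult)
      qed
      then show "am_seq (block b (Suc N)) n \<le> am_seq \<xi> n" by (simp only: mult_le_cancel_left_pos of_nat_0_less_iff zero_less_Suc)
    qed
    then show "am_seq \<xi> N \<le> real k * \<xi> (N div k)" by (simp add: block_def b_def)
  qed
  then show ?thesis using am_stable_iff[OF \<xi>] by blast
qed

subsection \<open>Principal am-open ideals\<close>

text \<open>Without a flat block beyond \<open>N\<close>, the increasing quantity
  \<open>(n + 1) * x n\<close> doubles from \<open>s\<close> to \<open>L * (s + 1)\<close>. A
  geometric estimate then bounds partial sums by its last value, and the mean of \<open>x\<close> is
  dominated by \<open>x\<close>.\<close>

lemma am_unstable_flat:
  fixes x :: "nat \<Rightarrow> real"
  assumes x: "x \<in> c0_star" "x 0 > 0" and mono: "\<And>m n. m \<le> n \<Longrightarrow> real (Suc m) * x m \<le> real (Suc n) * x n"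
    and not: "\<not> dominated (am_seq x) x"
  shows "\<exists>s\<ge>N. \<forall>i\<in>{s..K * Suc s + 1}. \<forall>j\<in>{s..K * Suc s + 1}. real (Suc i) * x i \<le> 2 * (real (Suc j) * x j)"
proof (rule ccontr)
  assume nf: "\<not> ?thesis"
  define R where "R = (\<lambda>n. real (Suc n) * x n)"
  have Rm: "R m \<le> R n" if "m \<le> n" for m n using mono[OF that] by (simp add: R_def)
  have Rpos: "R n > 0" for n using Rm[of 0 n] x(2) by (simp add: R_def)
  define L where "L = Suc K"
  have dbl: "2 * R s \<le> R (L * Suc s)" if s: "s \<ge> N" for s
  proof -
    obtain i j where ij: "i \<in> {s..K * Suc s + 1}" "j \<in> {s..K * Suc s + 1}" "\<not> R i \<le> 2 * R j"
      using nf s unfolding R_def by blast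
    have "2 * R s \<le> 2 * R j" using Rm[of s j] ij(2) by simp
    also have "\<dots> \<le> R i" using ij(3) by simp
    also have "\<dots> \<le> R (L * Suc s)" using ij(1) by (intro Rm) (simp add: L_def)
    finally show ?thesis .
  qed
  define B where "B = (\<Sum>j<L * Suc N. x j)"
  \<comment> \<open>\<open>B / x 0\<close> covers the initial segment. Afterwards the early part
    contributes \<open>C / 2\<close> and the rest at most \<open>L\<close>, so
    \<open>C \<ge> 2 * L\<close> closes the induction.\<close>
  define C where "C = 2 * real L + B / x 0"
  have B0: "0 \<le> B" unfolding B_def by (rule sum_nonneg) (rule c0_starD(1)[OF x(1)])
  have "(\<Sum>j<Suc n. x j) \<le> C * R n" for n
  proof (induction n rule: less_induct)
    case (less n)
    show ?case
    proof (cases "n < L * Suc N")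
      case True
      then have "(\<Sum>j<Suc n. x j) \<le> B" unfolding B_def by (intro psum_mono c0_starD(1)[OF x(1)]) simp
      also have "\<dots> = B / x 0 * R 0" using x(2) by (simp add: R_def)
      also have "\<dots> \<le> C * R n"
        using Rm[of 0 n] Rpos[of 0] B0 x(2) by (intro mult_mono) (auto simp: C_def)
      finally show ?thesis .
    next
      case False
      define q where "q = n div L"
      have L: "L > 0" by (simp add: L_def)
      have "Suc N \<le> q" using div_le_mono[of "L * Suc N" n L] False L by (simp add: q_def)
      then obtain k where k: "q = Suc k" "N \<le> k" by (cases q) auto
      have kn: "L * Suc k \<le> n" using times_div_less_eq_dividend[of L n] k(1) by (simp only: q_def)
      have nk: "n < Suc (Suc k) * L" using dividend_less_div_times[OF L, of n] k(1) by (simp add: q_def)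
      have "Suc k \<le> L * Suc k" using mult_le_mono1[of 1 L "Suc k"] L by simp
      then have kl: "k < n" using kn by linarith
      have "(\<Sum>j<Suc n. x j) = (\<Sum>j<Suc k. x j) + (\<Sum>j=Suc k..<Suc n. x j)"
        using sum.atLeastLessThan_concat[of 0 "Suc k" "Suc n" x] kl by (simp add: atLeast0LessThan)
      also have "(\<Sum>j<Suc k. x j) \<le> C * R k" by (rule less.IH[OF kl])
      also have "C * R k \<le> C / 2 * R n"
      proof -
        have "2 * R k \<le> R n" using dbl[OF k(2)] Rm[OF kn] by linarith
        moreover have "C \<ge> 0" using B0 x(2) by (simp add: C_def)
        ultimately have "C / 2 * (2 * R k) \<le> C / 2 * R n" by (intro mult_left_mono) auto
        then show ?thesis by simp
      qed
      also have "(\<Sum>j=Suc k..<Suc n. x j) \<le> (\<Sum>j=Suc k..<Suc n. R n / real (Suc (Suc k)))"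
      proof (rule sum_mono)
        fix j assume j: "j \<in> {Suc k..<Suc n}"
        have "x j = R j / real (Suc j)" by (simp add: R_def)
        also have "\<dots> \<le> R n / real (Suc (Suc k))"
          using j Rpos[of n] by (intro frac_le Rm) (auto simp: less_imp_le)
        finally show "x j \<le> R n / real (Suc (Suc k))" .
      qed
      also have "\<dots> \<le> real L * R n"
      proof -
        have "real (n - k) \<le> real (Suc (Suc k) * L)" using nk by (intro of_nat_mono) linarith
        then have "real (n - k) * (R n / real (Suc (Suc k))) \<le> real (Suc (Suc k) * L) * (R n / real (Suc (Suc k)))"
          using Rpos[of n] by (intro mult_right_mono) auto
        also have "\<dots> = real L * R n" unfolding of_nat_mult by (simp del: of_nat_Suc)
        finally show ?thesis by simp
      qed
      finally have "(\<Sum>j<Suc n. x j) \<le> (C / 2 + real L) * R n" by (simp add: distrib_right)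
      also have "\<dots> \<le> C * R n" using Rpos[of n] B0 x(2) by (intro mult_right_mono) (auto simp: C_def field_simps)
      finally show ?thesis .
    qed
  qed
  then have "real (Suc n) * am_seq x n \<le> real (Suc n) * (C * x n)" for n
    unfolding am_seq_mult R_def by (simp only: mult_ac)
  then have "am_seq x n \<le> C * x n" for n by (simp only: mult_le_cancel_left_pos of_nat_0_less_iff zero_less_Suc)
  then show False using not dominated_le by blast
qed

text \<open>Replaces the generator by a mean, whose product with \<open>n + 1\<close> is increasing
  as \<open>am_unstable_flat\<close> requires.\<close>

lemma am_open_generator:
  assumes \<xi>: "\<xi> \<in> c0_star" "\<xi> 0 > 0" and op: "princ \<xi> = am.F (am.G (princ \<xi>))"
  obtains \<rho> where "\<rho> \<in> c0_star" "\<rho> 0 > 0" "princ \<xi> = princ (am_seq \<rho>)"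
proof -
  note P = char_set_princ[OF \<xi>(1)]
  have "\<xi> \<in> am.F (am.G (princ \<xi>))" using op princ_self[OF \<xi>(1)] by blast
  then obtain \<rho> M where \<rho>: "\<rho> \<in> am.G (princ \<xi>)" "\<rho> \<in> c0_star" "M > 0" "\<And>n. \<xi> n \<le> M * am_seq \<rho> n" by (rule am.FE) blast
  have "am_seq \<rho> \<in> princ \<xi>" by (rule am.a_G[OF P \<rho>(1)])
  then have "princ (am_seq \<rho>) \<subseteq> princ \<xi>" by (rule princ_subset[OF P])
  moreover have "\<xi> \<in> princ (am_seq \<rho>)" using \<xi>(1) dominated_le[OF \<rho>(4)] by (simp add: princ_def)
  then have "princ \<xi> \<subseteq> princ (am_seq \<rho>)" by (rule princ_subset[OF char_set_princ[OF am_seq_c0[OF \<rho>(2)]]])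
  moreover have "\<rho> 0 > 0" using \<rho>(4)[of 0] \<xi>(2) \<rho>(3) zero_less_mult_pos[of M "\<rho> 0"] by (simp add: am_seq_def)
  ultimately show ?thesis using that \<rho>(2) by blast
qed

lemma am_open_unstable:
  assumes \<xi>: "\<xi> \<in> c0_star" "\<xi> 0 > 0" and op: "princ \<xi> = am.F (am.G (princ \<xi>))" and un: "princ \<xi> \<noteq> am.G (princ \<xi>)"
  shows "\<exists>J. char_set J \<and> am.G J = am.G (princ \<xi>) \<and> J \<noteq> princ \<xi>"
    and "\<exists>J. char_set J \<and> am.so J = am.so (princ \<xi>) \<and> J \<noteq> princ \<xi>"
proof -
  obtain \<rho> where \<rho>: "\<rho> \<in> c0_star" "\<rho> 0 > 0" "princ \<xi> = princ (am_seq \<rho>)" by (rule am_open_generator[OF \<xi> op])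
  define x where "x = am_seq \<rho>"
  have x: "x \<in> c0_star" unfolding x_def by (rule am_seq_c0[OF \<rho>(1)])
  have x0: "x 0 > 0" using \<rho>(2) by (simp add: x_def am_seq_def)
  have Px: "princ \<xi> = princ x" using \<rho>(3) by (simp add: x_def)
  have mono: "real (Suc m) * x m \<le> real (Suc n) * x n" if "m \<le> n" for m n
    unfolding x_def am_seq_mult by (rule psum_mono) (use c0_starD(1)[OF \<rho>(1)] that in auto)
  have pos: "x n > 0" for n using mono[of 0 n] x0 zero_less_mult_pos[of "real (Suc n)" "x n"] by simp
  have nd: "\<not> dominated (am_seq x) x" using un am_stable_iff[OF x x0] Px by simp
  have flat: "\<exists>s\<ge>N. \<forall>i\<in>{s..K * Suc s + 1}. \<forall>j\<in>{s..K * Suc s + 1}. real (Suc i) * x i \<le> 2 * (real (Suc j) * x j)" for K N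
    by (rule am_unstable_flat[OF x x0 _ nd]) (rule mono)
  note P = char_set_princ[OF x]
  show "\<exists>J. char_set J \<and> am.G J = am.G (princ \<xi>) \<and> J \<noteq> princ \<xi>"
  proof -
    obtain \<eta> where \<eta>: "\<eta> \<in> c0_star" "\<And>n. x n \<le> \<eta> n" "\<not> dominated \<eta> x"
      "\<And>l. \<exists>s\<le>l. \<eta> s = x s \<and> real (Suc s) * x s \<le> 2 * (real (Suc l) * x l)"
      and e: "\<And>l. \<exists>e\<ge>l. \<eta> e = x e \<and> real (Suc e) * x e \<le> 2 * (real (Suc l) * x l)"
      by (rule flat_upper[OF x pos flat]) (rule that)
    note Q = char_set_princ[OF \<eta>(1)]
    have "dominated x \<eta>" by (rule dominated_le[where M=1]) (use \<eta>(2) in simp)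
    then have "princ x \<subseteq> princ \<eta>" by (intro princ_subset[OF Q]) (simp add: princ_def x)
    then have sub: "am.G (princ x) \<subseteq> am.G (princ \<eta>)" by (rule am.G_mono[OF P Q])
    have "am.G (princ \<eta>) \<subseteq> am.G (princ x)"
    proof
      fix \<zeta> assume \<zeta>G: "\<zeta> \<in> am.G (princ \<eta>)"
      then have \<zeta>: "\<zeta> \<in> c0_star" using am.G_U by blast
      have "dominated (am_seq \<zeta>) \<eta>" using am.a_G[OF Q \<zeta>G] by (simp add: princ_def)
      then obtain m M where m: "m > 0" "M > 0" "\<And>n. am_seq \<zeta> n \<le> M * \<eta> (n div m)" by (rule dominatedE[OF _ \<eta>(1)]) blast
      have "dominated (am_seq \<zeta>) x"
      proof (rule dominatedI[OF m(1)])
        fix n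
        define l where "l = n div m"
        obtain e where e: "e \<ge> l" "\<eta> e = x e" "real (Suc e) * x e \<le> 2 * (real (Suc l) * x l)" using e by blast
        \<comment> \<open>Partial sums of \<zeta> increase, so the bound at the right meeting point
          \<open>e\<close>, where \<eta> equals \<open>x\<close>, passes back to
          \<open>l\<close>.\<close>
        have "real (Suc (m * l)) * am_seq \<zeta> (m * l) \<le> real (Suc (m * e)) * am_seq \<zeta> (m * e)"
          unfolding am_seq_mult by (rule psum_mono) (use c0_starD(1)[OF \<zeta>] e(1) in auto)
        also have "\<dots> \<le> real (m * Suc e) * (M * x e)"
          using m(3)[of "m * e"] m(1,2) e(2) c0_starD(1)[OF am_seq_c0[OF \<zeta>]] pos[of e] by (intro mult_mono) (auto simp: less_imp_le)
        also have "\<dots> = (real m * M) * (real (Suc e) * x e)" by (simp only: of_nat_mult mult_ac)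
        also have "\<dots> \<le> (real m * M) * (2 * (real (Suc l) * x l))" by (rule mult_left_mono[OF e(3)]) (use m in simp)
        also have "\<dots> = real (Suc l) * (2 * (real m * M) * x l)" by (simp only: mult_ac)
        also have "\<dots> \<le> real (Suc (m * l)) * (2 * (real m * M) * x l)"
        proof (rule mult_right_mono)
          have "l \<le> m * l" using m(1) by simp
          then show "real (Suc l) \<le> real (Suc (m * l))" by (simp only: of_nat_le_iff Suc_le_mono)
          show "0 \<le> 2 * (real m * M) * x l" using m pos[of l] by (simp add: less_imp_le)
        qed
        finally have "am_seq \<zeta> (m * l) \<le> 2 * (real m * M) * x l" by (simp only: mult_le_cancel_left_pos of_nat_0_less_iff zero_less_Suc)
        moreover have "am_seq \<zeta> n \<le> am_seq \<zeta> (m * l)" by (rule c0_starD(2)[OF am_seq_c0[OF \<zeta>]]) (simp add: l_def)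
        ultimately show "am_seq \<zeta> n \<le> 2 * (real m * M) * x (n div m)" by (simp add: l_def)
      qed
      then show "\<zeta> \<in> am.G (princ x)"
        by (intro am.GI[OF princ_nonzero[OF x x0] \<zeta>]) (simp add: princ_def am_seq_c0[OF \<zeta>])
    qed
    then have "am.G (princ \<eta>) = am.G (princ x)" using sub by (rule antisym)
    moreover have "princ \<eta> \<noteq> princ x" using \<eta>(3) princ_self[OF \<eta>(1)] by (auto simp: princ_def)
    ultimately show ?thesis using Q Px by (intro exI[of _ "princ \<eta>"]) simp
  qed
  show "\<exists>J. char_set J \<and> am.so J = am.so (princ \<xi>) \<and> J \<noteq> princ \<xi>"
  proof -
    obtain \<eta> where \<eta>: "\<eta> \<in> c0_star" "\<And>n. \<eta> n \<le> x n" "\<not> dominated x \<eta>"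
      and s: "\<And>l. \<exists>s\<le>l. \<eta> s = x s \<and> real (Suc l) * x l \<le> 2 * (real (Suc s) * x s)"
      "\<And>l. \<exists>e\<ge>l. \<eta> e = x e \<and> real (Suc l) * x l \<le> 2 * (real (Suc e) * x e)"
      by (rule flat_lower[OF x pos flat]) (rule that)
    note Q = char_set_princ[OF \<eta>(1)]
    have "dominated \<eta> x" by (rule dominated_le[where M=1]) (use \<eta>(2) in simp)
    then have "princ \<eta> \<subseteq> princ x" by (intro princ_subset[OF P]) (simp add: princ_def \<eta>(1))
    then have sub: "am.so (princ \<eta>) \<subseteq> am.so (princ x)" by (intro am.so_mono) blast
    \<comment> \<open>The running maximum still sees the left end of the block, where \<eta> equals
      \<open>x\<close>; so the lowering is undone up to the factor 2.\<close>
    have "x n \<le> 2 * am_mu \<eta> n" for n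
    proof -
      obtain s where s: "s \<le> n" "\<eta> s = x s" "real (Suc n) * x n \<le> 2 * (real (Suc s) * x s)" using s by blast
      then have "real (Suc n) * x n \<le> 2 * am_maxq \<eta> n" using am_maxq_ge[OF s(1), of \<eta>] by simp
      also have "\<dots> = real (Suc n) * (2 * am_mu \<eta> n)" unfolding am_mu_mult[symmetric] by simp
      finally show ?thesis by (simp only: mult_le_cancel_left_pos of_nat_0_less_iff zero_less_Suc)
    qed
    then have "dominated x (am_mu \<eta>)" by (rule dominated_le)
    then have "x \<in> am.so (princ \<eta>)" using x princ_self[OF \<eta>(1)] \<eta>(1) by (auto simp: am.so_def)
    then have "princ x \<subseteq> am.so (princ \<eta>)" by (rule princ_subset[OF am.char_so[OF Q]])
    moreover have "am.so (princ x) = princ x" by (rule am.so_of_open[OF P]) (use op Px in simp)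
    ultimately have "am.so (princ \<eta>) = am.so (princ x)" using sub by blast
    moreover have "princ \<eta> \<noteq> princ x" using \<eta>(3) princ_self[OF x] by (auto simp: princ_def)
    ultimately show ?thesis using Q Px by metis
  qed
qed

interpretation am: mean_cancellation am_seq c0_star c0_star am_mu
proof (rule mean_cancellation.intro[OF am.mean_theory_axioms], rule mean_cancellation_axioms.intro, goal_cases)
  case 1 then show ?case by (rule am_stable_pre_cancel)
next
  case 2 then show ?case by (rule am_stable_mean_cancel)
next
  case 3 then show ?case by (rule am_stable_open_cancel)
next
  case 4 then show ?case by (rule am_closed_imp_stable)
next
  case 5 then show ?case by (rule am_open_unstable(1))
next
  case 6 then show ?case by (rule am_open_unstable(2))
qed

section \<open>Arithmetic means at infinity\<close>

text \<open>Starts at \<open>n\<close>, whereas \<open>am_inf_seq \<xi> n\<close> sums from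
  \<open>n + 1\<close>. Hence the shift in \<open>am_inf_seq_mult\<close>, and
  \<open>tail \<xi> 0\<close> enters no mean at infinity.\<close>

definition tail :: "(nat \<Rightarrow> real) \<Rightarrow> nat \<Rightarrow> real" where
  "tail \<xi> n = (\<Sum>j. \<xi> (j + n))"

lemma am_inf_seq_eq: "am_inf_seq \<xi> n = tail \<xi> (Suc n) / real (Suc n)"
  by (simp add: am_inf_seq_def tail_def)

lemma am_inf_seq_mult: "real (Suc n) * am_inf_seq \<xi> n = tail \<xi> (Suc n)"
  unfolding am_inf_seq_eq by simp

lemma l1_starD:
  assumes "\<xi> \<in> l1_star" shows "\<xi> \<in> c0_star" "summable \<xi>"
  using assms by (auto simp: l1_star_def)

lemma tail_eq: "summable \<xi> \<Longrightarrow> tail \<xi> n = suminf \<xi> - (\<Sum>i<n. \<xi> i)"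
  unfolding tail_def by (rule suminf_minus_initial_segment)

lemma tail_split:
  assumes "summable \<xi>" "n \<le> m" shows "tail \<xi> n = (\<Sum>i=n..<m. \<xi> i) + tail \<xi> m"
  using sum.atLeastLessThan_concat[of 0 n m \<xi>] assms by (simp add: tail_eq atLeast0LessThan)

lemma tail_nonneg: "\<xi> \<in> l1_star \<Longrightarrow> 0 \<le> tail \<xi> n"
  unfolding tail_def using l1_starD[of \<xi>] c0_starD(1)[of \<xi>] by (intro suminf_nonneg) (auto simp: summable_iff_shift)

lemma tail_antimono:
  assumes "\<xi> \<in> l1_star" "n \<le> m" shows "tail \<xi> m \<le> tail \<xi> n"
proof -
  have "0 \<le> (\<Sum>i=n..<m. \<xi> i)" by (rule sum_nonneg) (rule c0_starD(1)[OF l1_starD(1)[OF assms(1)]])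
  then show ?thesis using tail_split[OF l1_starD(2)[OF assms(1)] assms(2)] by linarith
qed

lemma tail_tendsto:
  assumes "summable \<xi>" shows "tail \<xi> \<longlonglongrightarrow> 0"
proof -
  have "(\<lambda>n. suminf \<xi> - (\<Sum>i<n. \<xi> i)) \<longlonglongrightarrow> suminf \<xi> - suminf \<xi>"
    by (intro tendsto_intros summable_LIMSEQ assms)
  then show ?thesis unfolding tail_eq[OF assms] by simp
qed

lemma tail_lower:
  assumes "\<xi> \<in> l1_star" "n \<le> k" shows "real (Suc k - n) * \<xi> k \<le> tail \<xi> n"
proof -
  have "(\<Sum>i=n..<Suc k. \<xi> k) \<le> (\<Sum>i=n..<Suc k. \<xi> i)"
    by (rule sum_mono) (use c0_starD(2)[OF l1_starD(1)[OF assms(1)]] in auto)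
  then show ?thesis
    using tail_split[OF l1_starD(2)[OF assms(1)], of n "Suc k"] assms(2) tail_nonneg[OF assms(1), of "Suc k"] by simp
qed

lemma tail_upper:
  assumes "\<xi> \<in> l1_star" "n \<le> m" shows "tail \<xi> n \<le> real (m - n) * \<xi> n + tail \<xi> m"
proof -
  have "(\<Sum>i=n..<m. \<xi> i) \<le> (\<Sum>i=n..<m. \<xi> n)"
    by (rule sum_mono) (use c0_starD(2)[OF l1_starD(1)[OF assms(1)]] in auto)
  then show ?thesis using tail_split[OF l1_starD(2)[OF assms(1)] assms(2)] by simp
qed

text \<open>At least half of the indices up to \<open>n\<close> are at or beyond
  \<open>(n + 1) div 2\<close>, and there the sequence is at least \<open>\<xi> n\<close>. This
  converts single terms into tails throughout.\<close>

lemma tail_half: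
  assumes "\<xi> \<in> l1_star" shows "real (Suc n) * \<xi> n \<le> 2 * tail \<xi> (Suc n div 2)"
proof (cases "n = 0")
  case True
  then show ?thesis using tail_lower[OF assms, of 0 0] tail_nonneg[OF assms, of 0] by simp
next
  case False
  have "real (Suc n) \<le> 2 * real (Suc n - Suc n div 2)"
  proof -
    have "Suc n \<le> 2 * (Suc n - Suc n div 2)" by linarith
    then show ?thesis by linarith
  qed
  then have "real (Suc n) * \<xi> n \<le> 2 * real (Suc n - Suc n div 2) * \<xi> n"
    by (rule mult_right_mono[OF _ c0_starD(1)[OF l1_starD(1)[OF assms]]])
  moreover have "Suc n div 2 \<le> n" using False by linarith
  ultimately show ?thesis using tail_lower[OF assms \<open>Suc n div 2 \<le> n\<close>] by linarith
qed

lemma tail_mono: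
  assumes "\<xi> \<in> l1_star" "\<eta> \<in> l1_star" "\<And>n. \<xi> n \<le> \<eta> n" shows "tail \<xi> n \<le> tail \<eta> n"
  unfolding tail_def using assms(3) l1_starD(2)[OF assms(1)] l1_starD(2)[OF assms(2)]
  by (intro suminf_le) (auto simp: summable_iff_shift)

lemma tail_add:
  assumes "\<xi> \<in> l1_star" "\<eta> \<in> l1_star" shows "tail (\<lambda>n. \<xi> n + \<eta> n) n = tail \<xi> n + tail \<eta> n"
  unfolding tail_def using l1_starD(2)[OF assms(1)] l1_starD(2)[OF assms(2)]
  by (intro suminf_add[symmetric]) (auto simp: summable_iff_shift)

lemma tail_scale:
  assumes "\<xi> \<in> l1_star" shows "tail (\<lambda>n. M * \<xi> n) n = M * tail \<xi> n"
  unfolding tail_def using l1_starD(2)[OF assms] by (intro suminf_mult) (auto simp: summable_iff_shift)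

lemma l1_star_ampliation:
  assumes \<xi>: "\<xi> \<in> l1_star" and m: "m > 0" shows "(\<lambda>n. \<xi> (n div m)) \<in> l1_star"
proof -
  note c = l1_starD(1)[OF \<xi>]
  have "summable (\<lambda>n. \<xi> (n div m))"
  proof (rule summableI_nonneg_bounded)
    show "0 \<le> \<xi> (n div m)" for n by (rule c0_starD(1)[OF c])
    fix N
    have "(\<Sum>i<N. \<xi> (i div m)) \<le> (\<Sum>i<N * m. \<xi> (i div m))"
      by (rule psum_mono) (use c0_starD(1)[OF c] m in auto)
    also have "\<dots> = real m * (\<Sum>i<N. \<xi> i)" by (rule sum_ampliation[OF m])
    also have "\<dots> \<le> real m * suminf \<xi>"
      by (intro mult_left_mono sum_le_suminf l1_starD(2)[OF \<xi>]) (use c0_starD(1)[OF c] in auto)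
    finally show "(\<Sum>i<N. \<xi> (i div m)) \<le> real m * suminf \<xi>" .
  qed
  then show ?thesis using c0_star_ampliation[OF c m] by (simp add: l1_star_def)
qed

lemma tail_ampliation:
  assumes \<xi>: "\<xi> \<in> l1_star" and m: "m > 0"
  shows "tail (\<lambda>n. \<xi> (n div m)) (q * m) = real m * tail \<xi> q"
proof -
  note s = l1_starD(2)[OF l1_star_ampliation[OF \<xi> m]]
  have "(\<lambda>N. \<Sum>i<N * m. \<xi> (i div m)) \<longlonglongrightarrow> (\<Sum>n. \<xi> (n div m))"
    by (rule filterlim_compose[OF summable_LIMSEQ[OF s]]) (rule mult_nat_right_at_top[OF m])
  moreover have "(\<lambda>N. \<Sum>i<N * m. \<xi> (i div m)) \<longlonglongrightarrow> real m * suminf \<xi>"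
    unfolding sum_ampliation[OF m] by (intro tendsto_intros summable_LIMSEQ l1_starD(2)[OF \<xi>])
  ultimately have "(\<Sum>n. \<xi> (n div m)) = real m * suminf \<xi>" by (rule LIMSEQ_unique)
  then show ?thesis
    by (simp add: tail_eq[OF s] tail_eq[OF l1_starD(2)[OF \<xi>]] sum_ampliation[OF m] right_diff_distrib)
qed

lemma char_set_l1_star: "char_set l1_star"
  unfolding char_set_def
proof (intro conjI ballI impI)
  show "l1_star \<subseteq> c0_star" by (auto simp: l1_star_def)
  show "(\<lambda>_. 0) \<in> l1_star" using c0_star_zero by (simp add: l1_star_def)
  show "(\<lambda>n. \<xi> n + \<eta> n) \<in> l1_star" if "\<xi> \<in> l1_star" "\<eta> \<in> l1_star" for \<xi> \<eta>
    using that c0_star_add summable_add by (auto simp: l1_star_def)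
  fix \<xi> \<eta> assume \<xi>: "\<xi> \<in> l1_star" and \<eta>: "\<eta> \<in> c0_star" "dominated \<eta> \<xi>"
  obtain m M where m: "m > 0" "\<And>n. \<eta> n \<le> M * \<xi> (n div m)" by (rule dominatedE[OF \<eta>(2) l1_starD(1)[OF \<xi>]]) blast
  have "summable (\<lambda>n. M * \<xi> (n div m))" by (intro summable_mult l1_starD(2)[OF l1_star_ampliation[OF \<xi> m(1)]])
  then have "summable \<eta>"
    by (rule summable_comparison_test'[where N=0]) (use m(2) c0_starD(1)[OF \<eta>(1)] in simp)
  then show "\<eta> \<in> l1_star" using \<eta>(1) by (simp add: l1_star_def)
qed

definition o_omega :: "(nat \<Rightarrow> real) set" where
  "o_omega = {\<xi> \<in> c0_star. \<xi> \<in> o(\<lambda>n. 1 / real (Suc n))}"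

lemma o_omega_iff: "\<xi> \<in> o_omega \<longleftrightarrow> \<xi> \<in> c0_star \<and> (\<lambda>n. real (Suc n) * \<xi> n) \<longlonglongrightarrow> 0"
proof -
  have "\<xi> \<in> o(\<lambda>n. 1 / real (Suc n)) \<longleftrightarrow> (\<lambda>n. real (Suc n) * \<xi> n) \<longlonglongrightarrow> 0"
  proof
    assume "\<xi> \<in> o(\<lambda>n. 1 / real (Suc n))"
    then have "(\<lambda>n. \<xi> n / (1 / real (Suc n))) \<longlonglongrightarrow> 0" by (rule smalloD_tendsto)
    then show "(\<lambda>n. real (Suc n) * \<xi> n) \<longlonglongrightarrow> 0" by (simp add: mult.commute)
  next
    assume "(\<lambda>n. real (Suc n) * \<xi> n) \<longlonglongrightarrow> 0"
    then have "(\<lambda>n. \<xi> n / (1 / real (Suc n))) \<longlonglongrightarrow> 0" by (simp add: mult.commute)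
    then show "\<xi> \<in> o(\<lambda>n. 1 / real (Suc n))" by (rule smalloI_tendsto) simp
  qed
  then show ?thesis by (simp add: o_omega_def)
qed

lemma char_set_o_omega: "char_set o_omega"
  unfolding char_set_def
proof (intro conjI ballI impI)
  show "o_omega \<subseteq> c0_star" by (auto simp: o_omega_def)
  show "(\<lambda>_. 0) \<in> o_omega" using c0_star_zero by (simp add: o_omega_iff)
  show "(\<lambda>n. \<xi> n + \<eta> n) \<in> o_omega" if "\<xi> \<in> o_omega" "\<eta> \<in> o_omega" for \<xi> \<eta>
    using that c0_star_add[of \<xi> \<eta>] tendsto_add[of "\<lambda>n. real (Suc n) * \<xi> n" 0 sequentially "\<lambda>n. real (Suc n) * \<eta> n" 0]
    by (simp add: o_omega_iff distrib_left)
  fix \<xi> \<eta> assume \<xi>: "\<xi> \<in> o_omega" and \<eta>: "\<eta> \<in> c0_star" "dominated \<eta> \<xi>"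
  have c: "\<xi> \<in> c0_star" and lim: "(\<lambda>n. real (Suc n) * \<xi> n) \<longlonglongrightarrow> 0" using \<xi> by (auto simp: o_omega_iff)
  obtain m M where m: "m > 0" "M > 0" "\<And>n. \<eta> n \<le> M * \<xi> (n div m)" by (rule dominatedE[OF \<eta>(2) c]) blast
  have "(\<lambda>n. real (Suc n) * \<eta> n) \<longlonglongrightarrow> 0"
  proof (rule null_sandwich)
    show "0 \<le> real (Suc n) * \<eta> n" for n using c0_starD(1)[OF \<eta>(1)] by simp
    show "(\<lambda>n. M * real m * (real (Suc (n div m)) * \<xi> (n div m))) \<longlonglongrightarrow> 0"
      by (rule tendsto_mult_right_zero[OF filterlim_compose[OF lim filterlim_nat_div[OF m(1)]]])
    fix n
    have "n < Suc (n div m) * m" using m(1) by (simp add: dividend_less_div_times)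
    then have "real (Suc n) \<le> real m * real (Suc (n div m))" by (metis Suc_leI mult.commute of_nat_mono of_nat_mult)
    note le = this
    have "real (Suc n) * \<eta> n \<le> real (Suc n) * (M * \<xi> (n div m))" by (rule mult_left_mono[OF m(3)]) simp
    also have "\<dots> \<le> real m * real (Suc (n div m)) * (M * \<xi> (n div m))"
      by (rule mult_right_mono[OF le]) (use m(2) c0_starD(1)[OF c] in simp)
    also have "\<dots> = M * real m * (real (Suc (n div m)) * \<xi> (n div m))" by (simp only: mult_ac)
    finally show "real (Suc n) * \<eta> n \<le> M * real m * (real (Suc (n div m)) * \<xi> (n div m))" .
  qed
  then show "\<eta> \<in> o_omega" using \<eta>(1) by (simp add: o_omega_iff)
qed

lemma l1_star_o_omega: "l1_star \<subseteq> o_omega"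
proof
  fix \<xi> assume \<xi>: "\<xi> \<in> l1_star"
  have lim: "(\<lambda>n. 2 * tail \<xi> (Suc n div 2)) \<longlonglongrightarrow> 0"
  proof (rule tendsto_mult_right_zero)
    have "(\<lambda>n. tail \<xi> (n div 2)) \<longlonglongrightarrow> 0"
      by (rule filterlim_compose[OF tail_tendsto[OF l1_starD(2)[OF \<xi>]] filterlim_nat_div]) simp
    then show "(\<lambda>n. tail \<xi> (Suc n div 2)) \<longlonglongrightarrow> 0" by (rule LIMSEQ_Suc)
  qed
  have "(\<lambda>n. real (Suc n) * \<xi> n) \<longlonglongrightarrow> 0"
    by (rule null_sandwich[OF _ tail_half[OF \<xi>] lim]) (use c0_starD(1)[OF l1_starD(1)[OF \<xi>]] in simp)
  then show "\<xi> \<in> o_omega" using l1_starD(1)[OF \<xi>] by (simp add: o_omega_iff)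
qed

lemma am_inf_seq_o_omega:
  assumes \<xi>: "\<xi> \<in> l1_star" shows "am_inf_seq \<xi> \<in> o_omega"
proof -
  have t: "(\<lambda>n. tail \<xi> (Suc n)) \<longlonglongrightarrow> 0" by (rule LIMSEQ_Suc[OF tail_tendsto[OF l1_starD(2)[OF \<xi>]]])
  have nn: "0 \<le> am_inf_seq \<xi> n" for n unfolding am_inf_seq_eq using tail_nonneg[OF \<xi>] by simp
  have "am_inf_seq \<xi> \<in> c0_star"
  proof (rule c0_starI[OF nn])
    show "am_inf_seq \<xi> n \<le> am_inf_seq \<xi> m" if "m \<le> n" for m n
      unfolding am_inf_seq_eq using that by (intro frac_le tail_antimono[OF \<xi>] tail_nonneg[OF \<xi>]) auto
    show "am_inf_seq \<xi> \<longlonglongrightarrow> 0"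
    proof (rule null_sandwich[OF nn _ t])
      fix n
      have "tail \<xi> (Suc n) / real (Suc n) \<le> tail \<xi> (Suc n) / 1" by (intro frac_le tail_nonneg[OF \<xi>]) auto
      then show "am_inf_seq \<xi> n \<le> tail \<xi> (Suc n)" by (simp add: am_inf_seq_eq)
    qed
  qed
  then show ?thesis unfolding o_omega_iff am_inf_seq_mult using t by blast
qed

lemma o_omega_c0: "\<xi> \<in> o_omega \<Longrightarrow> \<xi> \<in> c0_star" by (simp add: o_omega_def)

lemma am_inf_seq_c0: "\<xi> \<in> l1_star \<Longrightarrow> am_inf_seq \<xi> \<in> c0_star"
  using am_inf_seq_o_omega o_omega_c0 by blast

interpretation am_inf: mean_op am_inf_seq l1_star o_omega
proof (rule mean_op.intro, goal_cases)
  case 1 show ?case by (rule char_set_l1_star)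
next
  case 2 show ?case by (rule char_set_o_omega)
next
  case 3 show ?case by (rule l1_star_o_omega)
next
  case 4 then show ?case by (rule am_inf_seq_o_omega)
next
  case (5 \<xi> \<eta>) then show ?case by (simp add: fun_eq_iff am_inf_seq_eq tail_add add_divide_distrib)
next
  case (6 \<xi> M) then show ?case by (simp add: fun_eq_iff am_inf_seq_eq tail_scale)
next
  case (7 \<xi> \<eta> n) then show ?case unfolding am_inf_seq_eq by (intro divide_right_mono tail_mono) auto
next
  case (8 \<xi> m n)
  define q where "q = n div m"
  note D = l1_star_ampliation[OF 8]
  have "n < Suc q * m" unfolding q_def using 8(2) by (simp add: dividend_less_div_times)
  then have le: "Suc n \<le> Suc q * m" by simp
  have "am_inf_seq \<xi> q = tail (\<lambda>k. \<xi> (k div m)) (Suc q * m) / real (Suc q * m)"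
    using 8(2) by (simp only: tail_ampliation[OF 8] am_inf_seq_eq of_nat_mult) (simp del: of_nat_Suc)
  also have "\<dots> \<le> tail (\<lambda>k. \<xi> (k div m)) (Suc n) / real (Suc n)"
    by (intro frac_le tail_antimono[OF D le] tail_nonneg[OF D]) (use le in \<open>simp_all only: of_nat_le_iff of_nat_0_less_iff zero_less_Suc\<close>)
  finally show ?case by (simp add: am_inf_seq_eq q_def)
next
  case (9 \<xi> m \<sigma>)
  note D = l1_star_ampliation[OF 9(1,2)]
  define \<theta> where "\<theta> = (\<lambda>n. am_inf_seq \<xi> n + \<sigma> n)"
  have \<theta>: "\<theta> \<in> c0_star" "\<theta> 0 > 0" unfolding \<theta>_def
    using c0_star_add[OF am_inf_seq_c0[OF 9(1)] 9(3)] c0_starD(1)[OF am_inf_seq_c0[OF 9(1)], of 0] 9(4) by auto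
  \<comment> \<open>The tail of an ampliation is computed at multiples of \<open>m\<close>, so
    \<open>n\<close> is rounded down to one. The shift between tail and mean then leads to
    \<open>p = n div m - 1\<close>, which the doubled ampliation absorbs.\<close>
  have "dominated (am_inf_seq (\<lambda>k. \<xi> (k div m))) \<theta>"
  proof (rule dominated_eventually[OF \<theta>, where m="m * 2" and N=m and M=1])
    show "m * 2 > 0" using 9(2) by simp
    show "am_inf_seq (\<lambda>k. \<xi> (k div m)) n \<le> am_inf_seq (\<lambda>k. \<xi> (k div m)) 0" for n
      by (rule c0_starD(2)[OF am_inf_seq_c0[OF D]]) simp
    fix n assume n: "n \<ge> m"
    define q where "q = n div m"
    have "q \<ge> 1" using div_le_mono[OF n, of m] 9(2) by (simp add: q_def)
    then obtain p where p: "q = Suc p" by (cases q) auto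
    have qm: "Suc p * m \<le> n" using p by (metis q_def div_times_less_eq_dividend)
    have "am_inf_seq (\<lambda>k. \<xi> (k div m)) n = tail (\<lambda>k. \<xi> (k div m)) (Suc n) / real (Suc n)" by (rule am_inf_seq_eq)
    also have "\<dots> \<le> tail (\<lambda>k. \<xi> (k div m)) (Suc p * m) / real (Suc p * m)"
    proof (intro frac_le tail_antimono[OF D] tail_nonneg[OF D])
      show "Suc p * m \<le> Suc n" using qm by linarith
      then show "real (Suc p * m) \<le> real (Suc n)" by (simp only: of_nat_le_iff)
      show "0 < real (Suc p * m)" using 9(2) by (simp only: of_nat_0_less_iff) simp
    qed
    also have "\<dots> = am_inf_seq \<xi> p"
      using 9(2) by (simp only: tail_ampliation[OF 9(1,2)] am_inf_seq_eq of_nat_mult) (simp del: of_nat_Suc)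
    also have "\<dots> \<le> \<theta> p" using c0_starD(1)[OF 9(3), of p] by (simp add: \<theta>_def)
    also have "\<dots> \<le> 1 * \<theta> (n div (m * 2))"
    proof -
      have "n div (m * 2) = q div 2" by (simp add: q_def div_mult2_eq)
      also have "\<dots> \<le> p" using p by linarith
      finally show ?thesis using c0_starD(2)[OF \<theta>(1)] by simp
    qed
    finally show "am_inf_seq (\<lambda>k. \<xi> (k div m)) n \<le> 1 * \<theta> (n div (m * 2))" .
  qed
  then show ?case by (simp add: \<theta>_def)
next
  case (10 \<xi> \<sigma>)
  define \<theta> where "\<theta> = (\<lambda>n. am_inf_seq \<xi> n + \<sigma> n)"
  have \<theta>: "\<theta> \<in> c0_star" "\<theta> 0 > 0" unfolding \<theta>_def
    using c0_star_add[OF am_inf_seq_c0[OF 10(1)] 10(2)] c0_starD(1)[OF am_inf_seq_c0[OF 10(1)], of 0] 10(3) by auto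
  \<comment> \<open>\<open>tail_half\<close> leads from the term at \<open>n\<close> to the mean at
    \<open>p = (n + 1) div 2 - 1\<close>, which is at least \<open>n div 4\<close>; the index
    \<open>0\<close> is covered by \<sigma>.\<close>
  have "dominated \<xi> \<theta>"
  proof (rule dominated_eventually[OF \<theta>, where m=4 and N=1 and M=2])
    show "\<xi> n \<le> \<xi> 0" for n by (rule c0_starD(2)[OF l1_starD(1)[OF 10(1)]]) simp
    fix n :: nat assume n: "n \<ge> 1"
    define p where "p = Suc n div 2 - 1"
    have p: "Suc n div 2 = Suc p" using n unfolding p_def by linarith
    have "Suc p \<le> Suc n" using p by linarith
    then have "real (Suc p) * \<xi> n \<le> real (Suc n) * \<xi> n" by (intro mult_right_mono c0_starD(1)[OF l1_starD(1)[OF 10(1)]]) (simp only: of_nat_le_iff)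
    also have "\<dots> \<le> 2 * tail \<xi> (Suc p)" using tail_half[OF 10(1), of n] p by simp
    also have "\<dots> = real (Suc p) * (2 * am_inf_seq \<xi> p)" unfolding am_inf_seq_mult[symmetric] by simp
    finally have "\<xi> n \<le> 2 * am_inf_seq \<xi> p" by (simp only: mult_le_cancel_left_pos of_nat_0_less_iff zero_less_Suc)
    also have "\<dots> \<le> 2 * \<theta> p" using c0_starD(1)[OF 10(2), of p] by (simp add: \<theta>_def)
    also have "\<theta> p \<le> \<theta> (n div 4)"
    proof (rule c0_starD(2)[OF \<theta>(1)])
      show "n div 4 \<le> p" using n unfolding p_def by linarith
    qed
    finally show "\<xi> n \<le> 2 * \<theta> (n div 4)" by simp
  qed simp
  then show ?case by (simp add: \<theta>_def)
next
  case (11 \<xi>)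
  have "0 < \<xi> 0" by (rule 11(2))
  \<comment> \<open>Doubling repeats the first term at index \<open>1\<close>, where the tail in the
    mean at \<open>0\<close> begins.\<close>
  also have "\<xi> 0 \<le> tail (\<lambda>k. \<xi> (k div 2)) 1" using tail_lower[OF l1_star_ampliation[OF 11(1), of 2], of 1 1] by simp
  finally show ?case by (simp add: am_inf_seq_eq)
qed

subsection \<open>Sums of am-infinity closed ideals\<close>

text \<open>The comparison at half the index, which is what \<open>tail_half\<close> delivers, is an
  ampliation; \<open>max 1\<close> avoids \<open>tail \<eta> 0\<close>, which no mean at infinity
  sees.\<close>

lemma am_inf_GF_memI:
  assumes e: "e \<in> l1_star" and T: "char_set T" "\<eta> \<in> T" and \<eta>: "\<eta> \<in> l1_star" and nz: "am_inf.F T \<noteq> {\<lambda>_. 0}"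
    and C: "C \<ge> 0" and le: "\<And>n. n \<ge> 1 \<Longrightarrow> tail e n \<le> C * tail \<eta> (max 1 (n div 2))"
  shows "e \<in> am_inf.G (am_inf.F T)"
proof (rule am_inf.GI[OF nz e])
  have "dominated (am_inf_seq e) (am_inf_seq \<eta>)"
  proof (rule dominatedI[where m=4 and M=C])
    fix k
    define p where "p = max 1 (Suc k div 2) - 1"
    have p: "max 1 (Suc k div 2) = Suc p" by (simp add: p_def)
    have pk: "p \<le> k" "k div 4 \<le> p" unfolding p_def by linarith+
    have "am_inf_seq e k \<le> C * tail \<eta> (Suc p) / real (Suc k)"
      unfolding am_inf_seq_eq using le[of "Suc k"] p by (intro divide_right_mono) auto
    also have "\<dots> \<le> C * tail \<eta> (Suc p) / real (Suc p)"
      using pk(1) C tail_nonneg[OF \<eta>, of "Suc p"] by (intro frac_le) auto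
    also have "\<dots> = C * am_inf_seq \<eta> p" by (simp add: am_inf_seq_eq)
    also have "\<dots> \<le> C * am_inf_seq \<eta> (k div 4)" by (intro mult_left_mono c0_starD(2)[OF am_inf_seq_c0[OF \<eta>] pk(2)] C)
    finally show "am_inf_seq e k \<le> C * am_inf_seq \<eta> (k div 4)" .
  qed simp
  then show "am_inf_seq e \<in> am_inf.F T"
    by (rule char_setD(4)[OF am_inf.char_F[OF T(1)] am_inf.a_in_F[OF T(2) \<eta>] am_inf_seq_c0[OF e]])
qed

lemma env_l1: 
  assumes "\<zeta> \<in> l1_star" shows "env E \<zeta> \<in> l1_star"
  by (rule char_set_le[OF char_set_l1_star assms env_c0[OF l1_starD(1)[OF assms]], where M=1])
     (simp add: env_le[OF l1_starD(1)[OF assms]])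

text \<open>Let \<open>p\<close> be the first index of \<open>E\<close> from \<open>n\<close> on. Up
  to \<open>p\<close> the envelope is at most \<open>\<zeta> p\<close>, which costs at most two
  tails of \<zeta> at half the index \<open>p\<close>; the remaining tail is at most a third. The
  hypothesis doubles all three, hence 6.\<close>

lemma tail_env:
  assumes \<zeta>: "\<zeta> \<in> l1_star" and \<eta>: "\<eta> \<in> l1_star"
    and E: "\<And>j. j \<in> E \<Longrightarrow> j \<ge> 1 \<Longrightarrow> tail \<zeta> (Suc j div 2) \<le> 2 * tail \<eta> (Suc j div 2)" and n: "n \<ge> 1"
  shows "tail (env E \<zeta>) n \<le> 6 * tail \<eta> (max 1 (n div 2))"
proof (cases "\<exists>p\<ge>n. p \<in> E")
  case False
  have "env E \<zeta> (j + n) = 0" for j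
    by (rule antisym[OF env_leI env_nonneg[OF l1_starD(1)[OF \<zeta>]]]) (use False in auto)
  then have "tail (env E \<zeta>) n = 0" by (simp add: tail_def)
  then show ?thesis using tail_nonneg[OF \<eta>] by simp
next
  case True
  note \<zeta>c = l1_starD(1)[OF \<zeta>]
  define p where "p = (LEAST p. p \<ge> n \<and> p \<in> E)"
  have p: "p \<ge> n" "p \<in> E" using LeastI_ex[of "\<lambda>p. p \<ge> n \<and> p \<in> E"] True by (auto simp: p_def)
  have p_le: "p \<le> i" if "i \<ge> n" "i \<in> E" for i unfolding p_def by (rule Least_le) (use that in auto)
  have "env E \<zeta> n \<le> \<zeta> p"
    by (rule env_leI) (use p_le c0_starD(1,2)[OF \<zeta>c] in auto)
  then have "real (p - n) * env E \<zeta> n \<le> real (Suc p) * \<zeta> p"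
    by (intro mult_mono c0_starD(1)[OF \<zeta>c] env_nonneg[OF \<zeta>c]) auto
  moreover have "tail (env E \<zeta>) n \<le> real (p - n) * env E \<zeta> n + tail (env E \<zeta>) p"
    by (rule tail_upper[OF env_l1[OF \<zeta>] p(1)])
  moreover have "tail (env E \<zeta>) p \<le> tail \<zeta> p" by (rule tail_mono[OF env_l1[OF \<zeta>] \<zeta> env_le[OF \<zeta>c]])
  moreover have "tail \<zeta> p \<le> tail \<zeta> (Suc p div 2)" by (rule tail_antimono[OF \<zeta>]) (use p(1) n in linarith)
  moreover have "real (Suc p) * \<zeta> p \<le> 2 * tail \<zeta> (Suc p div 2)" by (rule tail_half[OF \<zeta>])
  moreover have "tail \<zeta> (Suc p div 2) \<le> 2 * tail \<eta> (Suc p div 2)" by (rule E[OF p(2)]) (use p(1) n in linarith)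
  moreover have "tail \<eta> (Suc p div 2) \<le> tail \<eta> (max 1 (n div 2))" by (rule tail_antimono[OF \<eta>]) (use p(1) n in linarith)
  ultimately show ?thesis by linarith
qed

lemma am_inf_GF_add:
  assumes z1: "\<zeta>1 \<in> l1_star" and z2: "\<zeta>2 \<in> l1_star" and \<zeta>: "\<zeta> \<in> am_inf.G (am_inf.F (princ (\<lambda>n. \<zeta>1 n + \<zeta>2 n)))"
  shows "\<exists>e1\<in>am_inf.G (am_inf.F (princ \<zeta>1)). \<exists>e2\<in>am_inf.G (am_inf.F (princ \<zeta>2)). dominated \<zeta> (\<lambda>n. e1 n + e2 n)"
proof -
  note c1 = l1_starD(1)[OF z1] and c2 = l1_starD(1)[OF z2]
  have zero: "(\<lambda>_. 0) \<in> am_inf.G (am_inf.F (princ \<theta>))" if "\<theta> \<in> c0_star" for \<theta>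
    by (rule char_setD(2)[OF am_inf.char_G[OF am_inf.char_F[OF char_set_princ[OF that]]]])
  \<comment> \<open>\<open>am_inf_GF_memI\<close> asks for a nonzero mean set, so a vanishing
    summand is treated apart.\<close>
  consider "\<zeta>1 = (\<lambda>_. 0)" | "\<zeta>2 = (\<lambda>_. 0)" | "\<zeta>1 \<noteq> (\<lambda>_. 0)" "\<zeta>2 \<noteq> (\<lambda>_. 0)" by blast
  then show ?thesis
  proof cases
    case 1
    then have "\<zeta> \<in> am_inf.G (am_inf.F (princ \<zeta>2))" using \<zeta> by simp
    then show ?thesis using zero[OF c1] dominated_refl[of \<zeta>] by (intro bexI[of _ "\<lambda>_. 0"] bexI[of _ \<zeta>]) auto
  next
    case 2
    then have "\<zeta> \<in> am_inf.G (am_inf.F (princ \<zeta>1))" using \<zeta> by simp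
    then show ?thesis using zero[OF c2] dominated_refl[of \<zeta>] by (intro bexI[of _ "\<lambda>_. 0"] bexI[of _ \<zeta>]) auto
  next
    case 3
    note P1 = char_set_princ[OF c1] and P2 = char_set_princ[OF c2]
    note z = c0_star_add[OF c1 c2]
    have \<zeta>l: "\<zeta> \<in> l1_star" using \<zeta> am_inf.G_U by blast
    note \<zeta>c = l1_starD(1)[OF \<zeta>l]
    obtain \<kappa> M where \<kappa>: "\<kappa> \<in> princ (\<lambda>n. \<zeta>1 n + \<zeta>2 n)" "\<kappa> \<in> l1_star" "M > 0" "\<And>n. am_inf_seq \<zeta> n \<le> M * am_inf_seq \<kappa> n"
      by (rule am_inf.FE[OF am_inf.a_G[OF am_inf.char_F[OF char_set_princ[OF z]] \<zeta>]]) blast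
    obtain m K where m: "m > 0" "K > 0" "\<And>n. \<kappa> n \<le> K * (\<zeta>1 (n div m) + \<zeta>2 (n div m))"
      using dominatedE[of \<kappa> "\<lambda>n. \<zeta>1 n + \<zeta>2 n"] \<kappa>(1) z by (auto simp: princ_def)
    define \<eta>1 where "\<eta>1 = (\<lambda>n. M * K * \<zeta>1 (n div m))"
    define \<eta>2 where "\<eta>2 = (\<lambda>n. M * K * \<zeta>2 (n div m))"
    have MK: "M * K \<ge> 0" using \<kappa>(3) m(2) by simp
    have \<eta>1: "\<eta>1 \<in> princ \<zeta>1" "\<eta>1 \<in> l1_star" unfolding \<eta>1_def
      by (rule char_set_scale[OF P1 char_set_ampliation[OF P1 princ_self[OF c1] m(1)] MK],
          rule char_set_scale[OF char_set_l1_star l1_star_ampliation[OF z1 m(1)] MK])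
    have \<eta>2: "\<eta>2 \<in> princ \<zeta>2" "\<eta>2 \<in> l1_star" unfolding \<eta>2_def
      by (rule char_set_scale[OF P2 char_set_ampliation[OF P2 princ_self[OF c2] m(1)] MK],
          rule char_set_scale[OF char_set_l1_star l1_star_ampliation[OF z2 m(1)] MK])
    have le: "tail \<zeta> n \<le> tail \<eta>1 n + tail \<eta>2 n" if "n \<ge> 1" for n
    proof -
      obtain k where k: "n = Suc k" using \<open>n \<ge> 1\<close> by (cases n) auto
      have "real (Suc k) * am_inf_seq \<zeta> k \<le> real (Suc k) * (M * am_inf_seq \<kappa> k)" by (rule mult_left_mono[OF \<kappa>(4)]) simp
      also have "\<dots> = M * (real (Suc k) * am_inf_seq \<kappa> k)" by (simp only: mult_ac)
      finally have "tail \<zeta> n \<le> M * tail \<kappa> n" unfolding am_inf_seq_mult k .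
      also have "\<dots> = tail (\<lambda>n. M * \<kappa> n) n" by (rule tail_scale[OF \<kappa>(2), symmetric])
      also have "\<dots> \<le> tail (\<lambda>n. \<eta>1 n + \<eta>2 n) n"
      proof (rule tail_mono)
        show "(\<lambda>n. M * \<kappa> n) \<in> l1_star" by (rule char_set_scale[OF char_set_l1_star \<kappa>(2)]) (use \<kappa>(3) in simp)
        show "(\<lambda>n. \<eta>1 n + \<eta>2 n) \<in> l1_star" by (rule char_setD(3)[OF char_set_l1_star \<eta>1(2) \<eta>2(2)])
        fix n show "M * \<kappa> n \<le> \<eta>1 n + \<eta>2 n"
          using mult_left_mono[OF m(3)[of n], of M] \<kappa>(3) by (simp add: \<eta>1_def \<eta>2_def algebra_simps)
      qed
      also have "\<dots> = tail \<eta>1 n + tail \<eta>2 n" by (rule tail_add[OF \<eta>1(2) \<eta>2(2)])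
      finally show ?thesis .
    qed
    \<comment> \<open>As for the ordinary mean, but comparing at half the index, where
      \<open>tail_half\<close> bounds a term by a tail.\<close>
    define E where "E = {j. tail \<zeta> (Suc j div 2) \<le> 2 * tail \<eta>1 (Suc j div 2)}"
    have E1: "tail \<zeta> (Suc j div 2) \<le> 2 * tail \<eta>1 (Suc j div 2)" if "j \<in> E" "j \<ge> 1" for j using that by (simp add: E_def)
    have E2: "tail \<zeta> (Suc j div 2) \<le> 2 * tail \<eta>2 (Suc j div 2)" if "j \<in> - E" "j \<ge> 1" for j
    proof -
      have "Suc j div 2 \<ge> 1" using that(2) by linarith
      from le[OF this] show ?thesis using that(1) by (simp add: E_def)
    qed
    have t1: "tail (env E \<zeta>) n \<le> 6 * tail \<eta>1 (max 1 (n div 2))" if "n \<ge> 1" for n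
      by (rule tail_env[OF \<zeta>l \<eta>1(2) _ that]) (rule E1)
    have t2: "tail (env (- E) \<zeta>) n \<le> 6 * tail \<eta>2 (max 1 (n div 2))" if "n \<ge> 1" for n
      by (rule tail_env[OF \<zeta>l \<eta>2(2) _ that]) (rule E2)
    have F1: "am_inf.F (princ \<zeta>1) \<noteq> {\<lambda>_. 0}" using am_inf.F_zero_imp[OF P1 _ princ_self[OF c1] z1] 3(1) by blast
    have F2: "am_inf.F (princ \<zeta>2) \<noteq> {\<lambda>_. 0}" using am_inf.F_zero_imp[OF P2 _ princ_self[OF c2] z2] 3(2) by blast
    have "env E \<zeta> \<in> am_inf.G (am_inf.F (princ \<zeta>1))"
      by (rule am_inf_GF_memI[OF env_l1[OF \<zeta>l] P1 \<eta>1 F1 _ t1]) simp_all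
    moreover have "env (- E) \<zeta> \<in> am_inf.G (am_inf.F (princ \<zeta>2))"
      by (rule am_inf_GF_memI[OF env_l1[OF \<zeta>l] P2 \<eta>2 F2 _ t2]) simp_all
    moreover have "dominated \<zeta> (\<lambda>n. env E \<zeta> n + env (- E) \<zeta> n)"
    proof (rule dominated_le[where M=1])
      fix n show "\<zeta> n \<le> 1 * (env E \<zeta> n + env (- E) \<zeta> n)"
        using env_ge[OF \<zeta>c, of n E] env_ge[OF \<zeta>c, of n "- E"] env_nonneg[OF \<zeta>c, of E n] env_nonneg[OF \<zeta>c, of "- E" n]
        by (cases "n \<in> E") auto
    qed
    ultimately show ?thesis by blast
  qed
qed

subsection \<open>The least mean at infinity above a sequence\<close>

definition am_inf_supq :: "(nat \<Rightarrow> real) \<Rightarrow> nat \<Rightarrow> real" where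
  "am_inf_supq \<eta> n = (SUP i\<in>{n..}. real (Suc i) * \<eta> i)"

text \<open>\<open>n + 1\<close> times a mean at infinity is a tail, hence decreasing; so here the
  supremum runs over the later indices. It is finite on \<open>o_omega\<close>.\<close>

definition am_inf_mu :: "(nat \<Rightarrow> real) \<Rightarrow> nat \<Rightarrow> real" where
  "am_inf_mu \<eta> n = am_inf_supq \<eta> n / real (Suc n)"

lemma am_inf_mu_mult: "real (Suc n) * am_inf_mu \<eta> n = am_inf_supq \<eta> n"
  by (simp add: am_inf_mu_def)

lemma am_inf_supq_bdd:
  assumes "\<eta> \<in> o_omega" shows "bdd_above ((\<lambda>i. real (Suc i) * \<eta> i) ` {n..})"
proof -
  have "Bseq (\<lambda>i. real (Suc i) * \<eta> i)" using assms by (intro convergent_imp_Bseq) (auto simp: o_omega_iff convergent_def)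
  then obtain K where K: "\<And>i. norm (real (Suc i) * \<eta> i) \<le> K" using BseqD by blast
  show ?thesis by (rule bdd_aboveI2[where M=K]) (use K in \<open>auto intro: order_trans[OF abs_ge_self]\<close>)
qed

lemma am_inf_supq_ge: "\<eta> \<in> o_omega \<Longrightarrow> n \<le> i \<Longrightarrow> real (Suc i) * \<eta> i \<le> am_inf_supq \<eta> n"
  unfolding am_inf_supq_def by (rule cSUP_upper[OF _ am_inf_supq_bdd]) auto

lemma am_inf_supq_leI: "(\<And>i. n \<le> i \<Longrightarrow> real (Suc i) * \<eta> i \<le> b) \<Longrightarrow> am_inf_supq \<eta> n \<le> b"
  unfolding am_inf_supq_def by (rule cSUP_least) auto

lemma am_inf_supq_antimono: "\<eta> \<in> o_omega \<Longrightarrow> m \<le> n \<Longrightarrow> am_inf_supq \<eta> n \<le> am_inf_supq \<eta> m"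
  by (rule am_inf_supq_leI) (rule am_inf_supq_ge, auto)

lemma am_inf_supq_nonneg: "\<eta> \<in> o_omega \<Longrightarrow> 0 \<le> am_inf_supq \<eta> n"
  using am_inf_supq_ge[of \<eta> n n] c0_starD(1)[OF o_omega_c0, of \<eta> n] by (smt (verit) mult_nonneg_nonneg of_nat_0_le_iff order.refl)

lemma am_inf_supq_tendsto:
  assumes \<eta>: "\<eta> \<in> o_omega" shows "am_inf_supq \<eta> \<longlonglongrightarrow> 0"
proof (rule LIMSEQ_I)
  fix r :: real assume r: "r > 0"
  have lim: "(\<lambda>i. real (Suc i) * \<eta> i) \<longlonglongrightarrow> 0" using \<eta> by (simp only: o_omega_iff)
  obtain N where N: "\<And>i. i \<ge> N \<Longrightarrow> norm (real (Suc i) * \<eta> i - 0) < r / 2" using LIMSEQ_D[OF lim half_gt_zero[OF r]] by blast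
  have "am_inf_supq \<eta> n \<le> r / 2" if "n \<ge> N" for n
  proof (rule am_inf_supq_leI)
    fix i assume "n \<le> i"
    then have "norm (real (Suc i) * \<eta> i - 0) < r / 2" by (intro N order_trans[OF that])
    then show "real (Suc i) * \<eta> i \<le> r / 2" unfolding real_norm_def diff_0_right by linarith
  qed
  then show "\<exists>no. \<forall>n\<ge>no. norm (am_inf_supq \<eta> n - 0) < r"
    using am_inf_supq_nonneg[OF \<eta>] r by (intro exI[of _ N]) force
qed

lemma am_inf_mu_c0:
  assumes \<eta>: "\<eta> \<in> o_omega" shows "am_inf_mu \<eta> \<in> c0_star"
proof (rule c0_starI)
  show nn: "0 \<le> am_inf_mu \<eta> n" for n unfolding am_inf_mu_def using am_inf_supq_nonneg[OF \<eta>] by simp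
  show "am_inf_mu \<eta> n \<le> am_inf_mu \<eta> m" if "m \<le> n" for m n
    unfolding am_inf_mu_def using that by (intro frac_le am_inf_supq_antimono[OF \<eta>] am_inf_supq_nonneg[OF \<eta>]) auto
  show "am_inf_mu \<eta> \<longlonglongrightarrow> 0"
  proof (rule null_sandwich[OF nn _ am_inf_supq_tendsto[OF \<eta>]])
    fix n
    have "am_inf_supq \<eta> n / real (Suc n) \<le> am_inf_supq \<eta> n / 1" by (intro frac_le am_inf_supq_nonneg[OF \<eta>]) auto
    then show "am_inf_mu \<eta> n \<le> am_inf_supq \<eta> n" by (simp add: am_inf_mu_def)
  qed
qed

lemma am_inf_mu_ge: "\<eta> \<in> o_omega \<Longrightarrow> \<eta> n \<le> am_inf_mu \<eta> n"
  using am_inf_supq_ge[of \<eta> n n] by (simp add: am_inf_mu_def pos_le_divide_eq mult.commute)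

lemma am_inf_mu_least:
  assumes \<zeta>: "\<zeta> \<in> l1_star" and M: "M > 0" and le: "\<And>n. \<eta> n \<le> M * am_inf_seq \<zeta> n"
  shows "am_inf_mu \<eta> n \<le> M * am_inf_seq \<zeta> n"
proof -
  have "am_inf_supq \<eta> n \<le> M * tail \<zeta> (Suc n)"
  proof (rule am_inf_supq_leI)
    fix i assume "n \<le> i"
    have "real (Suc i) * \<eta> i \<le> real (Suc i) * (M * am_inf_seq \<zeta> i)" by (rule mult_left_mono[OF le]) simp
    also have "\<dots> = M * tail \<zeta> (Suc i)" unfolding am_inf_seq_mult[symmetric] by simp
    also have "\<dots> \<le> M * tail \<zeta> (Suc n)"
      by (intro mult_left_mono tail_antimono[OF \<zeta>]) (use M \<open>n \<le> i\<close> in auto)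
    finally show "real (Suc i) * \<eta> i \<le> M * tail \<zeta> (Suc n)" .
  qed
  then have "real (Suc n) * am_inf_mu \<eta> n \<le> real (Suc n) * (M * am_inf_seq \<zeta> n)"
    unfolding am_inf_mu_mult am_inf_seq_mult[symmetric] by (simp only: mult_ac)
  then show ?thesis by (simp only: mult_le_cancel_left_pos of_nat_0_less_iff zero_less_Suc)
qed

text \<open>A supremum of convex piecewise linear functions dominates the decreasing function \<open>n \<mapsto> n \<mu>\<^sub>n\<close> and is
  dominated by a dilate of it; being convex, it is the sequence of tails of a monotone sequence.\<close>

lemma am_inf_mu_mean:
  assumes \<eta>: "\<eta> \<in> o_omega"
  shows "\<exists>\<rho>\<in>l1_star. dominated (am_inf_seq \<rho>) (am_inf_mu \<eta>) \<and> dominated (am_inf_mu \<eta>) (am_inf_seq \<rho>)"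
proof -
  define g where "g = (\<lambda>i. real (Suc i) * \<eta> i)"
  define S where "S = am_inf_supq \<eta>"
  \<comment> \<open>A descending ramp that is still at least \<open>g i\<close> up to
    \<open>x = i + 1\<close> and vanishes from \<open>x = 2 * (i + 1)\<close> on. The former gives
    the lower bound \<open>S n\<close>, the latter the dilated upper bound
    \<open>2 * S (n div 2)\<close>.\<close>
  define h where "h = (\<lambda>x i. 2 * g i * max 0 (1 - real x / (2 * real (Suc i))))"
  define T where "T = (\<lambda>x. SUP i. h x i)"
  have g0: "0 \<le> g i" for i using c0_starD(1)[OF o_omega_c0[OF \<eta>]] by (simp add: g_def)
  have gS: "g i \<le> S n" if "n \<le> i" for i n unfolding g_def S_def by (rule am_inf_supq_ge[OF \<eta> that])
  have h0: "0 \<le> h x i" for x i using g0[of i] by (simp add: h_def)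
  have h2: "h x i \<le> 2 * g i" for x i
  proof -
    have "max 0 (1 - real x / (2 * real (Suc i))) \<le> 1" by simp
    then have "2 * g i * max 0 (1 - real x / (2 * real (Suc i))) \<le> 2 * g i * 1" by (rule mult_left_mono) (use g0[of i] in simp)
    then show ?thesis by (simp add: h_def)
  qed
  have bdd: "bdd_above (range (h x))" for x
    by (rule bdd_aboveI2[where M="2 * S 0"]) (use h2 gS[of 0] in \<open>fastforce intro: order_trans\<close>)
  have T_ge: "h x i \<le> T x" for x i unfolding T_def by (rule cSUP_upper[OF _ bdd]) simp
  have T_le: "T x \<le> b" if "\<And>i. h x i \<le> b" for x b unfolding T_def by (rule cSUP_least) (use that in auto)
  have T0: "0 \<le> T x" for x using h0[of x 0] T_ge[of x 0] by linarith
  have T_anti: "T (Suc x) \<le> T x" for x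
  proof (rule T_le)
    fix i
    have "max 0 (1 - real (Suc x) / (2 * real (Suc i))) \<le> max 0 (1 - real x / (2 * real (Suc i)))"
      by (intro max.mono diff_left_mono divide_right_mono) auto
    then have "h (Suc x) i \<le> h x i" unfolding h_def by (rule mult_left_mono) (use g0[of i] in simp)
    then show "h (Suc x) i \<le> T x" using T_ge[of x i] by linarith
  qed
  have T_conv: "T (Suc x) - T (Suc (Suc x)) \<le> T x - T (Suc x)" for x
  proof -
    have "T (Suc x) \<le> (T x + T (Suc (Suc x))) / 2"
    proof (rule T_le)
      fix i
      obtain c where c: "\<And>y. h y i = 2 * g i * max 0 (1 - real y * c)"
        by (rule that[of "1 / (2 * real (Suc i))"]) (simp add: h_def)
      have "2 * max 0 (1 - real (Suc x) * c) \<le> max 0 (1 - real x * c) + max 0 (1 - real (Suc (Suc x)) * c)"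
        by (auto simp: max_def algebra_simps)
      then have "2 * g i * (2 * max 0 (1 - real (Suc x) * c)) \<le> 2 * g i * (max 0 (1 - real x * c) + max 0 (1 - real (Suc (Suc x)) * c))"
        by (rule mult_left_mono) (use g0[of i] in simp)
      then have "2 * h (Suc x) i \<le> h x i + h (Suc (Suc x)) i" unfolding c by (simp only: distrib_left mult_ac)
      then show "h (Suc x) i \<le> (T x + T (Suc (Suc x))) / 2" using T_ge[of x i] T_ge[of "Suc (Suc x)" i] by (simp add: field_simps)
    qed
    then show ?thesis by (simp add: field_simps)
  qed
  have T_S: "S n \<le> T (Suc n)" for n
    unfolding S_def
  proof (rule am_inf_supq_leI)
    fix i assume i: "n \<le> i"
    have "real (Suc n) / (2 * real (Suc i)) \<le> 1 / 2" using i by (simp add: field_simps)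
    then have "1 / 2 \<le> max 0 (1 - real (Suc n) / (2 * real (Suc i)))" by (simp add: max_def)
    then have "2 * g i * (1 / 2) \<le> h (Suc n) i" unfolding h_def by (rule mult_left_mono) (use g0[of i] in simp)
    then show "real (Suc i) * \<eta> i \<le> T (Suc n)" using T_ge[of "Suc n" i] by (simp add: g_def)
  qed
  have T_2S: "T (Suc n) \<le> 2 * S (n div 2)" for n
  proof (rule T_le)
    fix i
    show "h (Suc n) i \<le> 2 * S (n div 2)"
    proof (cases "2 * Suc i \<le> Suc n")
      case True
      then have "real (2 * Suc i) \<le> real (Suc n)" by (simp only: of_nat_le_iff)
      then have "1 - real (Suc n) / (2 * real (Suc i)) \<le> 0" by (simp add: field_simps)
      then have "h (Suc n) i = 0" by (simp add: h_def)
      then show ?thesis using gS[OF order.refl, of "n div 2"] g0[of "n div 2"] by simp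
    next
      case False
      then have "n div 2 \<le> i" by presburger
      from gS[OF this] show ?thesis using h2[of "Suc n" i] by linarith
    qed
  qed
  have T_lim: "T \<longlonglongrightarrow> 0"
  proof -
    have "(\<lambda>n. 2 * S (n div 2)) \<longlonglongrightarrow> 0"
      unfolding S_def by (intro tendsto_mult_right_zero filterlim_compose[OF am_inf_supq_tendsto[OF \<eta>] filterlim_nat_div]) simp
    then have "(\<lambda>n. T (Suc n)) \<longlonglongrightarrow> 0" by (rule null_sandwich[OF T0 T_2S])
    then show ?thesis by (rule LIMSEQ_imp_Suc)
  qed
  \<comment> \<open>Convexity of \<open>T\<close> makes its decrements monotone, and since
    \<open>T\<close> tends to \<open>0\<close> it is their sequence of tails.\<close>
  define \<rho> where "\<rho> = (\<lambda>n. T n - T (Suc n))"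
  have \<rho>0: "0 \<le> \<rho> n" for n using T_anti[of n] by (simp add: \<rho>_def)
  have "\<rho> (Suc n) \<le> \<rho> n" for n using T_conv[of n] by (simp add: \<rho>_def)
  then have anti: "antimono \<rho>" unfolding antimono_iff_le_Suc by blast
  have psum: "(\<Sum>i<n. \<rho> i) = T 0 - T n" for n unfolding \<rho>_def by (rule sum_lessThan_telescope')
  have "(\<lambda>n. T 0 - T n) \<longlonglongrightarrow> T 0 - 0" by (intro tendsto_intros T_lim)
  then have sums: "\<rho> sums T 0" unfolding sums_def psum by simp
  then have sm: "summable \<rho>" and si: "suminf \<rho> = T 0" by (auto simp: sums_iff)
  have tail: "tail \<rho> n = T n" for n unfolding tail_eq[OF sm] si psum by simp
  have "\<rho> \<in> l1_star" using \<rho>0 anti sm summable_LIMSEQ_zero[OF sm] by (simp add: l1_star_def c0_star_def)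
  moreover have "dominated (am_inf_mu \<eta>) (am_inf_seq \<rho>)"
  proof (rule dominated_le[where M=1])
    fix n show "am_inf_mu \<eta> n \<le> 1 * am_inf_seq \<rho> n"
      unfolding am_inf_mu_def am_inf_seq_eq tail S_def[symmetric] mult_1 by (rule divide_right_mono[OF T_S]) simp
  qed
  moreover have "dominated (am_inf_seq \<rho>) (am_inf_mu \<eta>)"
  proof (rule dominatedI[where m=2 and M=2])
    fix n
    have "am_inf_seq \<rho> n \<le> 2 * S (n div 2) / real (Suc n)"
      unfolding am_inf_seq_eq tail by (rule divide_right_mono[OF T_2S]) simp
    also have "\<dots> \<le> 2 * S (n div 2) / real (Suc (n div 2))"
      using am_inf_supq_nonneg[OF \<eta>] by (intro frac_le) (auto simp: S_def)
    also have "\<dots> = 2 * am_inf_mu \<eta> (n div 2)" by (simp add: am_inf_mu_def S_def)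
    finally show "am_inf_seq \<rho> n \<le> 2 * am_inf_mu \<eta> (n div 2)" .
  qed simp
  ultimately show ?thesis by blast
qed

interpretation am_inf: mean_theory am_inf_seq l1_star o_omega am_inf_mu
proof (rule mean_theory.intro[OF am_inf.mean_op_axioms], rule mean_theory_axioms.intro, goal_cases)
  case 1 then show ?case by (rule am_inf_GF_add)
next
  case 2 then show ?case by (rule am_inf_mu_c0)
next
  case 3 then show ?case by (rule am_inf_mu_ge)
next
  case (4 \<eta> \<eta>' n) show ?case
    unfolding am_inf_mu_def
    by (intro divide_right_mono am_inf_supq_leI order_trans[OF mult_left_mono[OF 4(3)] am_inf_supq_ge[OF 4(2)]]) auto
next
  case 5 then show ?case by (rule am_inf_mu_mean)
next
  case 6 then show ?case by (intro am_inf_mu_least)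
qed

subsection \<open>Principal am-infinity stable ideals\<close>

lemma am_inf_stable_iff:
  assumes \<xi>: "\<xi> \<in> c0_star" "\<xi> 0 > 0"
  shows "princ \<xi> = am_inf.G (princ \<xi>) \<longleftrightarrow> \<xi> \<in> l1_star \<and> dominated (am_inf_seq \<xi>) \<xi>"
proof
  note P = char_set_princ[OF \<xi>(1)]
  assume "princ \<xi> = am_inf.G (princ \<xi>)"
  then have "\<xi> \<in> am_inf.G (princ \<xi>)" using princ_self[OF \<xi>(1)] by blast
  then have "am_inf_seq \<xi> \<in> princ \<xi>" "\<xi> \<in> l1_star" using am_inf.a_G[OF P] am_inf.G_U by auto
  then show "\<xi> \<in> l1_star \<and> dominated (am_inf_seq \<xi>) \<xi>" by (simp add: princ_def)
next
  note P = char_set_princ[OF \<xi>(1)]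
  assume H: "\<xi> \<in> l1_star \<and> dominated (am_inf_seq \<xi>) \<xi>"
  then have "am_inf_seq \<xi> \<in> princ \<xi>" using am_inf_seq_c0[of \<xi>] by (simp add: princ_def)
  then have "\<xi> \<in> am_inf.G (princ \<xi>)" using H by (intro am_inf.GI[OF princ_nonzero[OF \<xi>]]) auto
  then show "princ \<xi> = am_inf.G (princ \<xi>)" using princ_subset[OF am_inf.char_G[OF P]] am_inf.G_subset[OF P] by blast
qed

text \<open>In contrast to \<open>am_regular\<close>, the ampliation stays visible as the factor
  \<open>m\<close> inside the tail: tails decrease, so passing from \<open>j * m\<close> back to
  \<open>j\<close> would go in the wrong direction.\<close>

lemma am_inf_regular:
  assumes \<xi>: "\<xi> \<in> l1_star" and dom: "dominated (am_inf_seq \<xi>) \<xi>"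
  obtains m \<delta> where "m > 0" "\<delta> > 0" "\<And>j. \<delta> * tail \<xi> (m * Suc j) \<le> real (Suc j) * \<xi> j"
proof -
  note c = l1_starD(1)[OF \<xi>]
  obtain m M where m: "m > 0" "M > 0" "\<And>n. am_inf_seq \<xi> n \<le> M * \<xi> (n div m)" by (rule dominatedE[OF dom c]) blast
  have "1 / (real m * M) * tail \<xi> (m * Suc j) \<le> real (Suc j) * \<xi> j" for j
  proof -
    have le: "Suc (j * m) \<le> m * Suc j" using m(1) by simp
    have "tail \<xi> (m * Suc j) \<le> tail \<xi> (Suc (j * m))" by (rule tail_antimono[OF \<xi> le])
    also have "\<dots> = real (Suc (j * m)) * am_inf_seq \<xi> (j * m)" by (rule am_inf_seq_mult[symmetric])
    also have "\<dots> \<le> real (m * Suc j) * (M * \<xi> j)"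
    proof (rule mult_mono)
      show "real (Suc (j * m)) \<le> real (m * Suc j)" using le by (simp only: of_nat_le_iff)
      show "am_inf_seq \<xi> (j * m) \<le> M * \<xi> j" using m(3)[of "j * m"] m(1) by simp
    qed (use c0_starD(1)[OF am_inf_seq_c0[OF \<xi>]] in auto)
    also have "\<dots> = real m * M * (real (Suc j) * \<xi> j)" by (simp only: of_nat_mult mult_ac)
    finally show ?thesis using m(1,2) by (simp add: field_simps del: of_nat_Suc)
  qed
  then show ?thesis using m(1,2) by (intro that[of m "1 / (real m * M)"]) auto
qed

text \<open>The terms between \<open>n\<close> and \<open>2 * n\<close> contribute at least
  \<open>n * \<xi> j\<close> with \<open>j = 2 * n - 1\<close>, by regularity at least \<delta>/2
  times the tail at \<open>2 * m * n\<close>. So multiplying the index by \<open>2 * m\<close>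
  shrinks the tail by the factor \<open>1 + \<delta> / 2\<close>, and this is iterated.\<close>

lemma am_inf_decay:
  assumes \<xi>: "\<xi> \<in> l1_star" and m: "m > 0" and \<delta>: "\<delta> > 0" "\<And>j. \<delta> * tail \<xi> (m * Suc j) \<le> real (Suc j) * \<xi> j"
  shows "\<exists>c\<ge>1. \<forall>n\<ge>1. C * tail \<xi> (c * n) \<le> tail \<xi> n"
proof -
  have step: "(1 + \<delta> / 2) * tail \<xi> (2 * m * n) \<le> tail \<xi> n" if n: "n \<ge> 1" for n
  proof -
    define j where "j = 2 * n - 1"
    have j: "Suc j = 2 * n" "n \<le> Suc j" using n by (auto simp: j_def)
    have "(\<Sum>i=n..<Suc j. \<xi> j) \<le> (\<Sum>i=n..<Suc j. \<xi> i)"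
      by (rule sum_mono) (use c0_starD(2)[OF l1_starD(1)[OF \<xi>]] in auto)
    then have "real n * \<xi> j + tail \<xi> (Suc j) \<le> tail \<xi> n"
      unfolding tail_split[OF l1_starD(2)[OF \<xi>] j(2)] by (simp add: j(1) del: sum.op_ivl_Suc)
    moreover have "\<delta> / 2 * tail \<xi> (2 * m * n) \<le> real n * \<xi> j"
    proof -
      have "m * Suc j = 2 * m * n" by (simp add: j(1))
      moreover have "real (Suc j) = 2 * real n" by (simp only: j(1) of_nat_mult of_nat_numeral)
      ultimately have "\<delta> * tail \<xi> (2 * m * n) \<le> 2 * real n * \<xi> j" using \<delta>(2)[of j] by metis
      then show ?thesis by simp
    qed
    moreover have "tail \<xi> (2 * m * n) \<le> tail \<xi> (Suc j)"
    proof (rule tail_antimono[OF \<xi>])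
      have "1 * (2 * n) \<le> m * (2 * n)" by (rule mult_le_mono1) (use m in simp)
      then show "Suc j \<le> 2 * m * n" unfolding j(1) by (simp only: mult_ac nat_mult_1)
    qed
    ultimately show ?thesis by (simp add: distrib_right)
  qed
  have pw: "(1 + \<delta> / 2) ^ k * tail \<xi> ((2 * m) ^ k * n) \<le> tail \<xi> n" if n: "n \<ge> 1" for k n
  proof (induction k)
    case (Suc k)
    define t where "t = tail \<xi> ((2 * m) ^ Suc k * n)"
    have "(2 * m) ^ k * n \<ge> 1" using n m by simp
    from step[OF this] have "(1 + \<delta> / 2) * t \<le> tail \<xi> ((2 * m) ^ k * n)" by (simp add: mult.assoc t_def)
    then have "(1 + \<delta> / 2) ^ k * ((1 + \<delta> / 2) * t) \<le> (1 + \<delta> / 2) ^ k * tail \<xi> ((2 * m) ^ k * n)"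
      by (rule mult_left_mono) (use \<delta> in simp)
    moreover have "(1 + \<delta> / 2) ^ Suc k * t = (1 + \<delta> / 2) ^ k * ((1 + \<delta> / 2) * t)" by (simp only: power_Suc mult_ac)
    ultimately have "(1 + \<delta> / 2) ^ Suc k * t \<le> tail \<xi> n" using Suc.IH by linarith
    then show ?case unfolding t_def .
  qed simp
  obtain k where k: "C < (1 + \<delta> / 2) ^ k" using real_arch_pow[of "1 + \<delta> / 2" C] \<delta> by auto
  have "C * tail \<xi> ((2 * m) ^ k * n) \<le> tail \<xi> n" if "n \<ge> 1" for n
    using mult_right_mono[OF less_imp_le[OF k] tail_nonneg[OF \<xi>, of "(2 * m) ^ k * n"]] pw[OF that, of k] by linarith
  moreover have "(2 * m) ^ k \<ge> 1" using m by simp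
  ultimately show ?thesis by blast
qed

text \<open>A tail is an infinite sum, so its bound is replaced by bounds on the sums over
  \<open>{n..<N}\<close> for all \<open>N\<close>; those with \<open>n = 0\<close> force
  summability.\<close>

lemma am_inf_uniform:
  assumes \<xi>: "\<xi> \<in> c0_star"
    and dom: "\<And>\<rho>. \<rho> \<in> l1_star \<Longrightarrow> (\<And>n. tail \<rho> n \<le> g n) \<Longrightarrow> dominated \<rho> \<xi>"
  obtains m where "m > 0" "\<And>\<rho> n. \<rho> \<in> l1_star \<Longrightarrow> (\<And>n. tail \<rho> n \<le> g n) \<Longrightarrow> \<rho> n \<le> real m * \<xi> (n div m)"
proof -
  define C where "C = range (\<lambda>(n, N). ({n..<N::nat}, g n))"
  define Q where "Q = {\<rho>. (\<forall>n. 0 \<le> \<rho> n) \<and> antimono \<rho> \<and> (\<forall>A b. (A, b) \<in> C \<longrightarrow> sum \<rho> A \<le> b)}"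
  have Q_iff: "\<rho> \<in> Q \<longleftrightarrow> \<rho> \<in> l1_star \<and> (\<forall>n. tail \<rho> n \<le> g n)" for \<rho>
  proof
    assume "\<rho> \<in> Q"
    then have \<rho>: "\<And>n. 0 \<le> \<rho> n" "antimono \<rho>" and C: "\<And>A b. (A, b) \<in> C \<Longrightarrow> sum \<rho> A \<le> b"
      unfolding Q_def by blast+
    have le: "sum \<rho> {n..<N} \<le> g n" for n N
      by (rule C, unfold C_def, rule range_eqI[of _ _ "(n, N)"]) simp
    have sm: "summable \<rho>"
      by (rule summableI_nonneg_bounded[where x="g 0"]) (use \<rho>(1) le[of 0] in \<open>auto simp: atLeast0LessThan\<close>)
    then have "\<rho> \<in> l1_star" using \<rho> summable_LIMSEQ_zero[OF sm] by (simp add: l1_star_def c0_star_def)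
    moreover have "tail \<rho> n \<le> g n" for n
    proof (rule LIMSEQ_le_const2)
      show "(\<lambda>N. tail \<rho> n - tail \<rho> N) \<longlonglongrightarrow> tail \<rho> n"
        using tendsto_diff[OF tendsto_const tail_tendsto[OF sm], of "tail \<rho> n"] by simp
      show "\<exists>N. \<forall>k\<ge>N. tail \<rho> n - tail \<rho> k \<le> g n"
        using tail_split[OF sm, of n] le[of n] by (intro exI[of _ n]) auto
    qed
    ultimately show "\<rho> \<in> l1_star \<and> (\<forall>n. tail \<rho> n \<le> g n)" by blast
  next
    assume H: "\<rho> \<in> l1_star \<and> (\<forall>n. tail \<rho> n \<le> g n)"
    then have l: "\<rho> \<in> l1_star" by blast
    have "sum \<rho> {n..<N} \<le> g n" for n N
    proof (cases "n \<le> N")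
      case True
      have "sum \<rho> {n..<N} \<le> tail \<rho> n" using tail_split[OF l1_starD(2)[OF l] True] tail_nonneg[OF l, of N] by linarith
      then show ?thesis using H order_trans by blast
    next
      case False
      then show ?thesis using H tail_nonneg[OF l, of n] by (auto intro: order_trans)
    qed
    then show "\<rho> \<in> Q" using l1_starD(1)[OF l] by (auto simp: Q_def C_def c0_star_def)
  qed
  have "\<exists>m>0. \<forall>\<rho>\<in>Q. \<forall>n. \<rho> n \<le> real m * \<xi> (n div m)"
    unfolding Q_def
  proof (rule uniform_domination[OF _ _ \<xi>])
    show "finite A" if "(A, b) \<in> C" for A b using that by (auto simp: C_def)
    show "\<exists>A b. (A, b) \<in> C \<and> n \<in> A" for n
      by (intro exI[of _ "{0..<Suc n}"] exI[of _ "g 0"]) (auto simp: C_def intro: range_eqI[of _ _ "(0, Suc n)"])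
    fix \<rho> assume "\<rho> \<in> {\<rho>. (\<forall>n. 0 \<le> \<rho> n) \<and> antimono \<rho> \<and> (\<forall>A b. (A, b) \<in> C \<longrightarrow> sum \<rho> A \<le> b)}"
    then have "\<rho> \<in> Q" by (simp only: Q_def)
    then show "dominated \<rho> \<xi>" unfolding Q_iff using dom by blast
  qed
  then obtain m where m: "m > 0" "\<And>\<rho> n. \<rho> \<in> Q \<Longrightarrow> \<rho> n \<le> real m * \<xi> (n div m)" by blast
  show ?thesis by (rule that[OF m(1)], rule m(2)) (simp add: Q_iff)
qed

lemma block_l1:
  assumes "0 \<le> b" shows "block b N \<in> l1_star" "tail (block b N) n = real (N - n) * b"
proof -
  have s: "block b N sums (real N * b)"
    using sums_finite[of "{..<N}" "block b N"] by (simp add: block_def)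
  then have sm: "summable (block b N)" by (simp add: sums_iff)
  show "block b N \<in> l1_star"
    using assms block_antimono[OF assms] sm summable_LIMSEQ_zero[OF sm] by (simp add: l1_star_def c0_star_def block_def)
  show "tail (block b N) n = real (N - n) * b"
    using s unfolding tail_eq[OF sm] sum_block by (cases "n \<le> N") (auto simp: sums_iff of_nat_diff left_diff_distrib)
qed

text \<open>Blocks again test the uniform bound, but now the constraints concern indices before the
  end of the block. At small indices the required lower bound for \<eta> comes from the decay of the
  tails of \<xi>, at large ones from monotonicity of \<eta>.\<close>

lemma am_inf_stable_pre_cancel:
  assumes \<xi>: "\<xi> \<in> c0_star" "\<xi> 0 > 0" and st: "princ \<xi> = am_inf.G (princ \<xi>)" and J: "char_set J"
    and sub: "princ \<xi> \<subseteq> J" and GJ: "am_inf.G J \<subseteq> princ \<xi>"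
  shows "J \<subseteq> princ \<xi>"
proof
  fix \<theta> assume \<theta>: "\<theta> \<in> J"
  define \<eta> where "\<eta> = (\<lambda>n. \<theta> n + \<xi> n)"
  have \<eta>J: "\<eta> \<in> J" unfolding \<eta>_def using char_setD(3)[OF J \<theta>] sub princ_self[OF \<xi>(1)] by blast
  have \<theta>c: "\<theta> \<in> c0_star" and \<eta>: "\<eta> \<in> c0_star" using char_setD(1)[OF J] \<theta> \<eta>J by auto
  have \<xi>\<eta>: "\<xi> n \<le> \<eta> n" and \<theta>\<eta>: "\<theta> n \<le> 1 * \<eta> n" for n
    using c0_starD(1)[OF \<theta>c, of n] c0_starD(1)[OF \<xi>(1), of n] by (auto simp: \<eta>_def)
  have \<eta>0: "0 \<le> \<eta> n" for n by (rule c0_starD(1)[OF \<eta>])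
  have l1: "\<xi> \<in> l1_star" and dom: "dominated (am_inf_seq \<xi>) \<xi>" using am_inf_stable_iff[OF \<xi>] st by auto
  obtain m \<delta> where m: "m > 0" "\<delta> > 0" "\<And>j. \<delta> * tail \<xi> (m * Suc j) \<le> real (Suc j) * \<xi> j"
    by (rule am_inf_regular[OF l1 dom]) blast
  have Jnz: "J \<noteq> {\<lambda>_. 0}" using sub princ_self[OF \<xi>(1)] \<xi>(2) by auto
  \<comment> \<open>For \<open>n \<ge> 1\<close> this bounds the mean at infinity by \<eta> at index
    \<open>n - 1\<close>. The value at \<open>0\<close> bounds the total sum, which the mean does
    not control.\<close>
  define g where "g = (\<lambda>n. if n = 0 then 2 * \<eta> 0 else real n * \<eta> (n - 1))"
  obtain k where k: "k > 0" "\<And>\<rho> n. \<rho> \<in> l1_star \<Longrightarrow> (\<And>n. tail \<rho> n \<le> g n) \<Longrightarrow> \<rho> n \<le> real k * \<xi> (n div k)"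
  proof (rule am_inf_uniform[OF \<xi>(1)])
    fix \<rho> assume \<rho>: "\<rho> \<in> l1_star" "\<And>n. tail \<rho> n \<le> g n"
    have "am_inf_seq \<rho> \<in> J"
    proof (rule char_set_le[OF J \<eta>J am_inf_seq_c0[OF \<rho>(1)], where M=1])
      fix n
      have "real (Suc n) * am_inf_seq \<rho> n \<le> real (Suc n) * \<eta> n"
        unfolding am_inf_seq_mult using \<rho>(2)[of "Suc n"] by (simp add: g_def del: of_nat_Suc)
      then have "am_inf_seq \<rho> n \<le> \<eta> n" by (simp only: mult_le_cancel_left_pos of_nat_0_less_iff zero_less_Suc)
      then show "am_inf_seq \<rho> n \<le> 1 * \<eta> n" by simp
    qed
    then have "\<rho> \<in> princ \<xi>" using am_inf.GI[OF Jnz \<rho>(1)] GJ by blast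
    then show "dominated \<rho> \<xi>" by (simp add: princ_def)
  qed blast
  text \<open>A block of height \<open>b\<close> and length \<open>N\<close> is admissible as soon as \<open>N b \<le> n \<eta>\<^sub>n\<^sub>-\<^sub>1\<close> for \<open>1 \<le> n < N\<close>.\<close>
  have adm: "b \<le> real k * \<xi> ((N - 1) div k)"
    if N: "N \<ge> 2" and b: "0 \<le> b" and le: "\<And>j. Suc j < N \<Longrightarrow> real N * b \<le> real (Suc j) * \<eta> j" for b N
  proof -
    have "block b N (N - 1) \<le> real k * \<xi> ((N - 1) div k)"
    proof (rule k(2)[of "block b N" "N - 1", OF block_l1(1)[OF b]])
      fix n
      show "tail (block b N) n \<le> g n"
        unfolding block_l1(2)[OF b]
      proof (cases n)
        case 0
        have "real N * b \<le> 2 * (real (N - 1) * b)"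
        proof -
          have "real N \<le> 2 * real (N - 1)" using N by (simp add: of_nat_diff)
          then show ?thesis using mult_right_mono[OF _ b] by fastforce
        qed
        also have "\<dots> \<le> 2 * (real N * b)" using b by (intro mult_left_mono mult_right_mono) auto
        finally have "real N * b \<le> 2 * (real N * b)" .
        moreover have "real N * b \<le> \<eta> 0" using le[of 0] N by simp
        ultimately show "real (N - n) * b \<le> g n" using 0 \<eta>0[of 0] by (simp add: g_def)
      next
        case (Suc j)
        show "real (N - n) * b \<le> g n"
        proof (cases "n < N")
          case True
          have "real (N - n) * b \<le> real N * b" using b by (intro mult_right_mono) auto
          also have "\<dots> \<le> real (Suc j) * \<eta> j" by (rule le) (use True Suc in simp)
          finally show ?thesis using Suc by (simp add: g_def)
        next
          case False
          then show ?thesis using \<eta>0 by (simp add: g_def)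
        qed
      qed
    qed
    then show ?thesis using N by (simp add: block_def)
  qed
  \<comment> \<open>Gives \<open>\<delta> * C = 4 * (real k)\<^sup>2 + \<delta>\<close>, just above
    the factor that arises from a block of length \<open>4 * k * x\<close>.\<close>
  define C where "C = 4 * (real k)\<^sup>2 / \<delta> + 1"
  obtain c' where c': "c' \<ge> 1" "\<And>n. n \<ge> 1 \<Longrightarrow> C * tail \<xi> (c' * n) \<le> tail \<xi> n"
    using am_inf_decay[OF l1 m] by blast
  define c where "c = m * c'"
  have c: "c > 0" using m(1) c'(1) by (simp add: c_def)
  have key: "\<eta> (4 * k * x) \<le> (4 * (real k)\<^sup>2 * real c) * \<xi> (4 * x - 1)" if x: "x \<ge> 1" for x
  proof -
    define N where "N = 4 * k * x"
    have kx: "1 \<le> k * x" using k(1) x by simp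
    then have N: "N \<ge> 2" unfolding N_def by linarith
    have Npos: "real N > 0" using N by simp
    have div: "(N - 1) div k = 4 * x - 1"
    proof (rule div_nat_eqI)
      have "k * (4 * x - 1) = N - k" by (simp add: N_def right_diff_distrib')
      then show "k * (4 * x - 1) \<le> N - 1" using k(1) by linarith
      have "k * Suc (4 * x - 1) = N" using x by (simp add: N_def)
      then show "N - 1 < k * Suc (4 * x - 1)" using N by linarith
    qed
    have \<eta>N: "\<eta> N \<le> \<eta> j" if "Suc j < N" for j by (rule c0_starD(2)[OF \<eta>]) (use that in simp)
    show ?thesis
    proof (cases "\<xi> (4 * x - 1) = 0")
      \<comment> \<open>The contradiction in the other case cancels
        \<open>\<xi> (4 * x - 1)\<close>. If this value vanishes, the smaller height
        \<open>\<eta> N / N\<close> already shows that \<eta> vanishes at \<open>N\<close>.\<close>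
      case True
      have "\<eta> N / real N \<le> real k * \<xi> ((N - 1) div k)"
      proof (rule adm[OF N])
        show "0 \<le> \<eta> N / real N" using \<eta>0 by simp
        fix j assume j: "Suc j < N"
        have "real N * (\<eta> N / real N) = \<eta> N" using Npos by simp
        also have "\<dots> \<le> 1 * \<eta> j" using \<eta>N[OF j] by simp
        also have "\<dots> \<le> real (Suc j) * \<eta> j" by (rule mult_right_mono[OF _ \<eta>0]) simp
        finally show "real N * (\<eta> N / real N) \<le> real (Suc j) * \<eta> j" .
      qed
      then have "\<eta> N / real N \<le> 0" unfolding div True by simp
      then have "\<eta> N \<le> 0" using Npos by (simp add: divide_le_0_iff)
      then show ?thesis using True by (simp add: N_def)
    next
      case False
      then have pos: "\<xi> (4 * x - 1) > 0" using c0_starD(1)[OF \<xi>(1), of "4 * x - 1"] by linarith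
      have Cp: "C > 0" unfolding C_def using m(2) by (simp add: add_nonneg_pos)
      \<comment> \<open>The first bound makes the block admissible at indices with
        \<open>c * Suc j > x\<close>, the second, by decay and regularity, at those with
        \<open>c * Suc j \<le> x\<close>. If the first is the minimum the claim follows; otherwise
        the choice of \<open>C\<close> is contradicted.\<close>
      define b where "b = min (real x * \<eta> N / real c / real N) (\<delta> * C * tail \<xi> x / real N)"
      have b0: "0 \<le> b" unfolding b_def using \<eta>0 m(2) Cp tail_nonneg[OF l1] by simp
      have Nb1: "real N * b \<le> real x * \<eta> N / real c"
      proof -
        have "real N * b \<le> real N * (real x * \<eta> N / real c / real N)" unfolding b_def by (intro mult_left_mono min.cobounded1) simp
        then show ?thesis using Npos by simp
      qed
      have Nb2: "real N * b \<le> \<delta> * C * tail \<xi> x"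
      proof -
        have "real N * b \<le> real N * (\<delta> * C * tail \<xi> x / real N)" unfolding b_def by (intro mult_left_mono min.cobounded2) simp
        then show ?thesis using Npos by simp
      qed
      have "b \<le> real k * \<xi> ((N - 1) div k)"
      proof (rule adm[OF N b0])
        fix j assume j: "Suc j < N"
        show "real N * b \<le> real (Suc j) * \<eta> j"
        proof (cases "c * Suc j \<le> x")
          case True
          have "m * Suc j \<ge> 1" using m(1) by simp
          then have "C * tail \<xi> (c' * (m * Suc j)) \<le> tail \<xi> (m * Suc j)" by (rule c'(2))
          moreover have "c' * (m * Suc j) = c * Suc j" by (simp only: c_def mult_ac)
          moreover have "tail \<xi> x \<le> tail \<xi> (c * Suc j)" by (rule tail_antimono[OF l1 True])
          then have "C * tail \<xi> x \<le> C * tail \<xi> (c * Suc j)" using Cp by simp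
          ultimately have "C * tail \<xi> x \<le> tail \<xi> (m * Suc j)" by simp
          then have "\<delta> * (C * tail \<xi> x) \<le> \<delta> * tail \<xi> (m * Suc j)" using m(2) by simp
          also have "\<dots> \<le> real (Suc j) * \<xi> j" by (rule m(3))
          also have "\<dots> \<le> real (Suc j) * \<eta> j" by (rule mult_left_mono[OF \<xi>\<eta>]) simp
          finally show ?thesis using Nb2 by (simp only: mult.assoc)
        next
          case False
          then have "real x \<le> real (c * Suc j)" by (simp only: of_nat_le_iff)
          then have "real x \<le> real (Suc j) * real c" by (simp only: of_nat_mult mult.commute)
          moreover have "real c > 0" using c by simp
          ultimately have "real x / real c \<le> real (Suc j)" by (simp only: pos_divide_le_eq)
          then have "real x / real c * \<eta> N \<le> real (Suc j) * \<eta> j" by (intro mult_mono \<eta>N[OF j] \<eta>0) auto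
          then show ?thesis using Nb1 by simp
        qed
      qed
      then have b: "b \<le> real k * \<xi> (4 * x - 1)" by (simp only: div)
      show ?thesis
      proof (cases "real x * \<eta> N / real c / real N \<le> \<delta> * C * tail \<xi> x / real N")
        case True
        then have "real x * \<eta> N / real c / real N \<le> real k * \<xi> (4 * x - 1)" using b by (simp add: b_def)
        then have "real x * \<eta> N \<le> real k * \<xi> (4 * x - 1) * (real c * real N)" using Npos c by (simp add: divide_le_eq mult_ac)
        also have "\<dots> = real x * ((4 * (real k)\<^sup>2 * real c) * \<xi> (4 * x - 1))" by (simp add: N_def power2_eq_square)
        finally show ?thesis using x by (simp add: N_def)
      next
        case False
        then have "\<delta> * C * tail \<xi> x / real N \<le> real k * \<xi> (4 * x - 1)" using b by (simp add: b_def min_def split: if_splits)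
        then have 1: "\<delta> * C * tail \<xi> x \<le> real k * \<xi> (4 * x - 1) * real N" using Npos by (simp add: divide_le_eq)
        have "real (Suc (4 * x - 1) - x) * \<xi> (4 * x - 1) \<le> tail \<xi> x" by (rule tail_lower[OF l1]) (use x in linarith)
        moreover have "real x * \<xi> (4 * x - 1) \<le> real (Suc (4 * x - 1) - x) * \<xi> (4 * x - 1)"
          by (rule mult_right_mono) (use pos x in auto)
        ultimately have "real x * \<xi> (4 * x - 1) \<le> tail \<xi> x" by linarith
        then have "\<delta> * C * (real x * \<xi> (4 * x - 1)) \<le> \<delta> * C * tail \<xi> x" by (rule mult_left_mono) (use m(2) Cp in simp)
        then have "\<delta> * C * (real x * \<xi> (4 * x - 1)) \<le> real k * \<xi> (4 * x - 1) * real N" using 1 by linarith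
        also have "\<dots> = 4 * (real k)\<^sup>2 * (real x * \<xi> (4 * x - 1))" by (simp add: N_def power2_eq_square)
        finally have "\<delta> * C \<le> 4 * (real k)\<^sup>2" using pos x by simp
        moreover have "\<delta> * C = 4 * (real k)\<^sup>2 + \<delta>" using m(2) by (simp add: C_def field_simps)
        ultimately show ?thesis using m(2) by simp
      qed
    qed
  qed
  have "dominated \<eta> \<xi>"
  proof (rule dominated_eventually[OF \<xi>, where m="4 * k" and N="4 * k" and B="\<eta> 0"])
    show "4 * k > 0" using k(1) by simp
    show "\<eta> n \<le> \<eta> 0" for n by (rule c0_starD(2)[OF \<eta>]) simp
    fix n assume n: "n \<ge> 4 * k"
    define x where "x = n div (4 * k)"
    have x: "x \<ge> 1" using div_le_mono[OF n, of "4 * k"] k(1) by (simp add: x_def)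
    have "\<eta> n \<le> \<eta> (4 * k * x)" by (rule c0_starD(2)[OF \<eta>]) (simp only: x_def times_div_less_eq_dividend)
    also have "\<dots> \<le> (4 * (real k)\<^sup>2 * real c) * \<xi> (4 * x - 1)" by (rule key[OF x])
    also have "\<dots> \<le> (4 * (real k)\<^sup>2 * real c) * \<xi> x"
      by (intro mult_left_mono c0_starD(2)[OF \<xi>(1)]) (use x in auto)
    finally show "\<eta> n \<le> (4 * (real k)\<^sup>2 * real c) * \<xi> (n div (4 * k))" by (simp only: x_def)
  qed
  then have "dominated \<theta> \<xi>" by (rule dominated_trans[OF dominated_le[OF \<theta>\<eta>] _ \<eta> \<xi>(1)])
  then show "\<theta> \<in> princ \<xi>" using \<theta>c by (simp add: princ_def)
qed

text \<open>\<open>am_inf.F\<close> and \<open>am_inf.so\<close> see only a part of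
  \<open>J\<close>, so summability of its elements must be deduced. Decreasing sequences below
  \<eta> with sum at most \<open>1\<close> are dominated by \<xi> uniformly; blocks transfer this to
  \<open>u\<close>, the minimum of \<eta> and 1/(n+1). So \<open>u\<close> is summable, hence
  o(1/n), hence eventually equal to \<eta>.\<close>

lemma char_set_l1_of_Int:
  assumes \<xi>: "\<xi> \<in> l1_star" and J: "char_set J" and sub: "J \<inter> l1_star \<subseteq> princ \<xi>"
  shows "J \<subseteq> l1_star"
proof
  fix \<eta> assume \<eta>J: "\<eta> \<in> J"
  have \<eta>: "\<eta> \<in> c0_star" by (rule char_setD(1)[OF J \<eta>J])
  note c = l1_starD(1)[OF \<xi>]
  define C where "C = range (\<lambda>n. ({n}, \<eta> n)) \<union> range (\<lambda>N. ({..<N::nat}, 1))"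
  define Q where "Q = {\<rho>. (\<forall>n. 0 \<le> \<rho> n) \<and> antimono \<rho> \<and> (\<forall>A b. (A, b) \<in> C \<longrightarrow> sum \<rho> A \<le> b)}"
  have "\<exists>k>0. \<forall>\<rho>\<in>Q. \<forall>n. \<rho> n \<le> real k * \<xi> (n div k)"
    unfolding Q_def
  proof (rule uniform_domination[OF _ _ c])
    show "finite A" if "(A, b) \<in> C" for A b using that by (auto simp: C_def)
    show "\<exists>A b. (A, b) \<in> C \<and> n \<in> A" for n by (intro exI[of _ "{n}"] exI[of _ "\<eta> n"]) (auto simp: C_def)
    fix \<rho> assume "\<rho> \<in> {\<rho>. (\<forall>n. 0 \<le> \<rho> n) \<and> antimono \<rho> \<and> (\<forall>A b. (A, b) \<in> C \<longrightarrow> sum \<rho> A \<le> b)}"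
    then have \<rho>: "\<And>n. 0 \<le> \<rho> n" "antimono \<rho>" and C: "\<And>A b. (A, b) \<in> C \<Longrightarrow> sum \<rho> A \<le> b" by blast+
    have le: "\<rho> n \<le> 1 * \<eta> n" for n using C[of "{n}" "\<eta> n"] by (auto simp: C_def)
    have "(\<Sum>i<N. \<rho> i) \<le> 1" for N using C[of "{..<N}" 1] by (auto simp: C_def)
    then have sm: "summable \<rho>" by (rule summableI_nonneg_bounded[OF \<rho>(1)])
    have l: "\<rho> \<in> l1_star" using \<rho> sm summable_LIMSEQ_zero[OF sm] by (simp add: l1_star_def c0_star_def)
    then have "\<rho> \<in> J" by (intro char_set_le[OF J \<eta>J l1_starD(1) le])
    then show "dominated \<rho> \<xi>" using l sub by (auto simp: princ_def)
  qed
  then obtain k where k: "k > 0" "\<And>\<rho> n. \<rho> \<in> Q \<Longrightarrow> \<rho> n \<le> real k * \<xi> (n div k)" by blast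
  define u where "u = (\<lambda>n. min (\<eta> n) (1 / real (Suc n)))"
  have u0: "0 \<le> u n" for n using c0_starD(1)[OF \<eta>, of n] by (simp add: u_def)
  have u_le: "u n \<le> real k * \<xi> (n div k)" for n
  proof -
    have "block (u n) (Suc n) \<in> Q"
      unfolding Q_def mem_Collect_eq
    proof (intro conjI allI impI)
      show "0 \<le> block (u n) (Suc n) i" for i using u0[of n] by (simp add: block_def)
      show "antimono (block (u n) (Suc n))" by (rule block_antimono[OF u0])
      fix A b assume "(A, b) \<in> C"
      then consider i where "A = {i}" "b = \<eta> i" | N where "A = {..<N}" "b = 1" by (auto simp: C_def)
      then show "sum (block (u n) (Suc n)) A \<le> b"
      proof cases
        case (1 i)
        have "u n \<le> \<eta> i" if "i \<le> n" using c0_starD(2)[OF \<eta> that] by (simp add: u_def min_le_iff_disj)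
        then show ?thesis using 1 c0_starD(1)[OF \<eta>, of i] by (simp add: block_def)
      next
        case (2 N)
        have "real (min N (Suc n)) * u n \<le> real (Suc n) * (1 / real (Suc n))"
          by (rule mult_mono) (use u0[of n] in \<open>auto simp: u_def\<close>)
        then show ?thesis using 2 by (simp add: sum_block del: of_nat_Suc)
      qed
    qed
    from k(2)[OF this, of n] show ?thesis by (simp add: block_def)
  qed
  have "summable (\<lambda>n. real k * \<xi> (n div k))" by (intro summable_mult l1_starD(2)[OF l1_star_ampliation[OF \<xi> k(1)]])
  then have sm: "summable u" by (rule summable_comparison_test'[where N=0]) (use u0 u_le in simp)
  have "u n \<le> u m" if "m \<le> n" for m n
    unfolding u_def using c0_starD(2)[OF \<eta> that] that by (intro min.mono frac_le) auto
  then have "u \<in> l1_star" using u0 sm summable_LIMSEQ_zero[OF sm] by (auto simp: l1_star_def intro: c0_starI)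
  then have "(\<lambda>n. real (Suc n) * u n) \<longlonglongrightarrow> 0" using l1_star_o_omega by (auto simp: o_omega_iff simp del: of_nat_Suc)
  then obtain N where N: "\<And>n. n \<ge> N \<Longrightarrow> norm (real (Suc n) * u n - 0) < 1" using LIMSEQ_D[OF _ zero_less_one] by blast
  have "u n = \<eta> n" if "n \<ge> N" for n
  proof (rule ccontr)
    assume "u n \<noteq> \<eta> n"
    then have "u n = 1 / real (Suc n)" by (simp add: u_def min_def split: if_splits)
    then have "real (Suc n) * u n = 1" by simp
    then show False using N[OF that] by (simp del: of_nat_Suc)
  qed
  then have "summable \<eta>"
    by (intro summable_comparison_test'[OF sm, of N]) (use c0_starD(1)[OF \<eta>] in simp)
  then show "\<eta> \<in> l1_star" using \<eta> by (simp add: l1_star_def)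
qed

text \<open>Take \<eta> in \<open>J\<close> whose mean at infinity dominates \<xi>. Comparing tails
  both ways, up to dilation, transfers decay to \<eta>: its tail at \<open>L * n\<close> is at most
  half of that at \<open>n\<close>. So at least half of the tail at \<open>n\<close> lies before
  \<open>L * n\<close>, and the tail is bounded by a multiple of
  \<open>n * \<eta> n\<close>.\<close>

lemma am_inf_stable_mean_cancel:
  assumes \<xi>: "\<xi> \<in> c0_star" "\<xi> 0 > 0" and st: "princ \<xi> = am_inf.G (princ \<xi>)" and J: "char_set J"
    and FJ: "am_inf.F J = princ \<xi>"
  shows "J = princ \<xi>"
proof
  have l1: "\<xi> \<in> l1_star" and dom: "dominated (am_inf_seq \<xi>) \<xi>" using am_inf_stable_iff[OF \<xi>] st by auto
  have Jl: "J \<inter> l1_star \<subseteq> princ \<xi>" using am_inf.subset_F[OF J] FJ by simp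
  show sub: "J \<subseteq> princ \<xi>" using char_set_l1_of_Int[OF l1 J Jl] Jl by blast
  obtain m \<delta> where m: "m > 0" "\<delta> > 0" "\<And>j. \<delta> * tail \<xi> (m * Suc j) \<le> real (Suc j) * \<xi> j"
    by (rule am_inf_regular[OF l1 dom]) blast
  have "\<xi> \<in> am_inf.F J" using FJ princ_self[OF \<xi>(1)] by simp
  then obtain \<eta> M where \<eta>: "\<eta> \<in> J" "\<eta> \<in> l1_star" "M > 0" "\<And>n. \<xi> n \<le> M * am_inf_seq \<eta> n" by (rule am_inf.FE) blast
  note \<eta>c = l1_starD(1)[OF \<eta>(2)]
  obtain k K where k: "k > 0" "K > 0" "\<And>n. \<eta> n \<le> K * \<xi> (n div k)"
    using dominatedE[of \<eta> \<xi>] sub \<eta>(1) \<xi>(1) by (auto simp: princ_def)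
  have up: "tail \<eta> (k * n) \<le> K * real k * tail \<xi> n" for n
  proof -
    have "tail \<eta> (k * n) \<le> tail (\<lambda>n. K * \<xi> (n div k)) (k * n)"
      by (rule tail_mono[OF \<eta>(2) char_set_scale[OF char_set_l1_star l1_star_ampliation[OF l1 k(1)]] k(3)]) (use k(2) in simp)
    also have "\<dots> = K * tail (\<lambda>n. \<xi> (n div k)) (n * k)"
      by (simp add: tail_scale[OF l1_star_ampliation[OF l1 k(1)]] mult.commute)
    also have "\<dots> = K * real k * tail \<xi> n" by (simp add: tail_ampliation[OF l1 k(1)])
    finally show ?thesis .
  qed
  have low: "real (Suc j) * \<xi> j \<le> M * tail \<eta> (Suc j)" for j
  proof -
    have "real (Suc j) * \<xi> j \<le> real (Suc j) * (M * am_inf_seq \<eta> j)" by (rule mult_left_mono[OF \<eta>(4)]) simp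
    then show ?thesis unfolding am_inf_seq_mult[symmetric] by (simp only: mult_ac)
  qed
  obtain c where c: "c \<ge> 1" "\<And>n. n \<ge> 1 \<Longrightarrow> (2 * K * real k * M / \<delta>) * tail \<xi> (c * n) \<le> tail \<xi> n"
    using am_inf_decay[OF l1 m] by blast
  \<comment> \<open>Collects three index dilations: \<open>k\<close> from the domination of \<eta>
    by \<xi>, \<open>c\<close> from decay and \<open>m\<close> from regularity.\<close>
  define L where "L = k * (c * m)"
  have L: "L \<ge> 1" using k(1) c(1) m(1) by (simp add: L_def)
  have "dominated \<xi> \<eta>"
  proof (rule dominated_eventually[OF \<eta>c _ zero_less_one, where N=1 and M="2 * M * real L" and B="\<xi> 0"])
    show "0 < \<eta> 0"
    proof (rule c0_star_pos_0[OF \<eta>c])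
      show "\<eta> \<noteq> (\<lambda>_. 0)" using \<eta>(4)[of 0] \<xi>(2) am_inf.a_zero by auto
    qed
    show "\<xi> n \<le> \<xi> 0" for n by (rule c0_starD(2)[OF \<xi>(1)]) simp
    fix n :: nat assume n: "n \<ge> 1"
    then obtain j where j: "n = Suc j" by (cases n) auto
    have "L * n = k * (c * (m * n))" by (simp only: L_def mult_ac)
    then have "tail \<eta> (L * n) \<le> K * real k * tail \<xi> (c * (m * n))" using up[of "c * (m * n)"] by (simp only:)
    then have "2 * M / \<delta> * tail \<eta> (L * n) \<le> 2 * M / \<delta> * (K * real k * tail \<xi> (c * (m * n)))"
      by (rule mult_left_mono) (use \<eta>(3) m(2) in simp)
    also have "\<dots> = (2 * K * real k * M / \<delta>) * tail \<xi> (c * (m * n))" by simp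
    also have "\<dots> \<le> tail \<xi> (m * n)" by (rule c(2)) (use m(1) n in simp)
    finally have "\<delta> * (2 * M / \<delta> * tail \<eta> (L * n)) \<le> \<delta> * tail \<xi> (m * n)" by (rule mult_left_mono) (use m(2) in simp)
    also have "\<dots> \<le> real n * \<xi> j" using m(3)[of j] by (simp only: j)
    also have "\<dots> \<le> M * tail \<eta> n" using low[of j] by (simp only: j)
    finally have "M * (2 * tail \<eta> (L * n)) \<le> M * tail \<eta> n" using m(2) by (simp add: mult_ac)
    then have half: "2 * tail \<eta> (L * n) \<le> tail \<eta> n" using \<eta>(3) by simp
    have "tail \<eta> n \<le> real (L * n - n) * \<eta> n + tail \<eta> (L * n)" by (rule tail_upper[OF \<eta>(2)]) (use L in simp)
    moreover have "real (L * n - n) * \<eta> n \<le> real (L * n) * \<eta> n"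
      by (rule mult_right_mono[OF _ c0_starD(1)[OF \<eta>c]]) (simp only: of_nat_le_iff diff_le_self)
    ultimately have t: "tail \<eta> n \<le> 2 * (real (L * n) * \<eta> n)" using half by linarith
    have "real n * \<xi> n \<le> real n * \<xi> j" by (rule mult_left_mono[OF c0_starD(2)[OF \<xi>(1)]]) (simp_all add: j)
    also have "\<dots> \<le> M * tail \<eta> n" using low[of j] by (simp only: j)
    also have "\<dots> \<le> M * (2 * (real (L * n) * \<eta> n))" using t \<eta>(3) by simp
    also have "\<dots> = real n * ((2 * M * real L) * \<eta> n)" by (simp only: of_nat_mult mult_ac)
    finally show "\<xi> n \<le> (2 * M * real L) * \<eta> (n div 1)" using n by simp
  qed
  then have "\<xi> \<in> J" by (rule char_setD(4)[OF J \<eta>(1) \<xi>(1)])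
  then show "princ \<xi> \<subseteq> J" by (rule princ_subset[OF J])
qed

text \<open>Take an index \<open>i\<close> that nearly attains the supremum behind
  \<open>am_inf_mu \<eta>\<close>. Its term is bounded by a tail of \<xi> near \<open>i\<close>, so
  decay keeps \<open>i\<close> below a fixed multiple of \<open>n\<close>, and the supremum is
  comparable to a term of \<eta> near \<open>n\<close>.\<close>

lemma am_inf_stable_open_cancel:
  assumes \<xi>: "\<xi> \<in> c0_star" "\<xi> 0 > 0" and st: "princ \<xi> = am_inf.G (princ \<xi>)" and J: "char_set J"
    and so: "am_inf.so J = princ \<xi>"
  shows "J = princ \<xi>"
proof
  have l1: "\<xi> \<in> l1_star" and dom: "dominated (am_inf_seq \<xi>) \<xi>" using am_inf_stable_iff[OF \<xi>] st by auto
  have JV: "J \<inter> o_omega \<subseteq> princ \<xi>" using am_inf.subset_so[of J] so by simp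
  have "J \<subseteq> l1_star" by (rule char_set_l1_of_Int[OF l1 J]) (use JV l1_star_o_omega in blast)
  then show sub: "J \<subseteq> princ \<xi>" using JV l1_star_o_omega by blast
  obtain m \<delta> where m: "m > 0" "\<delta> > 0" "\<And>j. \<delta> * tail \<xi> (m * Suc j) \<le> real (Suc j) * \<xi> j"
    by (rule am_inf_regular[OF l1 dom]) blast
  have "\<xi> \<in> am_inf.so J" using so princ_self[OF \<xi>(1)] by simp
  then obtain \<eta> where \<eta>: "\<eta> \<in> J" "\<eta> \<in> o_omega" "dominated \<xi> (am_inf_mu \<eta>)" by (auto simp: am_inf.so_def)
  note \<eta>c = o_omega_c0[OF \<eta>(2)]
  obtain r M where r: "r > 0" "M > 0" "\<And>n. \<xi> n \<le> M * am_inf_mu \<eta> (n div r)"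
    by (rule dominatedE[OF \<eta>(3) am_inf_mu_c0[OF \<eta>(2)]]) blast
  obtain k K where k: "k > 0" "K > 0" "\<And>n. \<eta> n \<le> K * \<xi> (n div k)"
    using dominatedE[of \<eta> \<xi>] sub \<eta>(1) \<xi>(1) by (auto simp: princ_def)
  define D where "D = 2 * real r * M * (2 * K * real k)"
  have D: "D > 0" using r k by (simp add: D_def)
  obtain c where c: "c \<ge> 1" "\<And>n. n \<ge> 1 \<Longrightarrow> (D / \<delta> + 1) * tail \<xi> (c * n) \<le> tail \<xi> n"
    using am_inf_decay[OF l1 m] by blast
  define L where "L = k * (2 * (c * m))"
  have "\<xi> n \<le> (2 * real r * M * real L) * \<eta> (n div r)" for n
  proof (cases "\<xi> n = 0")
    case True
    then show ?thesis using c0_starD(1)[OF \<eta>c] r by simp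
  next
    case False
    then have pos: "\<xi> n > 0" using c0_starD(1)[OF \<xi>(1), of n] by linarith
    define l where "l = n div r"
    have "n < Suc l * r" unfolding l_def using r(1) by (simp add: dividend_less_div_times)
    then have nl: "real (Suc n) \<le> real r * real (Suc l)" by (metis Suc_leI mult.commute of_nat_mono of_nat_mult)
    have "real (Suc n) * \<xi> n \<le> real (Suc n) * (M * am_inf_mu \<eta> l)" unfolding l_def by (rule mult_left_mono[OF r(3)]) simp
    also have "\<dots> \<le> (real r * real (Suc l)) * (M * am_inf_mu \<eta> l)"
      by (rule mult_right_mono[OF nl]) (use r(2) c0_starD(1)[OF am_inf_mu_c0[OF \<eta>(2)]] in simp)
    also have "\<dots> = real r * M * (real (Suc l) * am_inf_mu \<eta> l)" by (simp only: mult_ac)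
    finally have 1: "real (Suc n) * \<xi> n \<le> real r * M * am_inf_supq \<eta> l" unfolding am_inf_mu_mult .
    have "am_inf_supq \<eta> l > 0"
    proof (rule ccontr)
      assume "\<not> am_inf_supq \<eta> l > 0"
      then have "real r * M * am_inf_supq \<eta> l \<le> 0" using r by (simp add: mult_le_0_iff)
      moreover have "real (Suc n) * \<xi> n > 0" using pos by simp
      ultimately show False using 1 by linarith
    qed
    \<comment> \<open>Half of a positive supremum is exceeded by some term.\<close>
    then have "am_inf_supq \<eta> l / 2 < (SUP i\<in>{l..}. real (Suc i) * \<eta> i)" by (simp add: am_inf_supq_def)
    then obtain i where i: "i \<ge> l" "am_inf_supq \<eta> l / 2 < real (Suc i) * \<eta> i"
      using less_cSUP_iff[OF _ am_inf_supq_bdd[OF \<eta>(2)], of l "am_inf_supq \<eta> l / 2"] by blast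
    have "real r * M * am_inf_supq \<eta> l \<le> real r * M * (2 * (real (Suc i) * \<eta> i))"
      by (rule mult_left_mono) (use i(2) r in auto)
    then have 2: "real (Suc n) * \<xi> n \<le> 2 * real r * M * (real (Suc i) * \<eta> i)" using 1 by (simp only: mult_ac)
    define q where "q = i div k"
    define h where "h = Suc q div 2"
    have "i < Suc q * k" unfolding q_def using k(1) by (simp add: dividend_less_div_times)
    then have iq: "real (Suc i) \<le> real k * real (Suc q)" by (metis Suc_leI mult.commute of_nat_mono of_nat_mult)
    have "real (Suc i) * \<eta> i \<le> (real k * real (Suc q)) * (K * \<xi> q)"
      unfolding q_def by (rule mult_mono[OF iq[unfolded q_def] k(3)]) (use c0_starD(1)[OF \<eta>c] in auto)
    also have "\<dots> = K * real k * (real (Suc q) * \<xi> q)" by (simp only: mult_ac)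
    also have "\<dots> \<le> K * real k * (2 * tail \<xi> h)" unfolding h_def by (rule mult_left_mono[OF tail_half[OF l1]]) (use k in simp)
    finally have "2 * real r * M * (real (Suc i) * \<eta> i) \<le> 2 * real r * M * (K * real k * (2 * tail \<xi> h))"
      by (rule mult_left_mono) (use r in simp)
    also have "\<dots> = D * tail \<xi> h" by (simp only: D_def mult_ac)
    finally have 3: "real (Suc n) * \<xi> n \<le> D * tail \<xi> h" using 2 by linarith
    have "h < c * (m * Suc n)"
    proof (rule ccontr)
      assume "\<not> h < c * (m * Suc n)"
      then have "tail \<xi> h \<le> tail \<xi> (c * (m * Suc n))" by (intro tail_antimono[OF l1]) simp
      then have "(D / \<delta> + 1) * tail \<xi> h \<le> (D / \<delta> + 1) * tail \<xi> (c * (m * Suc n))"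
        by (rule mult_left_mono) (use D m(2) in simp)
      also have "\<dots> \<le> tail \<xi> (m * Suc n)" by (rule c(2)) (use m(1) in simp)
      finally have "\<delta> * ((D / \<delta> + 1) * tail \<xi> h) \<le> \<delta> * tail \<xi> (m * Suc n)" by (rule mult_left_mono) (use m(2) in simp)
      also have "\<dots> \<le> real (Suc n) * \<xi> n" by (rule m(3))
      also have "\<dots> \<le> D * tail \<xi> h" by (rule 3)
      finally have "\<delta> * ((D / \<delta> + 1) * tail \<xi> h) \<le> D * tail \<xi> h" .
      moreover have "\<delta> * ((D / \<delta> + 1) * tail \<xi> h) = D * tail \<xi> h + \<delta> * tail \<xi> h" using m(2) by (simp add: field_simps)
      ultimately have "\<delta> * tail \<xi> h \<le> 0" by linarith
      then have "tail \<xi> h \<le> 0" using m(2) by (simp add: mult_le_0_iff)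
      then have "D * tail \<xi> h \<le> 0" using D by (simp add: mult_le_0_iff)
      moreover have "real (Suc n) * \<xi> n > 0" using pos by simp
      ultimately show False using 3 by linarith
    qed
    then have "Suc q \<le> 2 * (c * (m * Suc n))" unfolding h_def by linarith
    then have "k * Suc q \<le> k * (2 * (c * (m * Suc n)))" by (rule mult_le_mono2)
    moreover have "Suc i \<le> k * Suc q" using \<open>i < Suc q * k\<close> by (simp only: mult.commute Suc_le_eq)
    ultimately have "Suc i \<le> L * Suc n" by (simp only: L_def mult_ac)
    then have iL: "real (Suc i) \<le> real L * real (Suc n)" by (metis of_nat_mono of_nat_mult)
    have "real (Suc i) * \<eta> i \<le> (real L * real (Suc n)) * \<eta> l"
      by (rule mult_mono[OF iL c0_starD(2)[OF \<eta>c i(1)]]) (use c0_starD(1)[OF \<eta>c] in auto)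
    then have "2 * real r * M * (real (Suc i) * \<eta> i) \<le> 2 * real r * M * ((real L * real (Suc n)) * \<eta> l)"
      by (rule mult_left_mono) (use r in simp)
    also have "\<dots> = real (Suc n) * ((2 * real r * M * real L) * \<eta> l)" by (simp only: mult_ac)
    finally have "real (Suc n) * \<xi> n \<le> real (Suc n) * ((2 * real r * M * real L) * \<eta> l)" using 2 by linarith
    then show ?thesis unfolding l_def by (simp only: mult_le_cancel_left_pos of_nat_0_less_iff zero_less_Suc)
  qed
  then have "dominated \<xi> \<eta>" by (rule dominatedI[OF r(1)])
  then have "\<xi> \<in> J" by (rule char_setD(4)[OF J \<eta>(1) \<xi>(1)])
  then show "princ \<xi> \<subseteq> J" by (rule princ_subset[OF J])
qed

text \<open>The block of height \<open>am_inf_seq \<xi> n\<close> and length \<open>n + 1\<close>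
  has total mass \<open>tail \<xi> (n + 1)\<close>, so all its tails lie below those of
  \<xi>.\<close>

lemma am_inf_closed_imp_stable:
  assumes \<xi>: "\<xi> \<in> c0_star" "\<xi> 0 > 0" and cl: "princ \<xi> = am_inf.G (am_inf.F (princ \<xi>))"
  shows "princ \<xi> = am_inf.G (princ \<xi>)"
proof -
  note P = char_set_princ[OF \<xi>(1)]
  have l1: "\<xi> \<in> l1_star" using cl princ_self[OF \<xi>(1)] am_inf.G_U by blast
  have Fnz: "am_inf.F (princ \<xi>) \<noteq> {\<lambda>_. 0}"
    using am_inf.F_zero_imp[OF P _ princ_self[OF \<xi>(1)] l1] \<xi>(2) by auto
  obtain k where k: "k > 0" "\<And>\<rho> n. \<rho> \<in> l1_star \<Longrightarrow> (\<And>n. tail \<rho> n \<le> tail \<xi> n) \<Longrightarrow> \<rho> n \<le> real k * \<xi> (n div k)"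
  proof (rule am_inf_uniform[OF \<xi>(1)])
    fix \<rho> assume \<rho>: "\<rho> \<in> l1_star" "\<And>n. tail \<rho> n \<le> tail \<xi> n"
    have "am_inf_seq \<rho> n \<le> 1 * am_inf_seq \<xi> n" for n
      unfolding am_inf_seq_eq mult_1 by (rule divide_right_mono[OF \<rho>(2)]) simp
    then have "am_inf_seq \<rho> \<in> am_inf.F (princ \<xi>)" by (rule am_inf.FI[OF am_inf_seq_c0[OF \<rho>(1)] princ_self[OF \<xi>(1)] l1])
    then have "\<rho> \<in> am_inf.G (am_inf.F (princ \<xi>))" by (rule am_inf.GI[OF Fnz \<rho>(1)])
    then show "dominated \<rho> \<xi>" using cl by (simp add: princ_def)
  qed blast
  have "dominated (am_inf_seq \<xi>) \<xi>"
  proof (rule dominatedI[OF k(1)])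
    fix n
    define b where "b = am_inf_seq \<xi> n"
    have b0: "0 \<le> b" unfolding b_def by (rule c0_starD(1)[OF am_inf_seq_c0[OF l1]])
    have "block b (Suc n) n \<le> real k * \<xi> (n div k)"
    proof (rule k(2)[of "block b (Suc n)" n, OF block_l1(1)[OF b0]])
      fix j
      show "tail (block b (Suc n)) j \<le> tail \<xi> j"
        unfolding block_l1(2)[OF b0]
      proof (cases "j \<le> Suc n")
        case True
        have "real (Suc n - j) * b \<le> real (Suc n) * b" by (rule mult_right_mono[OF _ b0]) (simp only: of_nat_le_iff diff_le_self)
        also have "\<dots> = tail \<xi> (Suc n)" unfolding b_def by (rule am_inf_seq_mult)
        also have "\<dots> \<le> tail \<xi> j" by (rule tail_antimono[OF l1 True])
        finally show "real (Suc n - j) * b \<le> tail \<xi> j" .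
      next
        case False
        then show "real (Suc n - j) * b \<le> tail \<xi> j" using tail_nonneg[OF l1] by simp
      qed
    qed
    then show "am_inf_seq \<xi> n \<le> real k * \<xi> (n div k)" by (simp add: block_def b_def)
  qed
  then show ?thesis using am_inf_stable_iff[OF \<xi>] l1 by blast
qed

subsection \<open>Principal am-infinity open ideals\<close>

text \<open>Without flat blocks the decreasing quantity \<open>(n + 1) * x n\<close> would halve
  from \<open>s\<close> to \<open>L * (s + 1)\<close>, and a geometric series would give summability
  and stability. The same argument, with all later values zero, yields positivity.\<close>

lemma am_inf_unstable_flat:
  fixes x :: "nat \<Rightarrow> real"
  assumes x: "x \<in> c0_star" "x 0 > 0" and mono: "\<And>m n. m \<le> n \<Longrightarrow> real (Suc n) * x n \<le> real (Suc m) * x m"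
    and not: "\<not> (x \<in> l1_star \<and> dominated (am_inf_seq x) x)"
  shows "x n > 0"
    and "\<exists>s\<ge>N. \<forall>i\<in>{s..K * Suc s + 1}. \<forall>j\<in>{s..K * Suc s + 1}. real (Suc i) * x i \<le> 2 * (real (Suc j) * x j)"
proof -
  define R where "R = (\<lambda>n. real (Suc n) * x n)"
  have Rm: "R n \<le> R m" if "m \<le> n" for m n using mono[OF that] by (simp add: R_def)
  have R0: "0 \<le> R n" for n using c0_starD(1)[OF x(1)] by (simp add: R_def)
  have dbl: False if L: "L \<ge> 2" and halve: "\<And>s. s \<ge> N \<Longrightarrow> 2 * R (L * Suc s) \<le> R s" for L N
  proof -
    \<comment> \<open>The terms before \<open>E = L * (s + 1)\<close> cost \<open>L * R s\<close>;
      the rest starts at \<open>E\<close>, where \<open>R\<close> has halved, and costs the same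
      again. The induction is on the number of terms.\<close>
    have bound: "(\<Sum>j=s..<M. x j) \<le> 2 * real L * R s" if "s \<ge> N" for s M
      using that
    proof (induction "M - s" arbitrary: s rule: less_induct)
      case less
      define E where "E = L * Suc s"
      have "1 * Suc s \<le> E" unfolding E_def by (rule mult_le_mono1) (use L in simp)
      then have sE: "s < E" by simp
      have part: "(\<Sum>j=s..<T. x j) \<le> real L * R s" if T: "T \<le> E" for T
      proof -
        have "(\<Sum>j=s..<T. x j) \<le> (\<Sum>j=s..<T. R s / real (Suc s))"
        proof (rule sum_mono)
          fix j assume j: "j \<in> {s..<T}"
          have "x j = R j / real (Suc j)" by (simp add: R_def)
          also have "\<dots> \<le> R s / real (Suc s)" using j R0[of s] by (intro frac_le Rm) auto
          finally show "x j \<le> R s / real (Suc s)" .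
        qed
        also have "\<dots> = real (T - s) * (R s / real (Suc s))" by simp
        also have "\<dots> \<le> real E * (R s / real (Suc s))"
          by (rule mult_right_mono) (use T R0[of s] in auto)
        also have "\<dots> = real L * R s" unfolding E_def of_nat_mult by (simp del: of_nat_Suc)
        finally show ?thesis .
      qed
      show ?case
      proof (cases "M \<le> E")
        case True
        have "real L * R s \<le> 2 * real L * R s" using R0[of s] by (simp add: mult_right_mono)
        then show ?thesis using part[OF True] by linarith
      next
        case False
        have "(\<Sum>j=s..<M. x j) = (\<Sum>j=s..<E. x j) + (\<Sum>j=E..<M. x j)"
          using sum.atLeastLessThan_concat[of s E M x] sE False by simp
        also have "(\<Sum>j=E..<M. x j) \<le> 2 * real L * R E"
          by (rule less.hyps) (use sE False less.prems in auto)
        also have "2 * real L * R E \<le> real L * R s"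
          using mult_left_mono[OF halve[OF less.prems], of "real L"] by (simp add: E_def)
        finally show ?thesis using part[of E] by linarith
      qed
    qed
    have sm: "summable x"
    proof (rule summableI_nonneg_bounded)
      show "0 \<le> x n" for n by (rule c0_starD(1)[OF x(1)])
      fix n
      have "(\<Sum>i<n. x i) \<le> (\<Sum>i<max n N. x i)" by (rule psum_mono) (use c0_starD(1)[OF x(1)] in auto)
      also have "\<dots> = (\<Sum>i<N. x i) + (\<Sum>i=N..<max n N. x i)"
        using sum.atLeastLessThan_concat[of 0 N "max n N" x] by (simp add: atLeast0LessThan)
      also have "(\<Sum>i=N..<max n N. x i) \<le> 2 * real L * R N" by (rule bound) simp
      finally show "(\<Sum>i<n. x i) \<le> (\<Sum>i<N. x i) + 2 * real L * R N" by simp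
    qed
    then have l1: "x \<in> l1_star" using x(1) by (simp add: l1_star_def)
    have tb: "tail x s \<le> 2 * real L * R s" if s: "s \<ge> N" for s
    proof (rule LIMSEQ_le_const2)
      show "(\<lambda>M. tail x s - tail x M) \<longlonglongrightarrow> tail x s"
        using tendsto_diff[OF tendsto_const tail_tendsto[OF sm], of "tail x s"] by simp
      show "\<exists>M0. \<forall>M\<ge>M0. tail x s - tail x M \<le> 2 * real L * R s"
        using tail_split[OF sm, of s] bound[OF s] by (intro exI[of _ s]) auto
    qed
    have "dominated (am_inf_seq x) x"
    proof (rule dominated_eventually[OF x zero_less_one, where N=N and M="2 * real L" and B="am_inf_seq x 0"])
      show "am_inf_seq x n \<le> am_inf_seq x 0" for n by (rule c0_starD(2)[OF am_inf_seq_c0[OF l1]]) simp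
      fix s assume s: "s \<ge> N"
      have "real (Suc s) * am_inf_seq x s \<le> tail x s" unfolding am_inf_seq_mult by (rule tail_antimono[OF l1]) simp
      also have "\<dots> \<le> 2 * real L * R s" by (rule tb[OF s])
      also have "\<dots> = real (Suc s) * (2 * real L * x s)" by (simp only: R_def mult_ac)
      finally show "am_inf_seq x s \<le> 2 * real L * x (s div 1)"
        unfolding div_by_1 by (simp only: mult_le_cancel_left_pos of_nat_0_less_iff zero_less_Suc)
    qed
    then show False using not l1 by blast
  qed
  show "x n > 0"
  proof (rule ccontr)
    assume "\<not> x n > 0"
    then have "R n = 0" using c0_starD(1)[OF x(1), of n] by (simp add: R_def)
    then have z: "R s = 0" if "s \<ge> n" for s using Rm[OF that] R0[of s] by simp
    show False
    proof (rule dbl[of 2 n])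
      fix s assume s: "s \<ge> n"
      then have "2 * Suc s \<ge> n" by simp
      from z[OF this] z[OF s] show "2 * R (2 * Suc s) \<le> R s" by simp
    qed simp
  qed
  show "\<exists>s\<ge>N. \<forall>i\<in>{s..K * Suc s + 1}. \<forall>j\<in>{s..K * Suc s + 1}. real (Suc i) * x i \<le> 2 * (real (Suc j) * x j)"
  proof (rule ccontr)
    assume nf: "\<not> ?thesis"
    show False
    proof (rule dbl[of "Suc (Suc K)" N])
      fix s assume s: "s \<ge> N"
      obtain i j where ij: "i \<in> {s..K * Suc s + 1}" "j \<in> {s..K * Suc s + 1}" "\<not> R i \<le> 2 * R j"
        using nf s unfolding R_def by blast
      have "2 * R (Suc (Suc K) * Suc s) \<le> 2 * R j" using ij(2) by (intro mult_left_mono Rm) auto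
      also have "\<dots> \<le> R i" using ij(3) by simp
      also have "\<dots> \<le> R s" using ij(1) by (intro Rm) simp
      finally show "2 * R (Suc (Suc K) * Suc s) \<le> R s" .
    qed simp
  qed
qed

lemma am_inf_open_generator:
  assumes \<xi>: "\<xi> \<in> c0_star" "\<xi> 0 > 0" and op: "princ \<xi> = am_inf.F (am_inf.G (princ \<xi>))"
  obtains \<rho> where "\<rho> \<in> l1_star" "am_inf_seq \<rho> 0 > 0" "princ \<xi> = princ (am_inf_seq \<rho>)"
proof -
  note P = char_set_princ[OF \<xi>(1)]
  have "\<xi> \<in> am_inf.F (am_inf.G (princ \<xi>))" using op princ_self[OF \<xi>(1)] by blast
  then obtain \<rho> M where \<rho>: "\<rho> \<in> am_inf.G (princ \<xi>)" "\<rho> \<in> l1_star" "M > 0" "\<And>n. \<xi> n \<le> M * am_inf_seq \<rho> n" by (rule am_inf.FE) blast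
  have "am_inf_seq \<rho> \<in> princ \<xi>" by (rule am_inf.a_G[OF P \<rho>(1)])
  then have "princ (am_inf_seq \<rho>) \<subseteq> princ \<xi>" by (rule princ_subset[OF P])
  moreover have "\<xi> \<in> princ (am_inf_seq \<rho>)" using \<xi>(1) dominated_le[OF \<rho>(4)] by (simp add: princ_def)
  then have "princ \<xi> \<subseteq> princ (am_inf_seq \<rho>)" by (rule princ_subset[OF char_set_princ[OF am_inf_seq_c0[OF \<rho>(2)]]])
  moreover have "am_inf_seq \<rho> 0 > 0"
    by (rule zero_less_mult_pos[of M]) (use \<rho>(4)[of 0] \<xi>(2) \<rho>(3) in auto)
  ultimately show ?thesis using that \<rho>(2) by blast
qed

lemma am_inf_open_unstable:
  assumes \<xi>: "\<xi> \<in> c0_star" "\<xi> 0 > 0" and op: "princ \<xi> = am_inf.F (am_inf.G (princ \<xi>))" and un: "princ \<xi> \<noteq> am_inf.G (princ \<xi>)"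
  shows "\<exists>J. char_set J \<and> am_inf.G J = am_inf.G (princ \<xi>) \<and> J \<noteq> princ \<xi>"
    and "\<exists>J. char_set J \<and> am_inf.so J = am_inf.so (princ \<xi>) \<and> J \<noteq> princ \<xi>"
proof -
  obtain \<rho> where \<rho>: "\<rho> \<in> l1_star" "am_inf_seq \<rho> 0 > 0" "princ \<xi> = princ (am_inf_seq \<rho>)" by (rule am_inf_open_generator[OF \<xi> op])
  define x where "x = am_inf_seq \<rho>"
  have xV: "x \<in> o_omega" unfolding x_def by (rule am_inf_seq_o_omega[OF \<rho>(1)])
  note x = o_omega_c0[OF xV]
  have x0: "x 0 > 0" using \<rho>(2) by (simp add: x_def)
  have Px: "princ \<xi> = princ x" using \<rho>(3) by (simp add: x_def)
  have mono: "real (Suc n) * x n \<le> real (Suc m) * x m" if "m \<le> n" for m n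
    unfolding x_def am_inf_seq_mult by (rule tail_antimono[OF \<rho>(1)]) (use that in simp)
  have nd: "\<not> (x \<in> l1_star \<and> dominated (am_inf_seq x) x)" using un am_inf_stable_iff[OF x x0] Px by simp
  have pos: "x n > 0" for n by (rule am_inf_unstable_flat(1)[OF x x0 _ nd]) (rule mono)
  have flat: "\<exists>s\<ge>N. \<forall>i\<in>{s..K * Suc s + 1}. \<forall>j\<in>{s..K * Suc s + 1}. real (Suc i) * x i \<le> 2 * (real (Suc j) * x j)" for K N
    by (rule am_inf_unstable_flat(2)[OF x x0 _ nd]) (rule mono)
  note P = char_set_princ[OF x]
  show "\<exists>J. char_set J \<and> am_inf.G J = am_inf.G (princ \<xi>) \<and> J \<noteq> princ \<xi>"
  proof -
    obtain \<eta> where \<eta>: "\<eta> \<in> c0_star" "\<And>n. x n \<le> \<eta> n" "\<not> dominated \<eta> x"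
      and s: "\<And>l. \<exists>s\<le>l. \<eta> s = x s \<and> real (Suc s) * x s \<le> 2 * (real (Suc l) * x l)"
      "\<And>l. \<exists>e\<ge>l. \<eta> e = x e \<and> real (Suc e) * x e \<le> 2 * (real (Suc l) * x l)"
      by (rule flat_upper[OF x pos flat]) (rule that)
    note Q = char_set_princ[OF \<eta>(1)]
    have "dominated x \<eta>" by (rule dominated_le[where M=1]) (use \<eta>(2) in simp)
    then have "princ x \<subseteq> princ \<eta>" by (intro princ_subset[OF Q]) (simp add: princ_def x)
    then have sub: "am_inf.G (princ x) \<subseteq> am_inf.G (princ \<eta>)" by (rule am_inf.G_mono[OF P Q])
    have "am_inf.G (princ \<eta>) \<subseteq> am_inf.G (princ x)"
    proof
      fix \<zeta> assume \<zeta>G: "\<zeta> \<in> am_inf.G (princ \<eta>)"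
      then have \<zeta>: "\<zeta> \<in> l1_star" using am_inf.G_U by blast
      have "dominated (am_inf_seq \<zeta>) \<eta>" using am_inf.a_G[OF Q \<zeta>G] by (simp add: princ_def)
      then obtain m M where m: "m > 0" "M > 0" "\<And>n. am_inf_seq \<zeta> n \<le> M * \<eta> (n div m)" by (rule dominatedE[OF _ \<eta>(1)]) blast
      have "dominated (am_inf_seq \<zeta>) x"
      proof (rule dominatedI[OF m(1)])
        fix n
        define l where "l = n div m"
        obtain e where e: "e \<le> l" "\<eta> e = x e" "real (Suc e) * x e \<le> 2 * (real (Suc l) * x l)" using s(1) by blast
        \<comment> \<open>Tails decrease, so here the bound at the left meeting point
          \<open>e\<close> passes forward to \<open>l\<close>.\<close>
        have "real (Suc (m * l)) * am_inf_seq \<zeta> (m * l) \<le> real (Suc (m * e)) * am_inf_seq \<zeta> (m * e)"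
          unfolding am_inf_seq_mult by (rule tail_antimono[OF \<zeta>]) (use e(1) in simp)
        also have "\<dots> \<le> real (m * Suc e) * (M * x e)"
          using m(3)[of "m * e"] m(1,2) e(2) c0_starD(1)[OF am_inf_seq_c0[OF \<zeta>]] pos[of e] by (intro mult_mono) (auto simp: less_imp_le)
        also have "\<dots> = (real m * M) * (real (Suc e) * x e)" by (simp only: of_nat_mult mult_ac)
        also have "\<dots> \<le> (real m * M) * (2 * (real (Suc l) * x l))" by (rule mult_left_mono[OF e(3)]) (use m in simp)
        also have "\<dots> = real (Suc l) * (2 * (real m * M) * x l)" by (simp only: mult_ac)
        also have "\<dots> \<le> real (Suc (m * l)) * (2 * (real m * M) * x l)"
        proof (rule mult_right_mono)
          have "l \<le> m * l" using m(1) by simp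
          then show "real (Suc l) \<le> real (Suc (m * l))" by (simp only: of_nat_le_iff Suc_le_mono)
          show "0 \<le> 2 * (real m * M) * x l" using m pos[of l] by (simp add: less_imp_le)
        qed
        finally have "am_inf_seq \<zeta> (m * l) \<le> 2 * (real m * M) * x l" by (simp only: mult_le_cancel_left_pos of_nat_0_less_iff zero_less_Suc)
        moreover have "am_inf_seq \<zeta> n \<le> am_inf_seq \<zeta> (m * l)" by (rule c0_starD(2)[OF am_inf_seq_c0[OF \<zeta>]]) (simp add: l_def)
        ultimately show "am_inf_seq \<zeta> n \<le> 2 * (real m * M) * x (n div m)" by (simp add: l_def)
      qed
      then show "\<zeta> \<in> am_inf.G (princ x)"
        by (intro am_inf.GI[OF princ_nonzero[OF x x0] \<zeta>]) (simp add: princ_def am_inf_seq_c0[OF \<zeta>])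
    qed
    then have "am_inf.G (princ \<eta>) = am_inf.G (princ x)" using sub by (rule antisym)
    moreover have "princ \<eta> \<noteq> princ x" using \<eta>(3) princ_self[OF \<eta>(1)] by (auto simp: princ_def)
    ultimately show ?thesis using Q Px by (intro exI[of _ "princ \<eta>"]) simp
  qed
  show "\<exists>J. char_set J \<and> am_inf.so J = am_inf.so (princ \<xi>) \<and> J \<noteq> princ \<xi>"
  proof -
    obtain \<eta> where \<eta>: "\<eta> \<in> c0_star" "\<And>n. \<eta> n \<le> x n" "\<not> dominated x \<eta>"
      and e: "\<And>l. \<exists>s\<le>l. \<eta> s = x s \<and> real (Suc l) * x l \<le> 2 * (real (Suc s) * x s)"
      "\<And>l. \<exists>e\<ge>l. \<eta> e = x e \<and> real (Suc l) * x l \<le> 2 * (real (Suc e) * x e)"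
      by (rule flat_lower[OF x pos flat]) (rule that)
    note Q = char_set_princ[OF \<eta>(1)]
    have "dominated \<eta> x" by (rule dominated_le[where M=1]) (use \<eta>(2) in simp)
    then have "princ \<eta> \<subseteq> princ x" by (intro princ_subset[OF P]) (simp add: princ_def \<eta>(1))
    then have sub: "am_inf.so (princ \<eta>) \<subseteq> am_inf.so (princ x)"
      using am_inf.so_mono by blast
    have \<eta>V: "\<eta> \<in> o_omega" by (rule char_set_le[OF char_set_o_omega xV \<eta>(1), where M=1]) (use \<eta>(2) in simp)
    \<comment> \<open>The supremum over later indices still sees the right end of the block, where
      \<eta> equals \<open>x\<close>.\<close>
    have "x n \<le> 2 * am_inf_mu \<eta> n" for n
    proof -
      obtain i where i: "i \<ge> n" "\<eta> i = x i" "real (Suc n) * x n \<le> 2 * (real (Suc i) * x i)" using e(2) by blast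
      then have "real (Suc n) * x n \<le> 2 * am_inf_supq \<eta> n" using am_inf_supq_ge[OF \<eta>V i(1)] by simp
      also have "\<dots> = real (Suc n) * (2 * am_inf_mu \<eta> n)" unfolding am_inf_mu_mult[symmetric] by simp
      finally show ?thesis by (simp only: mult_le_cancel_left_pos of_nat_0_less_iff zero_less_Suc)
    qed
    then have "dominated x (am_inf_mu \<eta>)" by (rule dominated_le)
    then have "x \<in> am_inf.so (princ \<eta>)" using x princ_self[OF \<eta>(1)] \<eta>V by (auto simp: am_inf.so_def)
    then have "princ x \<subseteq> am_inf.so (princ \<eta>)" by (rule princ_subset[OF am_inf.char_so[OF Q]])
    moreover have "am_inf.so (princ x) = princ x" by (rule am_inf.so_of_open[OF P]) (use op Px in simp)
    ultimately have "am_inf.so (princ \<eta>) = am_inf.so (princ x)" using sub by blast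
    moreover have "princ \<eta> \<noteq> princ x" using \<eta>(3) princ_self[OF x] by (auto simp: princ_def)
    ultimately show ?thesis using Q Px by metis
  qed
qed

interpretation am_inf: mean_cancellation am_inf_seq l1_star o_omega am_inf_mu
proof (rule mean_cancellation.intro[OF am_inf.mean_theory_axioms], rule mean_cancellation_axioms.intro, goal_cases)
  case 1 then show ?case by (rule am_inf_stable_pre_cancel)
next
  case 2 then show ?case by (rule am_inf_stable_mean_cancel)
next
  case 3 then show ?case by (rule am_inf_stable_open_cancel)
next
  case 4 then show ?case by (rule am_inf_closed_imp_stable)
next
  case 5 then show ?case by (rule am_inf_open_unstable(1))
next
  case 6 then show ?case by (rule am_inf_open_unstable(2))
qed

section \<open>The cancellation theorem\<close>

theorem theorem6p7:
  fixes I :: "('h::chilbert_space \<Rightarrow>\<^sub>L 'h) set"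
  assumes separable: "\<exists>D::'h set. countable D \<and> closure D = UNIV"
    and infinite_dimensional: "\<nexists>B::'h set. finite B \<and> complex_vector.span B = UNIV"
    and principal: "principal_ideal I"
    and nonzero: "I \<noteq> {0}"
  shows
    "((\<forall>J. is_ideal J \<longrightarrow> (pre_am J = pre_am I \<longleftrightarrow> am_interior J = am_interior I)) \<and>
      (\<forall>J. is_ideal J \<longrightarrow> (am J = am I \<longleftrightarrow> am_closure J = am_closure I)) \<and>
      (am_stable I \<longleftrightarrow> (\<forall>J. is_ideal J \<longrightarrow> pre_am J = pre_am I \<longrightarrow> J = I)) \<and>
      (am_stable I \<longleftrightarrow> (\<forall>J. is_ideal J \<longrightarrow> am J = am I \<longrightarrow> J = I)) \<and>
      (am_stable I \<longleftrightarrow>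
        (\<forall>J. is_ideal J \<longrightarrow> smallest_am_open J = smallest_am_open I \<longrightarrow> J = I)) \<and>
      (am_stable I \<longleftrightarrow>
        (\<forall>J. is_ideal J \<longrightarrow> largest_am_closed J = largest_am_closed I \<longrightarrow> J = I)))
     \<and>
     ((\<forall>J. is_ideal J \<longrightarrow>
        (pre_am_inf J = pre_am_inf I \<longleftrightarrow> am_inf_interior J = am_inf_interior I)) \<and>
      (\<forall>J. is_ideal J \<longrightarrow> (am_inf J = am_inf I \<longleftrightarrow> am_inf_closure J = am_inf_closure I)) \<and>
      (am_inf_stable I \<longleftrightarrow> (\<forall>J. is_ideal J \<longrightarrow> pre_am_inf J = pre_am_inf I \<longrightarrow> J = I)) \<and>
      (am_inf_stable I \<longleftrightarrow> (\<forall>J. is_ideal J \<longrightarrow> am_inf J = am_inf I \<longrightarrow> J = I)) \<and>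
      (am_inf_stable I \<longleftrightarrow>
        (\<forall>J. is_ideal J \<longrightarrow> smallest_am_inf_open J = smallest_am_inf_open I \<longrightarrow> J = I)) \<and>
      (am_inf_stable I \<longleftrightarrow>
        (\<forall>J. is_ideal J \<longrightarrow> largest_am_inf_closed J = largest_am_inf_closed I \<longrightarrow> J = I)))"
proof (rule conjI)
  interpret infinite_dimensional_hilbert "TYPE('h)"
    by unfold_locales (use infinite_dimensional in \<open>simp add: infinite_dim_def\<close>)
  have Sig_le: "Sig J \<subseteq> c0_star" if "is_ideal J" for J :: "('h \<Rightarrow>\<^sub>L 'h) set"
    using char_set_Sig[OF that] by (auto simp: char_set_def)
  \<comment> \<open>\<open>UNIV\<close> in the place of \<open>W\<close> turns the condition on the
    open envelope into plain containment of the ideal.\<close>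
  interpret A: ideal_mean_cancellation am_seq c0_star c0_star am_mu "TYPE('h)" pre_am am UNIV
  proof (unfold_locales, goal_cases)
    case (1 K)
    \<comment> \<open>\<open>pre_am\<close> has no branch for the zero ideal; it agrees with
      \<open>G\<close> because a vanishing arithmetic mean forces the sequence to vanish.\<close>
    have "{\<xi> \<in> c0_star. am_seq \<xi> \<in> Sig K} = am.G (Sig K)"
    proof (cases "Sig K = {\<lambda>_. 0}")
      case True
      have "\<xi> = (\<lambda>_. 0)" if "\<xi> \<in> c0_star" "am_seq \<xi> = (\<lambda>_. 0)" for \<xi>
        using c0_star_pos_0[OF that(1)] fun_cong[OF that(2), of 0] by (auto simp: am_seq_def)
      then show ?thesis using True c0_star_zero am.a_zero by (auto simp: am.G_def)
    qed (simp add: am.G_def)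
    then show ?case by (simp add: pre_am_def)
  next
    case (2 K)
    have "{\<xi> \<in> c0_star. \<exists>\<eta>\<in>Sig K. big_oh \<xi> (am_seq \<eta>)} = am.F (Sig K)"
      using Sig_le[OF 2] by (auto simp: am.F_def)
    then show ?case by (simp add: am_def)
  next
    case (4 K)
    then show ?case using Sig_le[of K] by auto
  qed simp
  show "(\<forall>J. is_ideal J \<longrightarrow> (pre_am J = pre_am I \<longleftrightarrow> am_interior J = am_interior I)) \<and>
      (\<forall>J. is_ideal J \<longrightarrow> (am J = am I \<longleftrightarrow> am_closure J = am_closure I)) \<and>
      (am_stable I \<longleftrightarrow> (\<forall>J. is_ideal J \<longrightarrow> pre_am J = pre_am I \<longrightarrow> J = I)) \<and>
      (am_stable I \<longleftrightarrow> (\<forall>J. is_ideal J \<longrightarrow> am J = am I \<longrightarrow> J = I)) \<and>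
      (am_stable I \<longleftrightarrow>
        (\<forall>J. is_ideal J \<longrightarrow> smallest_am_open J = smallest_am_open I \<longrightarrow> J = I)) \<and>
      (am_stable I \<longleftrightarrow>
        (\<forall>J. is_ideal J \<longrightarrow> largest_am_closed J = largest_am_closed I \<longrightarrow> J = I))"
    using A.ideal_cancellation[OF principal nonzero]
    unfolding am_interior_def am_closure_def am_stable_def smallest_am_open_def largest_am_closed_def
      am_open_def am_closed_def Int_UNIV_right .
  interpret B: ideal_mean_cancellation am_inf_seq l1_star o_omega am_inf_mu "TYPE('h)" pre_am_inf am_inf "se_omega"
  proof (unfold_locales, goal_cases)
    case (1 K)
    \<comment> \<open>\<open>pre_am_inf\<close> branches on the ideal, \<open>G\<close> on the
      characteristic set; the bijection identifies the two conditions.\<close>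
    have "K = {0} \<longleftrightarrow> Sig K = {\<lambda>_. 0}" using Sig_eq_iff[OF 1 zero_ideal(1)] zero_ideal(2) by simp
    then show ?case using ideal_with_Sig[OF zero_ideal(1)] zero_ideal(2)
      by (auto simp: pre_am_inf_def am_inf.G_def)
  next
    case (2 K)
    have "{\<xi> \<in> c0_star. \<exists>\<eta>\<in>Sig (K \<inter> trace_class). big_oh \<xi> (am_inf_seq \<eta>)} = am_inf.F (Sig K)"
      unfolding Sig_trace_class[OF 2] am_inf.F_def ..
    then show ?case by (simp add: am_inf_def)
  next
    case (3 K)
    have "is_ideal (se_omega :: ('h \<Rightarrow>\<^sub>L 'h) set)"
      using ideal_with(1)[OF char_set_o_omega] by (simp add: se_omega_def o_omega_def)
    then show ?case by (rule ideal_Int[OF 3])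
  next
    case (4 K)
    note i = ideal_with[OF char_set_o_omega]
    have "is_ideal (se_omega :: ('h \<Rightarrow>\<^sub>L 'h) set)" "Sig (se_omega :: ('h \<Rightarrow>\<^sub>L 'h) set) = o_omega"
      using i by (simp_all add: se_omega_def o_omega_def)
    then show ?case using Sig_Int[OF 4] by simp
  qed
  show "(\<forall>J. is_ideal J \<longrightarrow>
        (pre_am_inf J = pre_am_inf I \<longleftrightarrow> am_inf_interior J = am_inf_interior I)) \<and>
      (\<forall>J. is_ideal J \<longrightarrow> (am_inf J = am_inf I \<longleftrightarrow> am_inf_closure J = am_inf_closure I)) \<and>
      (am_inf_stable I \<longleftrightarrow> (\<forall>J. is_ideal J \<longrightarrow> pre_am_inf J = pre_am_inf I \<longrightarrow> J = I)) \<and>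
      (am_inf_stable I \<longleftrightarrow> (\<forall>J. is_ideal J \<longrightarrow> am_inf J = am_inf I \<longrightarrow> J = I)) \<and>
      (am_inf_stable I \<longleftrightarrow>
        (\<forall>J. is_ideal J \<longrightarrow> smallest_am_inf_open J = smallest_am_inf_open I \<longrightarrow> J = I)) \<and>
      (am_inf_stable I \<longleftrightarrow>
        (\<forall>J. is_ideal J \<longrightarrow> largest_am_inf_closed J = largest_am_inf_closed I \<longrightarrow> J = I))"
    using B.ideal_cancellation[OF principal nonzero]
    unfolding am_inf_interior_def am_inf_closure_def am_inf_stable_def smallest_am_inf_open_def largest_am_inf_closed_def
      am_inf_open_def am_inf_closed_def .
qed

end
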